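(* The following two problems are decidable in EXPTIME. (Reachability) Given an $\mathcal E_{\mathsf{pw}}$-automaton $(S,T)$, an initial state $s_0\in S$, a set of accepting states $F\subseteq S$ and a computable initial energy $x_0\in[0,\infty)$: does there exist a finite run of $(S,T)$ from $(s_0,x_0)$ which ends in a state in $F$? (Büchi acceptance) Given the same data: does there exist an infinite run of $(S,T)$ from $(s_0,x_0)$ which visits $F$ infinitely often?
   Context: Let $[0,\infty]_\bot=\{\bot\}\cup[0,\infty]$, totally ordered by the usual order with $\bot<x<\infty$ for $x\in[0,\infty)$. Conventions: $\bot\pm y=\bot$ and $\infty\pm y=\infty$ for real $y\ge 0$. An extended energy function is a map $f:[0,\infty]_\bot\to[0,\infty]_\bot$ with $f(\bot)=\bot$; $f(x_2)\ge f(x_1)+x_2-x_1$ for all real $0\le x_1\le x_2$; and $f(\infty)=\infty$, unless $f$ is constantly $\bot$. An extended energy function $f$ is (rational) piecewise affine if there exist $x_0<x_1<\dots<x_k\in\mathbb Q$ such that $f(x)\ne\bot$ iff $x\ge x_0$, or $f(x)\neq\bot$ iff $x>x_0$; $f(x_j)\in\mathbb Q\cup\{\bot\}$ for all $j$; and all restrictions of $f$ to the open intervals $(x_j,x_{j+1})$ ($0\le j<k$) and $(x_k,\infty)$ are affine functions $x\mapsto a_jx+b_j$ with $a_j,b_j\in\mathbb Q$, $a_j\ge1$. Such a function is represented by its break points $x_0,\dots,x_k$, the values $f(x_0),\dots,f(x_k)$, and the numbers $a_0,b_0,\dots,a_k,b_k$. $\mathcal E_{\mathsf{pw}}$ is the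 class of piecewise affine extended energy functions. An $\mathcal E_{\mathsf{pw}}$-automaton $(S,T)$ consists of finite sets $S$ of states and $T\subseteq S\times\mathcal E_{\mathsf{pw}}\times S$ of transitions. A global state is a pair $(s,x)$ with $s\in S$, $x\in[0,\infty)$; there is a transition from $(s,x)$ to $(s',x')$ if there is $(s,f,s')\in T$ with $x'=f(x)\ne\bot$. A run is a path in the graph of global states and transitions.
   Formalization: For a computable initial energy both problems are shown decidable; the EXPTIME bound is shown when comparing the initial energy with a given rational is itself in EXPTIME, a condition that is necessary, since some computable energies make reachability harder than EXPTIME. *)

theory Defs
  imports
    Complex_Main
    "HOL-Library.Extended_Nonnegative_Real"
    "HOL-Library.Option_ord"
begin

section \<open>Extended energy functions\<close>

text \<open>With the ordering on \<^type>\<open>option\<close> that puts \<^const>\<open>None\<close> below everything else,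
  this type is $[0,\infty]_\bot$, where \<^const>\<open>None\<close> is $\bot$.\<close>

type_synonym energy = "ennreal option"

abbreviation energy_of_real :: "real \<Rightarrow> energy" where
  "energy_of_real x \<equiv> Some (ennreal x)"

definition ext_energy_fun :: "(energy \<Rightarrow> energy) \<Rightarrow> bool" where
  "ext_energy_fun f \<longleftrightarrow>
     f None = None \<and>
     (\<forall>x1 x2 :: real. 0 \<le> x1 \<and> x1 \<le> x2 \<longrightarrow>
        map_option (\<lambda>y. y + ennreal (x2 - x1)) (f (energy_of_real x1)) \<le> f (energy_of_real x2)) \<and>
     ((\<forall>x. f x = None) \<or> f (Some top) = Some top)"

text \<open>The list of all $(x_j, f(x_j), a_j, b_j)$ for $j = 0, \dots, k$.\<close>

type_synonym pw_rep = "(rat \<times> rat option \<times> rat \<times> rat) list"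

text \<open>The break points lie in the domain of \<open>f\<close>, hence are nonnegative. Since \<^const>\<open>ennreal\<close>
  maps negative numbers to 0, nonnegativity of the values is stated explicitly as well.\<close>

definition pw_represents :: "pw_rep \<Rightarrow> (energy \<Rightarrow> energy) \<Rightarrow> bool" where
  "pw_represents r f \<longleftrightarrow>
     r \<noteq> [] \<and>
     sorted_wrt (<) (map fst r) \<and>
     0 \<le> fst (hd r) \<and>
     ((\<forall>x. f x \<noteq> None \<longleftrightarrow> energy_of_real (of_rat (fst (hd r))) \<le> x) \<or>
      (\<forall>x. f x \<noteq> None \<longleftrightarrow> energy_of_real (of_rat (fst (hd r))) < x)) \<and>
     (\<forall>j < length r. case r ! j of (xj, v, a, b) \<Rightarrow>
        (\<forall>q. v = Some q \<longrightarrow> 0 \<le> q) \<and>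
        f (energy_of_real (of_rat xj)) = map_option (\<lambda>q. ennreal (of_rat q)) v \<and>
        1 \<le> a \<and>
        (\<forall>x :: real.
           of_rat xj < x \<and> (Suc j < length r \<longrightarrow> x < of_rat (fst (r ! Suc j))) \<longrightarrow>
           0 \<le> of_rat a * x + of_rat b \<and>
           f (energy_of_real x) = energy_of_real (of_rat a * x + of_rat b)))"

definition piecewise_affine :: "(energy \<Rightarrow> energy) \<Rightarrow> bool" where
  "piecewise_affine f \<longleftrightarrow> (\<exists>r. pw_represents r f)"

definition E_pw :: "(energy \<Rightarrow> energy) set" where
  "E_pw = {f. ext_energy_fun f \<and> piecewise_affine f}"


section \<open>Energy automata and their runs\<close>

type_synonym 's transition = "'s \<times> (energy \<Rightarrow> energy) \<times> 's"

definition pw_automaton :: "'s set \<Rightarrow> 's transition set \<Rightarrow> bool" where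
  "pw_automaton S T \<longleftrightarrow> finite S \<and> finite T \<and> T \<subseteq> S \<times> E_pw \<times> S"

definition global_step :: "'s transition set \<Rightarrow> 's \<times> real \<Rightarrow> 's \<times> real \<Rightarrow> bool" where
  "global_step T = (\<lambda>(s, x) (s', x').
     0 \<le> x \<and> 0 \<le> x' \<and> (\<exists>f. (s, f, s') \<in> T \<and> f (energy_of_real x) = energy_of_real x'))"

definition has_reaching_run :: "'s transition set \<Rightarrow> 's \<Rightarrow> 's set \<Rightarrow> real \<Rightarrow> bool" where
  "has_reaching_run T s0 F x0 \<longleftrightarrow> (\<exists>s x. (global_step T)\<^sup>*\<^sup>* (s0, x0) (s, x) \<and> s \<in> F)"

definition has_buechi_run :: "'s transition set \<Rightarrow> 's \<Rightarrow> 's set \<Rightarrow> real \<Rightarrow> bool" where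
  "has_buechi_run T s0 F x0 \<longleftrightarrow>
     (\<exists>\<rho> :: nat \<Rightarrow> 's \<times> real.
        \<rho> 0 = (s0, x0) \<and> (\<forall>i. global_step T (\<rho> i) (\<rho> (Suc i))) \<and> (\<exists>\<^sub>\<infinity>i. fst (\<rho> i) \<in> F))"


section \<open>Deterministic multi-tape Turing machines and EXPTIME\<close>

datatype head_move = Move_Left | Stay | Move_Right

fun head_offset :: "head_move \<Rightarrow> int" where
  "head_offset Move_Left = -1"
| "head_offset Stay = 0"
| "head_offset Move_Right = 1"

text \<open>States and tape symbols are initial segments of the natural numbers. Symbol 0 is the blank,
  symbols 1 and 2 stand for the input bits \<^const>\<open>False\<close> and \<^const>\<open>True\<close>.\<close>

record tm =
  tm_tapes :: nat
  tm_states :: nat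
  tm_symbols :: nat
  tm_start :: nat
  tm_accept :: nat
  tm_reject :: nat
  tm_trans :: "nat \<Rightarrow> nat list \<Rightarrow> nat \<times> (nat \<times> head_move) list"

definition tm_wf :: "tm \<Rightarrow> bool" where
  "tm_wf M \<longleftrightarrow>
     1 \<le> tm_tapes M \<and> 3 \<le> tm_symbols M \<and>
     tm_start M < tm_states M \<and> tm_accept M < tm_states M \<and> tm_reject M < tm_states M \<and>
     tm_accept M \<noteq> tm_reject M \<and>
     (\<forall>q as. q < tm_states M \<and> length as = tm_tapes M \<and> (\<forall>a \<in> set as. a < tm_symbols M) \<longrightarrow>
        (case tm_trans M q as of (q', acts) \<Rightarrow>
           q' < tm_states M \<and> length acts = tm_tapes M \<and>
           (\<forall>(a, m) \<in> set acts. a < tm_symbols M)))"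

text \<open>A tape is two-way infinite and comes with its head position.\<close>

type_synonym tape = "(int \<Rightarrow> nat) \<times> int"
type_synonym tm_config = "nat \<times> tape list"

definition tm_step :: "tm \<Rightarrow> tm_config \<Rightarrow> tm_config" where
  "tm_step M = (\<lambda>(q, ts).
     if q = tm_accept M \<or> q = tm_reject M then (q, ts)
     else case tm_trans M q (map (\<lambda>(t, h). t h) ts) of (q', acts) \<Rightarrow>
       (q', map2 (\<lambda>(t, h) (a, m). (t(h := a), h + head_offset m)) ts acts))"

definition input_tape :: "bool list \<Rightarrow> tape" where
  "input_tape w =
     (\<lambda>i. if 0 \<le> i \<and> i < int (length w) then (if w ! nat i then 2 else 1) else 0, 0)"

definition tm_init :: "tm \<Rightarrow> bool list \<Rightarrow> tm_config" where
  "tm_init M w = (tm_start M, input_tape w # replicate (tm_tapes M - 1) (\<lambda>_. 0, 0))"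

definition tm_decides :: "tm \<Rightarrow> bool list set \<Rightarrow> bool" where
  "tm_decides M A \<longleftrightarrow>
     tm_wf M \<and>
     (\<forall>w. \<exists>n. fst ((tm_step M ^^ n) (tm_init M w)) =
            (if w \<in> A then tm_accept M else tm_reject M))"

definition DECIDABLE :: "bool list set set" where
  "DECIDABLE = {A. \<exists>M. tm_decides M A}"

text \<open>Accepting and rejecting configurations are fixed by \<^const>\<open>tm_step\<close>, so looking at the
  configuration after exactly \<open>t (length w)\<close> steps bounds the halting time by that number.\<close>

definition tm_decides_in_time :: "tm \<Rightarrow> bool list set \<Rightarrow> (nat \<Rightarrow> nat) \<Rightarrow> bool" where
  "tm_decides_in_time M A t \<longleftrightarrow>
     tm_wf M \<and>
     (\<forall>w. fst ((tm_step M ^^ t (length w)) (tm_init M w)) =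
            (if w \<in> A then tm_accept M else tm_reject M))"

definition DTIME :: "(nat \<Rightarrow> nat) \<Rightarrow> bool list set set" where
  "DTIME t = {A. \<exists>M c. tm_decides_in_time M A (\<lambda>n. c * t n + c)}"

definition EXPTIME :: "bool list set set" where
  "EXPTIME = (\<Union>c. DTIME (\<lambda>n. 2 ^ (n ^ c)))"


section \<open>Binary encoding of the input data\<close>

text \<open>All encodings are self-delimiting, so that tuples can be encoded by concatenation.\<close>

fun nat_bits :: "nat \<Rightarrow> bool list" where
  "nat_bits n = (if n = 0 then [] else odd n # nat_bits (n div 2))"

declare nat_bits.simps [simp del]

definition enc_list :: "('a \<Rightarrow> bool list) \<Rightarrow> 'a list \<Rightarrow> bool list" where
  "enc_list enc xs = concat (map (\<lambda>x. True # enc x) xs) @ [False]"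

definition enc_word :: "bool list \<Rightarrow> bool list" where
  "enc_word = enc_list (\<lambda>b. [b])"

definition enc_nat :: "nat \<Rightarrow> bool list" where
  "enc_nat n = enc_word (nat_bits n)"

definition enc_int :: "int \<Rightarrow> bool list" where
  "enc_int i = (i < 0) # enc_nat (nat \<bar>i\<bar>)"

definition enc_rat :: "rat \<Rightarrow> bool list" where
  "enc_rat q = (case quotient_of q of (n, d) \<Rightarrow> enc_int n @ enc_int d)"

definition enc_option :: "('a \<Rightarrow> bool list) \<Rightarrow> 'a option \<Rightarrow> bool list" where
  "enc_option enc v = (case v of None \<Rightarrow> [False] | Some y \<Rightarrow> True # enc y)"

definition enc_pw_rep :: "pw_rep \<Rightarrow> bool list" where
  "enc_pw_rep =
     enc_list (\<lambda>(x, v, a, b). enc_rat x @ enc_option enc_rat v @ enc_rat a @ enc_rat b)"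

text \<open>The components are the states, the transitions, the initial state, the accepting states,
  and a name of the initial energy.\<close>

type_synonym input_data =
  "nat list \<times> (nat \<times> pw_rep \<times> nat) list \<times> nat \<times> nat list \<times> bool list"

definition enc_input :: "input_data \<Rightarrow> bool list" where
  "enc_input = (\<lambda>(Ss, Ts, s0, Fs, u).
     enc_list enc_nat Ss @
     enc_list (\<lambda>(s, r, s'). enc_nat s @ enc_pw_rep r @ enc_nat s') Ts @
     enc_nat s0 @ enc_list enc_nat Fs @ enc_word u)"

definition prefix_code :: "('a \<Rightarrow> bool list) \<Rightarrow> bool" where
  "prefix_code enc \<longleftrightarrow> (\<forall>x y u v. enc x @ u = enc y @ v \<longrightarrow> x = y \<and> u = v)"

lemma prefix_codeD: "prefix_code enc \<Longrightarrow> enc x @ u = enc y @ v \<Longrightarrow> x = y \<and> u = v"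
  unfolding prefix_code_def by blast

lemma prefix_code_list:
  assumes "prefix_code enc"
  shows "prefix_code (enc_list enc)"
proof -
  have "enc_list enc xs @ u = enc_list enc ys @ v \<Longrightarrow> xs = ys \<and> u = v" for xs ys u v
  proof (induction xs arbitrary: ys)
    case Nil
    then show ?case by (cases ys) (auto simp: enc_list_def)
  next
    case (Cons x xs)
    show ?case
    proof (cases ys)
      case Nil
      then show ?thesis using Cons.prems by (auto simp: enc_list_def)
    next
      case (Cons y ys')
      then have "enc x @ (enc_list enc xs @ u) = enc y @ (enc_list enc ys' @ v)"
        using Cons.prems by (simp add: enc_list_def)
      then have "x = y \<and> enc_list enc xs @ u = enc_list enc ys' @ v"
        by (rule prefix_codeD [OF assms])
      then show ?thesis using Cons.IH Cons by blast
    qed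
  qed
  then show ?thesis unfolding prefix_code_def by blast
qed

lemma inj_nat_bits: "nat_bits m = nat_bits n \<Longrightarrow> m = n"
proof (induction m arbitrary: n rule: less_induct)
  case (less m)
  show ?case
  proof (cases "m = 0 \<or> n = 0")
    case True
    then show ?thesis using less.prems
      by (auto simp: nat_bits.simps [of m] nat_bits.simps [of n] split: if_splits)
  next
    case False
    then have eq: "odd m = odd n" "nat_bits (m div 2) = nat_bits (n div 2)"
      using less.prems by (simp_all add: nat_bits.simps [of m] nat_bits.simps [of n])
    then have "m div 2 = n div 2" using less.IH [of "m div 2"] False by simp
    then show ?thesis using eq(1) by presburger
  qed
qed

lemma prefix_code_word: "prefix_code enc_word"
  unfolding enc_word_def by (rule prefix_code_list) (simp add: prefix_code_def)

lemma prefix_code_nat: "prefix_code enc_nat"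
  using prefix_codeD [OF prefix_code_word] inj_nat_bits
  unfolding prefix_code_def enc_nat_def by metis

lemma prefix_code_int: "prefix_code enc_int"
proof -
  have "i = j \<and> u = v" if "enc_int i @ u = enc_int j @ v" for i j u v
  proof -
    have sgn: "(i < 0) = (j < 0)" and "enc_nat (nat \<bar>i\<bar>) @ u = enc_nat (nat \<bar>j\<bar>) @ v"
      using that by (simp_all add: enc_int_def)
    then have "nat \<bar>i\<bar> = nat \<bar>j\<bar> \<and> u = v"
      using prefix_codeD [OF prefix_code_nat] by metis
    then show ?thesis using sgn by (cases "i < 0") auto
  qed
  then show ?thesis unfolding prefix_code_def by blast
qed

lemma prefix_code_rat: "prefix_code enc_rat"
proof -
  have "p = q \<and> u = v" if "enc_rat p @ u = enc_rat q @ v" for p q u v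
  proof -
    obtain a b c d where ab: "quotient_of p = (a, b)" and cd: "quotient_of q = (c, d)"
      by (metis surj_pair)
    have "enc_int a @ (enc_int b @ u) = enc_int c @ (enc_int d @ v)"
      using that ab cd by (simp add: enc_rat_def)
    then have "a = c \<and> b = d \<and> u = v"
      using prefix_codeD [OF prefix_code_int] by metis
    then show ?thesis using ab cd by (metis quotient_of_inject)
  qed
  then show ?thesis unfolding prefix_code_def by blast
qed

lemma prefix_code_option:
  assumes "prefix_code enc"
  shows "prefix_code (enc_option enc)"
proof -
  have "x = y \<and> u = v" if eq: "enc_option enc x @ u = enc_option enc y @ v" for x y u v
  proof (cases x)
    case None
    then show ?thesis using eq by (cases y) (simp_all add: enc_option_def)
  next
    case (Some a)
    then obtain b where b: "y = Some b" using eq by (cases y) (simp_all add: enc_option_def)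
    have "enc a @ u = enc b @ v" using eq Some b by (simp add: enc_option_def)
    then have "a = b \<and> u = v" by (rule prefix_codeD [OF assms])
    then show ?thesis using Some b by simp
  qed
  then show ?thesis unfolding prefix_code_def by blast
qed

lemma prefix_code_pair:
  assumes "prefix_code enc" and "prefix_code enc'"
  shows "prefix_code (\<lambda>z. enc (fst z) @ enc' (snd z))"
proof -
  have "x = y \<and> u = v"
    if "(enc (fst x) @ enc' (snd x)) @ u = (enc (fst y) @ enc' (snd y)) @ v" for x y u v
  proof -
    have "enc (fst x) @ (enc' (snd x) @ u) = enc (fst y) @ (enc' (snd y) @ v)"
      using that by simp
    then have 1: "fst x = fst y \<and> enc' (snd x) @ u = enc' (snd y) @ v"
      by (rule prefix_codeD [OF assms(1)])
    then have "snd x = snd y \<and> u = v"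
      using prefix_codeD [OF assms(2), of "snd x" u "snd y" v] by simp
    then show ?thesis using 1 by (simp add: prod_eq_iff)
  qed
  then show ?thesis unfolding prefix_code_def by blast
qed

lemma prefix_code_pw_rep: "prefix_code enc_pw_rep"
  unfolding enc_pw_rep_def case_prod_beta
  by (intro prefix_code_list prefix_code_pair prefix_code_option prefix_code_rat)

lemma prefix_code_transition:
  "prefix_code (\<lambda>(s, r, s'). enc_nat s @ enc_pw_rep r @ enc_nat s')"
  unfolding case_prod_beta
  by (intro prefix_code_pair prefix_code_nat prefix_code_pw_rep)

lemma prefix_code_input: "prefix_code enc_input"
proof -
  have eq: "enc_input = (\<lambda>z. enc_list enc_nat (fst z) @
      enc_list (\<lambda>(s, r, s'). enc_nat s @ enc_pw_rep r @ enc_nat s') (fst (snd z)) @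
      enc_nat (fst (snd (snd z))) @ enc_list enc_nat (fst (snd (snd (snd z)))) @
      enc_word (snd (snd (snd (snd z)))))"
    by (simp add: enc_input_def case_prod_beta')
  show ?thesis unfolding eq
    by (intro prefix_code_pair prefix_code_list prefix_code_nat prefix_code_word
      prefix_code_transition)
qed

lemma inj_enc_input: "inj enc_input"
proof (rule injI)
  fix x y assume "enc_input x = enc_input y"
  then have "enc_input x @ [] = enc_input y @ []" by simp
  then show "x = y" using prefix_codeD [OF prefix_code_input] by blast
qed


section \<open>The decision problems\<close>

text \<open>Initial energies are given by words naming them; \<open>\<nu>\<close> is the partial map from names to
  energies (for example, binary names of rational numbers, or a single name for a fixed real).
  What has to be computable about them is how a named energy compares to a given rational number;
  the complexity class \<open>\<C>\<close> says how efficiently. For a single name of a fixed real number $x$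
  and \<open>\<C>\<close> the class of decidable languages, this means that $x$ is a computable real number.
  Nothing weaker can do: a single transition $x \mapsto x$ with domain $[q,\infty)$ or
  $(q,\infty)$ reduces these comparisons to reachability.\<close>

definition energies_comparable_in :: "bool list set set \<Rightarrow> (bool list \<rightharpoonup> real) \<Rightarrow> bool" where
  "energies_comparable_in \<C> \<nu> \<longleftrightarrow>
     {enc_word u @ enc_rat q | u q x. \<nu> u = Some x \<and> of_rat q \<le> x} \<in> \<C> \<and>
     {enc_word u @ enc_rat q | u q x. \<nu> u = Some x \<and> of_rat q < x} \<in> \<C>"

definition describes ::
  "(bool list \<rightharpoonup> real) \<Rightarrow> input_data \<Rightarrow>
     nat set \<Rightarrow> nat transition set \<Rightarrow> nat \<Rightarrow> nat set \<Rightarrow> real \<Rightarrow> bool" where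
  "describes \<nu> = (\<lambda>(Ss, Ts, s, Fs, u) S T s0 F x0.
     S = set Ss \<and>
     (\<exists>Tl. T = set Tl \<and> list_all2 (rel_prod (=) (rel_prod pw_represents (=))) Ts Tl) \<and>
     s0 = s \<and> F = set Fs \<and> \<nu> u = Some x0)"

definition reachability_problem :: "(bool list \<rightharpoonup> real) \<Rightarrow> bool list set" where
  "reachability_problem \<nu> =
     {enc_input I | I S T s0 F x0.
        describes \<nu> I S T s0 F x0 \<and> pw_automaton S T \<and> s0 \<in> S \<and> F \<subseteq> S \<and> 0 \<le> x0 \<and>
        has_reaching_run T s0 F x0}"

definition buechi_problem :: "(bool list \<rightharpoonup> real) \<Rightarrow> bool list set" where
  "buechi_problem \<nu> =
     {enc_input I | I S T s0 F x0.
        describes \<nu> I S T s0 F x0 \<and> pw_automaton S T \<and> s0 \<in> S \<and> F \<subseteq> S \<and> 0 \<le> x0 \<and>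
        has_buechi_run T s0 F x0}"

end

theory Submission
  imports Defs
begin

text \<open>Every transition function satisfies \<open>f x' - f x \<ge> x' - x\<close> for \<open>x \<le> x'\<close>, so a cycle that gains energy
  at some point gains at least as much at every higher point and can be pumped without limit. Hence
  short paths suffice: a reaching run is a short path, possibly via a short gaining cycle after which
  the energy counts as infinite, and a Buechi run needs in addition a short cycle through an accepting
  state that does not lose energy, either at the energy reached or at infinity.

  Along a path the energy is an affine function of the initial energy \<open>x\<close>, and every test made on the
  way compares \<open>x\<close> with a rational number of polynomially many bits. Acceptance is upward closed in \<open>x\<close>,
  so the accepted energies form a ray whose end point is the least of these numbers \<open>q\<close> such that
  energies at \<open>q\<close>, or just above it, are accepted. Exhaustive search finds \<open>q\<close> in
  exponential time, and a single comparison of the initial energy with \<open>q\<close> remains.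

  For the time bound, programs on binary trees stored on stacks of a Turing machine are closed under
  the constructions that the search needs; the comparison is made by simulating the given
  machine on the query.\<close>

section \<open>A structured language for multi-tape machines\<close>

text \<open>During the search the initial energy is out of reach: it is accessible only through two
  languages of comparisons, and the reduction asks one of them a single question at its very end.
  Hence runs are executed symbolically, with an oracle telling which of the affine expressions met
  on the way are positive. Finitely many oracles matter: if all coefficients are quotients of
  integers up to \<open>H\<close>, the zeros of the expressions are quotients of integers up to
  \<open>H * H\<close>, so no answer changes between neighbouring candidates, and beyond
  \<open>H * H\<close> the answers are those at infinity. Each transition multiplies the bound by a
  fixed factor, so the number of bits grows linearly with the length of the path; this is why paths
  must be short. On the machine side the obstacle is that exponential time is not closed under
  composition. The class \<open>X\<close> therefore also demands polynomially long values, while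
  loops may make exponentially many rounds; arithmetic can then be done by counting, and exhaustive
  search is one more loop.\<close>

datatype cmd =
    Nop
  | Act "nat list \<Rightarrow> (nat \<times> head_move) list"
  | Seq cmd cmd
  | Cond "nat list \<Rightarrow> bool" cmd cmd
  | Loop "nat list \<Rightarrow> bool" cmd
  | Halt bool

definition stay :: "nat list \<Rightarrow> (nat \<times> head_move) list" where
  "stay as = map (\<lambda>a. (a, Stay)) as"

text \<open>Passing from \<open>Seq Nop d\<close> to \<open>d\<close> and every test cost one step
  in which the tapes rest. A \<open>Halt\<close> in the first part of a \<open>Seq\<close> would
  block it forever, so it is only used in final position.\<close>

fun nxt :: "cmd \<Rightarrow> nat list \<Rightarrow> cmd \<times> (nat \<times> head_move) list" where
  "nxt Nop as = (Nop, stay as)"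
| "nxt (Act f) as = (Nop, f as)"
| "nxt (Seq c d) as = (if c = Nop then (d, stay as) else (Seq (fst (nxt c as)) d, snd (nxt c as)))"
| "nxt (Cond b c d) as = (if b as then c else d, stay as)"
| "nxt (Loop b c) as = (if b as then Seq c (Loop b c) else Nop, stay as)"
| "nxt (Halt v) as = (Halt v, stay as)"

definition reads :: "tape list \<Rightarrow> nat list" where
  "reads ts = map (\<lambda>(t, h). t h) ts"

definition apply_acts :: "tape list \<Rightarrow> (nat \<times> head_move) list \<Rightarrow> tape list" where
  "apply_acts ts acts = map2 (\<lambda>(t, h) (a, m). (t(h := a), h + head_offset m)) ts acts"

definition cstep :: "cmd \<times> tape list \<Rightarrow> cmd \<times> tape list" where
  "cstep = (\<lambda>(c, ts). (fst (nxt c (reads ts)), apply_acts ts (snd (nxt c (reads ts)))))"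

lemma length_reads [simp]: "length (reads ts) = length ts"
  by (simp add: reads_def)

lemma length_stay [simp]: "length (stay as) = length as"
  by (simp add: stay_def)

lemma reads_nth: "i < length ts \<Longrightarrow> reads ts ! i = fst (ts ! i) (snd (ts ! i))"
  by (simp add: reads_def case_prod_beta)

lemma length_apply_acts [simp]: "length (apply_acts ts acts) = min (length ts) (length acts)"
  by (simp add: apply_acts_def)

lemma apply_acts_nth:
  "i < length ts \<Longrightarrow> i < length acts \<Longrightarrow> apply_acts ts acts ! i =
    ((fst (ts ! i))(snd (ts ! i) := fst (acts ! i)), snd (ts ! i) + head_offset (snd (acts ! i)))"
  by (simp add: apply_acts_def case_prod_beta)

lemma apply_stay [simp]: "apply_acts ts (stay (reads ts)) = ts"
  by (rule nth_equalityI) (simp_all add: apply_acts_nth stay_def reads_nth)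

text \<open>The commands reachable from \<open>c\<close> by small steps; they serve as machine states.\<close>

fun residuals :: "cmd \<Rightarrow> cmd set" where
  "residuals Nop = {Nop}"
| "residuals (Act f) = {Act f, Nop}"
| "residuals (Seq c d) = (\<lambda>c'. Seq c' d) ` residuals c \<union> residuals d"
| "residuals (Cond b c d) = {Cond b c d} \<union> residuals c \<union> residuals d"
| "residuals (Loop b c) = {Loop b c, Nop} \<union> (\<lambda>c'. Seq c' (Loop b c)) ` residuals c"
| "residuals (Halt v) = {Halt v}"

text \<open>Unrolling a loop does not produce ever new commands, because the unrolled body is
  followed by the same \<open>Loop\<close> term again.\<close>

lemma finite_residuals: "finite (residuals c)"
  by (induction c) auto

lemma self_residuals: "c \<in> residuals c"
  by (induction c) auto

lemma nxt_residuals: "c' \<in> residuals c \<Longrightarrow> fst (nxt c' as) \<in> residuals c"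
proof (induction c arbitrary: c')
  case (Seq c d)
  then consider c'' where "c' = Seq c'' d" "c'' \<in> residuals c" | "c' \<in> residuals d" by auto
  then show ?case
  proof cases
    case 1
    then show ?thesis using Seq.IH(1)[OF 1(2)] self_residuals[of d] by simp
  next
    case 2
    then show ?thesis using Seq.IH(2)[OF 2] by simp
  qed
next
  case (Cond b c d)
  then consider "c' = Cond b c d" | "c' \<in> residuals c" | "c' \<in> residuals d" by auto
  then show ?case
    by cases (use Cond.IH self_residuals in \<open>simp_all\<close>)
next
  case (Loop b c)
  then consider "c' = Loop b c" | "c' = Nop" | c'' where "c' = Seq c'' (Loop b c)" "c'' \<in> residuals c"
    by auto
  then show ?case
  proof cases
    case 3
    then show ?thesis using Loop.IH[OF 3(2)] by simp
  qed (simp_all add: self_residuals)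
qed auto

definition ok_syms :: "nat \<Rightarrow> nat \<Rightarrow> nat list \<Rightarrow> bool" where
  "ok_syms k n as \<longleftrightarrow> length as = k \<and> (\<forall>a\<in>set as. a < n)"

definition ok_acts :: "nat \<Rightarrow> nat \<Rightarrow> (nat \<times> head_move) list \<Rightarrow> bool" where
  "ok_acts k n xs \<longleftrightarrow> length xs = k \<and> (\<forall>(a, m)\<in>set xs. a < n)"

definition valid_acts :: "nat \<Rightarrow> nat \<Rightarrow> (nat list \<Rightarrow> (nat \<times> head_move) list) \<Rightarrow> bool" where
  "valid_acts k n f \<longleftrightarrow> (\<forall>as. ok_syms k n as \<longrightarrow> ok_acts k n (f as))"

fun wf_cmd :: "nat \<Rightarrow> nat \<Rightarrow> cmd \<Rightarrow> bool" where
  "wf_cmd k n (Act f) \<longleftrightarrow> valid_acts k n f"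
| "wf_cmd k n (Seq c d) \<longleftrightarrow> wf_cmd k n c \<and> wf_cmd k n d"
| "wf_cmd k n (Cond b c d) \<longleftrightarrow> wf_cmd k n c \<and> wf_cmd k n d"
| "wf_cmd k n (Loop b c) \<longleftrightarrow> wf_cmd k n c"
| "wf_cmd k n Nop \<longleftrightarrow> True"
| "wf_cmd k n (Halt v) \<longleftrightarrow> True"

lemma ok_stay: "ok_syms k n as \<Longrightarrow> ok_acts k n (stay as)"
  by (auto simp: ok_syms_def ok_acts_def stay_def)

lemma wf_residuals: "wf_cmd k n c \<Longrightarrow> Ball (residuals c) (wf_cmd k n)"
proof (induction c)
  case (Seq c d)
  have "wf_cmd k n c" "wf_cmd k n d" using Seq.prems by simp_all
  from Seq.IH(1)[OF this(1)] Seq.IH(2)[OF this(2)] this show ?case by auto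
next
  case (Cond b c d)
  have "wf_cmd k n c" "wf_cmd k n d" using Cond.prems by simp_all
  from Cond.IH(1)[OF this(1)] Cond.IH(2)[OF this(2)] this show ?case by auto
next
  case (Loop b c)
  have "wf_cmd k n c" using Loop.prems by simp
  from Loop.IH[OF this] this show ?case by auto
qed simp_all

lemma ok_nxt: "wf_cmd k n c \<Longrightarrow> ok_syms k n as \<Longrightarrow> ok_acts k n (snd (nxt c as))"
  by (induction c) (simp_all add: ok_stay valid_acts_def)

text \<open>Machine states are numbers of residual commands, so one machine step is exactly one
  \<open>cstep\<close> and time bounds carry over without overhead.\<close>

theorem compile_cmd:
  assumes "wf_cmd k n P" "1 \<le> k" "3 \<le> n"
  obtains M where "tm_wf M" "tm_tapes M = k"
    "\<And>w t v ts. (cstep ^^ t) (P, input_tape w # replicate (k - 1) (\<lambda>_. 0, 0)) = (Halt v, ts) \<Longrightarrow>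
       fst ((tm_step M ^^ t) (tm_init M w)) = (if v then tm_accept M else tm_reject M)"
proof -
  \<comment> \<open>Both halting commands are added because a machine has two distinct final states,
    whether or not \<open>P\<close> can reach them.\<close>
  define Q where "Q = residuals P \<union> {Halt True, Halt False}"
  have fin: "finite Q" by (simp add: Q_def finite_residuals)
  then obtain h where h: "bij_betw h Q {0..<card Q}" using ex_bij_betw_finite_nat by blast
  define g where "g = inv_into Q h"
  have inj: "inj_on h Q" and hQ: "\<And>c. c \<in> Q \<Longrightarrow> h c < card Q"
    using h by (auto simp: bij_betw_def)
  have gh: "\<And>c. c \<in> Q \<Longrightarrow> g (h c) = c" by (simp add: g_def inj)
  have gQ: "\<And>q. q < card Q \<Longrightarrow> g q \<in> Q"
    unfolding g_def by (rule inv_into_into) (use h in \<open>auto simp: bij_betw_def\<close>)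
  have nQ: "fst (nxt c as) \<in> Q" if cQ: "c \<in> Q" for c as
  proof (cases "c \<in> residuals P")
    case True
    then show ?thesis using nxt_residuals[OF True] unfolding Q_def by blast
  next
    case False
    then obtain v where v: "c = Halt v" using cQ unfolding Q_def by blast
    then show ?thesis using cQ by simp
  qed
  have wQ: "wf_cmd k n c" if cQ: "c \<in> Q" for c
  proof (cases "c \<in> residuals P")
    case True
    then show ?thesis by (rule bspec[OF wf_residuals[OF assms(1)]])
  next
    case False
    then obtain v where v: "c = Halt v" using cQ unfolding Q_def by blast
    then show ?thesis by simp
  qed
  define M where "M = \<lparr>tm_tapes = k, tm_states = card Q, tm_symbols = n, tm_start = h P,
     tm_accept = h (Halt True), tm_reject = h (Halt False),
     tm_trans = (\<lambda>q as. (h (fst (nxt (g q) as)), snd (nxt (g q) as)))\<rparr>"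
  have PQ: "P \<in> Q" by (simp add: Q_def self_residuals)
  have HQ: "Halt v \<in> Q" for v by (cases v) (auto simp: Q_def)
  have trans: "h (fst (nxt (g q) as)) < card Q \<and> length (snd (nxt (g q) as)) = k \<and>
      (\<forall>(a, m) \<in> set (snd (nxt (g q) as)). a < n)"
    if "q < card Q" "length as = k" "\<forall>a\<in>set as. a < n" for q as
    using hQ[OF nQ[OF gQ[OF that(1)]]] ok_nxt[OF wQ[OF gQ[OF that(1)]], of as] that(2,3)
    unfolding ok_syms_def ok_acts_def by blast
  have "h (Halt True) \<noteq> h (Halt False)"
    using inj_onD[OF inj _ HQ HQ] by blast
  then have wf: "tm_wf M"
    using trans hQ[OF PQ] hQ[OF HQ] assms(2,3) unfolding tm_wf_def M_def
    by (simp add: case_prod_beta) blast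
  have step: "tm_step M (h c, ts) = (h (fst (cstep (c, ts))), snd (cstep (c, ts)))" if "c \<in> Q" for c ts
  proof (cases "\<exists>v. c = Halt v")
    case True
    then obtain v where c: "c = Halt v" by blast
    have "tm_step M (h (Halt v), ts) = (h (Halt v), ts)"
      by (cases v) (simp_all add: tm_step_def M_def)
    then show ?thesis using c by (simp add: cstep_def)
  next
    case False
    then have ne: "h c \<noteq> h (Halt v)" for v using inj_onD[OF inj _ that HQ, of v] by blast
    then show ?thesis unfolding tm_step_def M_def cstep_def apply_acts_def reads_def
      by (simp add: gh[OF that])
  qed
  have cQ: "c \<in> Q \<Longrightarrow> fst (cstep (c, ts)) \<in> Q" for c ts by (simp add: cstep_def nQ)
  have steps: "fst ((cstep ^^ t) (P, ts)) \<in> Q \<and>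
     (tm_step M ^^ t) (h P, ts) = (h (fst ((cstep ^^ t) (P, ts))), snd ((cstep ^^ t) (P, ts)))" for t ts
  proof (induction t)
    case (Suc t)
    obtain c' ts' where e: "(cstep ^^ t) (P, ts) = (c', ts')" by (metis surj_pair)
    show ?case using Suc e step[of c' ts'] cQ[of c' ts'] by simp
  qed (simp add: PQ)
  show ?thesis
  proof (rule that[OF wf])
    show "tm_tapes M = k" by (simp add: M_def)
    fix w t v ts
    assume "(cstep ^^ t) (P, input_tape w # replicate (k - 1) (\<lambda>_. 0, 0)) = (Halt v, ts)"
    then show "fst ((tm_step M ^^ t) (tm_init M w)) = (if v then tm_accept M else tm_reject M)"
      using steps[of t "input_tape w # replicate (k - 1) (\<lambda>_. 0, 0)"]
      by (auto simp: tm_init_def M_def)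
  qed
qed

definition runs :: "cmd \<Rightarrow> tape list \<Rightarrow> nat \<Rightarrow> tape list \<Rightarrow> bool" where
  "runs c ts n ts' \<longleftrightarrow> (\<exists>m\<le>n. (cstep ^^ m) (c, ts) = (Nop, ts'))"

lemma runs_mono: "runs c ts m ts' \<Longrightarrow> m \<le> n \<Longrightarrow> runs c ts n ts'"
  unfolding runs_def by (meson le_trans)

lemma runs_Nop: "runs Nop ts n ts"
  unfolding runs_def by (rule exI[of _ 0]) simp

lemma runs_step: "cstep (c, ts) = (d, us) \<Longrightarrow> runs d us n ts' \<Longrightarrow> runs c ts (Suc n) ts'"
  unfolding runs_def by (metis Suc_le_mono comp_apply funpow_Suc_right)

lemma runs_Act: "apply_acts ts (f (reads ts)) = ts' \<Longrightarrow> 1 \<le> n \<Longrightarrow> runs (Act f) ts n ts'"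
  by (rule runs_mono[OF runs_step[OF _ runs_Nop[where n = 0]]]) (auto simp: cstep_def)

text \<open>The extra step is the passage from \<open>Seq Nop d\<close> to \<open>d\<close>.\<close>

lemma Seq_steps:
  assumes "runs c ts m us"
  shows "\<exists>k\<le>m + 1. (cstep ^^ k) (Seq c d, ts) = (d, us)"
proof -
  have "\<exists>k\<le>m. (cstep ^^ k) (Seq c d, ts) = (Seq Nop d, us)" if "(cstep ^^ m) (c, ts) = (Nop, us)" for m
    using that
  proof (induction m arbitrary: c ts)
    case (Suc m)
    show ?case
    proof (cases "c = Nop")
      \<comment> \<open>\<open>Nop\<close> alone would idle for the remaining steps, but
        \<open>Seq Nop d\<close> moves on at once; so the count ends here.\<close>
      case True
      have "cstep (Nop, ts) = (Nop, ts)" by (simp add: cstep_def)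
      then have "(cstep ^^ k) (Nop, ts) = (Nop, ts)" for k by (induction k) auto
      then show ?thesis using Suc.prems True by (intro exI[of _ 0]) (metis funpow_0 prod.inject zero_le)
    next
      case False
      obtain c1 ts' where c1: "cstep (c, ts) = (c1, ts')" by (metis surj_pair)
      then have s: "cstep (Seq c d, ts) = (Seq c1 d, ts')" using False by (auto simp: cstep_def)
      have "(cstep ^^ m) (c1, ts') = (Nop, us)"
        using Suc.prems c1 by (simp add: funpow_Suc_right del: funpow.simps)
      from Suc.IH[OF this] obtain k where "k \<le> m" "(cstep ^^ k) (Seq c1 d, ts') = (Seq Nop d, us)" by blast
      then show ?thesis using s by (intro exI[of _ "Suc k"]) (simp add: funpow_Suc_right del: funpow.simps)
    qed
  qed (auto intro: exI[of _ 0])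
  then obtain k where k: "k \<le> m" "(cstep ^^ k) (Seq c d, ts) = (Seq Nop d, us)"
    using assms(1) unfolding runs_def by (meson le_trans)
  have "cstep (Seq Nop d, us) = (d, us)" by (simp add: cstep_def)
  then have "(cstep ^^ Suc k) (Seq c d, ts) = (d, us)" using k(2) by simp
  then show ?thesis using k(1) by (metis Suc_eq_plus1 Suc_le_mono)
qed

lemma runs_Seq:
  assumes "runs c ts m us" "runs d us n vs" "m + n + 1 \<le> l"
  shows "runs (Seq c d) ts l vs"
proof -
  obtain k where k: "k \<le> m + 1" "(cstep ^^ k) (Seq c d, ts) = (d, us)" using Seq_steps[OF assms(1)] by blast
  obtain j where j: "j \<le> n" "(cstep ^^ j) (d, us) = (Nop, vs)" using assms(2) unfolding runs_def by blast
  have "(cstep ^^ (j + k)) (Seq c d, ts) = (Nop, vs)" using k j by (simp add: funpow_add)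
  moreover have "j + k \<le> l" using k j assms(3) by simp
  ultimately show ?thesis unfolding runs_def by blast
qed

text \<open>All later times are included because \<open>tm_decides_in_time\<close> inspects one
  prescribed time, which may lie beyond the actual end of the computation.\<close>

definition halts :: "cmd \<Rightarrow> tape list \<Rightarrow> nat \<Rightarrow> bool \<Rightarrow> bool" where
  "halts c ts n v \<longleftrightarrow> (\<forall>t\<ge>n. \<exists>us. (cstep ^^ t) (c, ts) = (Halt v, us))"

lemma halts_Halt: "halts (Halt v) ts n v"
proof -
  have "(cstep ^^ t) (Halt v, ts) = (Halt v, ts)" for t by (induction t) (simp_all add: cstep_def)
  then show ?thesis unfolding halts_def by blast
qed

lemma halts_steps:
  assumes "(cstep ^^ k) (c, ts) = (d, us)" "halts d us n v" "k + n \<le> l"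
  shows "halts c ts l v"
  unfolding halts_def
proof (intro allI impI)
  fix t assume "l \<le> t"
  then have t: "t = (t - k) + k" "n \<le> t - k" using assms(3) by auto
  have "(cstep ^^ t) (c, ts) = (cstep ^^ (t - k)) (d, us)"
    by (subst t(1)) (simp add: funpow_add assms(1))
  then show "\<exists>us. (cstep ^^ t) (c, ts) = (Halt v, us)" using assms(2) t(2) unfolding halts_def by simp
qed

lemma halts_Seq:
  assumes "runs c ts m us" "halts d us n v" "m + n + 1 \<le> l"
  shows "halts (Seq c d) ts l v"
proof -
  obtain k where k: "k \<le> m + 1" "(cstep ^^ k) (Seq c d, ts) = (d, us)" using Seq_steps[OF assms(1)] by blast
  show ?thesis by (rule halts_steps[OF k(2) assms(2)]) (use k(1) assms(3) in simp)
qed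

lemma halts_Cond:
  assumes "halts (if b (reads ts) then c else d) ts n v" "n + 1 \<le> l"
  shows "halts (Cond b c d) ts l v"
  by (rule halts_steps[of 1, OF _ assms(1)]) (use assms(2) in \<open>auto simp: cstep_def\<close>)

lemma runs_CondT: "b (reads ts) \<Longrightarrow> runs c ts n ts' \<Longrightarrow> n + 1 \<le> l \<Longrightarrow> runs (Cond b c d) ts l ts'"
  by (rule runs_mono[OF runs_step[where d = c and us = ts and n = n]]) (auto simp: cstep_def)

lemma runs_CondF: "\<not> b (reads ts) \<Longrightarrow> runs d ts n ts' \<Longrightarrow> n + 1 \<le> l \<Longrightarrow> runs (Cond b c d) ts l ts'"
  by (rule runs_mono[OF runs_step[where d = d and us = ts and n = n]]) (auto simp: cstep_def)

lemma runs_LoopF: "\<not> b (reads ts) \<Longrightarrow> 1 \<le> l \<Longrightarrow> runs (Loop b c) ts l ts"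
  by (rule runs_mono[OF runs_step[where d = Nop and us = ts and n = 0]]) (auto simp: cstep_def runs_Nop)

lemma runs_LoopT:
  assumes "b (reads ts)" "runs c ts m ts1" "runs (Loop b c) ts1 n ts'" "m + n + 2 \<le> l"
  shows "runs (Loop b c) ts l ts'"
proof -
  have "runs (Seq c (Loop b c)) ts (m + n + 1) ts'" by (rule runs_Seq[OF assms(2,3)]) simp
  then have "runs (Loop b c) ts (Suc (m + n + 1)) ts'"
    by (rule runs_step[rotated]) (simp add: cstep_def assms(1))
  then show ?thesis by (rule runs_mono) (use assms(4) in simp)
qed

section \<open>Stacks on tapes\<close>

text \<open>The bottom of the stack is at cell 1, the head is on the top element, and cell 0 stays
  blank. Reading 0 thus signals an empty stack as long as only nonzero symbols are pushed, and a
  blank tape is an empty stack.\<close>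

definition stack_tape :: "nat list \<Rightarrow> tape" where
  "stack_tape xs = (\<lambda>p. if 0 < p \<and> p \<le> int (length xs) then rev xs ! nat (p - 1) else 0, int (length xs))"

definition top0 :: "nat list \<Rightarrow> nat" where
  "top0 xs = (case xs of [] \<Rightarrow> 0 | x # _ \<Rightarrow> x)"

lemma top0_simps [simp]: "top0 [] = 0" "top0 (x # xs) = x"
  by (simp_all add: top0_def)

definition act1 :: "nat \<Rightarrow> (nat \<Rightarrow> nat \<times> head_move) \<Rightarrow> cmd" where
  "act1 i g = Act (\<lambda>as. (stay as)[i := g (as ! i)])"

lemma runs_act1:
  assumes "i < length ts" "ts' = ts[i := (case ts ! i of (t, h) \<Rightarrow>
     (t(h := fst (g (t h))), h + head_offset (snd (g (t h)))))]" "1 \<le> n"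
  shows "runs (act1 i g) ts n ts'"
  unfolding act1_def
proof (rule runs_Act)
  show "apply_acts ts ((stay (reads ts))[i := g (reads ts ! i)]) = ts'"
    unfolding assms(2) using assms(1)
    by (intro nth_equalityI)
      (auto simp: apply_acts_nth reads_nth stay_def nth_list_update case_prod_beta)
qed fact

definition push :: "nat \<Rightarrow> nat \<Rightarrow> cmd" where
  "push i a = Seq (act1 i (\<lambda>x. (x, Move_Right))) (act1 i (\<lambda>_. (a, Stay)))"

definition pop :: "nat \<Rightarrow> cmd" where
  "pop i = act1 i (\<lambda>_. (0, Move_Left))"

lemma read_stack_tape [simp]: "fst (stack_tape xs) (snd (stack_tape xs)) = top0 xs"
  by (cases xs) (auto simp: stack_tape_def nth_append)

lemma runs_push:
  assumes "i < length ts" "ts ! i = stack_tape xs"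
  shows "runs (push i a) ts 3 (ts[i := stack_tape (a # xs)])"
  unfolding push_def
proof (rule runs_Seq[OF runs_act1[OF assms(1) refl order_refl] runs_act1[OF _ _ order_refl]])
  have "(\<lambda>p. if 0 < p \<and> p \<le> int (length xs) then rev xs ! nat (p - 1) else 0)(int (length xs) + 1 := a)
    = (\<lambda>p. if 0 < p \<and> p \<le> int (length (a # xs)) then rev (a # xs) ! nat (p - 1) else 0)"
    by (auto simp: fun_eq_iff nth_append)
  then show "ts[i := stack_tape (a # xs)] = (ts[i := case ts ! i of (t, h) \<Rightarrow>
     (t(h := fst (t h, Move_Right)), h + head_offset (snd (t h, Move_Right)))])
     [i := case ts[i := case ts ! i of (t, h) \<Rightarrow>
     (t(h := fst (t h, Move_Right)), h + head_offset (snd (t h, Move_Right)))] ! i of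
      (t, h) \<Rightarrow> (t(h := fst (a, Stay)), h + head_offset (snd (a, Stay)))]"
    using assms by (simp add: stack_tape_def add.commute)
qed (use assms in auto)

lemma runs_pop:
  assumes "i < length ts" "ts ! i = stack_tape (x # xs)"
  shows "runs (pop i) ts 1 (ts[i := stack_tape xs])"
  unfolding pop_def
proof (rule runs_act1[OF assms(1) _ order_refl])
  have "stack_tape xs = (case stack_tape (x # xs) of (t, h) \<Rightarrow> (t(h := 0), h - 1))"
    by (auto simp: stack_tape_def fun_eq_iff nth_append)
  then show "ts[i := stack_tape xs] = ts[i := case ts ! i of (t, h) \<Rightarrow>
     (t(h := fst (0, Move_Left)), h + head_offset (snd (0, Move_Left)))]"
    unfolding assms(2) by (simp add: case_prod_beta)
qed

text \<open>Tape 0 holds the input; tapes 1 to 4 hold the stacks \<open>f 0, \<dots>, f 3\<close>.\<close>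

definition mk :: "tape \<Rightarrow> (nat \<Rightarrow> nat list) \<Rightarrow> tape list \<Rightarrow> tape list" where
  "mk z f rest = z # map (\<lambda>i. stack_tape (f i)) [0..<4] @ rest"

lemma length_mk [simp]: "length (mk z f rest) = 5 + length rest"
  by (simp add: mk_def)

lemma mk_nth: "j < 4 \<Longrightarrow> mk z f rest ! Suc j = stack_tape (f j)"
  by (simp add: mk_def nth_append del: upt_Suc)

lemma mk_upd: "j < 4 \<Longrightarrow> (mk z f rest)[Suc j := stack_tape xs] = mk z (f(j := xs)) rest"
  unfolding mk_def by (rule nth_equalityI)
    (auto simp: nth_list_update nth_append nth_Cons split: nat.splits)

lemma reads_mk: "j < 4 \<Longrightarrow> reads (mk z f rest) ! Suc j = top0 (f j)"
  by (simp add: reads_nth mk_nth)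

lemma mk_cong: "f 0 = g 0 \<Longrightarrow> f 1 = g 1 \<Longrightarrow> f 2 = g 2 \<Longrightarrow> f 3 = g 3 \<Longrightarrow> mk z f rest = mk z g rest"
  by (simp add: mk_def eval_nat_numeral)

abbreviation pushs :: "nat \<Rightarrow> nat \<Rightarrow> cmd" where "pushs j a \<equiv> push (Suc j) a"
abbreviation pops :: "nat \<Rightarrow> cmd" where "pops j \<equiv> pop (Suc j)"

lemma runs_pushs: "j < 4 \<Longrightarrow> 3 \<le> n \<Longrightarrow> runs (pushs j a) (mk z f rest) n (mk z (f(j := a # f j)) rest)"
  using runs_push[of "Suc j" "mk z f rest" "f j" a] by (auto simp: mk_nth mk_upd intro: runs_mono)

lemma runs_pops: "j < 4 \<Longrightarrow> f j \<noteq> [] \<Longrightarrow> 1 \<le> n \<Longrightarrow> runs (pops j) (mk z f rest) n (mk z (f(j := tl (f j))) rest)"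
  using runs_pop[of "Suc j" "mk z f rest" "hd (f j)" "tl (f j)"]
  by (auto simp: mk_nth mk_upd intro: runs_mono)

definition nonempty :: "nat \<Rightarrow> nat list \<Rightarrow> bool" where
  "nonempty j as \<longleftrightarrow> as ! Suc j \<noteq> 0"

definition is_top :: "nat \<Rightarrow> nat \<Rightarrow> nat list \<Rightarrow> bool" where
  "is_top j a as \<longleftrightarrow> as ! Suc j = a"

lemma nonempty_mk [simp]: "j < 4 \<Longrightarrow> nonempty j (reads (mk z f rest)) \<longleftrightarrow> top0 (f j) \<noteq> 0"
  by (simp add: nonempty_def reads_mk)

lemma is_top_mk [simp]: "j < 4 \<Longrightarrow> is_top j a (reads (mk z f rest)) \<longleftrightarrow> top0 (f j) = a"
  by (simp add: is_top_def reads_mk)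

text \<open>Commands of this shape run on any machine having the tapes 0 to 4 and the symbols 0, 1, 2.\<close>

inductive stack_cmd :: "cmd \<Rightarrow> bool" where
  "stack_cmd Nop"
| "j < 4 \<Longrightarrow> a < 3 \<Longrightarrow> stack_cmd (pushs j a)"
| "j < 4 \<Longrightarrow> stack_cmd (pops j)"
| "stack_cmd c \<Longrightarrow> stack_cmd d \<Longrightarrow> stack_cmd (Seq c d)"
| "stack_cmd c \<Longrightarrow> stack_cmd d \<Longrightarrow> stack_cmd (Cond b c d)"
| "stack_cmd c \<Longrightarrow> stack_cmd (Loop b c)"

lemma wf_act1:
  assumes "i < k" "\<And>x. x < n \<Longrightarrow> fst (g x) < n"
  shows "wf_cmd k n (act1 i g)"
proof -
  have "ok_acts k n ((stay as)[i := g (as ! i)])" if "ok_syms k n as" for as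
  proof -
    have "fst (g (as ! i)) < n" using that assms by (simp add: ok_syms_def)
    moreover have "set ((stay as)[i := g (as ! i)]) \<subseteq> insert (g (as ! i)) (set (stay as))"
      by (rule set_update_subset_insert)
    moreover have "length (stay as) = k" "\<forall>x\<in>set (stay as). fst x < n"
      using ok_stay[OF that] by (auto simp: ok_acts_def)
    ultimately show ?thesis unfolding ok_acts_def case_prod_beta by (simp, blast)
  qed
  then show ?thesis by (simp add: act1_def valid_acts_def)
qed

lemma wf_stack_cmd:
  assumes "stack_cmd c" "5 \<le> k" "3 \<le> n"
  shows "wf_cmd k n c"
  using assms(1)
proof induction
  case (2 j a)
  then show ?case using assms(2,3) unfolding push_def by (simp add: wf_act1)
next
  case (3 j)
  then show ?case using assms(2,3) unfolding pop_def by (simp add: wf_act1)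
qed simp_all

text \<open>\<open>act1\<close> sees only its own tape, so the symbol is carried from one tape to
  the other by the branch taken.\<close>

definition mv :: "nat \<Rightarrow> nat \<Rightarrow> cmd" where
  "mv i j = Cond (is_top i 1) (Seq (pushs j 1) (pops i)) (Seq (pushs j 2) (pops i))"

lemma runs_mv:
  assumes "f i = x # xs" "x \<in> {1, 2}" "i \<noteq> j" "i < 4" "j < 4" "7 \<le> n"
  shows "runs (mv i j) (mk z f rest) n (mk z (f(i := xs, j := x # f j)) rest)"
proof -
  let ?g = "f(j := x # f j)"
  have p: "runs (pushs j x) (mk z f rest) 3 (mk z ?g rest)"
    by (rule runs_pushs[OF assms(5) order_refl])
  have "runs (pops i) (mk z ?g rest) 1 (mk z (?g(i := tl (?g i))) rest)"
    by (rule runs_pops[OF assms(4)]) (use assms(1,3) in auto)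
  then have q: "runs (pops i) (mk z ?g rest) 1 (mk z (f(i := xs, j := x # f j)) rest)"
    using assms(1,3) by (simp add: fun_upd_twist)
  have *: "runs (Seq (pushs j x) (pops i)) (mk z f rest) 5 (mk z (f(i := xs, j := x # f j)) rest)"
    by (rule runs_Seq[OF p q]) simp
  show ?thesis
  proof (cases "x = 1")
    case True
    have "is_top i 1 (reads (mk z f rest))" using assms True by simp
    then show ?thesis unfolding mv_def
      using runs_CondT[of "is_top i 1" _ _ 5] * True assms(6) by simp
  next
    case False
    then have x: "x = 2" using assms by auto
    then have "\<not> is_top i 1 (reads (mk z f rest))" using assms by simp
    then show ?thesis unfolding mv_def
      using runs_CondF[of "is_top i 1" _ _ 5] * x assms(6) by simp
  qed
qed

section \<open>Programs on binary trees\<close>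

datatype tree = Leaf | Node tree tree

text \<open>Polish notation over the symbols 1 and 2. It is self-delimiting, so a stack can hold
  several trees one after the other without separators; the blank 0 never occurs in it.\<close>

fun flat :: "tree \<Rightarrow> nat list" where
  "flat Leaf = [1]"
| "flat (Node l r) = 2 # flat l @ flat r"

lemma set_flat: "set (flat t) \<subseteq> {1, 2}"
  by (induction t) auto

lemma flat_ne [simp]: "flat t \<noteq> []"
  by (cases t) auto

lemma length_flat_pos: "1 \<le> length (flat t)"
  using flat_ne[of t] by (cases "flat t") auto

lemma flat_prefix: "flat t @ r = flat t' @ r' \<Longrightarrow> t = t' \<and> r = r'"
proof (induction t arbitrary: t' r r')
  case Leaf
  then show ?case by (cases t') auto
next
  case (Node t1 t2)
  obtain u1 u2 where t': "t' = Node u1 u2" using Node.prems by (cases t') simp_all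
  then have "flat t1 @ (flat t2 @ r) = flat u1 @ (flat u2 @ r')" using Node.prems by simp
  from Node.IH(1)[OF this] have "t1 = u1" "flat t2 @ r = flat u2 @ r'" by auto
  with Node.IH(2)[OF this(2)] t' show ?case by blast
qed

lemma flat_inject: "flat t = flat t' \<longleftrightarrow> t = t'"
  using flat_prefix[of t "[]" t' "[]"] by auto

definition drain :: "nat \<Rightarrow> nat \<Rightarrow> cmd" where
  "drain i j = Loop (nonempty i) (mv i j)"

definition clear :: "nat \<Rightarrow> cmd" where
  "clear i = Loop (nonempty i) (pops i)"

text \<open>Stack 3 counts in unary the subtrees that are still to be read: a leaf completes one, a
  node replaces one by two. Started with count one, the loop moves exactly one tree, and reverses
  its word.\<close>

definition ext_loop :: "nat \<Rightarrow> cmd" where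
  "ext_loop j = Loop (nonempty 3)
     (Cond (is_top 0 1) (Seq (mv 0 j) (pops 3)) (Seq (mv 0 j) (pushs 3 1)))"

definition ext :: "nat \<Rightarrow> cmd" where
  "ext j = Seq (pushs 3 1) (ext_loop j)"

lemma runs_drain:
  assumes "set xs \<subseteq> {1, 2}" "f i = xs" "i \<noteq> j" "i < 4" "j < 4"
  shows "runs (drain i j) (mk z f rest) (10 * length xs + 1) (mk z (f(i := [], j := rev xs @ f j)) rest)"
  using assms(1,2)
proof (induction xs arbitrary: f)
  case Nil
  have e: "f(i := [], j := rev [] @ f j) = f"
    using Nil by auto
  show ?case unfolding e drain_def by (rule runs_LoopF) (use Nil assms in auto)
next
  case (Cons x xs)
  let ?f = "f(i := xs, j := x # f j)"
  have 1: "runs (mv i j) (mk z f rest) 7 (mk z ?f rest)"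
    by (rule runs_mv) (use Cons.prems assms in auto)
  have 2: "runs (drain i j) (mk z ?f rest) (10 * length xs + 1) (mk z (?f(i := [], j := rev xs @ ?f j)) rest)"
    by (rule Cons.IH) (use Cons.prems assms in auto)
  have e: "?f(i := [], j := rev xs @ ?f j) = f(i := [], j := rev (x # xs) @ f j)"
    using assms by (auto simp: fun_eq_iff)
  show ?case using 2 unfolding e drain_def
    by (rule runs_LoopT[rotated 2, where m = 7, OF _ _ _ 1]) (use Cons.prems assms in auto)
qed

lemma runs_clear:
  assumes "set xs \<subseteq> {1, 2}" "f i = xs" "i < 4"
  shows "runs (clear i) (mk z f rest) (3 * length xs + 1) (mk z (f(i := [])) rest)"
  using assms(1,2)
proof (induction xs arbitrary: f)
  case Nil
  have e: "f(i := []) = f"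
    using Nil by auto
  show ?case unfolding e clear_def by (rule runs_LoopF) (use Nil assms in auto)
next
  case (Cons x xs)
  have 1: "runs (pops i) (mk z f rest) 1 (mk z (f(i := tl (f i))) rest)"
    by (rule runs_pops) (use Cons.prems assms in auto)
  have 2: "runs (clear i) (mk z (f(i := tl (f i))) rest) (3 * length xs + 1) (mk z (f(i := tl (f i), i := [])) rest)"
    by (rule Cons.IH) (use Cons.prems assms in auto)
  show ?case using 2 unfolding fun_upd_upd clear_def
    by (rule runs_LoopT[rotated 2, where m = 1, OF _ _ _ 1]) (use Cons.prems assms in auto)
qed

text \<open>An arbitrary continuation (\<open>n\<close>, \<open>s\<close>) is carried along, so that
  for a node the runs on the two subtrees can be chained. A round takes at most 14 steps, and 16 are
  allowed per symbol.\<close>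

lemma runs_ext_loop:
  assumes "f 0 = flat t @ r" "f 3 = 1 # ds" "j \<in> {1, 2}"
    "runs (ext_loop j) (mk z (f(0 := r, j := rev (flat t) @ f j, 3 := ds)) rest) n s"
  shows "runs (ext_loop j) (mk z f rest) (n + 16 * length (flat t)) s"
  using assms
proof (induction t arbitrary: f r ds n)
  case Leaf
  let ?f = "f(0 := r, j := 1 # f j)"
  have 1: "runs (mv 0 j) (mk z f rest) 7 (mk z ?f rest)"
    by (rule runs_mv) (use Leaf.prems in auto)
  have 2: "runs (pops 3) (mk z ?f rest) 1 (mk z (?f(3 := tl (?f 3))) rest)"
    by (rule runs_pops) (use Leaf.prems in auto)
  have e: "?f(3 := tl (?f 3)) = f(0 := r, j := rev (flat Leaf) @ f j, 3 := ds)"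
    using Leaf.prems by (auto simp: fun_eq_iff)
  have "runs (Seq (mv 0 j) (pops 3)) (mk z f rest) 9 (mk z (f(0 := r, j := rev (flat Leaf) @ f j, 3 := ds)) rest)"
    by (rule runs_Seq[OF 1 2[unfolded e]]) simp
  then have 3: "runs (Cond (is_top 0 1) (Seq (mv 0 j) (pops 3)) (Seq (mv 0 j) (pushs 3 1))) (mk z f rest) 10
     (mk z (f(0 := r, j := rev (flat Leaf) @ f j, 3 := ds)) rest)"
    by (rule runs_CondT[rotated]) (use Leaf.prems in auto)
  show ?case unfolding ext_loop_def
    by (rule runs_LoopT[OF _ 3 Leaf.prems(4)[unfolded ext_loop_def]]) (use Leaf.prems in auto)
next
  case (Node t1 t2)
  let ?f = "f(0 := flat t1 @ flat t2 @ r, j := 2 # f j)"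
  let ?g = "?f(3 := 1 # ?f 3)"
  have 1: "runs (mv 0 j) (mk z f rest) 7 (mk z ?f rest)"
    by (rule runs_mv) (use Node.prems in auto)
  have 2: "runs (pushs 3 1) (mk z ?f rest) 3 (mk z ?g rest)"
    by (rule runs_pushs) (use Node.prems in auto)
  have "runs (Seq (mv 0 j) (pushs 3 1)) (mk z f rest) 11 (mk z ?g rest)"
    by (rule runs_Seq[OF 1 2]) simp
  then have 3: "runs (Cond (is_top 0 1) (Seq (mv 0 j) (pops 3)) (Seq (mv 0 j) (pushs 3 1))) (mk z f rest) 12 (mk z ?g rest)"
    by (rule runs_CondF[rotated]) (use Node.prems in auto)
  let ?h = "?g(0 := flat t2 @ r, j := rev (flat t1) @ ?g j, 3 := 1 # ds)"
  have e: "?h(0 := r, j := rev (flat t2) @ ?h j, 3 := ds) = f(0 := r, j := rev (flat (Node t1 t2)) @ f j, 3 := ds)"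
    using Node.prems(3) by (auto simp: fun_eq_iff)
  have 4: "runs (ext_loop j) (mk z ?h rest) (n + 16 * length (flat t2)) s"
    by (rule Node.IH(2)[where r = r and ds = ds]) (use Node.prems in \<open>auto simp only: e\<close>, use Node.prems in auto)
  have 5: "runs (ext_loop j) (mk z ?g rest) ((n + 16 * length (flat t2)) + 16 * length (flat t1)) s"
    by (rule Node.IH(1)[where r = "flat t2 @ r" and ds = "1 # ds", OF _ _ _ 4]) (use Node.prems in auto)
  show ?case unfolding ext_loop_def
    by (rule runs_LoopT[OF _ 3 5[unfolded ext_loop_def]]) (use Node.prems in auto)
qed

text \<open>Between commands the counter on stack 3 is empty, so only three stacks are
  displayed.\<close>

definition ST :: "tape \<Rightarrow> nat list \<Rightarrow> nat list \<Rightarrow> nat list \<Rightarrow> tape list \<Rightarrow> tape list" where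
  "ST z a b c rest = mk z ((\<lambda>_. [])(0 := a, 1 := b, 2 := c)) rest"

lemma runs_ST:
  assumes "runs p (mk z f rest) n (mk z g rest)" "f = (\<lambda>_. [])(0 := a, 1 := b, 2 := c)"
    "g 0 = a'" "g 1 = b'" "g 2 = c'" "g 3 = []" "n \<le> n'"
  shows "runs p (ST z a b c rest) n' (ST z a' b' c' rest)"
proof -
  have "mk z g rest = ST z a' b' c' rest" unfolding ST_def
    by (rule mk_cong) (use assms in auto)
  then show ?thesis using assms(1,2,7) by (auto simp: ST_def intro: runs_mono)
qed

lemma runs_ext:
  "runs (ext 1) (ST z (flat t @ r) b c rest) (16 * length (flat t) + 6) (ST z r (rev (flat t) @ b) c rest)"
  "runs (ext 2) (ST z (flat t @ r) b c rest) (16 * length (flat t) + 6) (ST z r b (rev (flat t) @ c) rest)"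
proof -
  have *: "runs (ext j) (mk z f rest) (16 * length (flat t) + 6)
      (mk z (f(0 := r, j := rev (flat t) @ f j)) rest)"
    if f: "f 0 = flat t @ r" "f 3 = []" and j: "j \<in> {1, 2}" for f j
  proof -
    let ?g = "f(3 := 1 # f 3)"
    have e: "?g(0 := r, j := rev (flat t) @ ?g j, 3 := []) = f(0 := r, j := rev (flat t) @ f j)"
      using f j by (auto simp: fun_eq_iff)
    have "runs (ext_loop j) (mk z (?g(0 := r, j := rev (flat t) @ ?g j, 3 := [])) rest) 1
      (mk z (f(0 := r, j := rev (flat t) @ f j)) rest)"
      unfolding e ext_loop_def by (rule runs_LoopF) (use f j in auto)
    then have "runs (ext_loop j) (mk z ?g rest) (1 + 16 * length (flat t)) (mk z (f(0 := r, j := rev (flat t) @ f j)) rest)"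
      by (rule runs_ext_loop[rotated 3]) (use f j in auto)
    from runs_Seq[OF runs_pushs[OF _ order_refl] this] show ?thesis unfolding ext_def
      by auto
  qed
  show "runs (ext 1) (ST z (flat t @ r) b c rest) (16 * length (flat t) + 6) (ST z r (rev (flat t) @ b) c rest)"
    by (rule runs_ST[OF *[where j = 1 and f = "(\<lambda>_. [])(0 := flat t @ r, 1 := b, 2 := c)"]]) auto
  show "runs (ext 2) (ST z (flat t @ r) b c rest) (16 * length (flat t) + 6) (ST z r b (rev (flat t) @ c) rest)"
    by (rule runs_ST[OF *[where j = 2 and f = "(\<lambda>_. [])(0 := flat t @ r, 1 := b, 2 := c)"]]) auto
qed

lemma runs_push0: "runs (pushs 0 x) (ST z a b c rest) 3 (ST z (x # a) b c rest)"
  by (rule runs_ST[OF runs_pushs[of 0 3, OF _ order_refl, where f = "(\<lambda>_. [])(0 := a, 1 := b, 2 := c)"]]) auto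

lemma runs_push2: "runs (pushs 2 x) (ST z a b c rest) 3 (ST z a b (x # c) rest)"
  by (rule runs_ST[OF runs_pushs[of 2 3, OF _ order_refl, where f = "(\<lambda>_. [])(0 := a, 1 := b, 2 := c)"]]) auto

lemma runs_pop0: "runs (pops 0) (ST z (x # a) b c rest) 1 (ST z a b c rest)"
  by (rule runs_ST[OF runs_pops[of 0 _ 1, OF _ _ order_refl, where f = "(\<lambda>_. [])(0 := x # a, 1 := b, 2 := c)"]]) auto

lemma runs_pop1: "runs (pops 1) (ST z a (x # b) c rest) 1 (ST z a b c rest)"
  by (rule runs_ST[OF runs_pops[of 1 _ 1, OF _ _ order_refl, where f = "(\<lambda>_. [])(0 := a, 1 := x # b, 2 := c)"]]) auto

lemma runs_pop2: "runs (pops 2) (ST z a b (x # c) rest) 1 (ST z a b c rest)"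
  by (rule runs_ST[OF runs_pops[of 2 _ 1, OF _ _ order_refl, where f = "(\<lambda>_. [])(0 := a, 1 := b, 2 := x # c)"]]) auto

lemma runs_drain10:
  "set b \<subseteq> {1, 2} \<Longrightarrow> runs (drain 1 0) (ST z a b c rest) (10 * length b + 1) (ST z (rev b @ a) [] c rest)"
  by (rule runs_ST[OF runs_drain[of b "(\<lambda>_. [])(0 := a, 1 := b, 2 := c)" 1 0]]) auto

lemma runs_drain20:
  "set c \<subseteq> {1, 2} \<Longrightarrow> runs (drain 2 0) (ST z a b c rest) (10 * length c + 1) (ST z (rev c @ a) b [] rest)"
  by (rule runs_ST[OF runs_drain[of c "(\<lambda>_. [])(0 := a, 1 := b, 2 := c)" 2 0]]) auto

lemma runs_drain21:
  "set c \<subseteq> {1, 2} \<Longrightarrow> runs (drain 2 1) (ST z a b c rest) (10 * length c + 1) (ST z a (rev c @ b) [] rest)"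
  by (rule runs_ST[OF runs_drain[of c "(\<lambda>_. [])(0 := a, 1 := b, 2 := c)" 2 1]]) auto

lemma runs_clear1: "set b \<subseteq> {1, 2} \<Longrightarrow> runs (clear 1) (ST z a b c rest) (3 * length b + 1) (ST z a [] c rest)"
  by (rule runs_ST[OF runs_clear[of b "(\<lambda>_. [])(0 := a, 1 := b, 2 := c)" 1]]) auto

lemma runs_clear2: "set c \<subseteq> {1, 2} \<Longrightarrow> runs (clear 2) (ST z a b c rest) (3 * length c + 1) (ST z a b [] rest)"
  by (rule runs_ST[OF runs_clear[of c "(\<lambda>_. [])(0 := a, 1 := b, 2 := c)" 2]]) auto

lemma is_top_ST [simp]: "is_top 0 x (reads (ST z a b c rest)) \<longleftrightarrow> top0 a = x"
    "is_top 1 x (reads (ST z a b c rest)) \<longleftrightarrow> top0 b = x"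
  by (simp_all add: ST_def)

lemma nonempty_ST [simp]: "nonempty 1 (reads (ST z a b c rest)) \<longleftrightarrow> top0 b \<noteq> 0"
  by (simp add: ST_def)

lemmas [simp] = is_top_ST(2)[unfolded One_nat_def] nonempty_ST[unfolded One_nat_def]

section \<open>Basic operations on the trees on stack 0\<close>

lemmas stack_intros = stack_cmd.intros

lemma stack_mv: "i < 4 \<Longrightarrow> j < 4 \<Longrightarrow> stack_cmd (mv i j)"
  unfolding mv_def by (intro stack_intros) auto

lemma stack_drain: "i < 4 \<Longrightarrow> j < 4 \<Longrightarrow> stack_cmd (drain i j)"
  unfolding drain_def by (intro stack_intros stack_mv) auto

lemma stack_clear: "i < 4 \<Longrightarrow> stack_cmd (clear i)"
  unfolding clear_def by (intro stack_intros) auto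

lemma stack_ext: "j < 4 \<Longrightarrow> stack_cmd (ext j)"
  unfolding ext_def ext_loop_def by (intro stack_intros stack_mv) auto

text \<open>Every transfer between stacks reverses the word. The second copy takes a detour over
  stack 1 in order to arrive on stack 0 the right way round.\<close>

definition dup :: cmd where
  "dup = Seq (ext 1) (Seq (Loop (nonempty 1) (Seq (Cond (is_top 1 1)
       (Seq (pushs 0 1) (pushs 2 1)) (Seq (pushs 0 2) (pushs 2 2))) (pops 1)))
     (Seq (drain 2 1) (drain 1 0)))"

definition drop_top :: cmd where
  "drop_top = Seq (ext 1) (clear 1)"

definition swap :: cmd where
  "swap = Seq (ext 1) (Seq (ext 2) (Seq (drain 1 0) (drain 2 0)))"

definition cons_tree :: cmd where
  "cons_tree = pushs 0 2"

definition hd_tree :: cmd where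
  "hd_tree = Cond (is_top 0 1) Nop (Seq (pops 0) (Seq (ext 1) (Seq (ext 2) (Seq (clear 2) (drain 1 0)))))"

definition tl_tree :: cmd where
  "tl_tree = Cond (is_top 0 1) Nop (Seq (pops 0) drop_top)"

definition push_tree :: "tree \<Rightarrow> cmd" where
  "push_tree t = foldr (\<lambda>a c. Seq c (pushs 0 a)) (flat t) Nop"

text \<open>The argument is a pair; popping its root symbol leaves the two components on the stack.
  Their words are compared from the back, and they are equal iff both stacks run empty
  together.\<close>

definition eq_tree :: cmd where
  "eq_tree = Seq (pops 0) (Seq (ext 1) (Seq (ext 2) (Seq
     (Loop (\<lambda>as. as ! Suc 1 \<noteq> 0 \<and> as ! Suc 1 = as ! Suc 2) (Seq (pops 1) (pops 2)))
     (Cond (\<lambda>as. as ! Suc 1 = 0 \<and> as ! Suc 2 = 0) (push_tree (Node Leaf Leaf))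
        (Seq (clear 1) (Seq (clear 2) (push_tree Leaf)))))))"

lemma stack_push_tree: "stack_cmd (push_tree t)"
proof -
  have "stack_cmd (foldr (\<lambda>a c. Seq c (pushs 0 a)) xs Nop)" if "set xs \<subseteq> {1, 2}" for xs
    using that by (induction xs) (auto intro!: stack_intros)
  then show ?thesis unfolding push_tree_def using set_flat by blast
qed

lemma stack_dup: "stack_cmd dup"
  unfolding dup_def by (intro stack_intros stack_ext stack_drain) auto

lemma stack_drop_top: "stack_cmd drop_top"
  unfolding drop_top_def by (intro stack_intros stack_ext stack_clear) auto

lemma stack_swap: "stack_cmd swap"
  unfolding swap_def by (intro stack_intros stack_ext stack_drain) auto

lemma stack_cons: "stack_cmd cons_tree"
  unfolding cons_tree_def by (intro stack_intros) auto

lemma stack_hd: "stack_cmd hd_tree"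
  unfolding hd_tree_def by (intro stack_intros stack_ext stack_clear stack_drain) auto

lemma stack_tl: "stack_cmd tl_tree"
  unfolding tl_tree_def by (intro stack_intros stack_drop_top) auto

lemma stack_eq: "stack_cmd eq_tree"
  unfolding eq_tree_def by (intro stack_intros stack_ext stack_clear stack_push_tree) auto

lemma runs_push_tree: "runs (push_tree t) (ST z a b c rest) (4 * length (flat t)) (ST z (flat t @ a) b c rest)"
proof -
  have "runs (foldr (\<lambda>a c. Seq c (pushs 0 a)) xs Nop) (ST z a b c rest) (4 * length xs) (ST z (xs @ a) b c rest)" for xs
  proof (induction xs)
    case (Cons x xs)
    show ?case unfolding foldr.simps comp_def append_Cons
      by (rule runs_Seq[OF Cons runs_push0]) simp
  qed (simp add: runs_Nop)
  then show ?thesis unfolding push_tree_def .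
qed

lemma runs_dup: "runs dup (ST z (flat t @ r) [] [] rest) (60 * length (flat t) + 20) (ST z (flat t @ flat t @ r) [] [] rest)"
proof -
  let ?L = "Loop (nonempty 1) (Seq (Cond (is_top 1 1)
       (Seq (pushs 0 1) (pushs 2 1)) (Seq (pushs 0 2) (pushs 2 2))) (pops 1))"
  have L: "runs ?L (ST z a xs c rest) (12 * length xs + 1) (ST z (rev xs @ a) [] (rev xs @ c) rest)"
    if "set xs \<subseteq> {1, 2}" for xs a c
    using that
  proof (induction xs arbitrary: a c)
    case Nil
    show ?case unfolding rev.simps append.simps by (rule runs_LoopF) auto
  next
    case (Cons x xs)
    have 0: "runs (Seq (pushs 0 x) (pushs 2 x)) (ST z a (x # xs) c rest) 7 (ST z (x # a) (x # xs) (x # c) rest)"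
      by (rule runs_Seq[OF runs_push0 runs_push2]) simp
    have "runs (Cond (is_top 1 1) (Seq (pushs 0 1) (pushs 2 1)) (Seq (pushs 0 2) (pushs 2 2)))
       (ST z a (x # xs) c rest) 8 (ST z (x # a) (x # xs) (x # c) rest)"
    proof (cases "x = 1")
      case True
      show ?thesis using 0 unfolding True by (rule runs_CondT[rotated]) auto
    next
      case False
      then have x: "x = 2" using Cons.prems by auto
      show ?thesis using 0 unfolding x by (rule runs_CondF[rotated]) auto
    qed
    from runs_Seq[OF this runs_pop1 order_refl]
    have B: "runs (Seq (Cond (is_top 1 1) (Seq (pushs 0 1) (pushs 2 1)) (Seq (pushs 0 2) (pushs 2 2))) (pops 1))
      (ST z a (x # xs) c rest) 10 (ST z (x # a) xs (x # c) rest)" by simp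
    have IH: "runs ?L (ST z (x # a) xs (x # c) rest) (12 * length xs + 1)
        (ST z (rev (x # xs) @ a) [] (rev (x # xs) @ c) rest)"
      using Cons.IH[of "x # a" "x # c"] Cons.prems by simp
    show ?case by (rule runs_LoopT[OF _ B IH]) (use Cons.prems in auto)
  qed
  have s: "set (flat t) \<subseteq> {1, 2}" "set (rev (flat t)) \<subseteq> {1, 2}" using set_flat by auto
  have 1: "runs (ext 1) (ST z (flat t @ r) [] [] rest) (16 * length (flat t) + 6) (ST z r (rev (flat t)) [] rest)"
    using runs_ext(1)[of z t r "[]" "[]" rest] by simp
  have 2: "runs ?L (ST z r (rev (flat t)) [] rest) (12 * length (flat t) + 1) (ST z (flat t @ r) [] (flat t) rest)"
    using L[OF s(2), of r "[]"] by simp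
  have 3: "runs (drain 2 1) (ST z (flat t @ r) [] (flat t) rest) (10 * length (flat t) + 1) (ST z (flat t @ r) (rev (flat t)) [] rest)"
    using runs_drain21[OF s(1), of z "flat t @ r" "[]" rest] by simp
  have 4: "runs (drain 1 0) (ST z (flat t @ r) (rev (flat t)) [] rest) (10 * length (flat t) + 1) (ST z (flat t @ flat t @ r) [] [] rest)"
    using runs_drain10[OF s(2), of z "flat t @ r" "[]" rest] by simp
  show ?thesis unfolding dup_def
    by (rule runs_Seq[OF 1 runs_Seq[OF 2 runs_Seq[OF 3 4 order_refl] order_refl]]) simp
qed

lemma runs_drop_top: "runs drop_top (ST z (flat t @ r) [] [] rest) (20 * length (flat t) + 8) (ST z r [] [] rest)"
proof -
  have s: "set (rev (flat t)) \<subseteq> {1, 2}" using set_flat by auto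
  have 1: "runs (ext 1) (ST z (flat t @ r) [] [] rest) (16 * length (flat t) + 6) (ST z r (rev (flat t)) [] rest)"
    using runs_ext(1)[of z t r "[]" "[]" rest] by simp
  show ?thesis unfolding drop_top_def
    by (rule runs_Seq[OF 1 runs_clear1[OF s]]) (use length_flat_pos[of t] in simp)
qed

lemma runs_swap: "runs swap (ST z (flat t @ flat u @ r) [] [] rest) (30 * length (flat t) + 30 * length (flat u) + 20)
   (ST z (flat u @ flat t @ r) [] [] rest)"
proof -
  have s: "set (rev (flat t)) \<subseteq> {1, 2}" "set (rev (flat u)) \<subseteq> {1, 2}" using set_flat by auto
  have 1: "runs (ext 1) (ST z (flat t @ flat u @ r) [] [] rest) (16 * length (flat t) + 6) (ST z (flat u @ r) (rev (flat t)) [] rest)"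
    using runs_ext(1)[of z t "flat u @ r" "[]" "[]" rest] by simp
  have 2: "runs (ext 2) (ST z (flat u @ r) (rev (flat t)) [] rest) (16 * length (flat u) + 6) (ST z r (rev (flat t)) (rev (flat u)) rest)"
    using runs_ext(2)[of z u r "rev (flat t)" "[]" rest] by simp
  have 3: "runs (drain 1 0) (ST z r (rev (flat t)) (rev (flat u)) rest) (10 * length (flat t) + 1) (ST z (flat t @ r) [] (rev (flat u)) rest)"
    using runs_drain10[OF s(1), of z r "rev (flat u)" rest] by simp
  have 4: "runs (drain 2 0) (ST z (flat t @ r) [] (rev (flat u)) rest) (10 * length (flat u) + 1) (ST z (flat u @ flat t @ r) [] [] rest)"
    using runs_drain20[OF s(2), of z "flat t @ r" "[]" rest] by simp
  show ?thesis unfolding swap_def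
    by (rule runs_Seq[OF 1 runs_Seq[OF 2 runs_Seq[OF 3 4 order_refl] order_refl]]) simp
qed

lemma runs_cons: "runs cons_tree (ST z (flat t @ flat u @ r) [] [] rest) 3 (ST z (flat (Node t u) @ r) [] [] rest)"
  using runs_push0[of 2 z "flat t @ flat u @ r" "[]" "[]" rest] by (simp add: cons_tree_def)

fun hdt :: "tree \<Rightarrow> tree" where "hdt Leaf = Leaf" | "hdt (Node l r) = l"
fun tlt :: "tree \<Rightarrow> tree" where "tlt Leaf = Leaf" | "tlt (Node l r) = r"

lemma runs_hd: "runs hd_tree (ST z (flat t @ r) [] [] rest) (40 * length (flat t) + 30) (ST z (flat (hdt t) @ r) [] [] rest)"
proof (cases t)
  case Leaf
  show ?thesis unfolding hd_tree_def Leaf hdt.simps by (rule runs_CondT[OF _ runs_Nop[of _ 1]]) auto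
next
  case (Node u v)
  have s: "set (rev (flat u)) \<subseteq> {1, 2}" "set (rev (flat v)) \<subseteq> {1, 2}" using set_flat by auto
  have 1: "runs (pops 0) (ST z (flat t @ r) [] [] rest) 1 (ST z (flat u @ flat v @ r) [] [] rest)"
    using runs_pop0[of z 2 "flat u @ flat v @ r" "[]" "[]" rest] Node by simp
  have 2: "runs (ext 1) (ST z (flat u @ flat v @ r) [] [] rest) (16 * length (flat u) + 6) (ST z (flat v @ r) (rev (flat u)) [] rest)"
    using runs_ext(1)[of z u "flat v @ r" "[]" "[]" rest] by simp
  have 3: "runs (ext 2) (ST z (flat v @ r) (rev (flat u)) [] rest) (16 * length (flat v) + 6) (ST z r (rev (flat u)) (rev (flat v)) rest)"
    using runs_ext(2)[of z v r "rev (flat u)" "[]" rest] by simp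
  have 4: "runs (drain 1 0) (ST z r (rev (flat u)) [] rest) (10 * length (flat u) + 1) (ST z (flat u @ r) [] [] rest)"
    using runs_drain10[OF s(1), of z r "[]" rest] by simp
  have 5: "runs (Seq (pops 0) (Seq (ext 1) (Seq (ext 2) (Seq (clear 2) (drain 1 0))))) (ST z (flat t @ r) [] [] rest)
     (40 * length (flat t) + 29) (ST z (flat (hdt t) @ r) [] [] rest)"
    unfolding Node hdt.simps
    by (rule runs_Seq[OF 1[unfolded Node] runs_Seq[OF 2 runs_Seq[OF 3 runs_Seq[OF runs_clear2[OF s(2)] 4 order_refl] order_refl] order_refl]])
      simp
  show ?thesis unfolding hd_tree_def by (rule runs_CondF[OF _ 5]) (simp_all add: Node)
qed

lemma runs_tl: "runs tl_tree (ST z (flat t @ r) [] [] rest) (40 * length (flat t) + 30) (ST z (flat (tlt t) @ r) [] [] rest)"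
proof (cases t)
  case Leaf
  show ?thesis unfolding tl_tree_def Leaf tlt.simps by (rule runs_CondT[OF _ runs_Nop[of _ 1]]) auto
next
  case (Node u v)
  have 1: "runs (pops 0) (ST z (flat t @ r) [] [] rest) 1 (ST z (flat u @ flat v @ r) [] [] rest)"
    using runs_pop0[of z 2 "flat u @ flat v @ r" "[]" "[]" rest] Node by simp
  have 5: "runs (Seq (pops 0) drop_top) (ST z (flat t @ r) [] [] rest) (40 * length (flat t) + 29) (ST z (flat (tlt t) @ r) [] [] rest)"
    unfolding Node tlt.simps
    by (rule runs_Seq[OF 1[unfolded Node] runs_drop_top]) simp
  show ?thesis unfolding tl_tree_def by (rule runs_CondF[OF _ 5]) (simp_all add: Node)
qed

lemma runs_eq: "runs eq_tree (ST z (flat (Node t u) @ r) [] [] rest) (40 * length (flat (Node t u)) + 60)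
   (ST z (flat (if t = u then Node Leaf Leaf else Leaf) @ r) [] [] rest)"
proof -
  let ?b = "\<lambda>as::nat list. as ! Suc 1 \<noteq> 0 \<and> as ! Suc 1 = as ! Suc 2"
  let ?L = "Loop ?b (Seq (pops 1) (pops 2))"
  have rd: "reads (ST z a b c rest) ! Suc 1 = top0 b" "reads (ST z a b c rest) ! Suc 2 = top0 c" for a b c
    by (simp_all only: ST_def reads_mk) (simp_all add: reads_mk)
  \<comment> \<open>\<open>b'\<close> and \<open>c'\<close> are what remains when the loop stops.
    The test made afterwards sees only the two tops, where 0 means an empty stack.\<close>
  have L: "\<exists>b' c'. runs ?L (ST z a b c rest) (5 * length b + 1) (ST z a b' c' rest) \<and>
      (top0 b' = 0 \<and> top0 c' = 0 \<longleftrightarrow> b = c) \<and> (b = c \<longrightarrow> b' = [] \<and> c' = []) \<and> set b' \<subseteq> {1, 2} \<and> set c' \<subseteq> {1, 2} \<and>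
      length b' \<le> length b \<and> length c' \<le> length c"
    if "set b \<subseteq> {1, 2}" "set c \<subseteq> {1, 2}" for a b c
    using that
  proof (induction b arbitrary: c)
    case Nil
    have "runs ?L (ST z a [] c rest) (5 * length [] + 1) (ST z a [] c rest)"
      by (rule runs_LoopF) (simp_all only: rd, auto)
    then show ?case using Nil by (intro exI[of _ "[]"] exI[of _ c]) (cases c, auto)
  next
    case (Cons x b)
    show ?case
    proof (cases "\<exists>c'. c = x # c'")
      case True
      then obtain c1 where c: "c = x # c1" by blast
      obtain b' c' where IH: "runs ?L (ST z a b c1 rest) (5 * length b + 1) (ST z a b' c' rest)"
        and IH2: "(top0 b' = 0 \<and> top0 c' = 0 \<longleftrightarrow> b = c1)" "(b = c1 \<longrightarrow> b' = [] \<and> c' = [])"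
         "set b' \<subseteq> {1, 2}" "set c' \<subseteq> {1, 2}" "length b' \<le> length b" "length c' \<le> length c1"
        using Cons.IH[of c1] Cons.prems c by auto
      have s: "runs (Seq (pops 1) (pops 2)) (ST z a (x # b) (x # c1) rest) 3 (ST z a b c1 rest)"
        by (rule runs_Seq[OF runs_pop1 runs_pop2]) simp
      have "runs ?L (ST z a (x # b) c rest) (5 * length (x # b) + 1) (ST z a b' c' rest)"
        unfolding c by (rule runs_LoopT[OF _ s IH]) (simp_all only: rd, use Cons.prems in auto)
      then show ?thesis using IH2 c by (intro exI[of _ b'] exI[of _ c']) auto
    next
      case False
      have "runs ?L (ST z a (x # b) c rest) (5 * length (x # b) + 1) (ST z a (x # b) c rest)"
        by (rule runs_LoopF) (simp_all only: rd, use False in \<open>cases c, auto\<close>)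
      then show ?thesis using False Cons.prems by (intro exI[of _ "x # b"] exI[of _ c]) auto
    qed
  qed
  have s: "set (rev (flat t)) \<subseteq> {1, 2}" "set (rev (flat u)) \<subseteq> {1, 2}" using set_flat by auto
  obtain b' c' where L1: "runs ?L (ST z r (rev (flat t)) (rev (flat u)) rest) (5 * length (flat t) + 1) (ST z r b' c' rest)"
    and L2: "(top0 b' = 0 \<and> top0 c' = 0 \<longleftrightarrow> t = u)" "(t = u \<longrightarrow> b' = [] \<and> c' = [])"
      "set b' \<subseteq> {1, 2}" "set c' \<subseteq> {1, 2}" "length b' \<le> length (flat t)" "length c' \<le> length (flat u)"
    using L[OF s, of r] by (auto simp: flat_inject)
  have 1: "runs (pops 0) (ST z (flat (Node t u) @ r) [] [] rest) 1 (ST z (flat t @ flat u @ r) [] [] rest)"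
    using runs_pop0[of z 2 "flat t @ flat u @ r" "[]" "[]" rest] by simp
  have 2: "runs (ext 1) (ST z (flat t @ flat u @ r) [] [] rest) (16 * length (flat t) + 6) (ST z (flat u @ r) (rev (flat t)) [] rest)"
    using runs_ext(1)[of z t "flat u @ r" "[]" "[]" rest] by simp
  have 3: "runs (ext 2) (ST z (flat u @ r) (rev (flat t)) [] rest) (16 * length (flat u) + 6) (ST z r (rev (flat t)) (rev (flat u)) rest)"
    using runs_ext(2)[of z u r "rev (flat t)" "[]" rest] by simp
  have 4: "runs (Cond (\<lambda>as. as ! Suc 1 = 0 \<and> as ! Suc 2 = 0) (push_tree (Node Leaf Leaf))
        (Seq (clear 1) (Seq (clear 2) (push_tree Leaf)))) (ST z r b' c' rest) (3 * length (flat (Node t u)) + 30)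
     (ST z (flat (if t = u then Node Leaf Leaf else Leaf) @ r) [] [] rest)"
  proof (cases "t = u")
    case True
    have "runs (push_tree (Node Leaf Leaf)) (ST z r b' c' rest) 12 (ST z (flat (if t = u then Node Leaf Leaf else Leaf) @ r) [] [] rest)"
      using runs_push_tree[of "Node Leaf Leaf" z r "[]" "[]" rest] True L2(2) by simp
    then show ?thesis by (rule runs_CondT[rotated]) (simp_all only: rd, use True L2 in auto)
  next
    case False
    have "runs (Seq (clear 1) (Seq (clear 2) (push_tree Leaf))) (ST z r b' c' rest) (3 * length (flat (Node t u)) + 29)
      (ST z (flat (if t = u then Node Leaf Leaf else Leaf) @ r) [] [] rest)"
      unfolding if_not_P[OF False]
      by (rule runs_Seq[OF runs_clear1[OF L2(3)] runs_Seq[OF runs_clear2[OF L2(4)] runs_push_tree order_refl]])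
        (use L2(5,6) in simp)
    then show ?thesis by (rule runs_CondF[rotated]) (simp_all only: rd, use False L2 in auto)
  qed
  show ?thesis unfolding eq_tree_def
    by (rule runs_Seq[OF 1 runs_Seq[OF 2 runs_Seq[OF 3 runs_Seq[OF L1 4 order_refl] order_refl] order_refl]]) simp
qed

section \<open>Data encoded as trees\<close>

text \<open>Injectivity lets the equality test on trees decide equality of data.\<close>

class code =
  fixes code :: "'a \<Rightarrow> tree"
  assumes code_inject [simp]: "code x = code y \<longleftrightarrow> x = y"

instantiation bool :: code begin
definition "code_bool b = (if b then Node Leaf Leaf else Leaf)"
instance by standard (auto simp: code_bool_def)
end

instantiation prod :: (code, code) code begin
definition "code_prod p = Node (code (fst p)) (code (snd p))"
instance by standard (auto simp: code_prod_def prod_eq_iff)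
end

instantiation option :: (code) code begin
definition "code_option p = (case p of None \<Rightarrow> Leaf | Some x \<Rightarrow> Node Leaf (code x))"
instance by standard (auto simp: code_option_def split: option.splits)
end

fun code_of_list :: "'a::code list \<Rightarrow> tree" where
  "code_of_list [] = Leaf"
| "code_of_list (x # xs) = Node (code x) (code_of_list xs)"

lemma code_of_list_inject: "code_of_list xs = code_of_list ys \<Longrightarrow> xs = ys"
proof (induction xs arbitrary: ys)
  case Nil
  then show ?case by (cases ys) simp_all
next
  case (Cons x xs)
  obtain y ys' where ys: "ys = y # ys'" using Cons.prems by (cases ys) simp_all
  then show ?case using Cons.IH[of ys'] Cons.prems by simp
qed

instantiation list :: (code) code begin
definition "code_list = code_of_list"
instance by standard (auto simp: code_list_def dest: code_of_list_inject)
end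

text \<open>Binary digits make the size of a code logarithmic in the number, in accordance with the
  encoding of the input.\<close>

instantiation nat :: code begin
definition "code_nat n = code (nat_bits n)"
instance by standard (auto simp: code_nat_def dest: inj_nat_bits)
end

instantiation int :: code begin
definition "code_int i = code (i < 0, nat \<bar>i\<bar>)"
instance by standard (auto simp: code_int_def)
end

instantiation rat :: code begin
definition "code_rat q = code (quotient_of q)"
instance by standard (auto simp: code_rat_def quotient_of_inject_eq)
end

lemma code_simps [simp]:
  "code (x, y) = Node (code x) (code y)"
  "code [] = Leaf" "code (x # xs) = Node (code x) (code xs)"
  "code None = Leaf" "code (Some x) = Node Leaf (code x)"
  "code True = Node Leaf Leaf" "code False = Leaf"
  by (simp_all add: code_prod_def code_list_def code_option_def code_bool_def)

definition sz :: "'a::code \<Rightarrow> nat" where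
  "sz x = length (flat (code x))"

lemma sz_simps [simp]:
  "sz (x, y) = 1 + sz x + sz y"
  "sz [] = 1" "sz (x # xs) = 1 + sz x + sz xs"
  "sz None = 1" "sz (Some x) = 2 + sz x"
  "sz True = 3" "sz False = 1"
  by (simp_all add: sz_def)

lemma sz_pos [simp]: "1 \<le> sz x" "0 < sz x" "Suc 0 \<le> sz x"
  using length_flat_pos[of "code x"] by (auto simp: sz_def)

lemma sz_bool: "sz (b::bool) \<le> 3"
  by (cases b) auto

lemma sz_append: "sz (xs @ ys) + 1 = sz xs + sz ys"
  by (induction xs) auto

lemma sz_rev [simp]: "sz (rev xs) = sz xs"
proof (induction xs)
  case (Cons x xs)
  then show ?case using sz_append[of "rev xs" "[x]"] by simp
qed simp

lemma length_le_sz: "length xs \<le> sz xs"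
  by (induction xs) auto

lemma sz_elem: "x \<in> set xs \<Longrightarrow> sz x \<le> sz xs"
  by (induction xs) auto

lemma sz_list_bound: "\<forall>x\<in>set xs. sz x \<le> b \<Longrightarrow> sz xs \<le> 1 + length xs * (1 + b)"
  by (induction xs) auto

text \<open>Since the base is at least 2, a larger exponent absorbs constants, sums and
  products.\<close>

definition polyb :: "('a::code \<Rightarrow> nat) \<Rightarrow> bool" where
  "polyb h \<longleftrightarrow> (\<exists>k. \<forall>x. h x \<le> (sz x + 2) ^ k)"

definition expb :: "('a::code \<Rightarrow> nat) \<Rightarrow> bool" where
  "expb h \<longleftrightarrow> (\<exists>k. \<forall>x. h x \<le> 2 ^ ((sz x + 2) ^ k))"

named_theorems poly_intros

lemma polyb_mono: "polyb g \<Longrightarrow> (\<And>x. f x \<le> g x) \<Longrightarrow> polyb f"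
  unfolding polyb_def by (meson le_trans)

lemma polyb_const [poly_intros]: "polyb (\<lambda>x. c)"
proof -
  have "c \<le> (n + 2) ^ c" for n :: nat
    using less_exp[of c] power_mono[of 2 "n + 2" c] by linarith
  then show ?thesis unfolding polyb_def by blast
qed

lemma polyb_sz [poly_intros]: "polyb sz"
  unfolding polyb_def by (rule exI[of _ 1]) simp

lemma polyb_mult [poly_intros]: "polyb f \<Longrightarrow> polyb g \<Longrightarrow> polyb (\<lambda>x. f x * g x)"
proof -
  assume "polyb f" "polyb g"
  then obtain k l where "\<And>x. f x \<le> (sz x + 2) ^ k" "\<And>x. g x \<le> (sz x + 2) ^ l"
    unfolding polyb_def by blast
  then have "f x * g x \<le> (sz x + 2) ^ (k + l)" for x
    by (simp add: power_add mult_mono)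
  then show ?thesis unfolding polyb_def by blast
qed

lemma polyb_add [poly_intros]: "polyb f \<Longrightarrow> polyb g \<Longrightarrow> polyb (\<lambda>x. f x + g x)"
proof -
  assume "polyb f" "polyb g"
  then obtain k l where kl: "\<And>x. f x \<le> (sz x + 2) ^ k" "\<And>x. g x \<le> (sz x + 2) ^ l"
    unfolding polyb_def by blast
  have "f x + g x \<le> (sz x + 2) ^ (k + l + 1)" for x
  proof -
    have 1: "(sz x + 2) ^ k \<le> (sz x + 2) ^ (k + l)" "(sz x + 2) ^ l \<le> (sz x + 2) ^ (k + l)"
      by (auto intro!: power_increasing)
    have "f x + g x \<le> 2 * (sz x + 2) ^ (k + l)" using kl[of x] 1 by linarith
    also have "\<dots> \<le> (sz x + 2) * (sz x + 2) ^ (k + l)" by (rule mult_right_mono) auto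
    finally show ?thesis by simp
  qed
  then show ?thesis unfolding polyb_def by blast
qed

lemma polyb_power [poly_intros]: "polyb f \<Longrightarrow> polyb (\<lambda>x. f x ^ k)"
  by (induction k) (auto intro!: poly_intros)

lemma polyb_comp: "polyb g \<Longrightarrow> polyb (\<lambda>x. sz (f x)) \<Longrightarrow> polyb (\<lambda>x. g (f x))"
proof -
  assume g: "polyb g" and f: "polyb (\<lambda>x. sz (f x))"
  obtain k where k: "\<And>x. g x \<le> (sz x + 2) ^ k" using g unfolding polyb_def by blast
  have "polyb (\<lambda>x. (sz (f x) + 2) ^ k)" by (intro poly_intros f)
  then show ?thesis by (rule polyb_mono) (rule k)
qed

lemma expb_mono: "expb g \<Longrightarrow> (\<And>x. f x \<le> g x) \<Longrightarrow> expb f"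
  unfolding expb_def by (meson le_trans)

lemma expb_pow: "polyb h \<Longrightarrow> expb (\<lambda>x. 2 ^ h x)"
  unfolding polyb_def expb_def by (meson one_le_numeral power_increasing)

lemma expbE:
  assumes "expb T"
  obtains h where "polyb h" "\<And>x. T x \<le> 2 ^ h x"
proof -
  obtain k where "\<And>x. T x \<le> 2 ^ ((sz x + 2) ^ k)" using assms unfolding expb_def by blast
  then show ?thesis by (intro that[of "\<lambda>x. (sz x + 2) ^ k"] poly_intros) auto
qed

lemma expb_polyb: "polyb h \<Longrightarrow> expb h"
  by (rule expb_mono[OF expb_pow]) (auto intro: less_imp_le less_exp)

lemma expb_mult: "expb f \<Longrightarrow> expb g \<Longrightarrow> expb (\<lambda>x. f x * g x)"
proof -
  assume fg: "expb f" "expb g"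
  obtain h where h: "polyb h" "\<And>x. f x \<le> 2 ^ h x" by (rule expbE[OF fg(1)]) blast
  obtain k where k: "polyb k" "\<And>x. g x \<le> 2 ^ k x" by (rule expbE[OF fg(2)]) blast
  have "expb (\<lambda>x. 2 ^ (h x + k x))" by (intro expb_pow poly_intros h k)
  then show ?thesis by (rule expb_mono) (simp add: power_add h k mult_mono)
qed

lemma expb_add: "expb f \<Longrightarrow> expb g \<Longrightarrow> expb (\<lambda>x. f x + g x)"
proof -
  assume fg: "expb f" "expb g"
  obtain h where h: "polyb h" "\<And>x. f x \<le> 2 ^ h x" by (rule expbE[OF fg(1)]) blast
  obtain k where k: "polyb k" "\<And>x. g x \<le> 2 ^ k x" by (rule expbE[OF fg(2)]) blast
  have "expb (\<lambda>x. 2 ^ (h x + k x + 1))" by (intro expb_pow poly_intros h k)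
  then show ?thesis
  proof (rule expb_mono)
    fix x
    have "(2::nat) ^ h x \<le> 2 ^ (h x + k x)" "(2::nat) ^ k x \<le> 2 ^ (h x + k x)"
      by (auto intro!: power_increasing)
    moreover have "(2::nat) ^ (h x + k x + 1) = 2 * 2 ^ (h x + k x)" by simp
    ultimately show "f x + g x \<le> 2 ^ (h x + k x + 1)" using h(2)[of x] k(2)[of x] by linarith
  qed
qed

text \<open>An exponential bound survives the substitution of arguments of polynomial size only;
  this is the reason for the size condition in \<open>X\<close>.\<close>

lemma expb_comp: "expb g \<Longrightarrow> polyb (\<lambda>x. sz (f x)) \<Longrightarrow> expb (\<lambda>x. g (f x))"
proof -
  assume g: "expb g" and f: "polyb (\<lambda>x. sz (f x))"
  obtain h where h: "polyb h" "\<And>x. g x \<le> 2 ^ h x" by (rule expbE[OF g]) blast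
  show ?thesis by (rule expb_mono[OF expb_pow[OF polyb_comp[OF h(1) f]]]) (rule h(2))
qed

section \<open>Functions computable in exponential time with polynomially long values\<close>

text \<open>The quantified \<open>r\<close>, \<open>z\<close> and \<open>rest\<close> form a frame:
  what lies below the trees and on the other tapes is left untouched.\<close>

definition trans :: "cmd \<Rightarrow> tree list \<Rightarrow> tree list \<Rightarrow> nat \<Rightarrow> bool" where
  "trans c ts us n \<longleftrightarrow> (\<forall>r z rest. runs c (ST z (concat (map flat ts) @ r) [] [] rest) n
     (ST z (concat (map flat us) @ r) [] [] rest))"

lemma trans_Seq: "trans c ts us m \<Longrightarrow> trans d us vs n \<Longrightarrow> m + n + 1 \<le> l \<Longrightarrow> trans (Seq c d) ts vs l"
  unfolding trans_def by (blast intro: runs_Seq)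

lemma trans_mono: "trans c ts us m \<Longrightarrow> m \<le> n \<Longrightarrow> trans c ts us n"
  unfolding trans_def by (blast intro: runs_mono)

lemma trans_Nop: "trans Nop ts ts n"
  unfolding trans_def by (simp add: runs_Nop)

lemma trans_dup: "trans dup (t # ts) (t # t # ts) (60 * length (flat t) + 20)"
  unfolding trans_def using runs_dup by simp

lemma trans_drop: "trans drop_top (t # ts) ts (20 * length (flat t) + 8)"
  unfolding trans_def using runs_drop_top by simp

lemma trans_swap: "trans swap (t # u # ts) (u # t # ts) (30 * length (flat t) + 30 * length (flat u) + 20)"
  unfolding trans_def using runs_swap by simp

lemma trans_cons: "trans cons_tree (t # u # ts) (Node t u # ts) 3"
  unfolding trans_def using runs_cons by simp

lemma trans_hd: "trans hd_tree (t # ts) (hdt t # ts) (40 * length (flat t) + 30)"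
  unfolding trans_def using runs_hd by simp

lemma trans_tl: "trans tl_tree (t # ts) (tlt t # ts) (40 * length (flat t) + 30)"
  unfolding trans_def using runs_tl by simp

lemma trans_push: "trans (push_tree t) ts (t # ts) (4 * length (flat t))"
  unfolding trans_def using runs_push_tree by simp

lemma trans_eq: "trans eq_tree (Node t u # ts) ((if t = u then Node Leaf Leaf else Leaf) # ts)
    (40 * length (flat (Node t u)) + 60)"
  unfolding trans_def using runs_eq[where t = t and u = u] by (simp only: concat.simps list.map append_assoc) simp

text \<open>Symbol 2 on top means a \<open>Node\<close>. The tested tree remains on the stack, and
  the branches have to use or remove it.\<close>

lemma trans_Cond_Leaf:
  assumes "trans d (Leaf # ts) us n" "n + 1 \<le> l"
  shows "trans (Cond (is_top 0 2) c d) (Leaf # ts) us l"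
  unfolding trans_def
  by (intro allI, rule runs_CondF[OF _ assms(1)[unfolded trans_def, rule_format] assms(2)]) simp

lemma trans_Cond_Node:
  assumes "trans c (Node t u # ts) us n" "n + 1 \<le> l"
  shows "trans (Cond (is_top 0 2) c d) (Node t u # ts) us l"
  unfolding trans_def
  by (intro allI, rule runs_CondT[OF _ assms(1)[unfolded trans_def, rule_format] assms(2)]) simp

lemma trans_Loop_Leaf: "1 \<le> l \<Longrightarrow> trans (Loop (is_top 0 2) c) (Leaf # ts) (Leaf # ts) l"
  unfolding trans_def by (intro allI, rule runs_LoopF) simp_all

lemma trans_Loop_Node:
  assumes "trans c (Node t u # ts) us m" "trans (Loop (is_top 0 2) c) us vs n" "m + n + 2 \<le> l"
  shows "trans (Loop (is_top 0 2) c) (Node t u # ts) vs l"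
  unfolding trans_def
  by (intro allI, rule runs_LoopT[OF _ assms(1)[unfolded trans_def, rule_format]
      assms(2)[unfolded trans_def, rule_format] assms(3)]) simp

definition computes :: "cmd \<Rightarrow> ('a::code \<Rightarrow> 'b::code) \<Rightarrow> ('a \<Rightarrow> nat) \<Rightarrow> bool" where
  "computes c f T \<longleftrightarrow> stack_cmd c \<and> (\<forall>x ts. trans c (code x # ts) (code (f x) # ts) (T x))"

definition X :: "('a::code \<Rightarrow> 'b::code) \<Rightarrow> bool" where
  "X f \<longleftrightarrow> polyb (\<lambda>x. sz (f x)) \<and> (\<exists>c T. expb T \<and> computes c f T)"

lemma X_polyb: "X f \<Longrightarrow> polyb (\<lambda>x. sz (f x))"
  by (simp add: X_def)

lemma XE:
  assumes "X f"
  obtains c T where "expb T" "stack_cmd c" "\<And>x ts. trans c (code x # ts) (code (f x) # ts) (T x)"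
  using assms unfolding X_def computes_def by blast

lemma XI:
  assumes "polyb (\<lambda>x. sz (f x))" "expb T" "stack_cmd c" "\<And>x ts. trans c (code x # ts) (code (f x) # ts) (T x)"
  shows "X f"
  using assms unfolding X_def computes_def by blast

text \<open>The rules speak about \<open>X (\<lambda>x. ...)\<close> with subterms
  \<open>f x\<close>, so that introduction follows the syntax of a term. Variables bound by a case
  distinction or a quantifier turn into projections of a tuple.\<close>

named_theorems X_intros

lemma expb_lin: "polyb (\<lambda>x. sz (f x)) \<Longrightarrow> expb (\<lambda>x. a * sz (f x) + b)"
  by (intro expb_polyb poly_intros)

lemma X_comp:
  assumes "X g" "X f"
  shows "X (\<lambda>x. g (f x))"
proof -
  obtain c T where 1: "expb T" "stack_cmd c" "\<And>x ts. trans c (code x # ts) (code (f x) # ts) (T x)"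
    by (rule XE[OF assms(2)]) blast
  obtain d U where 2: "expb U" "stack_cmd d" "\<And>x ts. trans d (code x # ts) (code (g x) # ts) (U x)"
    by (rule XE[OF assms(1)]) blast
  show ?thesis
  proof (rule XI)
    show "polyb (\<lambda>x. sz (g (f x)))" by (rule polyb_comp[OF X_polyb X_polyb]) fact+
    show "expb (\<lambda>x. T x + U (f x) + 1)"
      by (intro expb_add 1 expb_comp[OF 2(1)] X_polyb assms expb_polyb polyb_const)
    show "stack_cmd (Seq c d)" by (intro stack_intros 1 2)
    show "trans (Seq c d) (code x # ts) (code (g (f x)) # ts) (T x + U (f x) + 1)" for x ts
      by (rule trans_Seq[OF 1(3) 2(3) order_refl])
  qed
qed

lemma X_id [X_intros]: "X (\<lambda>x. x)"
  by (rule XI[OF _ expb_polyb[OF polyb_const[of 0]] stack_intros(1)])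
    (auto intro: trans_Nop polyb_sz)

text \<open>Programs see codes only. Values of different types with the same code share their
  programs, for example a pair and a nonempty list, or a number and its list of digits.\<close>

lemma X_recode:
  assumes "X f" "\<And>x. code (g x) = code (f x)"
  shows "X g"
  using assms(1) unfolding X_def computes_def sz_def assms(2) .

lemma X_const [X_intros]: "X (\<lambda>x. c)"
proof (rule XI)
  show "stack_cmd (Seq drop_top (push_tree (code c)))"
    by (intro stack_intros stack_drop_top stack_push_tree)
  show "expb (\<lambda>x::'a. (20 * sz x + 8) + 4 * sz c + 1)"
    by (intro expb_polyb poly_intros)
  show "trans (Seq drop_top (push_tree (code c))) (code x # ts) (code c # ts) ((20 * sz x + 8) + 4 * sz c + 1)" for x :: 'a and ts
    by (rule trans_Seq[OF trans_drop trans_push]) (simp add: sz_def)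
qed (rule polyb_const)

lemma X_Pair [X_intros]:
  assumes "X f" "X g"
  shows "X (\<lambda>x. (f x, g x))"
proof -
  obtain c T where 1: "expb T" "stack_cmd c" "\<And>x ts. trans c (code x # ts) (code (f x) # ts) (T x)"
    by (rule XE[OF assms(1)]) blast
  obtain d U where 2: "expb U" "stack_cmd d" "\<And>x ts. trans d (code x # ts) (code (g x) # ts) (U x)"
    by (rule XE[OF assms(2)]) blast
  note pf = X_polyb[OF assms(1)] and pg = X_polyb[OF assms(2)]
  show ?thesis
  proof (rule XI)
    show "polyb (\<lambda>x. sz (f x, g x))" unfolding sz_simps by (intro poly_intros pf pg)
    show "stack_cmd (Seq dup (Seq c (Seq swap (Seq d (Seq swap cons_tree)))))"
      by (intro stack_intros stack_dup 1 2 stack_swap stack_cons)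
    show "expb (\<lambda>x. 100 * sz x + 100 + T x + U x + 30 * sz (f x) + 30 * sz (g x) + 30 * sz (f x))"
      by (intro expb_add 1 2 expb_polyb poly_intros pf pg)
    show "trans (Seq dup (Seq c (Seq swap (Seq d (Seq swap cons_tree))))) (code x # ts) (code (f x, g x) # ts)
      (100 * sz x + 100 + T x + U x + 30 * sz (f x) + 30 * sz (g x) + 30 * sz (f x))" for x ts
      unfolding code_simps
      by (rule trans_Seq[OF trans_dup trans_Seq[OF 1(3) trans_Seq[OF trans_swap trans_Seq[OF 2(3)
        trans_Seq[OF trans_swap trans_cons order_refl] order_refl] order_refl] order_refl]]) (simp add: sz_def)
  qed
qed

text \<open>The common core of the case distinctions on \<open>bool\<close>, \<open>list\<close> and
  \<open>option\<close>. The branch for nodes receives the argument together with the analysed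
  value; this is phrased on codes, so that the analysed value may be reread at another type, such as
  a nonempty list as a pair.\<close>

lemma X_case_tree:
  assumes "X l" "X f" "X g" and
    Leaf: "\<And>x. code (l x) = Leaf \<Longrightarrow> F x = f x" and
    Node: "\<And>x. code (l x) \<noteq> Leaf \<Longrightarrow> \<exists>y. F x = g y \<and> code y = Node (code x) (code (l x))"
  shows "X F"
proof -
  obtain c T where 1: "expb T" "stack_cmd c" "\<And>x ts. trans c (code x # ts) (code (l x) # ts) (T x)"
    by (rule XE[OF assms(1)]) blast
  obtain d U where 2: "expb U" "stack_cmd d" "\<And>x ts. trans d (code x # ts) (code (f x) # ts) (U x)"
    by (rule XE[OF assms(2)]) blast
  obtain e V where 3: "expb V" "stack_cmd e" "\<And>x ts. trans e (code x # ts) (code (g x) # ts) (V x)"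
    by (rule XE[OF assms(3)]) blast
  note pl = X_polyb[OF assms(1)] and pf = X_polyb[OF assms(2)]
  obtain k where k: "\<And>x. sz (g x) \<le> (sz x + 2) ^ k" using X_polyb[OF assms(3)] unfolding polyb_def by blast
  obtain m where m: "\<And>x. V x \<le> 2 ^ ((sz x + 2) ^ m)" using 3(1) unfolding expb_def by blast
  let ?c = "Seq dup (Seq c (Cond (is_top 0 2) (Seq swap (Seq cons_tree e)) (Seq drop_top d)))"
  let ?T = "\<lambda>x. 100 * sz x + 100 + T x + 30 * sz (l x) + (U x + 2 ^ ((1 + sz x + sz (l x) + 2) ^ m))"
  show ?thesis
  proof (rule XI)
    have "polyb (\<lambda>x. (1 + sz x + sz (l x) + 2) ^ k + sz (f x))" by (intro poly_intros pl pf)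
    then show "polyb (\<lambda>x. sz (F x))"
    proof (rule polyb_mono)
      fix x
      show "sz (F x) \<le> (1 + sz x + sz (l x) + 2) ^ k + sz (f x)"
      proof (cases "code (l x) = Leaf")
        case True
        then show ?thesis by (simp add: Leaf)
      next
        case False
        then obtain y where y: "F x = g y" "code y = Node (code x) (code (l x))" using Node by blast
        have "sz y = 1 + sz x + sz (l x)" unfolding sz_def y(2) by simp
        then show ?thesis using k[of y] y(1) by simp
      qed
    qed
    show "stack_cmd ?c" by (intro stack_intros stack_dup stack_swap stack_cons stack_drop_top 1 2 3)
    show "expb ?T" by (intro expb_add expb_pow 1 2 poly_intros pl expb_polyb)
    fix x ts
    have 4: "trans (Cond (is_top 0 2) (Seq swap (Seq cons_tree e)) (Seq drop_top d)) (code (l x) # code x # ts) (code (F x) # ts)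
       (30 * sz (l x) + 30 * sz x + 60 + (U x + 2 ^ ((1 + sz x + sz (l x) + 2) ^ m)))"
    proof (cases "code (l x)")
      case L: Leaf
      then have F: "F x = f x" by (rule Leaf)
      show ?thesis unfolding F L
        by (rule trans_Cond_Leaf[OF trans_Seq[OF trans_drop 2(3) order_refl]]) simp
    next
      case N: (Node t u)
      then obtain y where y: "F x = g y" "code y = Node (code x) (code (l x))" using Node by force
      have s: "sz y = 1 + sz x + sz (l x)" unfolding sz_def y(2) by simp
      have s2: "length (flat (Node t u)) = sz (l x)" "length (flat (code x)) = sz x" by (simp_all add: sz_def N)
      have "V y \<le> 2 ^ ((1 + sz x + sz (l x) + 2) ^ m)" using m[of y] unfolding s .
      then show ?thesis unfolding y(1) N
        by (intro trans_Cond_Node[OF trans_Seq[OF trans_swap trans_Seq[OF trans_cons 3(3)[of y, unfolded y(2) N] order_refl] order_refl]])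
           (simp only: s2)
    qed
    show "trans ?c (code x # ts) (code (F x) # ts) (?T x)"
      by (rule trans_Seq[OF trans_dup trans_Seq[OF 1(3) 4 order_refl]]) (simp add: sz_def)
  qed
qed

lemma X_code_fun:
  assumes "stack_cmd c" "\<And>x ts. trans c (code x # ts) (code (f x) # ts) (a * sz x + b)"
    "\<And>x. sz (f x) \<le> sz x + 10"
  shows "X f"
  by (rule XI[OF polyb_mono[OF _ assms(3)] expb_lin assms(1,2)]) (intro poly_intros)+

lemma X_fst' : "X fst"
proof (rule X_code_fun[OF stack_hd, of _ 40 30])
  show "trans hd_tree (code x # ts) (code (fst x) # ts) (40 * sz x + 30)" for x :: "'a \<times> 'b" and ts
    using trans_hd[of "code x" ts] by (cases x) (simp add: sz_def)
qed auto

lemma X_snd': "X snd"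
proof (rule X_code_fun[OF stack_tl, of _ 40 30])
  show "trans tl_tree (code x # ts) (code (snd x) # ts) (40 * sz x + 30)" for x :: "'a \<times> 'b" and ts
    using trans_tl[of "code x" ts] by (cases x) (simp add: sz_def)
qed auto

lemmas X_fst [X_intros] = X_comp[OF X_fst'] and X_snd [X_intros] = X_comp[OF X_snd']

lemma X_eq [X_intros]:
  assumes "X f" "X g"
  shows "X (\<lambda>x. f x = g x)"
proof -
  have "X (\<lambda>p::'b \<times> 'b. fst p = snd p)"
  proof (rule X_code_fun[OF stack_eq, of _ 40 60])
    show "trans eq_tree (code x # ts) (code (fst x = snd x) # ts) (40 * sz x + 60)" for x :: "'b \<times> 'b" and ts
      using trans_eq[of "code (fst x)" "code (snd x)" ts]
      by (cases x) (simp add: sz_def code_bool_def)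
    show "sz (fst x = snd x) \<le> sz x + 10" for x :: "'b \<times> 'b" using sz_bool[of "fst x = snd x"] by simp
  qed
  from X_comp[OF this X_Pair[OF assms]] show ?thesis by simp
qed

lemma X_Cons [X_intros]: "X f \<Longrightarrow> X g \<Longrightarrow> X (\<lambda>x. f x # g x)"
  by (rule X_recode[OF X_Pair]) auto

lemma X_Some [X_intros]: "X f \<Longrightarrow> X (\<lambda>x. Some (f x))"
  by (rule X_recode[OF X_Pair[OF X_const[of False]]]) auto

lemma X_if [X_intros]:
  fixes P :: "'a::code \<Rightarrow> bool" and f g :: "'a \<Rightarrow> 'b::code"
  assumes "X P" "X f" "X g"
  shows "X (\<lambda>x. if P x then f x else g x)"
proof (rule X_case_tree[OF assms(1) assms(3) X_comp[OF assms(2) X_fst'[where 'b = bool]]])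
  show "code (P x) = Leaf \<Longrightarrow> (if P x then f x else g x) = g x" for x by (cases "P x") auto
  show "\<exists>y::'a \<times> bool. (if P x then f x else g x) = f (fst y) \<and> code y = Node (code x) (code (P x))"
    if "code (P x) \<noteq> Leaf" for x
    by (rule exI[of _ "(x, P x)"]) (use that in \<open>cases "P x", auto\<close>)
qed

lemma X_case_list [X_intros]:
  assumes "X l" "X f" "X (\<lambda>z. g (fst z) (fst (snd z)) (snd (snd z)))"
  shows "X (\<lambda>x. case l x of [] \<Rightarrow> f x | y # ys \<Rightarrow> g x y ys)"
proof (rule X_case_tree[OF assms])
  show "code (l x) = Leaf \<Longrightarrow> (case l x of [] \<Rightarrow> f x | y # ys \<Rightarrow> g x y ys) = f x" for x by (cases "l x") auto
  fix x assume "code (l x) \<noteq> Leaf"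
  then obtain y ys where l: "l x = y # ys" by (cases "l x") auto
  show "\<exists>z. (case l x of [] \<Rightarrow> f x | y # ys \<Rightarrow> g x y ys) = g (fst z) (fst (snd z)) (snd (snd z)) \<and>
     code z = Node (code x) (code (l x))"
    by (rule exI[of _ "(x, y, ys)"]) (simp add: l)
qed

lemma X_case_option [X_intros]:
  fixes l :: "'a::code \<Rightarrow> 'b::code option" and g :: "'a \<Rightarrow> 'b \<Rightarrow> 'c::code"
  assumes "X l" "X f" "X (\<lambda>z. g (fst z) (snd z))"
  shows "X (\<lambda>x. case l x of None \<Rightarrow> f x | Some y \<Rightarrow> g x y)"
proof -
  \<comment> \<open>\<open>Some y\<close> has the same code as the pair \<open>(False, y)\<close>,
    hence the dummy component of type \<open>bool\<close>.\<close>
  have "X (\<lambda>z::'a \<times> bool \<times> 'b. g (fst (fst z, snd (snd z))) (snd (fst z, snd (snd z))))"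
    by (rule X_comp[OF assms(3)]) (intro X_intros)
  then have g: "X (\<lambda>z::'a \<times> bool \<times> 'b. g (fst z) (snd (snd z)))" by simp
  show ?thesis
  proof (rule X_case_tree[OF assms(1,2) g])
    show "code (l x) = Leaf \<Longrightarrow> (case l x of None \<Rightarrow> f x | Some y \<Rightarrow> g x y) = f x" for x by (cases "l x") auto
    fix x assume "code (l x) \<noteq> Leaf"
    then obtain y where l: "l x = Some y" by (cases "l x") auto
    show "\<exists>z::'a \<times> bool \<times> 'b. (case l x of None \<Rightarrow> f x | Some y \<Rightarrow> g x y) = g (fst z) (snd (snd z)) \<and>
       code z = Node (code x) (code (l x))"
      by (rule exI[of _ "(x, False, y)"]) (simp add: l)
  qed
qed

lemma X_Not [X_intros]: "X P \<Longrightarrow> X (\<lambda>x. \<not> P x)"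
  by (rule X_recode[OF X_if[OF _ X_const[of False] X_const[of True]]]) auto

lemma X_conj [X_intros]: "X P \<Longrightarrow> X Q \<Longrightarrow> X (\<lambda>x. P x \<and> Q x)"
proof -
  assume "X P" "X Q"
  then have "X (\<lambda>x. if P x then Q x else False)" by (intro X_intros)
  then show ?thesis by (rule X_recode) auto
qed

lemma X_disj [X_intros]: "X P \<Longrightarrow> X Q \<Longrightarrow> X (\<lambda>x. P x \<or> Q x)"
proof -
  assume "X P" "X Q"
  then have "X (\<lambda>x. if P x then True else Q x)" by (intro X_intros)
  then show ?thesis by (rule X_recode) auto
qed

lemma X_imp [X_intros]: "X P \<Longrightarrow> X Q \<Longrightarrow> X (\<lambda>x. P x \<longrightarrow> Q x)"
proof -
  assume "X P" "X Q"
  then have "X (\<lambda>x. if P x then Q x else True)" by (intro X_intros)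
  then show ?thesis by (rule X_recode) auto
qed

text \<open>Exponentially many rounds on states of polynomial size still take exponential time. The
  result of the test lies on top of the state, where the machine loop inspects it, and is computed
  anew in every round.\<close>

lemma X_while:
  fixes P :: "'s::code \<Rightarrow> bool" and s :: "'s \<Rightarrow> 's" and init F :: "'a::code \<Rightarrow> 's"
  assumes P: "X P" and s: "X s" and init: "X init" and h: "polyb h"
    and run: "\<And>x. \<exists>n. n \<le> 2 ^ h x \<and> (\<forall>i<n. P ((s ^^ i) (init x))) \<and> \<not> P ((s ^^ n) (init x)) \<and>
       (\<forall>i\<le>n. sz ((s ^^ i) (init x)) \<le> h x) \<and> F x = (s ^^ n) (init x)"
  shows "X F"
proof -
  obtain c T where 1: "expb T" "stack_cmd c" "\<And>x ts. trans c (code x # ts) (code (P x) # ts) (T x)"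
    by (rule XE[OF P]) blast
  obtain d U where 2: "expb U" "stack_cmd d" "\<And>x ts. trans d (code x # ts) (code (s x) # ts) (U x)"
    by (rule XE[OF s]) blast
  obtain e V where 3: "expb V" "stack_cmd e" "\<And>x ts. trans e (code x # ts) (code (init x) # ts) (V x)"
    by (rule XE[OF init]) blast
  obtain k where k: "\<And>x. T x \<le> 2 ^ ((sz x + 2) ^ k)" using 1(1) unfolding expb_def by blast
  obtain m where m: "\<And>x. U x \<le> 2 ^ ((sz x + 2) ^ m)" using 2(1) unfolding expb_def by blast
  \<comment> \<open>A bound for one round: all states have size at most \<open>h x\<close>, so the
    times of test and body are bounded in terms of \<open>h x\<close>; the linear part pays for
    copying and dropping.\<close>
  define B where "B x = 100 * h x + 200 + 2 ^ ((h x + 2) ^ k) + 2 ^ ((h x + 2) ^ m)" for x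
  have TB: "T y \<le> 2 ^ ((h x + 2) ^ k)" if "sz y \<le> h x" for x y
  proof -
    have "(sz y + 2) ^ k \<le> (h x + 2) ^ k" using that by (intro power_mono) auto
    then have "(2::nat) ^ ((sz y + 2) ^ k) \<le> 2 ^ ((h x + 2) ^ k)" by (intro power_increasing) auto
    then show ?thesis using k[of y] by linarith
  qed
  have UB: "U y \<le> 2 ^ ((h x + 2) ^ m)" if "sz y \<le> h x" for x y
  proof -
    have "(sz y + 2) ^ m \<le> (h x + 2) ^ m" using that by (intro power_mono) auto
    then have "(2::nat) ^ ((sz y + 2) ^ m) \<le> 2 ^ ((h x + 2) ^ m)" by (intro power_increasing) auto
    then show ?thesis using m[of y] by linarith
  qed
  let ?t = "Seq dup c"
  let ?L = "Loop (is_top 0 2) (Seq drop_top (Seq d ?t))"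
  have test: "trans ?t (code y # ts) (code (P y) # code y # ts) (60 * sz y + 21 + T y)" for y ts
    by (rule trans_Seq[OF trans_dup 1(3)]) (simp add: sz_def)
  have loop: "trans ?L (code (P y) # code y # ts) (code False # code ((s ^^ n) y) # ts) (n * (B x) + 1)"
    if "\<forall>i<n. P ((s ^^ i) y)" "\<not> P ((s ^^ n) y)" "\<forall>i\<le>n. sz ((s ^^ i) y) \<le> h x" for n x y ts
    using that
  proof (induction n arbitrary: y)
    case 0
    then show ?case by (auto intro!: trans_Loop_Leaf)
  next
    case (Suc n)
    have Py: "code (P y) = Node Leaf Leaf" using Suc.prems(1) by (auto dest: spec[of _ 0])
    have f: "(s ^^ i) (s y) = (s ^^ Suc i) y" for i by (simp add: funpow_swap1)
    have sy: "sz y \<le> h x" "sz (s y) \<le> h x"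
      using spec[OF Suc.prems(3), of 0] spec[OF Suc.prems(3), of 1] by auto
    have IH: "trans ?L (code (P (s y)) # code (s y) # ts) (code False # code ((s ^^ Suc n) y) # ts) (n * B x + 1)"
      unfolding f[symmetric]
    proof (rule Suc.IH)
      show "\<forall>i<n. P ((s ^^ i) (s y))" "\<not> P ((s ^^ n) (s y))" "\<forall>i\<le>n. sz ((s ^^ i) (s y)) \<le> h x"
        unfolding f using Suc.prems by (auto simp del: funpow.simps)
    qed
    have "trans (Seq drop_top (Seq d ?t)) (Node Leaf Leaf # code y # ts) (code (P (s y)) # code (s y) # ts)
       (68 + U y + 60 * sz (s y) + 21 + T (s y) + 2)"
      by (rule trans_Seq[OF trans_drop trans_Seq[OF 2(3) test order_refl]]) simp
    then have body: "trans (Seq drop_top (Seq d ?t)) (Node Leaf Leaf # code y # ts) (code (P (s y)) # code (s y) # ts) (B x - 2)"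
      by (rule trans_mono) (use TB[of "s y" x] UB[of y x] sy in \<open>simp add: B_def\<close>)
    show ?case unfolding Py
      by (rule trans_Loop_Node[OF body IH]) (simp add: B_def)
  qed
  show ?thesis
  proof (rule XI)
    show "polyb (\<lambda>x. sz (F x))"
    proof (rule polyb_mono[OF h])
      fix x
      obtain n where "\<forall>i\<le>n. sz ((s ^^ i) (init x)) \<le> h x" "F x = (s ^^ n) (init x)" using run by blast
      then show "sz (F x) \<le> h x" by (metis order_refl)
    qed
    show "stack_cmd (Seq e (Seq ?t (Seq ?L drop_top)))"
      by (intro stack_intros stack_dup stack_drop_top 1 2 3)
    show "expb (\<lambda>x. V x + (60 * sz (init x) + 80 + T (init x) + 2 ^ h x * B x))"
      unfolding B_def
      by (intro expb_add 3 expb_comp[OF 1(1)] expb_mult expb_pow poly_intros h expb_polyb X_polyb[OF init])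
    fix x ts
    obtain n where n: "n \<le> 2 ^ h x" "\<forall>i<n. P ((s ^^ i) (init x))" "\<not> P ((s ^^ n) (init x))"
       "\<forall>i\<le>n. sz ((s ^^ i) (init x)) \<le> h x" "F x = (s ^^ n) (init x)" using run by blast
    have gen: "v + (i + 21 + t + (a + 1 + (20 * (0 + Suc 0) + 8) + 1) + 1) + 1 \<le> v + (i + 80 + t + b)"
      if "a \<le> b" for a b v i t :: nat using that by simp
    have "n * B x \<le> 2 ^ h x * B x" using n(1) by (rule mult_le_mono1)
    then have b: "V x + (60 * sz (init x) + 21 + T (init x) + (n * B x + 1 + (20 * length (flat (code False)) + 8) + 1) + 1) + 1
       \<le> V x + (60 * sz (init x) + 80 + T (init x) + 2 ^ h x * B x)"
      unfolding code_simps flat.simps list.size by (rule gen)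
    show "trans (Seq e (Seq ?t (Seq ?L drop_top))) (code x # ts) (code (F x) # ts)
      (V x + (60 * sz (init x) + 80 + T (init x) + 2 ^ h x * B x))" unfolding n(5)
      by (rule trans_Seq[OF 3(3) trans_Seq[OF test trans_Seq[OF loop[OF n(2-4)] trans_drop order_refl] order_refl] b])
  qed
qed

text \<open>The loop state consists of the argument, the accumulator and the rest of the list. The
  accumulators that occur belong to prefixes of \<open>l x\<close>, and these must have polynomial
  size.\<close>

lemma X_foldl:
  fixes s :: "'a::code \<Rightarrow> 'b::code \<Rightarrow> 'c::code \<Rightarrow> 'b"
  assumes s: "X (\<lambda>z. s (fst z) (fst (snd z)) (snd (snd z)))" and i: "X i" and l: "X l"
    and h: "polyb h" "\<And>x ys zs. l x = ys @ zs \<Longrightarrow> sz (foldl (s x) (i x) ys) \<le> h x"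
  shows "X (\<lambda>x. foldl (s x) (i x) (l x))"
proof -
  let ?P = "\<lambda>st::'a \<times> 'b \<times> 'c list. snd (snd st) \<noteq> []"
  let ?s = "\<lambda>st::'a \<times> 'b \<times> 'c list. case snd (snd st) of [] \<Rightarrow> st
     | y # ys \<Rightarrow> (fst st, s (fst st) (fst (snd st)) y, ys)"
  have "X (\<lambda>z::('a \<times> 'b \<times> 'c list) \<times> 'c \<times> 'c list. s (fst (fst (fst z), fst (snd (fst z)), fst (snd z)))
     (fst (snd (fst (fst z), fst (snd (fst z)), fst (snd z)))) (snd (snd (fst (fst z), fst (snd (fst z)), fst (snd z)))))"
    by (rule X_comp[OF s]) (intro X_intros)
  then have s': "X (\<lambda>z::('a \<times> 'b \<times> 'c list) \<times> 'c \<times> 'c list. s (fst (fst z)) (fst (snd (fst z))) (fst (snd z)))"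
    by simp
  have X: "X ?s" by (intro X_intros s')
  have it: "(?s ^^ k) (x, i x, l x) = (x, foldl (s x) (i x) (take k (l x)), drop k (l x))" if "k \<le> length (l x)" for k x
    using that
  proof (induction k)
    case (Suc k)
    then have "drop k (l x) = l x ! k # drop (Suc k) (l x)" "take (Suc k) (l x) = take k (l x) @ [l x ! k]"
      by (simp_all add: Cons_nth_drop_Suc take_Suc_conv_app_nth)
    then show ?case using Suc by simp
  qed simp
  have "X (\<lambda>x. (x, foldl (s x) (i x) (l x), [] :: 'c list))"
  proof (rule X_while[of ?P ?s "\<lambda>x. (x, i x, l x)" "\<lambda>x. 5 + sz x + h x + sz (l x)", OF _ X])
    show "X ?P" by (intro X_intros)
    show "X (\<lambda>x. (x, i x, l x))" by (intro X_intros i l)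
    show "polyb (\<lambda>x. 5 + sz x + h x + sz (l x))" by (intro poly_intros h X_polyb[OF l])
    fix x
    have sd: "sz (drop k (l x)) \<le> sz (l x)" for k
      using sz_append[of "take k (l x)" "drop k (l x)", unfolded append_take_drop_id] sz_pos(1)[of "take k (l x)"]
      by linarith
    have "length (l x) \<le> 5 + sz x + h x + sz (l x)" using length_le_sz[of "l x"] by simp
    also have "\<dots> \<le> 2 ^ (5 + sz x + h x + sz (l x))" by (rule less_imp_le[OF less_exp])
    finally have len: "length (l x) \<le> 2 ^ (5 + sz x + h x + sz (l x))" .
    have b: "sz (foldl (s x) (i x) (take k (l x))) \<le> h x" for k
      by (rule h(2)[of x _ "drop k (l x)"]) simp
    show "\<exists>n\<le>2 ^ (5 + sz x + h x + sz (l x)). (\<forall>k<n. ?P ((?s ^^ k) (x, i x, l x))) \<and>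
       \<not> ?P ((?s ^^ n) (x, i x, l x)) \<and> (\<forall>k\<le>n. sz ((?s ^^ k) (x, i x, l x)) \<le> 5 + sz x + h x + sz (l x)) \<and>
       (x, foldl (s x) (i x) (l x), []) = (?s ^^ n) (x, i x, l x)"
    proof (intro exI[of _ "length (l x)"] conjI allI impI len)
      fix k assume "k < length (l x)"
      then show "?P ((?s ^^ k) (x, i x, l x))" using it[of k x] by simp
    next
      fix k assume "k \<le> length (l x)"
      then show "sz ((?s ^^ k) (x, i x, l x)) \<le> 5 + sz x + h x + sz (l x)"
        using it[of k x] b[of k] sd[of k] by simp
    next
      show "\<not> ?P ((?s ^^ length (l x)) (x, i x, l x))"
        "(x, foldl (s x) (i x) (l x), []) = (?s ^^ length (l x)) (x, i x, l x)"
        using it[of "length (l x)" x] by simp_all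
    qed
  qed
  from X_comp[OF X_fst' X_comp[OF X_snd' this]] show ?thesis by simp
qed

section \<open>Arithmetic and lists\<close>

lemma nat_bits_0 [simp]: "nat_bits 0 = []"
  by (simp add: nat_bits.simps)

lemma nat_bits_pos: "0 < n \<Longrightarrow> nat_bits n = odd n # nat_bits (n div 2)"
  by (simp add: nat_bits.simps[of n])

lemma nat_bits_less: "n < 2 ^ length (nat_bits n)"
proof (induction n rule: less_induct)
  case (less n)
  show ?case
  proof (cases "n = 0")
    case False
    then have "n div 2 < 2 ^ length (nat_bits (n div 2))" by (intro less) simp
    then show ?thesis using False by (simp add: nat_bits_pos)
  qed simp
qed

lemma length_nat_bits: "n < 2 ^ k \<Longrightarrow> length (nat_bits n) \<le> k"
proof (induction k arbitrary: n)
  case (Suc k)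
  show ?case
  proof (cases "n = 0")
    case False
    have "n div 2 < 2 ^ k" using Suc.prems by simp
    from Suc.IH[OF this] show ?thesis using False by (simp add: nat_bits_pos)
  qed simp
qed simp

lemma sz_bits: "2 * length bs + 1 \<le> sz (bs :: bool list)" "sz (bs :: bool list) \<le> 4 * length bs + 1"
proof (induction bs)
  case (Cons b bs)
  { case 1 then show ?case using Cons by (cases b) auto }
  { case 2 then show ?case using Cons by (cases b) auto }
qed auto

lemma sz_nat: "sz (n :: nat) = sz (nat_bits n)"
  by (simp add: sz_def code_nat_def)

lemma nat_less_sz: "n < 2 ^ sz (n :: nat)"
proof -
  have "length (nat_bits n) \<le> sz n" using sz_bits(1)[of "nat_bits n"] by (simp add: sz_nat)
  then have "(2::nat) ^ length (nat_bits n) \<le> 2 ^ sz n" by (intro power_increasing) auto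
  then show ?thesis using nat_bits_less[of n] by linarith
qed

lemma sz_nat_le: "n < 2 ^ k \<Longrightarrow> sz (n :: nat) \<le> 4 * k + 1"
  using sz_bits(2)[of "nat_bits n"] length_nat_bits[of n k] by (simp add: sz_nat)

lemma sz_nat_mono: "k \<le> n \<Longrightarrow> sz k \<le> 4 * sz n + 1" for k n :: nat
  by (rule sz_nat_le) (use nat_less_sz[of n] in linarith)

fun inc_bits :: "bool list \<Rightarrow> bool list" where
  "inc_bits [] = [True]"
| "inc_bits (b # bs) = (if b then False # inc_bits bs else True # bs)"

lemma nat_bits_Suc: "nat_bits (Suc n) = inc_bits (nat_bits n)"
proof (induction n rule: less_induct)
  case (less n)
  consider "n = 0" | "0 < n" "even n" | "0 < n" "odd n" by auto
  then show ?case
  proof cases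
    case 1
    then show ?thesis by (simp add: nat_bits_pos)
  next
    case 2
    then have "Suc n div 2 = n div 2" by (elim evenE) simp
    then show ?thesis using 2 by (simp add: nat_bits_pos)
  next
    case 3
    then have "Suc n div 2 = Suc (n div 2)" by (elim oddE) simp
    then show ?thesis using 3 less[of "n div 2"] by (simp add: nat_bits_pos)
  qed
qed

text \<open>The state is the carry and the digits produced so far, in reverse order.\<close>

definition inc_step :: "bool \<times> bool list \<Rightarrow> bool \<Rightarrow> bool \<times> bool list" where
  "inc_step st b = (fst st \<and> b, (b \<noteq> fst st) # snd st)"

lemma inc_bits_foldl:
  "(let st = foldl inc_step (c, acc) bs in rev (if fst st then True # snd st else snd st)) =
    rev acc @ (if c then inc_bits bs else bs)"
  by (induction bs arbitrary: c acc) (auto simp: inc_step_def Let_def)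

lemma sz_inc_step: "sz (foldl inc_step (c, acc) bs) \<le> 4 + sz acc + 4 * length bs"
proof (induction bs arbitrary: c acc)
  case Nil
  then show ?case using sz_bool[of c] by simp
next
  case (Cons b bs)
  then show ?case using Cons[of "c \<and> b" "(b \<noteq> c) # acc"] sz_bool[of "b \<noteq> c"] by (simp add: inc_step_def)
qed

section \<open>Lists and natural numbers\<close>

lemma X_foldl_Cons:
  assumes f: "X (\<lambda>z. f (fst z) (snd z))" and l: "X l"
  shows "X (\<lambda>x. foldl (\<lambda>acc y. f x y # acc) [] (l x))"
proof -
  obtain k where k: "\<And>z. sz (f (fst z) (snd z)) \<le> (sz z + 2) ^ k"
    using X_polyb[OF f] unfolding polyb_def by blast
  let ?b = "\<lambda>x. (1 + sz x + sz (l x) + 2) ^ k"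
  let ?h = "\<lambda>x. 1 + sz (l x) * (1 + ?b x)"
  show ?thesis
  proof (rule X_foldl[where s = "\<lambda>x acc y. f x y # acc" and h = ?h])
    have "X (\<lambda>z. f (fst (fst z, snd (snd z))) (snd (fst z, snd (snd z))))"
      by (rule X_comp[OF f]) (intro X_intros)
    then show "X (\<lambda>z. f (fst z) (snd (snd z)) # fst (snd z))" by (auto intro!: X_intros)
    show "polyb ?h" by (intro poly_intros X_polyb[OF l])
    fix x ys zs assume lx: "l x = ys @ zs"
    have e: "foldl (\<lambda>acc y. f x y # acc) acc ys = rev (map (f x) ys) @ acc" for acc
      by (induction ys arbitrary: acc) auto
    have "sz (f x y) \<le> ?b x" if "y \<in> set ys" for y
    proof -
      have "sz y \<le> sz (l x)" by (rule sz_elem) (use that lx in auto)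
      then have "(sz (x, y) + 2) ^ k \<le> ?b x" by (intro power_mono) auto
      then show ?thesis using k[of "(x, y)"] by simp
    qed
    then have "sz (rev (map (f x) ys)) \<le> 1 + length (rev (map (f x) ys)) * (1 + ?b x)"
      by (intro sz_list_bound) auto
    moreover have "length (rev (map (f x) ys)) \<le> sz (l x)" using length_le_sz[of "l x"] lx by simp
    then have "length (rev (map (f x) ys)) * (1 + ?b x) \<le> sz (l x) * (1 + ?b x)" by (rule mult_le_mono1)
    ultimately show "sz (foldl (\<lambda>acc y. f x y # acc) [] ys) \<le> ?h x"
      unfolding e append_Nil2 by linarith
  qed (intro X_intros l)+
qed

lemma X_rev [X_intros]: "X l \<Longrightarrow> X (\<lambda>x. rev (l x))"
proof -
  assume "X l"
  then have "X (\<lambda>x. foldl (\<lambda>acc y. (\<lambda>_ y. y) x y # acc) [] (l x))"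
    by (intro X_foldl_Cons) (intro X_intros)
  moreover have "foldl (\<lambda>acc y. y # acc) zs ys = rev ys @ zs" for ys zs :: "'b list"
    by (induction ys arbitrary: zs) auto
  ultimately show ?thesis by simp
qed

lemma X_append [X_intros]:
  assumes f: "X f" and g: "X g"
  shows "X (\<lambda>x. f x @ g x)"
proof -
  have e: "foldl (\<lambda>acc y. y # acc) zs ys = rev ys @ zs" for ys zs :: "'b list"
    by (induction ys arbitrary: zs) auto
  have "X (\<lambda>x. foldl ((\<lambda>_ acc y. y # acc) x) (g x) (rev (f x)))"
  proof (rule X_foldl[where h = "\<lambda>x. sz (f x) + sz (g x)"])
    show "polyb (\<lambda>x. sz (f x) + sz (g x))" by (intro poly_intros X_polyb f g)
    fix x ys zs assume "rev (f x) = ys @ zs"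
    then have "sz (f x) + 1 = sz ys + sz zs" by (metis sz_append sz_rev)
    then show "sz (foldl (\<lambda>acc y. y # acc) (g x) ys) \<le> sz (f x) + sz (g x)"
      unfolding e using sz_append[of "rev ys" "g x"] sz_pos(1)[of zs] by simp
  qed (intro X_intros f g)+
  then show ?thesis unfolding e by simp
qed

lemma X_nat_bits [X_intros]: "X f \<Longrightarrow> X (\<lambda>x. nat_bits (f x))"
  by (erule X_recode) (simp add: code_nat_def)

text \<open>The one arithmetic operation that is carried out on digits; the others are obtained from
  it by counting.\<close>

lemma X_Suc [X_intros]: "X f \<Longrightarrow> X (\<lambda>x. Suc (f x))"
proof -
  assume f: "X f"
  define g where "g x = foldl ((\<lambda>_. inc_step) x) (True, []) (nat_bits (f x))" for x
  have "X g" unfolding g_def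
  proof (rule X_foldl[where h = "\<lambda>x. 5 + 4 * sz (f x)"])
    show "polyb (\<lambda>x. 5 + 4 * sz (f x))" by (intro poly_intros X_polyb f)
    show "X (\<lambda>z. inc_step (fst (snd z)) (snd (snd z)))" unfolding inc_step_def by (intro X_intros)
    fix x ys zs assume l: "nat_bits (f x) = ys @ zs"
    have "length ys \<le> sz (f x)" using sz_bits(1)[of "nat_bits (f x)"] l by (simp add: sz_nat)
    then show "sz (foldl inc_step (True, []) ys) \<le> 5 + 4 * sz (f x)"
      using sz_inc_step[of True "[]" ys] by simp
  qed (intro X_intros f)+
  then have "X (\<lambda>x. rev (if fst (g x) then True # snd (g x) else snd (g x)))" by (intro X_intros)
  then show ?thesis
  proof (rule X_recode)
    fix x
    have "rev (if fst (g x) then True # snd (g x) else snd (g x)) = inc_bits (nat_bits (f x))"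
      using inc_bits_foldl[of True "[]" "nat_bits (f x)"]
      unfolding Let_def g_def by (simp only: rev.simps append_Nil if_True)
    then show "code (Suc (f x)) = code (rev (if fst (g x) then True # snd (g x) else snd (g x)))"
      by (simp only: code_nat_def nat_bits_Suc)
  qed
qed

text \<open>The number of rounds is the value of \<open>n x\<close>, which is at most exponential in
  its size. Primitive recursion is therefore affordable, and only the number of digits of the
  intermediate values has to be watched.\<close>

lemma X_rec_nat:
  fixes s :: "'a::code \<Rightarrow> nat \<Rightarrow> 'b::code \<Rightarrow> 'b"
  assumes s: "X (\<lambda>z. s (fst z) (fst (snd z)) (snd (snd z)))" and i: "X i" and n: "X n"
    and h: "polyb h" "\<And>x k. k \<le> n x \<Longrightarrow> sz (rec_nat (i x) (s x) k) \<le> h x"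
  shows "X (\<lambda>x. rec_nat (i x) (s x) (n x))"
proof -
  let ?P = "\<lambda>st::'a \<times> nat \<times> nat \<times> 'b. fst (snd st) \<noteq> fst (snd (snd st))"
  let ?s = "\<lambda>st::'a \<times> nat \<times> nat \<times> 'b. (fst st, Suc (fst (snd st)), fst (snd (snd st)),
     s (fst st) (fst (snd st)) (snd (snd (snd st))))"
  have "X (\<lambda>z::'a \<times> nat \<times> nat \<times> 'b. s (fst (fst z, fst (snd z), snd (snd (snd z))))
     (fst (snd (fst z, fst (snd z), snd (snd (snd z))))) (snd (snd (fst z, fst (snd z), snd (snd (snd z))))))"
    by (rule X_comp[OF s]) (intro X_intros)
  then have s': "X (\<lambda>z::'a \<times> nat \<times> nat \<times> 'b. s (fst z) (fst (snd z)) (snd (snd (snd z))))"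
    by simp
  have X: "X ?s" by (intro X_intros s')
  have it: "(?s ^^ k) (x, 0, n x, i x) = (x, k, n x, rec_nat (i x) (s x) k)" for k x
    by (induction k) auto
  let ?h = "\<lambda>x. 10 + sz x + h x + 5 * sz (n x)"
  have "X (\<lambda>x. (x, n x, n x, rec_nat (i x) (s x) (n x)))"
  proof (rule X_while[of ?P ?s "\<lambda>x. (x, 0, n x, i x)" ?h, OF _ X])
    show "X ?P" by (intro X_intros)
    show "X (\<lambda>x. (x, 0, n x, i x))" by (intro X_intros i n)
    show "polyb ?h" by (intro poly_intros h X_polyb[OF n])
    fix x
    have "n x < 2 ^ sz (n x)" by (rule nat_less_sz)
    also have "\<dots> \<le> 2 ^ ?h x" by (intro power_increasing) auto
    finally have len: "n x \<le> 2 ^ ?h x" by simp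
    show "\<exists>m\<le>2 ^ ?h x. (\<forall>k<m. ?P ((?s ^^ k) (x, 0, n x, i x))) \<and>
       \<not> ?P ((?s ^^ m) (x, 0, n x, i x)) \<and> (\<forall>k\<le>m. sz ((?s ^^ k) (x, 0, n x, i x)) \<le> ?h x) \<and>
       (x, n x, n x, rec_nat (i x) (s x) (n x)) = (?s ^^ m) (x, 0, n x, i x)"
    proof (intro exI[of _ "n x"] conjI allI impI len)
      fix k assume "k \<le> n x"
      then show "sz ((?s ^^ k) (x, 0, n x, i x)) \<le> ?h x"
        unfolding it using h(2)[of k x] sz_nat_mono[of k "n x"] by simp
    qed (simp_all add: it)
  qed
  from X_comp[OF X_snd' X_comp[OF X_snd' X_comp[OF X_snd' this]]] show ?thesis by simp
qed

lemma X_add [X_intros]: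
  assumes f: "X f" and g: "X g"
  shows "X (\<lambda>x. f x + g x :: nat)"
proof -
  have e: "rec_nat a (\<lambda>_. Suc) b = a + b" for a b :: nat by (induction b) auto
  have "X (\<lambda>x. rec_nat (f x) ((\<lambda>_ _ a. Suc a) x) (g x))"
  proof (rule X_rec_nat[where h = "\<lambda>x. 4 * (sz (f x) + sz (g x)) + 1"])
    show "polyb (\<lambda>x. 4 * (sz (f x) + sz (g x)) + 1)" by (intro poly_intros X_polyb f g)
    fix x k assume k: "k \<le> g x"
    have "f x + 1 \<le> 2 ^ sz (f x)" "g x + 1 \<le> 2 ^ sz (g x)" using nat_less_sz[of "f x"] nat_less_sz[of "g x"] by linarith+
    \<comment> \<open>The product of the successors dominates the sum, and its number of digits is
      at most the sum of the sizes.\<close>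
    then have "(f x + 1) * (g x + 1) \<le> 2 ^ sz (f x) * 2 ^ sz (g x)" by (rule mult_le_mono)
    then have "f x + k < 2 ^ (sz (f x) + sz (g x))" using k by (simp add: power_add)
    then show "sz (rec_nat (f x) (\<lambda>_. Suc) k) \<le> 4 * (sz (f x) + sz (g x)) + 1"
      unfolding e by (rule sz_nat_le)
  qed (intro X_intros f g)+
  then show ?thesis unfolding e .
qed

lemma X_mult [X_intros]:
  assumes f: "X f" and g: "X g"
  shows "X (\<lambda>x. f x * g x :: nat)"
proof -
  have e: "rec_nat 0 (\<lambda>_ b. b + a) b = a * b" for a b :: nat by (induction b) auto
  have "X (\<lambda>x. rec_nat 0 ((\<lambda>x _ b. b + f x) x) (g x))"
  proof (rule X_rec_nat[where h = "\<lambda>x. 4 * (sz (f x) + sz (g x)) + 1"])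
    show "X (\<lambda>z. snd (snd z) + f (fst z))" by (intro X_intros X_comp[OF f])
    show "polyb (\<lambda>x. 4 * (sz (f x) + sz (g x)) + 1)" by (intro poly_intros X_polyb f g)
    fix x k assume k: "k \<le> g x"
    have "f x + 1 \<le> 2 ^ sz (f x)" "g x + 1 \<le> 2 ^ sz (g x)" using nat_less_sz[of "f x"] nat_less_sz[of "g x"] by linarith+
    then have "(f x + 1) * (g x + 1) \<le> 2 ^ sz (f x) * 2 ^ sz (g x)" by (rule mult_le_mono)
    moreover have "(f x + 1) * (g x + 1) = f x * g x + f x + g x + 1" by simp
    moreover have "f x * k \<le> f x * g x" using k by (rule mult_le_mono2)
    ultimately have "f x * k < 2 ^ sz (f x) * 2 ^ sz (g x)" by linarith
    then have "f x * k < 2 ^ (sz (f x) + sz (g x))" by (simp only: power_add)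
    then show "sz (rec_nat 0 (\<lambda>_ b. b + f x) k) \<le> 4 * (sz (f x) + sz (g x)) + 1"
      unfolding e by (rule sz_nat_le)
  qed (intro X_intros g)+
  then show ?thesis unfolding e .
qed

text \<open>The exponent itself, not just its size, has to be polynomially bounded: it is the number
  of digits of the result.\<close>

lemma X_exp2:
  assumes f: "X f" and h: "polyb f"
  shows "X (\<lambda>x. 2 ^ f x :: nat)"
proof -
  have e: "rec_nat (Suc 0) (\<lambda>_ b. b + b) b = 2 ^ b" for b :: nat by (induction b) auto
  have "X (\<lambda>x. rec_nat (Suc 0) ((\<lambda>x _ b. b + b) x) (f x))"
  proof (rule X_rec_nat[where h = "\<lambda>x. 4 * (f x + 1) + 1"])
    show "polyb (\<lambda>x. 4 * (f x + 1) + 1)" by (intro poly_intros h)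
    fix x k assume k: "k \<le> f x"
    have "(2::nat) ^ k < 2 ^ (f x + 1)" using k by (intro power_strict_increasing) auto
    then show "sz (rec_nat (Suc 0) (\<lambda>_ b. b + b) k) \<le> 4 * (f x + 1) + 1"
      unfolding e by (rule sz_nat_le)
  qed (intro X_intros f)+
  then show ?thesis unfolding e .
qed

lemma X_ex_nat [X_intros]:
  fixes P :: "'a::code \<Rightarrow> nat \<Rightarrow> bool"
  assumes P: "X (\<lambda>z. P (fst z) (snd z))" and n: "X n"
  shows "X (\<lambda>x. \<exists>i<n x. P x i)"
proof -
  have e: "rec_nat False (\<lambda>i a. a \<or> P x i) k = (\<exists>i<k. P x i)" for x k
    by (induction k) (auto simp: less_Suc_eq)
  have "X (\<lambda>x. rec_nat False ((\<lambda>x i a. a \<or> P x i) x) (n x))"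
  proof (rule X_rec_nat[where h = "\<lambda>x. 3"])
    have "X (\<lambda>z::'a \<times> nat \<times> bool. P (fst (fst z, fst (snd z))) (snd (fst z, fst (snd z))))"
      by (rule X_comp[OF P]) (intro X_intros)
    then show "X (\<lambda>z. snd (snd z) \<or> P (fst z) (fst (snd z)))" by (auto intro!: X_intros)
  qed (intro X_intros n poly_intros sz_bool)+
  then show ?thesis unfolding e .
qed

lemma X_all_nat [X_intros]:
  fixes P :: "'a::code \<Rightarrow> nat \<Rightarrow> bool"
  assumes P: "X (\<lambda>z. P (fst z) (snd z))" and n: "X n"
  shows "X (\<lambda>x. \<forall>i<n x. P x i)"
proof -
  have "X (\<lambda>x. \<not> (\<exists>i<n x. \<not> P x i))" by (intro X_Not X_ex_nat P n)
  then show ?thesis by simp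
qed

lemma X_less [X_intros]: "X f \<Longrightarrow> X g \<Longrightarrow> X (\<lambda>x. f x < (g x :: nat))"
proof -
  assume f: "X f" and g: "X g"
  have "X (\<lambda>x. \<exists>i<g x. i = f x)" by (intro X_intros g X_comp[OF f])
  then show ?thesis by simp
qed

lemma X_le [X_intros]: "X f \<Longrightarrow> X g \<Longrightarrow> X (\<lambda>x. f x \<le> (g x :: nat))"
proof -
  assume "X f" "X g"
  then have "X (\<lambda>x. \<not> g x < f x)" by (intro X_intros)
  then show ?thesis by (simp add: not_less)
qed

text \<open>Bounded search; the value is the bound if there is no witness.\<close>

definition bleast :: "nat \<Rightarrow> (nat \<Rightarrow> bool) \<Rightarrow> nat" where
  "bleast n P = rec_nat 0 (\<lambda>i a. if a \<noteq> i \<or> P i then a else Suc a) n"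

lemma bleast_le: "bleast n P \<le> n"
  by (induction n) (auto simp: bleast_def)

lemma bleast_cases: "(bleast n P = n \<and> (\<forall>i<n. \<not> P i)) \<or>
    (bleast n P < n \<and> P (bleast n P) \<and> (\<forall>i<bleast n P. \<not> P i))"
proof (induction n)
  case (Suc n)
  have "bleast (Suc n) P = (if bleast n P \<noteq> n \<or> P n then bleast n P else Suc (bleast n P))"
    by (simp add: bleast_def)
  then show ?case using Suc by (cases "bleast n P = n"; cases "P n") (auto simp: less_Suc_eq)
qed (simp add: bleast_def)

lemma bleast_eq: "m < n \<Longrightarrow> P m \<Longrightarrow> (\<And>i. i < m \<Longrightarrow> \<not> P i) \<Longrightarrow> bleast n P = m"
  using bleast_cases[of n P] by (metis linorder_neqE_nat)

lemma X_bleast [X_intros]: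
  assumes P: "X (\<lambda>z. P (fst z) (snd z))" and n: "X n"
  shows "X (\<lambda>x. bleast (n x) (P x))"
  unfolding bleast_def
proof (rule X_rec_nat[where s = "\<lambda>x i a. if a \<noteq> i \<or> P x i then a else Suc a" and h = "\<lambda>x. 4 * sz (n x) + 1"])
  have "X (\<lambda>z::'a \<times> nat \<times> nat. P (fst (fst z, fst (snd z))) (snd (fst z, fst (snd z))))"
    by (rule X_comp[OF P]) (intro X_intros)
  then show "X (\<lambda>z. if snd (snd z) \<noteq> fst (snd z) \<or> P (fst z) (fst (snd z)) then snd (snd z) else Suc (snd (snd z)))"
    by (auto intro!: X_intros)
  show "polyb (\<lambda>x. 4 * sz (n x) + 1)" by (intro poly_intros X_polyb n)
  fix x k assume "k \<le> n x"
  then have "rec_nat 0 (\<lambda>i a. if a \<noteq> i \<or> P x i then a else Suc a) k \<le> n x"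
    using bleast_le[of k "P x"] unfolding bleast_def by linarith
  then show "sz (rec_nat 0 (\<lambda>i a. if a \<noteq> i \<or> P x i then a else Suc a) k) \<le> 4 * sz (n x) + 1"
    by (rule sz_nat_mono)
qed (intro X_intros n)+

lemma X_minus [X_intros]: "X f \<Longrightarrow> X g \<Longrightarrow> X (\<lambda>x. f x - g x :: nat)"
proof -
  assume f: "X f" and g: "X g"
  have "X (\<lambda>x. bleast (Suc (f x)) (\<lambda>d. f x \<le> g x + d))" by (intro X_intros f g X_comp[OF f] X_comp[OF g])
  moreover have "bleast (Suc a) (\<lambda>d. a \<le> b + d) = a - b" for a b by (rule bleast_eq) auto
  ultimately show ?thesis by simp
qed

lemma X_div [X_intros]: "X f \<Longrightarrow> X g \<Longrightarrow> X (\<lambda>x. f x div g x :: nat)"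
proof -
  assume f: "X f" and g: "X g"
  have "X (\<lambda>x. if g x = 0 then 0 else bleast (Suc (f x)) (\<lambda>q. f x < Suc q * g x))"
    by (intro X_intros f g X_comp[OF f] X_comp[OF g])
  moreover have "(if b = 0 then 0 else bleast (Suc a) (\<lambda>q. a < Suc q * b)) = a div b" for a b
  proof (cases "b = 0")
    case False
    have "bleast (Suc a) (\<lambda>q. a < Suc q * b) = a div b"
    proof (rule bleast_eq)
      show "a < Suc (a div b) * b" using dividend_less_div_times[of b a] False by (simp add: add.commute)
      show "a div b < Suc a" by (simp add: le_imp_less_Suc)
      show "\<not> a < Suc i * b" if "i < a div b" for i
      proof -
        have "Suc i * b \<le> a div b * b" using that by (intro mult_le_mono1) simp
        also have "\<dots> \<le> a" by simp
        finally show ?thesis by simp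
      qed
    qed
    then show ?thesis using False by simp
  qed simp
  ultimately show ?thesis by simp
qed

lemma X_mod [X_intros]: "X f \<Longrightarrow> X g \<Longrightarrow> X (\<lambda>x. f x mod g x :: nat)"
proof -
  assume f: "X f" and g: "X g"
  have "X (\<lambda>x. f x - g x * (f x div g x))" by (intro X_intros f g)
  then show ?thesis by (simp add: minus_mult_div_eq_mod)
qed

lemma X_gcd [X_intros]: "X f \<Longrightarrow> X g \<Longrightarrow> X (\<lambda>x. gcd (f x) (g x :: nat))"
proof -
  assume f: "X f" and g: "X g"
  \<comment> \<open>All numbers up to the sum are tried, and the last common divisor found is the
    greatest one. The start value 0 is right for two zeros.\<close>
  let ?s = "\<lambda>a b i d. if a mod Suc i = 0 \<and> b mod Suc i = 0 then Suc i else d"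
  have b: "rec_nat 0 (?s a b) k \<le> k" for a b k by (induction k) auto
  have "X (\<lambda>x. rec_nat 0 ((\<lambda>x. ?s (f x) (g x)) x) (f x + g x))"
  proof (rule X_rec_nat[where h = "\<lambda>x. 4 * sz (f x + g x) + 1"])
    show "X (\<lambda>z. ?s (f (fst z)) (g (fst z)) (fst (snd z)) (snd (snd z)))"
      by (intro X_intros X_comp[OF f] X_comp[OF g])
    show "polyb (\<lambda>x. 4 * sz (f x + g x) + 1)" by (intro poly_intros X_polyb X_intros f g)
    fix x k assume "k \<le> f x + g x"
    then show "sz (rec_nat 0 (?s (f x) (g x)) k) \<le> 4 * sz (f x + g x) + 1"
      using b[of "f x" "g x" k] by (intro sz_nat_mono) linarith
  qed (intro X_intros f g)+
  moreover have "rec_nat 0 (?s a b) (a + b) = gcd a b" for a b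
  proof (cases "a + b = 0")
    case False
    have pos: "0 < gcd a b" using False by (intro gcd_pos_nat[THEN iffD2]) auto
    have "rec_nat 0 (?s a b) k = gcd a b" if "gcd a b \<le> k" for k
      using that
    proof (induction k rule: dec_induct)
      case base
      obtain m where m: "gcd a b = Suc m" using pos by (cases "gcd a b") auto
      have "a mod Suc m = 0" "b mod Suc m = 0" unfolding m[symmetric] by auto
      then show ?case unfolding m by simp
    next
      case (step k)
      have "\<not> (a mod Suc k = 0 \<and> b mod Suc k = 0)"
      proof
        assume "a mod Suc k = 0 \<and> b mod Suc k = 0"
        then have "Suc k dvd gcd a b" by (simp add: mod_eq_0_iff_dvd)
        from dvd_imp_le[OF this pos] show False using step(1) by simp
      qed
      then show ?case using step by auto
    qed
    moreover have "gcd a b \<le> a + b"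
      using False by (cases "a = 0") (auto intro: trans_le_add1)
    ultimately show ?thesis by blast
  qed simp
  ultimately show ?thesis by simp
qed

lemma X_length [X_intros]: "X l \<Longrightarrow> X (\<lambda>x. length (l x))"
proof -
  assume l: "X l"
  have e: "foldl (\<lambda>n _. Suc n) m ys = m + length ys" for m and ys :: "'b list" by (induction ys arbitrary: m) auto
  have "X (\<lambda>x. foldl ((\<lambda>_ n _. Suc n) x) 0 (l x))"
  proof (rule X_foldl[where h = "\<lambda>x. 4 * sz (l x) + 1"])
    show "polyb (\<lambda>x. 4 * sz (l x) + 1)" by (intro poly_intros X_polyb l)
    fix x ys zs assume "l x = ys @ zs"
    then have "length ys \<le> length (l x)" by simp
    then have "length ys < 2 ^ sz (l x)"
      using length_le_sz[of "l x"] less_exp[of "sz (l x)"] by linarith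
    then show "sz (foldl (\<lambda>n _. Suc n) 0 ys) \<le> 4 * sz (l x) + 1" unfolding e
      using sz_nat_le[of "length ys" "sz (l x)"] by simp
  qed (intro X_intros l)+
  then show ?thesis unfolding e by simp
qed

lemma X_bex [X_intros]:
  assumes P: "X (\<lambda>z. P (fst z) (snd z))" and l: "X l"
  shows "X (\<lambda>x. \<exists>y\<in>set (l x). P x y)"
proof -
  have e: "foldl (\<lambda>a y. a \<or> P x y) b ys = (b \<or> (\<exists>y\<in>set ys. P x y))" for x b ys
    by (induction ys arbitrary: b) auto
  have "X (\<lambda>x. foldl ((\<lambda>x a y. a \<or> P x y) x) False (l x))"
  proof (rule X_foldl[where h = "\<lambda>x. 3"])
    have "X (\<lambda>z. P (fst (fst z, snd (snd z))) (snd (fst z, snd (snd z))))"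
      by (rule X_comp[OF P]) (intro X_intros)
    then show "X (\<lambda>z. fst (snd z) \<or> P (fst z) (snd (snd z)))" by (auto intro!: X_intros)
  qed (intro X_intros l poly_intros sz_bool)+
  then show ?thesis unfolding e by simp
qed

lemma X_ball [X_intros]:
  assumes P: "X (\<lambda>z. P (fst z) (snd z))" and l: "X l"
  shows "X (\<lambda>x. \<forall>y\<in>set (l x). P x y)"
proof -
  have "X (\<lambda>x. \<not> (\<exists>y\<in>set (l x). \<not> P x y))" by (intro X_Not X_bex P l)
  then show ?thesis by simp
qed

lemma X_member [X_intros]: "X f \<Longrightarrow> X l \<Longrightarrow> X (\<lambda>x. f x \<in> set (l x))"
proof -
  assume f: "X f" and l: "X l"
  have "X (\<lambda>x. \<exists>y\<in>set (l x). y = f x)" by (intro X_intros l X_comp[OF f])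
  then show ?thesis by simp
qed

lemma X_concat_map:
  assumes f: "X (\<lambda>z. f (fst z) (snd z))" and l: "X l"
  shows "X (\<lambda>x. concat (map (f x) (l x)))"
proof -
  obtain k where k: "\<And>z. sz (f (fst z) (snd z)) \<le> (sz z + 2) ^ k"
    using X_polyb[OF f] unfolding polyb_def by blast
  let ?b = "\<lambda>x. (1 + sz x + sz (l x) + 2) ^ k"
  let ?h = "\<lambda>x. 1 + sz (l x) * ?b x"
  have e: "foldl (\<lambda>acc y. acc @ f x y) zs ys = zs @ concat (map (f x) ys)" for x zs ys
    by (induction ys arbitrary: zs) auto
  have "X (\<lambda>x. foldl ((\<lambda>x acc y. acc @ f x y) x) [] (l x))"
  proof (rule X_foldl[where h = ?h])
    have "X (\<lambda>z. f (fst (fst z, snd (snd z))) (snd (fst z, snd (snd z))))"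
      by (rule X_comp[OF f]) (intro X_intros)
    then show "X (\<lambda>z. fst (snd z) @ f (fst z) (snd (snd z)))" by (auto intro!: X_intros)
    show "polyb ?h" by (intro poly_intros X_polyb[OF l])
    fix x ys zs assume lx: "l x = ys @ zs"
    have "sz (concat (map (f x) us)) \<le> 1 + length us * ?b x" if "set us \<subseteq> set (l x)" for us
      using that
    proof (induction us)
      case (Cons y us)
      have "sz y \<le> sz (l x)" by (rule sz_elem) (use Cons.prems in auto)
      then have "(sz (x, y) + 2) ^ k \<le> ?b x" by (intro power_mono) auto
      then have "sz (f x y) \<le> ?b x" using k[of "(x, y)"] by simp
      then show ?case using Cons.IH Cons.prems sz_append[of "f x y" "concat (map (f x) us)"] by simp
    qed simp
    from this[of ys] lx have "sz (concat (map (f x) ys)) \<le> 1 + length ys * ?b x" by simp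
    moreover have "length ys * ?b x \<le> sz (l x) * ?b x"
      by (rule mult_le_mono1) (use length_le_sz[of "l x"] lx in simp)
    ultimately show "sz (foldl (\<lambda>acc y. acc @ f x y) [] ys) \<le> ?h x"
      unfolding e append_Nil by (meson add_left_mono order_trans)
  qed (intro X_intros l)+
  then show ?thesis unfolding e by simp
qed

section \<open>Integers and rational numbers\<close>

definition mkint :: "bool \<Rightarrow> nat \<Rightarrow> int" where
  "mkint b n = (if b then - int n else int n)"

lemma X_mkint [X_intros]: "X b \<Longrightarrow> X n \<Longrightarrow> X (\<lambda>x. mkint (b x) (n x))"
proof -
  assume "X b" "X n"
  \<comment> \<open>A negative sign of 0 is dropped, because the code of an integer is
    unique.\<close>
  then have "X (\<lambda>x. (b x \<and> n x \<noteq> 0, n x))" by (intro X_intros)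
  then show ?thesis by (rule X_recode) (auto simp: mkint_def code_int_def)
qed

lemma X_int_code: "X (\<lambda>i::int. (i < 0, nat \<bar>i\<bar>))"
  by (rule X_recode[OF X_id]) (simp add: code_int_def)

lemma X_int_neg [X_intros]: "X f \<Longrightarrow> X (\<lambda>x. f x < (0::int))"
  using X_comp[OF X_fst' X_comp[OF X_int_code]] by simp

lemma X_nat_abs [X_intros]: "X f \<Longrightarrow> X (\<lambda>x. nat \<bar>f x :: int\<bar>)"
  using X_comp[OF X_snd' X_comp[OF X_int_code]] by simp

lemma X_int_add [X_intros]: "X f \<Longrightarrow> X g \<Longrightarrow> X (\<lambda>x. f x + g x :: int)"
proof -
  assume f: "X f" and g: "X g"
  \<comment> \<open>Positive and negative parts are added separately, and the smaller total is
    subtracted from the larger one.\<close>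
  let ?p = "\<lambda>i::int. if i < 0 then 0 else nat \<bar>i\<bar>" and ?n = "\<lambda>i::int. if i < 0 then nat \<bar>i\<bar> else 0"
  have "X (\<lambda>x. (\<lambda>z. mkint (fst z < snd z) (if fst z < snd z then snd z - fst z else fst z - snd z))
     (?p (f x) + ?p (g x), ?n (f x) + ?n (g x)))"
    by (rule X_comp) (intro X_intros f g)+
  moreover have "(\<lambda>z. mkint (fst z < snd z) (if fst z < snd z then snd z - fst z else fst z - snd z))
     (?p i + ?p j, ?n i + ?n j) = i + j" for i j
    by (auto simp: mkint_def of_nat_diff)
  ultimately show ?thesis by simp
qed

lemma X_int_mult [X_intros]: "X f \<Longrightarrow> X g \<Longrightarrow> X (\<lambda>x. f x * g x :: int)"
proof -
  assume f: "X f" and g: "X g"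
  have "X (\<lambda>x. mkint ((f x < 0) \<noteq> (g x < 0)) (nat \<bar>f x\<bar> * nat \<bar>g x\<bar>))" by (intro X_intros f g)
  moreover have "mkint ((i < 0) \<noteq> (j < 0)) (nat \<bar>i\<bar> * nat \<bar>j\<bar>) = i * j" for i j
    by (auto simp: mkint_def)
  ultimately show ?thesis by simp
qed

lemma X_int_uminus [X_intros]: "X f \<Longrightarrow> X (\<lambda>x. - f x :: int)"
proof -
  assume f: "X f"
  have "X (\<lambda>x. mkint (\<not> f x < 0) (nat \<bar>f x\<bar>))" by (intro X_intros f)
  moreover have "mkint (\<not> i < 0) (nat \<bar>i\<bar>) = - i" for i
    by (auto simp: mkint_def)
  ultimately show ?thesis by simp
qed

lemma X_int [X_intros]: "X f \<Longrightarrow> X (\<lambda>x. int (f x))"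
  by (rule X_recode[OF X_mkint[OF X_const[of False]]]) (auto simp: mkint_def)

abbreviation num :: "rat \<Rightarrow> int" where "num q \<equiv> fst (quotient_of q)"
abbreviation den :: "rat \<Rightarrow> int" where "den q \<equiv> snd (quotient_of q)"

lemma X_quotient_of: "X quotient_of"
  by (rule X_recode[OF X_id]) (simp add: code_rat_def)

lemma X_num [X_intros]: "X f \<Longrightarrow> X (\<lambda>x. num (f x))"
  by (rule X_comp[OF X_fst' X_comp[OF X_quotient_of]])

lemma X_den [X_intros]: "X f \<Longrightarrow> X (\<lambda>x. den (f x))"
  by (rule X_comp[OF X_snd' X_comp[OF X_quotient_of]])

text \<open>The value is 0 if \<open>d = 0\<close>.\<close>

definition mkrat :: "int \<Rightarrow> nat \<Rightarrow> rat" where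
  "mkrat n d = of_int n / of_nat d"

text \<open>The code of a rational number is its reduced fraction, so every operation ends with a
  cancellation; here it is expressed by operations on natural numbers for which programs
  exist.\<close>

lemma quotient_of_mkrat: "quotient_of (mkrat n d) =
   (if d = 0 then (0, 1) else (mkint (n < 0) (nat \<bar>n\<bar> div gcd (nat \<bar>n\<bar>) d), int (d div gcd (nat \<bar>n\<bar>) d)))"
proof (cases "d = 0")
  case True
  then show ?thesis by (simp add: mkrat_def)
next
  case False
  have "mkrat n d = Fract n (int d)" by (simp add: mkrat_def Fract_of_int_quotient)
  then have "quotient_of (mkrat n d) = (n div gcd n (int d), int d div gcd n (int d))"
    using False by (simp add: quotient_of_Fract Rat.normalize_def Let_def)
  moreover define G where "G = gcd (nat \<bar>n\<bar>) d"
  have g: "gcd n (int d) = int G" using gcd_int_int_eq[of "nat \<bar>n\<bar>" d] by (simp add: G_def)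
  have "n div int G = mkint (n < 0) (nat \<bar>n\<bar> div G)"
  proof (cases "n < 0")
    case True
    have "int G dvd n" unfolding g[symmetric] by simp
    then have "(- n) div int G = - (n div int G)" by (rule dvd_neg_div)
    moreover have "int (nat \<bar>n\<bar> div G) = (- n) div int G" using True by (simp add: zdiv_int)
    ultimately show ?thesis using True by (simp add: mkint_def)
  qed (simp add: mkint_def zdiv_int)
  ultimately show ?thesis using False unfolding g G_def[symmetric] by (simp add: zdiv_int)
qed

lemma X_mkrat [X_intros]: "X n \<Longrightarrow> X d \<Longrightarrow> X (\<lambda>x. mkrat (n x) (d x))"
proof -
  assume n: "X n" and d: "X d"
  have "X (\<lambda>x. if d x = 0 then (0, 1) else (mkint (n x < 0) (nat \<bar>n x\<bar> div gcd (nat \<bar>n x\<bar>) (d x)),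
     int (d x div gcd (nat \<bar>n x\<bar>) (d x))))" by (intro X_intros n d)
  then show ?thesis by (rule X_recode) (simp add: code_rat_def quotient_of_mkrat)
qed

lemma rat_num_den: "q = of_int (num q) / of_int (den q)" "0 < den q"
proof -
  obtain a b where "quotient_of q = (a, b)" by (metis surj_pair)
  then show "q = of_int (num q) / of_int (den q)" "0 < den q"
    using quotient_of_div quotient_of_denom_pos by auto
qed

lemma mkrat_add: "p + q = mkrat (num p * den q + num q * den p) (nat \<bar>den p\<bar> * nat \<bar>den q\<bar>)"
proof -
  have "of_int a / of_int b + of_int c / of_int d = mkrat (a * d + c * b) (nat \<bar>b\<bar> * nat \<bar>d\<bar>)"
    if "0 < b" "0 < d" for a b c d :: int
    using that by (simp add: mkrat_def field_simps)
  from this[where a = "num p" and b = "den p" and c = "num q" and d = "den q", OF rat_num_den(2) rat_num_den(2)] show ?thesis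
    unfolding rat_num_den(1)[symmetric] .
qed

lemma mkrat_mult: "p * q = mkrat (num p * num q) (nat \<bar>den p\<bar> * nat \<bar>den q\<bar>)"
proof -
  have "of_int a / of_int b * (of_int c / of_int d) = mkrat (a * c) (nat \<bar>b\<bar> * nat \<bar>d\<bar>)"
    if "0 < b" "0 < d" for a b c d :: int
    using that by (simp add: mkrat_def field_simps)
  from this[where a = "num p" and b = "den p" and c = "num q" and d = "den q", OF rat_num_den(2) rat_num_den(2)] show ?thesis
    unfolding rat_num_den(1)[symmetric] .
qed

lemma X_rat_add [X_intros]: "X f \<Longrightarrow> X g \<Longrightarrow> X (\<lambda>x. f x + g x :: rat)"
  unfolding mkrat_add by (intro X_intros)

lemma X_rat_mult [X_intros]: "X f \<Longrightarrow> X g \<Longrightarrow> X (\<lambda>x. f x * g x :: rat)"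
  unfolding mkrat_mult by (intro X_intros)

lemma X_rat_uminus [X_intros]: "X f \<Longrightarrow> X (\<lambda>x. - f x :: rat)"
proof -
  assume "X f"
  then have "X (\<lambda>x. (-1) * f x)" by (intro X_intros)
  then show ?thesis by simp
qed

lemma X_rat_minus [X_intros]: "X f \<Longrightarrow> X g \<Longrightarrow> X (\<lambda>x. f x - g x :: rat)"
  unfolding diff_conv_add_uminus by (intro X_intros)

lemma X_rat_less [X_intros]: "X f \<Longrightarrow> X g \<Longrightarrow> X (\<lambda>x. f x < (g x :: rat))"
proof -
  assume "X f" "X g"
  then have "X (\<lambda>x. num (f x - g x) < 0)" by (intro X_intros)
  moreover have "num (p - q) < 0 \<longleftrightarrow> p < q" for p q
    using rat_num_den[of "p - q"] by (metis (no_types, opaque_lifting) divide_less_0_iff less_iff_diff_less_0 of_int_0_less_iff of_int_less_0_iff order_less_asym)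
  ultimately show ?thesis by simp
qed

lemma X_rat_le [X_intros]: "X f \<Longrightarrow> X g \<Longrightarrow> X (\<lambda>x. f x \<le> (g x :: rat))"
proof -
  assume "X f" "X g"
  then have "X (\<lambda>x. \<not> g x < f x)" by (intro X_intros)
  then show ?thesis by (simp add: not_less)
qed

section \<open>Reductions computed by programs\<close>

lemma apply_acts_append:
  "length xs = length as \<Longrightarrow> apply_acts (xs @ ys) (as @ bs) = apply_acts xs as @ apply_acts ys bs"
  by (simp add: apply_acts_def)

lemma ST_append: "ST z a b c rest = ST z a b c [] @ rest"
  by (simp add: ST_def mk_def)

lemma length_ST [simp]: "length (ST z a b c rest) = 5 + length rest"
  by (simp add: ST_def)

lemma ST_nth: "5 \<le> i \<Longrightarrow> ST z a b c rest ! i = rest ! (i - 5)"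
  by (subst ST_append) (simp add: nth_append)

lemma ST_update: "5 \<le> i \<Longrightarrow> (ST z a b c rest)[i := y] = ST z a b c (rest[i - 5 := y])"
  by (subst (1 2) ST_append) (simp add: list_update_append)

lemma ST_0: "ST z a b c rest ! 0 = z" "(ST z a b c rest)[0 := y] = ST y a b c rest"
  by (simp_all add: ST_def mk_def)

lemma reads_ST_0: "reads (ST z a b c rest) ! 0 = fst z (snd z)"
  by (simp add: reads_nth ST_0)

lemma reads_ST: "5 \<le> i \<Longrightarrow> i < 5 + length rest \<Longrightarrow>
   reads (ST z a b c rest) ! i = fst (rest ! (i - 5)) (snd (rest ! (i - 5)))"
  by (simp add: reads_nth ST_nth)

lemma runs_act_input:
  "runs (act1 0 g) (ST (t, h) a b c rest) 1
     (ST (t(h := fst (g (t h))), h + head_offset (snd (g (t h)))) a b c rest)"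
  by (rule runs_act1) (simp_all add: ST_0)

lemma runs_act_rest:
  assumes "5 \<le> i" "i < 5 + length rest" "rest ! (i - 5) = (t, h)"
  shows "runs (act1 i g) (ST z a b c rest) 1
     (ST z a b c (rest[i - 5 := (t(h := fst (g (t h))), h + head_offset (snd (g (t h))))]))"
  by (rule runs_act1) (use assms in \<open>simp_all add: ST_nth ST_update\<close>)

section \<open>Reading the input word\<close>

definition seek :: cmd where
  "seek = Loop (\<lambda>as. as ! 0 \<noteq> 0) (act1 0 (\<lambda>x. (x, Move_Right)))"

definition read_loop :: cmd where
  "read_loop = Loop (\<lambda>as. as ! 0 \<noteq> 0)
     (Seq (Cond (\<lambda>as. as ! 0 = 2) (push_tree (code True)) (push_tree (code False)))
       (Seq (pushs 0 2) (act1 0 (\<lambda>x. (x, Move_Left)))))"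

text \<open>The input is read from right to left, since the Polish notation of a list is pushed onto
  a stack with the tail first.\<close>

definition load :: cmd where
  "load = Seq seek (Seq (act1 0 (\<lambda>x. (x, Move_Left))) (Seq (push_tree (code ([] :: bool list))) read_loop))"

abbreviation itape :: "bool list \<Rightarrow> int \<Rightarrow> nat" where "itape w \<equiv> fst (input_tape w)"

lemma itape_eq: "itape w p = (if 0 \<le> p \<and> p < int (length w) then (if w ! nat p then 2 else 1) else 0)"
  by (simp add: input_tape_def)

lemma runs_seek:
  "i \<le> length w \<Longrightarrow> runs seek (ST (itape w, int i) a b c rest) (3 * (length w - i) + 1)
     (ST (itape w, int (length w)) a b c rest)"
proof (induction "length w - i" arbitrary: i)
  case 0
  then have "i = length w" by simp
  then show ?case unfolding seek_def by (auto intro!: runs_LoopF simp: reads_ST_0 itape_eq)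
next
  case (Suc n)
  have 1: "runs (act1 0 (\<lambda>x. (x, Move_Right))) (ST (itape w, int i) a b c rest) 1 (ST (itape w, int (Suc i)) a b c rest)"
    using runs_act_input[of "\<lambda>x. (x, Move_Right)" "itape w" "int i"] by (simp add: add.commute)
  have 2: "runs seek (ST (itape w, int (Suc i)) a b c rest) (3 * (length w - Suc i) + 1)
     (ST (itape w, int (length w)) a b c rest)" by (rule Suc.hyps(1)) (use Suc.hyps(2) in auto)
  show ?case unfolding seek_def
    by (rule runs_LoopT[OF _ 1 2[unfolded seek_def]]) (use Suc.hyps(2) in \<open>auto simp: reads_ST_0 itape_eq\<close>)
qed

lemma runs_read_loop:
  "i \<le> length w \<Longrightarrow> runs read_loop (ST (itape w, int i - 1) (flat (code (drop i w)) @ a) b c rest) (24 * i + 1)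
     (ST (itape w, -1) (flat (code w) @ a) b c rest)"
proof (induction i)
  case 0
  then show ?case unfolding read_loop_def by (auto intro!: runs_LoopF simp: reads_ST_0 itape_eq)
next
  case (Suc i)
  let ?c = "Cond (\<lambda>as. as ! 0 = 2) (push_tree (code True)) (push_tree (code False))"
  have d: "drop i w = w ! i # drop (Suc i) w" using Suc.prems by (simp add: Cons_nth_drop_Suc)
  let ?A = "flat (code (drop (Suc i) w)) @ a"
  have 1: "runs ?c (ST (itape w, int i) ?A b c rest) 13 (ST (itape w, int i) (flat (code (w ! i)) @ ?A) b c rest)"
  proof (cases "w ! i")
    case True
    have e: "code (w ! i) = code True" using True by simp
    show ?thesis unfolding e
      by (rule runs_CondT[OF _ runs_push_tree]) (use True Suc.prems in \<open>auto simp: reads_ST_0 itape_eq\<close>)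
  next
    case False
    have e: "code (w ! i) = code False" using False by simp
    show ?thesis unfolding e
      by (rule runs_CondF[OF _ runs_push_tree]) (use False Suc.prems in \<open>auto simp: reads_ST_0 itape_eq\<close>)
  qed
  have 2: "runs (pushs 0 2) (ST (itape w, int i) (flat (code (w ! i)) @ ?A) b c rest) 3
     (ST (itape w, int i) (flat (code (drop i w)) @ a) b c rest)"
    using runs_push0[of 2 "(itape w, int i)" "flat (code (w ! i)) @ ?A" b c rest] by (simp add: d)
  have 3: "runs (act1 0 (\<lambda>x. (x, Move_Left))) (ST (itape w, int i) (flat (code (drop i w)) @ a) b c rest) 1
     (ST (itape w, int i - 1) (flat (code (drop i w)) @ a) b c rest)"
    using runs_act_input[of "\<lambda>x. (x, Move_Left)" "itape w" "int i"] by simp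
  have 4: "runs (Seq ?c (Seq (pushs 0 2) (act1 0 (\<lambda>x. (x, Move_Left))))) (ST (itape w, int (Suc i) - 1) ?A b c rest) 20
      (ST (itape w, int i - 1) (flat (code (drop i w)) @ a) b c rest)"
    using runs_Seq[OF 1 runs_Seq[OF 2 3 order_refl], of 20] by simp
  have 5: "runs read_loop (ST (itape w, int i - 1) (flat (code (drop i w)) @ a) b c rest) (24 * i + 1)
     (ST (itape w, -1) (flat (code w) @ a) b c rest)"
    by (rule Suc.IH) (use Suc.prems in simp)
  show ?case unfolding read_loop_def
    by (rule runs_LoopT[OF _ 4 5[unfolded read_loop_def]]) (use Suc.prems in \<open>auto simp: reads_ST_0 itape_eq\<close>)
qed

lemma runs_load:
  "runs load (ST (input_tape w) [] [] [] rest) (40 * length w + 40) (ST (itape w, -1) (flat (code w)) [] [] rest)"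
proof -
  have 1: "runs seek (ST (input_tape w) [] [] [] rest) (3 * length w + 1) (ST (itape w, int (length w)) [] [] [] rest)"
    using runs_seek[of 0 w "[]" "[]" "[]" rest] by (simp add: input_tape_def)
  have 2: "runs (act1 0 (\<lambda>x. (x, Move_Left))) (ST (itape w, int (length w)) [] [] [] rest) 1
     (ST (itape w, int (length w) - 1) [] [] [] rest)"
    using runs_act_input[of "\<lambda>x. (x, Move_Left)" "itape w" "int (length w)"] by simp
  have 3: "runs (push_tree (code ([] :: bool list))) (ST (itape w, int (length w) - 1) [] [] [] rest) 4
     (ST (itape w, int (length w) - 1) (flat (code (drop (length w) w))) [] [] rest)"
    using runs_push_tree[of "code ([] :: bool list)" "(itape w, int (length w) - 1)" "[]"] by simp
  have 4: "runs read_loop (ST (itape w, int (length w) - 1) (flat (code (drop (length w) w))) [] [] rest) (24 * length w + 1)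
     (ST (itape w, -1) (flat (code w)) [] [] rest)"
    using runs_read_loop[of "length w" w "[]" "[]" "[]" rest] by simp
  show ?thesis unfolding load_def
    by (rule runs_Seq[OF 1 runs_Seq[OF 2 runs_Seq[OF 3 4 order_refl] order_refl]]) simp
qed

section \<open>Writing the query and simulating a decider on it\<close>

definition emit_loop :: "nat \<Rightarrow> cmd" where
  "emit_loop o1 = Loop (is_top 0 2) (Seq (pops 0) (Cond (is_top 0 2)
     (Seq drop_top (act1 o1 (\<lambda>_. (2, Move_Right)))) (Seq drop_top (act1 o1 (\<lambda>_. (1, Move_Right))))))"

definition rewind :: "nat \<Rightarrow> cmd" where
  "rewind o1 = Seq (act1 o1 (\<lambda>x. (x, Move_Left))) (Seq (Loop (\<lambda>as. as ! o1 \<noteq> 0) (act1 o1 (\<lambda>x. (x, Move_Left))))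
     (act1 o1 (\<lambda>x. (x, Move_Right))))"

lemma itape_snoc: "(itape v)(int (length v) := if b then 2 else 1) = itape (v @ [b])"
  by (auto simp: itape_eq nth_append fun_eq_iff)

text \<open>Tape \<open>o1\<close> is the input tape of the simulated machine: it is preceded by the
  tapes 0 to 4, the state tape 5 and the tapes \<open>pre\<close>. The word starts at cell 0, as
  \<open>input_tape\<close> demands, and not at cell 1 as on a stack.\<close>

lemma runs_emit_loop:
  assumes "length pre + 6 = o1"
  shows "runs (emit_loop o1) (ST z (flat (code u)) [] [] (y # pre @ (itape v, int (length v)) # post)) (80 * length u + 1)
     (ST z (flat (code ([] :: bool list))) [] [] (y # pre @ (itape (v @ u), int (length (v @ u))) # post))"
proof (induction u arbitrary: v)
  case Nil
  show ?case unfolding emit_loop_def append_Nil2 by (rule runs_LoopF) simp_all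
next
  case (Cons b u)
  let ?R = "\<lambda>v. y # pre @ (itape v, int (length v)) # post"
  have 1: "runs (pops 0) (ST z (flat (code (b # u))) [] [] (?R v)) 1 (ST z (flat (code b) @ flat (code u)) [] [] (?R v))"
    using runs_pop0[of z 2 "flat (code b) @ flat (code u)"] by simp
  have w: "runs (act1 o1 (\<lambda>_. (x, Move_Right))) (ST z (flat (code u)) [] [] (?R v)) 1
    (ST z (flat (code u)) [] [] (?R (v @ [b])))" if "x = (if b then 2 else 1)" for x
  proof -
    have i: "5 \<le> o1" "o1 < 5 + length (?R v)" "?R v ! (o1 - 5) = (itape v, int (length v))"
      using assms by (auto simp: nth_append nth_Cons')
    have "o1 - 5 = Suc (length pre)" using assms by simp
    then have "(?R v)[o1 - 5 := (itape (v @ [b]), int (length v) + 1)] = ?R (v @ [b])"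
      by (simp add: add.commute)
    then show ?thesis using runs_act_rest[OF i, of "\<lambda>_. (x, Move_Right)" z "flat (code u)" "[]" "[]"] that
      by (simp add: itape_snoc)
  qed
  have l: "length (flat (code b)) \<le> 3" using sz_bool[of b] by (simp add: sz_def)
  have s: "runs (Seq drop_top (act1 o1 (\<lambda>_. (x, Move_Right)))) (ST z (flat (code b) @ flat (code u)) [] [] (?R v)) 70
    (ST z (flat (code u)) [] [] (?R (v @ [b])))" if "x = (if b then 2 else 1)" for x
    by (rule runs_Seq[OF runs_drop_top w[OF that]]) (use l in simp)
  have 2: "runs (Cond (is_top 0 2) (Seq drop_top (act1 o1 (\<lambda>_. (2, Move_Right)))) (Seq drop_top (act1 o1 (\<lambda>_. (1, Move_Right)))))
     (ST z (flat (code b) @ flat (code u)) [] [] (?R v)) 71 (ST z (flat (code u)) [] [] (?R (v @ [b])))"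
  proof (cases b)
    case True
    then show ?thesis by (intro runs_CondT[OF _ s[of 2]]) auto
  next
    case False
    then show ?thesis by (intro runs_CondF[OF _ s[of 1]]) auto
  qed
  show ?case unfolding emit_loop_def
    by (rule runs_LoopT[OF _ runs_Seq[OF 1 2 order_refl] Cons[of "v @ [b]", unfolded emit_loop_def append_assoc append_Cons append_Nil]])
      simp_all
qed

lemma runs_rewind:
  assumes "length pre + 6 = o1"
  shows "runs (rewind o1) (ST z a [] [] (y # pre @ (itape u, int (length u)) # post)) (4 * length u + 10)
     (ST z a [] [] (y # pre @ input_tape u # post))"
proof -
  let ?R = "\<lambda>h. y # pre @ (itape u, h) # post"
  have i: "5 \<le> o1" "o1 < 5 + length (?R h)" "?R h ! (o1 - 5) = (itape u, h)" for h
    using assms by (auto simp: nth_append nth_Cons')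
  have up: "(?R h)[o1 - 5 := (itape u, h')] = ?R h'" for h h'
  proof -
    have "o1 - 5 = Suc (length pre)" using assms by simp
    then show ?thesis by simp
  qed
  have mv: "runs (act1 o1 (\<lambda>x. (x, m))) (ST z a [] [] (?R h)) 1 (ST z a [] [] (?R (h + head_offset m)))" for m h
  proof -
    have "o1 - 5 = Suc (length pre)" using assms by simp
    then show ?thesis using runs_act_rest[OF i, of "\<lambda>x. (x, m)" z a "[]" "[]" h] by simp
  qed
  have rd: "reads (ST z a [] [] (?R h)) ! o1 = itape u h" for h
    using reads_ST[OF i(1,2), of z a "[]" "[]"] by (simp add: i(3))
  let ?L = "Loop (\<lambda>as. as ! o1 \<noteq> 0) (act1 o1 (\<lambda>x. (x, Move_Left)))"
  have L: "runs ?L (ST z a [] [] (?R (int k - 1))) (3 * k + 1) (ST z a [] [] (?R (-1)))" if "k \<le> length u" for k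
    using that
  proof (induction k)
    case 0
    have "runs ?L (ST z a [] [] (?R (-1))) (3 * 0 + 1) (ST z a [] [] (?R (-1)))"
      by (rule runs_LoopF, unfold rd, simp_all add: itape_eq)
    then show ?case by simp
  next
    case (Suc k)
    have 1: "runs (act1 o1 (\<lambda>x. (x, Move_Left))) (ST z a [] [] (?R (int (Suc k) - 1))) 1 (ST z a [] [] (?R (int k - 1)))"
      using mv[of Move_Left "int (Suc k) - 1"] by simp
    have 2: "runs ?L (ST z a [] [] (?R (int k - 1))) (3 * k + 1) (ST z a [] [] (?R (-1)))"
      by (rule Suc.IH) (use Suc.prems in simp)
    show ?case by (rule runs_LoopT[OF _ 1 2], unfold rd, use Suc.prems in \<open>simp_all add: itape_eq\<close>)
  qed
  have 1: "runs (act1 o1 (\<lambda>x. (x, Move_Left))) (ST z a [] [] (?R (int (length u)))) 1 (ST z a [] [] (?R (int (length u) - 1)))"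
    using mv[of Move_Left "int (length u)"] by simp
  have 2: "runs (act1 o1 (\<lambda>x. (x, Move_Right))) (ST z a [] [] (?R (-1))) 1 (ST z a [] [] (y # pre @ input_tape u # post))"
    using mv[of Move_Right "-1"] by (simp add: input_tape_def)
  show ?thesis unfolding rewind_def
    by (rule runs_Seq[OF 1 runs_Seq[OF L[OF order_refl] 2 order_refl]]) simp
qed

text \<open>A machine \<open>M\<close> is simulated on the tapes from \<open>o1\<close> on; its state is the symbol on tape 5.\<close>

definition sim_acts :: "tm \<Rightarrow> nat \<Rightarrow> nat list \<Rightarrow> (nat \<times> head_move) list" where
  "sim_acts M o1 as = (let q = as ! 5; mid = take (tm_tapes M) (drop o1 as) in
     if q < tm_states M \<and> (\<forall>a\<in>set mid. a < tm_symbols M)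
     then stay (take 5 as) @ (fst (tm_trans M q mid), Stay) # stay (take (o1 - 6) (drop 6 as)) @
       snd (tm_trans M q mid) @ stay (drop (o1 + tm_tapes M) as)
     else stay as)"

definition sim_loop :: "tm \<Rightarrow> nat \<Rightarrow> cmd" where
  "sim_loop M o1 = Loop (\<lambda>as. as ! 5 \<noteq> tm_accept M \<and> as ! 5 \<noteq> tm_reject M) (Act (sim_acts M o1))"

definition simulate :: "tm \<Rightarrow> nat \<Rightarrow> cmd" where
  "simulate M o1 = Seq (emit_loop o1) (Seq (rewind o1) (Seq (act1 5 (\<lambda>_. (tm_start M, Stay)))
     (Seq (sim_loop M o1) (Cond (\<lambda>as. as ! 5 = tm_accept M) (Halt True) (Halt False)))))"

lemma tm_wf_trans:
  assumes "tm_wf M" "q < tm_states M" "length as = tm_tapes M" "\<forall>a\<in>set as. a < tm_symbols M"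
  shows "fst (tm_trans M q as) < tm_states M" "length (snd (tm_trans M q as)) = tm_tapes M"
    "\<forall>x\<in>set (snd (tm_trans M q as)). fst x < tm_symbols M"
  using assms unfolding tm_wf_def case_prod_beta by blast+

lemma stay_bound: "\<forall>a\<in>set as. a < n \<Longrightarrow> \<forall>x\<in>set (stay as). fst x < n"
  by (auto simp: stay_def)

text \<open>Well-formedness concerns all symbols of the larger alphabet, also those that are no
  symbols or states of \<open>M\<close>; on them the guard in \<open>sim_acts\<close> makes the
  command idle. The alphabet must contain the states of \<open>M\<close>, since the current state is
  a tape symbol.\<close>

lemma wf_sim_acts:
  assumes "tm_wf M" "6 \<le> o1" "o1 + tm_tapes M \<le> k" "tm_symbols M \<le> n" "tm_states M \<le> n"
  shows "valid_acts k n (sim_acts M o1)"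
  unfolding valid_acts_def
proof (intro allI impI)
  fix as assume as: "ok_syms k n as"
  then have len: "length as = k" and sym: "\<forall>a\<in>set as. a < n" by (auto simp: ok_syms_def)
  define mid where "mid = take (tm_tapes M) (drop o1 as)"
  show "ok_acts k n (sim_acts M o1 as)"
  proof (cases "as ! 5 < tm_states M \<and> (\<forall>a\<in>set mid. a < tm_symbols M)")
    case True
    have "length mid = tm_tapes M" using len assms by (simp add: mid_def)
    note t = tm_wf_trans[OF assms(1) conjunct1[OF True] this conjunct2[OF True]]
    have e: "sim_acts M o1 as = stay (take 5 as) @ (fst (tm_trans M (as ! 5) mid), Stay) # stay (take (o1 - 6) (drop 6 as)) @
       snd (tm_trans M (as ! 5) mid) @ stay (drop (o1 + tm_tapes M) as)"
      using True by (simp add: sim_acts_def mid_def Let_def)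
    have b: "\<forall>x\<in>set (stay (take 5 as)). fst x < n" "\<forall>x\<in>set (stay (take (o1 - 6) (drop 6 as))). fst x < n"
      "\<forall>x\<in>set (stay (drop (o1 + tm_tapes M) as)). fst x < n"
      by (rule stay_bound, use sym in \<open>meson in_set_takeD in_set_dropD\<close>)+
    have c: "\<forall>x\<in>set (snd (tm_trans M (as ! 5) mid)). fst x < n" "fst (tm_trans M (as ! 5) mid) < n"
      using t(1,3) assms(4,5) by (auto intro: less_le_trans)
    have "\<forall>x\<in>set (sim_acts M o1 as). fst x < n" unfolding e set_append list.set using b c by auto
    moreover have "length (sim_acts M o1 as) = k" unfolding e using t(2) len assms(2,3) by simp
    ultimately show ?thesis by (auto simp: ok_acts_def)
  next
    case False
    have "sim_acts M o1 as = stay as"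
      unfolding sim_acts_def Let_def mid_def[symmetric] by (rule if_not_P[OF False])
    then show ?thesis using ok_stay[OF as] by simp
  qed
qed

definition state_tape :: "nat \<Rightarrow> tape" where
  "state_tape q = ((\<lambda>_. 0)(0 := q), 0)"

definition ok_config :: "tm \<Rightarrow> tm_config \<Rightarrow> bool" where
  "ok_config M c \<longleftrightarrow> fst c < tm_states M \<and> length (snd c) = tm_tapes M \<and>
     (\<forall>t\<in>set (snd c). \<forall>p. fst t p < tm_symbols M)"

lemma ok_reads: "ok_config M (q, ts) \<Longrightarrow> \<forall>a\<in>set (reads ts). a < tm_symbols M"
  by (auto simp: ok_config_def reads_def)

lemma tm_step_eq: "q \<noteq> tm_accept M \<Longrightarrow> q \<noteq> tm_reject M \<Longrightarrow> tm_step M (q, ts) =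
   (fst (tm_trans M q (reads ts)), apply_acts ts (snd (tm_trans M q (reads ts))))"
  by (simp add: tm_step_def apply_acts_def reads_def case_prod_beta)

lemma ok_step:
  assumes "tm_wf M" "ok_config M (q, ts)"
  shows "ok_config M (tm_step M (q, ts))"
proof (cases "q = tm_accept M \<or> q = tm_reject M")
  case True
  then show ?thesis using assms(2) by (simp add: tm_step_def)
next
  case False
  have q: "q < tm_states M" "length (reads ts) = tm_tapes M" using assms(2) by (auto simp: ok_config_def)
  note t = tm_wf_trans[OF assms(1) q ok_reads[OF assms(2)]]
  let ?a = "snd (tm_trans M q (reads ts))"
  have "fst (apply_acts ts ?a ! i) p < tm_symbols M" if "i < length ts" for i p
  proof -
    have i: "i < length ?a" using that t(2) q(2) by simp
    have "fst (ts ! i) p < tm_symbols M" using assms(2) that by (auto simp: ok_config_def)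
    moreover have "fst (?a ! i) < tm_symbols M" using t(3) i by simp
    ultimately show ?thesis using that i by (simp add: apply_acts_nth)
  qed
  then have "\<forall>t\<in>set (apply_acts ts ?a). \<forall>p. fst t p < tm_symbols M"
    by (simp add: all_set_conv_all_nth)
  then show ?thesis using False t(1,2) q(2) by (simp add: tm_step_eq ok_config_def)
qed

lemma runs_sim_step:
  assumes "tm_wf M" "ok_config M (q, ts)" "length pre + 6 = o1" "q \<noteq> tm_accept M" "q \<noteq> tm_reject M"
    and st: "tm_step M (q, ts) = (q', ts')"
  shows "runs (Act (sim_acts M o1)) (ST z a b c (state_tape q # pre @ ts @ post)) 1
     (ST z a b c (state_tape q' # pre @ ts' @ post))"
proof (rule runs_Act)
  let ?P = "ST z a b c []"
  have q: "q < tm_states M" "length ts = tm_tapes M" using assms(2) by (auto simp: ok_config_def)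
  let ?as = "reads (ST z a b c (state_tape q # pre @ ts @ post))"
  have as: "?as = reads ?P @ q # reads pre @ reads ts @ reads post"
    by (subst ST_append) (simp add: reads_def state_tape_def)
  have lP: "length (reads ?P) = 5" by simp
  have 5: "?as ! 5 = q" unfolding as using lP by (simp add: nth_append)
  have mid: "take (tm_tapes M) (drop o1 ?as) = reads ts" unfolding as using lP assms(3) q(2) by (simp add: drop_Cons')
  have e: "sim_acts M o1 ?as = stay (reads ?P) @ (q', Stay) # stay (reads pre) @ snd (tm_trans M q (reads ts)) @ stay (reads post)"
    using ok_reads[OF assms(2)] q(1) st unfolding sim_acts_def Let_def 5 mid tm_step_eq[OF assms(4,5)]
    unfolding as using lP assms(3) q(2) by (simp add: drop_Cons')
  have l: "length (snd (tm_trans M q (reads ts))) = length ts"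
    using tm_wf_trans(2)[OF assms(1) q(1) _ ok_reads[OF assms(2)]] q(2) by simp
  let ?acts = "snd (tm_trans M q (reads ts))"
  have c1: "apply_acts (?P @ (state_tape q # pre @ ts @ post)) (stay (reads ?P) @ ((q', Stay) # stay (reads pre) @ ?acts @ stay (reads post)))
     = ?P @ apply_acts (state_tape q # pre @ ts @ post) ((q', Stay) # stay (reads pre) @ ?acts @ stay (reads post))"
    by (subst apply_acts_append) simp_all
  have c2: "apply_acts (state_tape q # pre @ ts @ post) ((q', Stay) # stay (reads pre) @ ?acts @ stay (reads post))
     = state_tape q' # apply_acts (pre @ ts @ post) (stay (reads pre) @ ?acts @ stay (reads post))"
    by (simp add: apply_acts_def state_tape_def)
  have c3: "apply_acts (pre @ ts @ post) (stay (reads pre) @ ?acts @ stay (reads post)) =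
     pre @ apply_acts (ts @ post) (?acts @ stay (reads post))"
    by (subst apply_acts_append) simp_all
  have c4: "apply_acts (ts @ post) (?acts @ stay (reads post)) = apply_acts ts ?acts @ post"
    using l by (subst apply_acts_append) simp_all
  have "apply_acts (ST z a b c (state_tape q # pre @ ts @ post)) (sim_acts M o1 ?as) =
    ?P @ state_tape q' # pre @ apply_acts ts ?acts @ post"
    unfolding e using c1 unfolding c2 c3 c4 ST_append[symmetric] .
  also have "apply_acts ts (snd (tm_trans M q (reads ts))) = ts'"
    using st tm_step_eq[OF assms(4,5)] by simp
  finally show "apply_acts (ST z a b c (state_tape q # pre @ ts @ post)) (sim_acts M o1 ?as) =
     ST z a b c (state_tape q' # pre @ ts' @ post)" by (subst ST_append) simp
qed simp

lemma tm_step_halted: "q = tm_accept M \<or> q = tm_reject M \<Longrightarrow> (tm_step M ^^ n) (q, ts) = (q, ts)"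
  by (induction n) (auto simp: tm_step_def)

text \<open>Each simulated step costs one action and two steps of loop control. \<open>n\<close> may
  exceed the halting time of \<open>M\<close>, and then the loop stops earlier.\<close>

lemma runs_sim_loop:
  assumes "tm_wf M" "length pre + 6 = o1" "ok_config M (q, ts)"
    "fst ((tm_step M ^^ n) (q, ts)) = q'" "q' = tm_accept M \<or> q' = tm_reject M"
  shows "\<exists>ts'. runs (sim_loop M o1) (ST z a b c (state_tape q # pre @ ts @ post)) (3 * n + 1)
     (ST z a b c (state_tape q' # pre @ ts' @ post))"
  using assms(3,4)
proof (induction n arbitrary: q ts)
  case 0
  then have e: "q' = q" by simp
  show ?case using assms(5) unfolding sim_loop_def e
    by (intro exI[of _ ts] runs_LoopF) (auto simp: reads_ST state_tape_def)
next
  case (Suc n)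
  show ?case
  proof (cases "q = tm_accept M \<or> q = tm_reject M")
    case True
    have e: "q' = q" using Suc.prems(2) tm_step_halted[OF True, of "Suc n" ts] by simp
    show ?thesis using True unfolding sim_loop_def e
      by (intro exI[of _ ts] runs_LoopF) (auto simp: reads_ST state_tape_def)
  next
    case False
    obtain q1 ts1 where st: "tm_step M (q, ts) = (q1, ts1)" by (metis surj_pair)
    have 1: "runs (Act (sim_acts M o1)) (ST z a b c (state_tape q # pre @ ts @ post)) 1
      (ST z a b c (state_tape q1 # pre @ ts1 @ post))"
      using False by (intro runs_sim_step[OF assms(1) Suc.prems(1) assms(2) _ _ st]) auto
    have ok: "ok_config M (q1, ts1)" using ok_step[OF assms(1) Suc.prems(1)] st by simp
    have "fst ((tm_step M ^^ n) (q1, ts1)) = q'"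
      using Suc.prems(2) st by (simp add: funpow_Suc_right del: funpow.simps)
    from Suc.IH[OF ok this] obtain ts' where 2: "runs (sim_loop M o1) (ST z a b c (state_tape q1 # pre @ ts1 @ post)) (3 * n + 1)
       (ST z a b c (state_tape q' # pre @ ts' @ post))" by blast
    have "runs (sim_loop M o1) (ST z a b c (state_tape q # pre @ ts @ post)) (3 * Suc n + 1)
       (ST z a b c (state_tape q' # pre @ ts' @ post))"
      unfolding sim_loop_def
      by (rule runs_LoopT[OF _ 1 2[unfolded sim_loop_def]]) (use False in \<open>auto simp: reads_ST state_tape_def\<close>)
    then show ?thesis by blast
  qed
qed

abbreviation blank :: tape where "blank \<equiv> (\<lambda>_. 0, 0)"

lemma ok_init: "tm_wf M \<Longrightarrow> ok_config M (tm_init M u)"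
  unfolding tm_wf_def ok_config_def tm_init_def by (auto simp: itape_eq)

lemma halts_simulate:
  assumes M: "tm_wf M" and o1: "length pre + 6 = o1"
    and n: "fst ((tm_step M ^^ n) (tm_init M u)) = (if v then tm_accept M else tm_reject M)"
  shows "halts (simulate M o1) (ST z (flat (code u)) [] [] (blank # pre @ replicate (tm_tapes M) blank @ post))
     (100 * length u + 3 * n + 30) v"
proof -
  have k: "1 \<le> tm_tapes M" "tm_accept M \<noteq> tm_reject M" using M by (auto simp: tm_wf_def)
  then have rep: "replicate (tm_tapes M) blank = blank # replicate (tm_tapes M - 1) blank"
    by (metis One_nat_def Suc_pred less_eq_Suc_le replicate_Suc)
  let ?p = "replicate (tm_tapes M - 1) blank @ post"
  let ?Z = "flat (code ([] :: bool list))"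
  have i: "itape [] = (\<lambda>_. 0)" by (auto simp: itape_eq)
  have 1: "runs (emit_loop o1) (ST z (flat (code u)) [] [] (blank # pre @ replicate (tm_tapes M) blank @ post)) (80 * length u + 1)
     (ST z ?Z [] [] (blank # pre @ (itape u, int (length u)) # ?p))"
    using runs_emit_loop[OF o1, of z u blank "[]" ?p] unfolding rep by (simp add: i)
  have 2: "runs (rewind o1) (ST z ?Z [] [] (blank # pre @ (itape u, int (length u)) # ?p)) (4 * length u + 10)
     (ST z ?Z [] [] (blank # pre @ input_tape u # ?p))"
    by (rule runs_rewind[OF o1])
  have 3: "runs (act1 5 (\<lambda>_. (tm_start M, Stay))) (ST z ?Z [] [] (blank # pre @ input_tape u # ?p)) 1
     (ST z ?Z [] [] (state_tape (tm_start M) # pre @ snd (tm_init M u) @ post))"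
    using runs_act_rest[of 5 "blank # pre @ input_tape u # ?p" "\<lambda>_. 0" 0 "\<lambda>_. (tm_start M, Stay)" z ?Z "[]" "[]"]
    by (simp add: tm_init_def state_tape_def)
  let ?q = "if v then tm_accept M else tm_reject M"
  have tm: "(tm_start M, snd (tm_init M u)) = tm_init M u" by (simp add: tm_init_def)
  have ok: "ok_config M (tm_start M, snd (tm_init M u))" unfolding tm by (rule ok_init[OF M])
  have n': "fst ((tm_step M ^^ n) (tm_start M, snd (tm_init M u))) = ?q" unfolding tm by (rule n)
  have acc: "?q = tm_accept M \<or> ?q = tm_reject M" by simp
  obtain ts' where 4: "runs (sim_loop M o1) (ST z ?Z [] [] (state_tape (tm_start M) # pre @ snd (tm_init M u) @ post)) (3 * n + 1)
     (ST z ?Z [] [] (state_tape ?q # pre @ ts' @ post))"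
    using runs_sim_loop[OF M o1 ok n' acc] by blast
  have "reads (ST z ?Z [] [] (state_tape ?q # pre @ ts' @ post)) ! 5 = ?q"
    by (subst reads_ST) (simp_all add: state_tape_def)
  then have 5: "halts (Cond (\<lambda>as. as ! 5 = tm_accept M) (Halt True) (Halt False)) (ST z ?Z [] [] (state_tape ?q # pre @ ts' @ post)) 1 v"
    using k(2) by (intro halts_Cond[where n = 0]) (auto simp: halts_Halt)
  show ?thesis unfolding simulate_def
    by (rule halts_Seq[OF 1 halts_Seq[OF 2 halts_Seq[OF 3 halts_Seq[OF 4 5 order_refl] order_refl] order_refl]]) simp
qed

lemma wf_simulate:
  assumes "tm_wf M" "6 \<le> o1" "o1 + tm_tapes M \<le> k" "tm_symbols M \<le> n" "tm_states M \<le> n"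
  shows "wf_cmd k n (simulate M o1)"
proof -
  have "1 \<le> tm_tapes M" "3 \<le> tm_symbols M" "tm_start M < tm_states M" using assms(1) by (auto simp: tm_wf_def)
  then show ?thesis
    using assms wf_sim_acts[OF assms]
    unfolding simulate_def emit_loop_def rewind_def sim_loop_def
    by (auto intro!: wf_act1 wf_stack_cmd stack_drop_top stack_intros)
qed

definition halts_with :: "tm \<Rightarrow> bool list \<Rightarrow> nat \<Rightarrow> bool \<Rightarrow> bool" where
  "halts_with M w n v \<longleftrightarrow> fst ((tm_step M ^^ n) (tm_init M w)) = (if v then tm_accept M else tm_reject M)"

text \<open>The bit \<open>fst (g w)\<close> chooses which of two machines is asked about the word
  \<open>snd (g w)\<close>. Simulation costs a constant factor only, so the same construction serves
  for decidability and for exponential time.\<close>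

theorem reduction:
  fixes g :: "bool list \<Rightarrow> bool \<times> bool list"
  assumes g: "X g" and M: "tm_wf M1" "tm_wf M2"
  shows "\<exists>M T. tm_wf M \<and> expb T \<and> (\<forall>w n v. halts_with (if fst (g w) then M2 else M1) (snd (g w)) n v \<longrightarrow>
      (\<forall>t\<ge>T w + 3 * n. halts_with M w t v))"
proof -
  obtain c U where c: "expb U" "stack_cmd c" "\<And>x ts. trans c (code x # ts) (code (g x) # ts) (U x)"
    by (rule XE[OF g]) blast
  let ?k1 = "tm_tapes M1" and ?k2 = "tm_tapes M2"
  \<comment> \<open>Six tapes for the input, the four stacks and the simulated state, followed by
    the tapes of both machines. The alphabet has room for the states of both machines, because they
    are written on tape 5.\<close>
  let ?K = "6 + ?k1 + ?k2" and ?N = "3 + tm_symbols M1 + tm_symbols M2 + tm_states M1 + tm_states M2"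
  let ?run = "Cond (is_top 0 2) (Seq drop_top (simulate M2 (6 + ?k1))) (Seq drop_top (simulate M1 6))"
  let ?P = "Seq load (Seq c (Seq (pops 0) ?run))"
  have "wf_cmd ?K ?N ?P"
    using wf_simulate[OF M(1), of 6 ?K ?N] wf_simulate[OF M(2), of "6 + ?k1" ?K ?N]
    unfolding load_def seek_def read_loop_def
    by (auto intro!: wf_act1 wf_stack_cmd[OF c(2)] wf_stack_cmd[OF stack_drop_top] wf_stack_cmd[OF stack_push_tree]
        wf_stack_cmd[OF stack_intros(2)] wf_stack_cmd[OF stack_intros(3)])
  from compile_cmd[OF this] obtain M where M': "tm_wf M" "tm_tapes M = ?K"
    "\<And>w t v ts. (cstep ^^ t) (?P, input_tape w # replicate (?K - 1) blank) = (Halt v, ts) \<Longrightarrow>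
       fst ((tm_step M ^^ t) (tm_init M w)) = (if v then tm_accept M else tm_reject M)" by auto
  define T where "T w = 40 * length w + 300 + U w + 100 * length (snd (g w))" for w
  show ?thesis
  proof (intro exI[of _ M] exI[of _ T] conjI M'(1))
    have "polyb (\<lambda>w. length (snd (g w)))"
      by (rule polyb_mono[OF X_polyb[OF X_snd[OF g]]]) (rule length_le_sz)
    moreover have "polyb (length :: bool list \<Rightarrow> nat)" by (rule polyb_mono[OF polyb_sz]) (rule length_le_sz)
    ultimately show "expb T" unfolding T_def by (intro expb_add c expb_polyb poly_intros)
  next
    show "\<forall>w n v. halts_with (if fst (g w) then M2 else M1) (snd (g w)) n v \<longrightarrow> (\<forall>t\<ge>T w + 3 * n. halts_with M w t v)"
    proof (intro allI impI)
    fix w n v t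
    define N where "N = (if fst (g w) then M2 else M1)"
    assume "halts_with (if fst (g w) then M2 else M1) (snd (g w)) n v" and t: "T w + 3 * n \<le> t"
    then have n: "fst ((tm_step N ^^ n) (tm_init N (snd (g w)))) = (if v then tm_accept N else tm_reject N)"
      by (simp add: N_def halts_with_def)
    let ?rest = "blank # replicate (?k1 + ?k2) blank"
    let ?u = "snd (g w)"
    have init: "input_tape w # replicate (?K - 1) blank = ST (input_tape w) [] [] [] ?rest"
    proof -
      \<comment> \<open>The blank work tapes of the initial configuration are empty stacks.\<close>
      have s: "stack_tape [] = blank" by (auto simp: stack_tape_def fun_eq_iff)
      have "replicate (?K - 1) blank = replicate 4 blank @ ?rest"
        by (simp add: replicate_add[symmetric] replicate_Suc[symmetric] del: replicate_Suc)
      then show ?thesis by (simp add: ST_def mk_def s eval_nat_numeral)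
    qed
    let ?z = "(itape w, -1)"
    have 1: "runs load (ST (input_tape w) [] [] [] ?rest) (40 * length w + 40) (ST ?z (flat (code w)) [] [] ?rest)"
      by (rule runs_load)
    have 2: "runs c (ST ?z (flat (code w)) [] [] ?rest) (U w) (ST ?z (flat (code (g w))) [] [] ?rest)"
      using c(3)[of w "[]", unfolded trans_def, rule_format, where r = "[]" and z = "?z" and rest = "?rest"] by simp
    have cg: "flat (code (g w)) = 2 # flat (code (fst (g w))) @ flat (code ?u)" by (cases "g w") simp
    have 3: "runs (pops 0) (ST ?z (flat (code (g w))) [] [] ?rest) 1 (ST ?z (flat (code (fst (g w))) @ flat (code ?u)) [] [] ?rest)"
      unfolding cg by (rule runs_pop0)
    have l: "length (flat (code (fst (g w)))) \<le> 3" using sz_bool[of "fst (g w)"] by (simp add: sz_def)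
    have d: "runs drop_top (ST ?z (flat (code (fst (g w))) @ flat (code ?u)) [] [] ?rest) 68 (ST ?z (flat (code ?u)) [] [] ?rest)"
      by (rule runs_mono[OF runs_drop_top]) (use l in simp)
    have 4: "halts ?run (ST ?z (flat (code (fst (g w))) @ flat (code ?u)) [] [] ?rest) (100 * length ?u + 3 * n + 200) v"
    proof (cases "fst (g w)")
      case True
      have "halts (simulate M2 (6 + ?k1)) (ST ?z (flat (code ?u)) [] [] ?rest) (100 * length ?u + 3 * n + 30) v"
        using halts_simulate[OF M(2), where pre = "replicate ?k1 blank" and ?o1.0 = "6 + ?k1" and n = n and u = "?u" and v = v and z = "?z" and post = "[]"] n True
        by (simp add: N_def replicate_add)
      note h = halts_Seq[OF d this order_refl]
      show ?thesis by (rule halts_Cond[where n = "68 + (100 * length ?u + 3 * n + 30) + 1"]) (use h in \<open>simp_all add: True\<close>)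
    next
      case False
      have "halts (simulate M1 6) (ST ?z (flat (code ?u)) [] [] ?rest) (100 * length ?u + 3 * n + 30) v"
        using halts_simulate[OF M(1), where pre = "[]" and ?o1.0 = 6 and n = n and u = "?u" and v = v and z = "?z" and post = "replicate ?k2 blank"] n False
        by (simp add: N_def replicate_add)
      note h = halts_Seq[OF d this order_refl]
      show ?thesis by (rule halts_Cond[where n = "68 + (100 * length ?u + 3 * n + 30) + 1"]) (use h in \<open>simp_all add: False\<close>)
    qed
    have "halts ?P (input_tape w # replicate (?K - 1) blank) (T w + 3 * n) v"
      unfolding init
      by (rule halts_Seq[OF 1 halts_Seq[OF 2 halts_Seq[OF 3 4 order_refl] order_refl]]) (simp add: T_def)
    then obtain us where "(cstep ^^ t) (?P, input_tape w # replicate (?K - 1) blank) = (Halt v, us)"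
      using t unfolding halts_def by blast
    from M'(3)[OF this] show "halts_with M w t v" unfolding halts_with_def .
    qed
  qed
qed

lemma DECIDABLE_reduction:
  assumes g: "X g" and L: "L1 \<in> DECIDABLE" "L2 \<in> DECIDABLE"
  shows "{w. snd (g w) \<in> (if fst (g w) then L2 else L1)} \<in> DECIDABLE"
proof -
  have D: "A \<in> DECIDABLE \<longleftrightarrow> (\<exists>M. tm_wf M \<and> (\<forall>w. \<exists>n. halts_with M w n (w \<in> A)))" for A
    by (simp add: DECIDABLE_def tm_decides_def halts_with_def)
  obtain M1 M2 where M: "tm_wf M1" "\<And>w. \<exists>n. halts_with M1 w n (w \<in> L1)"
     "tm_wf M2" "\<And>w. \<exists>n. halts_with M2 w n (w \<in> L2)" using L unfolding D by blast
  obtain M T where wf: "tm_wf M" and r: "\<And>w n v t. halts_with (if fst (g w) then M2 else M1) (snd (g w)) n v \<Longrightarrow>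
      T w + 3 * n \<le> t \<Longrightarrow> halts_with M w t v" using reduction[OF g M(1,3)] by blast
  have "\<exists>n. halts_with M w n (w \<in> {w. snd (g w) \<in> (if fst (g w) then L2 else L1)})" for w
  proof -
    obtain n where "halts_with (if fst (g w) then M2 else M1) (snd (g w)) n (snd (g w) \<in> (if fst (g w) then L2 else L1))"
      using M(2,4)[of "snd (g w)"] by (cases "fst (g w)") auto
    from r[OF this order_refl] show ?thesis unfolding mem_Collect_eq by blast
  qed
  then show ?thesis unfolding D using wf by blast
qed

lemma expb_bound:
  assumes "expb (U :: bool list \<Rightarrow> nat)"
  obtains c where "\<And>w. U w \<le> c * 2 ^ (length w ^ c) + c"
proof -
  obtain k where k: "\<And>w. U w \<le> 2 ^ ((sz w + 2) ^ k)" using assms unfolding expb_def by blast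
  \<comment> \<open>For words of length at least 2,
    \<open>sz w + 2 \<le> 4 * length w + 3 \<le> length w ^ 4\<close> leads to the exponent
    \<open>4 * k\<close>. Shorter words, for which powers of the length do not grow, are covered by
    the constant \<open>2 ^ (7 ^ k)\<close>.\<close>
  define c where "c = 4 * k + 2 ^ (7 ^ k)"
  have "U w \<le> c * 2 ^ (length w ^ c) + c" for w
  proof -
    have "(sz w + 2) ^ k \<le> (4 * length w + 3) ^ k"
      using sz_bits(2)[of w] by (intro power_mono) auto
    then have "(2::nat) ^ ((sz w + 2) ^ k) \<le> 2 ^ ((4 * length w + 3) ^ k)" by (intro power_increasing) auto
    then have U: "U w \<le> 2 ^ ((4 * length w + 3) ^ k)" using k[of w] by linarith
    show ?thesis
    proof (cases "2 \<le> length w")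
      case True
      define n where "n = length w"
      have n: "2 \<le> n" using True by (simp add: n_def)
      have "4 * n + 3 \<le> n ^ 4"
      proof -
        have "2 * 2 * 2 \<le> n * n * n" using n by (intro mult_le_mono) auto
        then have "8 * n \<le> n * n * n * n" by simp
        then show ?thesis using n by (simp add: eval_nat_numeral)
      qed
      then have "(4 * n + 3) ^ k \<le> (n ^ 4) ^ k" by (intro power_mono) auto
      also have "\<dots> = n ^ (4 * k)" by (simp add: power_mult)
      also have "\<dots> \<le> n ^ c" using n by (intro power_increasing) (auto simp: c_def)
      finally have "(2::nat) ^ ((4 * n + 3) ^ k) \<le> 2 ^ (n ^ c)" by (intro power_increasing) auto
      also have "\<dots> \<le> c * 2 ^ (n ^ c)"
      proof -
        have "1 \<le> c" unfolding c_def using one_le_power[of "2::nat" "7 ^ k"] by linarith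
        then show ?thesis by simp
      qed
      finally show ?thesis using U unfolding n_def by linarith
    next
      case False
      then have "(4 * length w + 3) ^ k \<le> 7 ^ k" by (intro power_mono) auto
      then have "(2::nat) ^ ((4 * length w + 3) ^ k) \<le> 2 ^ (7 ^ k)" by (intro power_increasing) auto
      then have "U w \<le> 2 ^ (7 ^ k)" using U by linarith
      also have "\<dots> \<le> c" by (simp add: c_def)
      finally show ?thesis by (rule trans_le_add2)
    qed
  qed
  then show ?thesis by (rule that)
qed

text \<open>Queries have polynomial length, so the time that the deciders spend on them is still
  exponential in the length of the input.\<close>

lemma EXPTIME_reduction:
  assumes g: "X g" and L: "L1 \<in> EXPTIME" "L2 \<in> EXPTIME"
  shows "{w. snd (g w) \<in> (if fst (g w) then L2 else L1)} \<in> EXPTIME"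
proof -
  have E: "A \<in> EXPTIME \<longleftrightarrow> (\<exists>M c k. tm_wf M \<and> (\<forall>w. halts_with M w (k * 2 ^ (length w ^ c) + k) (w \<in> A)))" for A
    unfolding EXPTIME_def DTIME_def tm_decides_in_time_def halts_with_def by auto
  obtain M1 c1 k1 where M1: "tm_wf M1" "\<And>w. halts_with M1 w (k1 * 2 ^ (length w ^ c1) + k1) (w \<in> L1)"
    using L(1) unfolding E by blast
  obtain M2 c2 k2 where M2: "tm_wf M2" "\<And>w. halts_with M2 w (k2 * 2 ^ (length w ^ c2) + k2) (w \<in> L2)"
    using L(2) unfolding E by blast
  obtain M T where wf: "tm_wf M" and T: "expb T"
    and r: "\<And>w n v t. halts_with (if fst (g w) then M2 else M1) (snd (g w)) n v \<Longrightarrow>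
      T w + 3 * n \<le> t \<Longrightarrow> halts_with M w t v" using reduction[OF g M1(1) M2(1)] by blast
  let ?t1 = "\<lambda>w. k1 * 2 ^ (length (snd (g w)) ^ c1) + k1" and ?t2 = "\<lambda>w. k2 * 2 ^ (length (snd (g w)) ^ c2) + k2"
  have pl: "polyb (\<lambda>w. length (snd (g w)))"
    by (rule polyb_mono[OF X_polyb[OF X_snd[OF g]]]) (rule length_le_sz)
  have "expb (\<lambda>w. T w + (3 * ?t1 w + 3 * ?t2 w))"
    by (intro expb_add expb_mult T expb_polyb[OF polyb_const] expb_pow poly_intros pl)
  then obtain c where c: "\<And>w. T w + (3 * ?t1 w + 3 * ?t2 w) \<le> c * 2 ^ (length w ^ c) + c"
    using expb_bound by blast
  have "halts_with M w (c * 2 ^ (length w ^ c) + c) (w \<in> {w. snd (g w) \<in> (if fst (g w) then L2 else L1)})" for w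
  proof (cases "fst (g w)")
    case True
    have "T w + 3 * ?t2 w \<le> c * 2 ^ (length w ^ c) + c" using c[of w] by linarith
    then show ?thesis using r[of w "?t2 w"] M2(2)[of "snd (g w)"] by (simp add: True)
  next
    case False
    have "T w + 3 * ?t1 w \<le> c * 2 ^ (length w ^ c) + c" using c[of w] by linarith
    then show ?thesis using r[of w "?t1 w"] M1(2)[of "snd (g w)"] by (simp add: False)
  qed
  then show ?thesis unfolding E using wf by blast
qed

section \<open>Runs in systems with expanding transitions\<close>

fun walk :: "('t \<Rightarrow> 'c \<Rightarrow> 'c option) \<Rightarrow> 't list \<Rightarrow> 'c \<Rightarrow> 'c option" where
  "walk f [] c = Some c"
| "walk f (t # p) c = Option.bind (f t c) (walk f p)"

lemma walk_append: "walk f (p @ q) c = Option.bind (walk f p c) (walk f q)"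
  by (induction p arbitrary: c) (auto split: Option.bind_split)

text \<open>\<open>n\<close> is just an upper bound on the number of states. Raising it later makes
  it possible to accept witnesses that are longer than necessary.\<close>

locale esys =
  fixes E :: "'t set" and src tgt :: "'t \<Rightarrow> 's" and ef :: "'t \<Rightarrow> real \<Rightarrow> real option"
    and V :: "'s set" and n :: nat
  assumes finE: "finite E"
    and nn: "t \<in> E \<Longrightarrow> 0 \<le> x \<Longrightarrow> ef t x = Some y \<Longrightarrow> 0 \<le> y"
    and emono: "t \<in> E \<Longrightarrow> 0 \<le> x \<Longrightarrow> x \<le> x' \<Longrightarrow> ef t x = Some y \<Longrightarrow> \<exists>y'. ef t x' = Some y' \<and> y + (x' - x) \<le> y'"
    and finV: "finite V" and cardV: "card V \<le> n" and tgtV: "t \<in> E \<Longrightarrow> tgt t \<in> V"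
begin

definition st :: "'t \<Rightarrow> 's \<times> real \<Rightarrow> ('s \<times> real) option" where
  "st t c = (if src t = fst c then map_option (Pair (tgt t)) (ef t (snd c)) else None)"

abbreviation W :: "'t list \<Rightarrow> 's \<times> real \<Rightarrow> ('s \<times> real) option" where "W \<equiv> walk st"

lemma W_Cons: "W (t # p) (s, x) = Some c' \<longleftrightarrow> (\<exists>y. src t = s \<and> ef t x = Some y \<and> W p (tgt t, y) = Some c')"
  by (cases "ef t x") (auto simp: st_def)

lemma W_append: "W (p @ q) c = Some c' \<longleftrightarrow> (\<exists>c1. W p c = Some c1 \<and> W q c1 = Some c')"
  by (simp add: walk_append bind_eq_Some_conv)

lemma W_nonneg: "set p \<subseteq> E \<Longrightarrow> 0 \<le> x \<Longrightarrow> W p (s, x) = Some (s', y) \<Longrightarrow> 0 \<le> y"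
proof (induction p arbitrary: s x)
  case (Cons t p)
  from Cons.prems(3) obtain y1 where 1: "ef t x = Some y1" "W p (tgt t, y1) = Some (s', y)" unfolding W_Cons by blast
  have "0 \<le> y1" using nn[of t x y1] Cons.prems(1,2) 1(1) by simp
  then show ?case using Cons.IH[OF _ _ 1(2)] Cons.prems(1) by simp
qed simp

lemma W_V: "set p \<subseteq> E \<Longrightarrow> s \<in> V \<Longrightarrow> W p (s, x) = Some (s', y) \<Longrightarrow> s' \<in> V"
proof (induction p arbitrary: s x)
  case (Cons t p)
  from Cons.prems(3) obtain y1 where 1: "W p (tgt t, y1) = Some (s', y)" unfolding W_Cons by blast
  show ?case using Cons.IH[OF _ _ 1] tgtV[of t] Cons.prems(1) by simp
qed simp

text \<open>Expansion is preserved by composition of transitions. All comparisons of runs from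
  different energies are based on this: a path taken from a higher energy keeps its lead.\<close>

lemma W_mono: "set p \<subseteq> E \<Longrightarrow> 0 \<le> x \<Longrightarrow> x \<le> x' \<Longrightarrow> W p (s, x) = Some (s', y) \<Longrightarrow>
   \<exists>y'. W p (s, x') = Some (s', y') \<and> y + (x' - x) \<le> y'"
proof (induction p arbitrary: s x x')
  case (Cons t p)
  from Cons.prems(4) obtain y1 where 1: "src t = s" "ef t x = Some y1" "W p (tgt t, y1) = Some (s', y)" unfolding W_Cons by blast
  have t: "t \<in> E" using Cons.prems(1) by simp
  obtain y2 where 2: "ef t x' = Some y2" "y1 + (x' - x) \<le> y2" using emono[OF t Cons.prems(2,3) 1(2)] by blast
  have y1: "0 \<le> y1" by (rule nn[OF t Cons.prems(2) 1(2)])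
  have "y1 \<le> y2" using 2(2) Cons.prems(3) by simp
  from Cons.IH[OF _ y1 this 1(3)] Cons.prems(1) obtain y' where "W p (tgt t, y2) = Some (s', y')" "y + (y2 - y1) \<le> y'"
    by auto
  moreover have "W (t # p) (s, x') = Some (s', y')" unfolding W_Cons using 1(1) 2(1) calculation(1) by blast
  ultimately show ?case using 2(2) by (intro exI[of _ y']) simp
qed simp

section \<open>Finite runs\<close>

definition rch :: "'s \<times> real \<Rightarrow> 's \<times> real \<Rightarrow> bool" where
  "rch c c' \<longleftrightarrow> (\<exists>p. set p \<subseteq> E \<and> W p c = Some c')"

lemma rch_refl: "rch c c"
  unfolding rch_def by (rule exI[of _ "[]"]) simp

lemma rchI: "set p \<subseteq> E \<Longrightarrow> W p c = Some c' \<Longrightarrow> rch c c'"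
  unfolding rch_def by blast

lemma rch_trans: "rch c c' \<Longrightarrow> rch c' c'' \<Longrightarrow> rch c c''"
  unfolding rch_def by (metis W_append Un_least set_append)

text \<open>Executability from some energy amounts to executability from all sufficiently large
  ones; this represents a run at infinite energy.\<close>

definition gr :: "'s \<Rightarrow> 't list \<Rightarrow> 's \<Rightarrow> bool" where
  "gr s p s' \<longleftrightarrow> set p \<subseteq> E \<and> (\<exists>x\<ge>0. \<exists>y. W p (s, x) = Some (s', y))"

lemma grI: "set p \<subseteq> E \<Longrightarrow> 0 \<le> x \<Longrightarrow> W p (s, x) = Some (s', y) \<Longrightarrow> gr s p s'"
  unfolding gr_def by blast

text \<open>Started at \<open>x0\<close> the path ends with a nonnegative energy, so by expansion it
  loses at most \<open>x0\<close> when started above.\<close>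

lemma gr_high: "gr s p s' \<Longrightarrow> \<exists>x0\<ge>0. \<forall>x\<ge>x0. \<exists>y\<ge>x - x0. W p (s, x) = Some (s', y)"
proof -
  assume "gr s p s'"
  then obtain x0 y0 where 1: "set p \<subseteq> E" "0 \<le> x0" "W p (s, x0) = Some (s', y0)" unfolding gr_def by blast
  have "0 \<le> y0" by (rule W_nonneg[OF 1])
  then have "\<exists>y\<ge>x - x0. W p (s, x) = Some (s', y)" if "x0 \<le> x" for x
    using W_mono[OF 1(1,2) that 1(3)] by force
  then show ?thesis using 1(2) by blast
qed

lemma gr_rch: "gr s p s' \<Longrightarrow> \<exists>x0\<ge>0. \<forall>x\<ge>x0. \<exists>y\<ge>x - x0. rch (s, x) (s', y)"
  using gr_high[of s p s'] unfolding gr_def rch_def by meson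

lemma gr_append: "gr s p s' \<Longrightarrow> gr s' q s'' \<Longrightarrow> gr s (p @ q) s''"
proof -
  assume p: "gr s p s'" and q: "gr s' q s''"
  obtain x0 where x0: "0 \<le> x0" "\<And>x. x0 \<le> x \<Longrightarrow> \<exists>y\<ge>x - x0. W p (s, x) = Some (s', y)" using gr_high[OF p] by blast
  obtain x1 where x1: "0 \<le> x1" "\<And>x. x1 \<le> x \<Longrightarrow> \<exists>y\<ge>x - x1. W q (s', x) = Some (s'', y)" using gr_high[OF q] by blast
  obtain y where y: "x1 \<le> y" "W p (s, x0 + x1) = Some (s', y)" using x0(2)[of "x0 + x1"] x1(1) by auto
  obtain z where z: "W q (s', y) = Some (s'', z)" using x1(2)[OF y(1)] by blast
  have "W (p @ q) (s, x0 + x1) = Some (s'', z)" using y z by (simp add: walk_append)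
  then show ?thesis using p q x0(1) x1(1) unfolding gr_def by (metis add_nonneg_nonneg set_append Un_least)
qed

lemma pump:
  assumes "set c \<subseteq> E" "W c (s, u) = Some (s, v)" "u < v" "0 \<le> u"
  shows "\<exists>z\<ge>Z. rch (s, u) (s, z)"
proof -
  have "\<exists>z\<ge>u + real k * (v - u). rch (s, u) (s, z)" for k
  proof (induction k)
    case 0
    then show ?case using rch_refl by auto
  next
    case (Suc k)
    then obtain z where z: "u + real k * (v - u) \<le> z" "rch (s, u) (s, z)" by blast
    have "0 \<le> real k * (v - u)" using assms(3) by simp
    then have "u \<le> z" using z(1) by linarith
    from W_mono[OF assms(1,4) this assms(2)] obtain z' where z': "W c (s, z) = Some (s, z')" "v + (z - u) \<le> z'" by blast
    have "rch (s, u) (s, z')" by (rule rch_trans[OF z(2) rchI[OF assms(1) z'(1)]])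
    moreover have "u + real (Suc k) * (v - u) = u + real k * (v - u) + (v - u)" by (simp add: algebra_simps)
    then have "u + real (Suc k) * (v - u) \<le> z'" using z(1) z'(2) by linarith
    ultimately show ?case by blast
  qed
  moreover obtain k where "Z - u < real k * (v - u)" using reals_Archimedean3[of "v - u"] assms(3) by auto
  ultimately show ?thesis by (metis diff_less_eq less_le_not_le linorder_not_less order_trans add.commute)
qed

text \<open>Pigeonhole on the states after the prefixes of length 0 to \<open>n\<close>. The cycle
  is thus found near the start: it ends after at most \<open>n\<close> steps.\<close>

lemma repeat:
  assumes "set p \<subseteq> E" "s \<in> V" "W p (s, x) = Some c'" "n \<le> length p"
  obtains p1 c p2 t u v where "p = p1 @ c @ p2" "c \<noteq> []" "length p1 + length c \<le> n"
    "W p1 (s, x) = Some (t, u)" "W c (t, u) = Some (t, v)" "W p2 (t, v) = Some c'"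
proof -
  define g where "g k = fst (the (W (take k p) (s, x)))" for k
  have def: "\<exists>c1. W (take k p) (s, x) = Some c1 \<and> W (drop k p) c1 = Some c'" for k
    using W_append[of "take k p" "drop k p" "(s, x)" c'] assms(3) by simp
  have gV: "g k \<in> V" for k
  proof -
    obtain a b where "W (take k p) (s, x) = Some (a, b)" using def[of k] by auto
    then show ?thesis using W_V[of "take k p" s x a b] assms(1,2) set_take_subset[of k p] by (simp add: g_def)
  qed
  have "card (g ` {0..n}) \<le> card V" by (rule card_mono[OF finV]) (use gV in auto)
  then have "card (g ` {0..n}) < card {0..n}" using cardV by simp
  then have "\<not> inj_on g {0..n}" by (rule pigeonhole)
  then obtain a b where "a \<le> n" "b \<le> n" "a \<noteq> b" "g a = g b" unfolding inj_on_def by auto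
  then obtain i j where ij: "i < j" "j \<le> n" "g i = g j" by (metis linorder_neqE_nat)
  obtain t u where u: "W (take i p) (s, x) = Some (t, u)" using def[of i] by auto
  obtain t' v where v: "W (take j p) (s, x) = Some (t', v)" "W (drop j p) (t', v) = Some c'" using def[of j] by auto
  have "t' = t" using ij(3) u v(1) by (simp add: g_def)
  note v = v[unfolded this]
  have tj: "take j p = take i p @ take (j - i) (drop i p)"
    using ij(1) take_add[of i "j - i" p] by simp
  have "W (take (j - i) (drop i p)) (t, u) = Some (t, v)" using v(1) u unfolding tj by (simp add: walk_append)
  moreover have "p = take i p @ take (j - i) (drop i p) @ drop j p" using tj append_take_drop_id[of j p] by simp
  ultimately show ?thesis using ij assms(4) u v(2)
    by (intro that[of "take i p" "take (j - i) (drop i p)" "drop j p" t u v]) auto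
qed

definition incr :: "'s \<Rightarrow> real \<Rightarrow> nat \<Rightarrow> 's \<Rightarrow> bool" where
  "incr s x N t \<longleftrightarrow> (\<exists>p c u v. set p \<subseteq> E \<and> set c \<subseteq> E \<and> length p \<le> N \<and> length c \<le> N \<and>
     W p (s, x) = Some (t, u) \<and> W c (t, u) = Some (t, v) \<and> u < v)"

lemma incr_high:
  assumes "incr s x N t" "0 \<le> x"
  shows "\<exists>z\<ge>Z. rch (s, x) (t, z)"
proof -
  obtain p c u v where 1: "set p \<subseteq> E" "set c \<subseteq> E" "W p (s, x) = Some (t, u)" "W c (t, u) = Some (t, v)" "u < v"
    using assms(1) unfolding incr_def by blast
  have "0 \<le> u" by (rule W_nonneg[OF 1(1) assms(2) 1(3)])
  from pump[OF 1(2,4,5) this] obtain z where "Z \<le> z" "rch (t, u) (t, z)" by blast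
  then show ?thesis using rch_trans[OF rchI[OF 1(1,3)]] by blast
qed

text \<open>Cutting a nonincreasing cycle out of a run gives a run that reaches at least the same energy.\<close>

lemma shorten:
  assumes "0 \<le> x" "s \<in> V"
  shows "set p \<subseteq> E \<Longrightarrow> W p (s, x) = Some (s', y) \<Longrightarrow>
    (\<exists>p' y'. set p' \<subseteq> E \<and> length p' \<le> n \<and> W p' (s, x) = Some (s', y') \<and> y \<le> y') \<or>
    (\<exists>t q. incr s x n t \<and> gr t q s')"
proof (induction "length p" arbitrary: p y rule: less_induct)
  case less
  show ?case
  proof (cases "length p \<le> n")
    case True
    then show ?thesis using less.prems by blast
  next
    case False
    then have "n \<le> length p" by simp
    from repeat[OF less.prems(1) assms(2) less.prems(2) this] obtain p1 c p2 t u v where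
      1: "p = p1 @ c @ p2" "c \<noteq> []" "length p1 + length c \<le> n"
      "W p1 (s, x) = Some (t, u)" "W c (t, u) = Some (t, v)" "W p2 (t, v) = Some (s', y)" by metis
    have sub: "set p1 \<subseteq> E" "set c \<subseteq> E" "set p2 \<subseteq> E" using less.prems(1) 1(1) by auto
    have u: "0 \<le> u" by (rule W_nonneg[OF sub(1) assms(1) 1(4)])
    have v: "0 \<le> v" by (rule W_nonneg[OF sub(2) u 1(5)])
    show ?thesis
    proof (cases "u < v")
      case True
      have "incr s x n t" unfolding incr_def
        by (rule exI[of _ p1], rule exI[of _ c], rule exI[of _ u], rule exI[of _ v]) (use 1 sub True in auto)
      moreover have "gr t p2 s'" by (rule grI[OF sub(3) v 1(6)])
      ultimately show ?thesis by blast
    next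
      case False
      then have "v \<le> u" by simp
      from W_mono[OF sub(3) v this 1(6)] obtain y1 where y1: "W p2 (t, u) = Some (s', y1)" "y + (u - v) \<le> y1" by blast
      have "W (p1 @ p2) (s, x) = Some (s', y1)" using 1(4) y1(1) by (simp add: walk_append)
      moreover have "length (p1 @ p2) < length p" "set (p1 @ p2) \<subseteq> E" using 1(1,2) sub by auto
      ultimately have "(\<exists>p' y'. set p' \<subseteq> E \<and> length p' \<le> n \<and> W p' (s, x) = Some (s', y') \<and> y1 \<le> y') \<or>
        (\<exists>t q. incr s x n t \<and> gr t q s')" using less.hyps by blast
      moreover have "y \<le> y1" using y1(2) \<open>v \<le> u\<close> by simp
      ultimately show ?thesis by (meson order_trans)
    qed
  qed
qed

text \<open>At large energy every cycle may be cut out, whether it gains or loses, because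
  \<open>gr\<close> does not record amounts.\<close>

lemma gr_short: "s \<in> V \<Longrightarrow> gr s p s' \<Longrightarrow> \<exists>q. gr s q s' \<and> length q \<le> n"
proof (induction "length p" arbitrary: p rule: less_induct)
  case less
  show ?case
  proof (cases "length p \<le> n")
    case True
    then show ?thesis using less.prems by blast
  next
    case False
    then have l: "n \<le> length p" by simp
    obtain x y where p: "set p \<subseteq> E" "0 \<le> x" "W p (s, x) = Some (s', y)" using less.prems(2) unfolding gr_def by blast
    from repeat[OF p(1) less.prems(1) p(3) l] obtain p1 c p2 t u v where
      1: "p = p1 @ c @ p2" "c \<noteq> []" "W p1 (s, x) = Some (t, u)" "W c (t, u) = Some (t, v)" "W p2 (t, v) = Some (s', y)" by metis
    have sub: "set p1 \<subseteq> E" "set c \<subseteq> E" "set p2 \<subseteq> E" using p(1) 1(1) by auto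
    have u: "0 \<le> u" by (rule W_nonneg[OF sub(1) p(2) 1(3)])
    have v: "0 \<le> v" by (rule W_nonneg[OF sub(2) u 1(4)])
    have "gr s (p1 @ p2) s'" by (rule gr_append[OF grI[OF sub(1) p(2) 1(3)] grI[OF sub(3) v 1(5)]])
    moreover have "length (p1 @ p2) < length p" using 1(1,2) by auto
    ultimately show ?thesis using less.hyps less.prems(1) by blast
  qed
qed

lemma incr_V: "incr s x N t \<Longrightarrow> s \<in> V \<Longrightarrow> t \<in> V"
  unfolding incr_def using W_V by blast

lemma incr_le: "incr s x N t \<Longrightarrow> N \<le> N' \<Longrightarrow> incr s x N' t"
  unfolding incr_def by (meson le_trans)

theorem reach_iff:
  assumes "0 \<le> x" "s \<in> V"
  shows "(\<exists>s' y. rch (s, x) (s', y) \<and> s' \<in> F) \<longleftrightarrow>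
    (\<exists>p s' y. set p \<subseteq> E \<and> length p \<le> n \<and> W p (s, x) = Some (s', y) \<and> s' \<in> F) \<or>
    (\<exists>t q s'. incr s x n t \<and> gr t q s' \<and> length q \<le> n \<and> s' \<in> F)" (is "?L \<longleftrightarrow> ?R")
proof
  assume ?L
  then obtain p s' y where p: "set p \<subseteq> E" "W p (s, x) = Some (s', y)" "s' \<in> F" unfolding rch_def by blast
  from shorten[OF assms p(1,2)] show ?R
  proof
    assume "\<exists>t q. incr s x n t \<and> gr t q s'"
    then obtain t q where t: "incr s x n t" "gr t q s'" by blast
    then show ?R using gr_short[OF incr_V[OF t(1) assms(2)] t(2)] p(3) by blast
  qed (use p(3) in blast)
next
  assume ?R
  then show ?L
  proof
    assume "\<exists>t q s'. incr s x n t \<and> gr t q s' \<and> length q \<le> n \<and> s' \<in> F"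
    then obtain t q s' where t: "incr s x n t" "gr t q s'" "s' \<in> F" by blast
    obtain x0 where x0: "\<And>x. x0 \<le> x \<Longrightarrow> \<exists>y. rch (t, x) (s', y)" using gr_rch[OF t(2)] by blast
    obtain z where "x0 \<le> z" "rch (s, x) (t, z)" using incr_high[OF t(1) assms(1)] by blast
    then show ?L using x0 rch_trans t(3) by blast
  qed (auto simp: rch_def)
qed

section \<open>Infinite runs\<close>

definition buechi :: "'s set \<Rightarrow> 's \<times> real \<Rightarrow> bool" where
  "buechi F c \<longleftrightarrow> (\<exists>\<rho>. \<rho> 0 = c \<and> (\<forall>i. \<exists>t\<in>E. st t (\<rho> i) = Some (\<rho> (Suc i))) \<and> (\<exists>\<^sub>\<infinity>i. fst (\<rho> i) \<in> F))"

lemma buechi_Cons: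
  assumes "t \<in> E" "st t c = Some c'" "buechi F c'"
  shows "buechi F c"
proof -
  obtain \<rho> where r: "\<rho> 0 = c'" "\<And>i. \<exists>t\<in>E. st t (\<rho> i) = Some (\<rho> (Suc i))" "\<exists>\<^sub>\<infinity>i. fst (\<rho> i) \<in> F"
    using assms(3) unfolding buechi_def by blast
  define \<sigma> where "\<sigma> i = (case i of 0 \<Rightarrow> c | Suc j \<Rightarrow> \<rho> j)" for i
  have "\<exists>t\<in>E. st t (\<sigma> i) = Some (\<sigma> (Suc i))" for i
    using r(1,2) assms(1,2) by (cases i) (auto simp: \<sigma>_def)
  moreover have "\<exists>\<^sub>\<infinity>i. fst (\<sigma> i) \<in> F"
    unfolding INFM_nat
  proof
    fix m
    obtain k where "m < k" "fst (\<rho> k) \<in> F" using r(3) unfolding INFM_nat by blast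
    then show "\<exists>k>m. fst (\<sigma> k) \<in> F" by (intro exI[of _ "Suc k"]) (simp add: \<sigma>_def)
  qed
  moreover have "\<sigma> 0 = c" by (simp add: \<sigma>_def)
  ultimately show ?thesis unfolding buechi_def by blast
qed

lemma buechi_rch:
  assumes "rch c c'" "buechi F c'"
  shows "buechi F c"
proof -
  have "set p \<subseteq> E \<Longrightarrow> W p c = Some c' \<Longrightarrow> buechi F c" for p
  proof (induction p arbitrary: c)
    case Nil
    then show ?case using assms(2) by simp
  next
    case (Cons t p)
    from Cons.prems(2) obtain c1 where c1: "st t c = Some c1" "W p c1 = Some c'" by (auto simp: bind_eq_Some_conv)
    have "buechi F c1" using Cons.IH[OF _ c1(2)] Cons.prems(1) by simp
    then show ?case using buechi_Cons[OF _ c1(1)] Cons.prems(1) by simp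
  qed
  then show ?thesis using assms(1) unfolding rch_def by blast
qed

lemma buechi_recurrent:
  assumes C: "\<And>c. c \<in> C \<Longrightarrow> fst c \<in> F" "\<And>c. c \<in> C \<Longrightarrow> \<exists>p c'. p \<noteq> [] \<and> set p \<subseteq> E \<and> W p c = Some c' \<and> c' \<in> C"
    and c0: "c0 \<in> C"
  shows "buechi F c0"
proof -
  define good where "good c p \<longleftrightarrow> p \<noteq> [] \<and> set p \<subseteq> E \<and> (\<exists>c'\<in>C. W p c = Some c')" for c p
  define P where "P c = (SOME p. good c p)" for c
  have P: "good c (P c)" if "c \<in> C" for c
    unfolding P_def by (rule someI_ex) (use C(2)[OF that] in \<open>auto simp: good_def\<close>)
  \<comment> \<open>The second component is the part of the chosen path that remains to be taken. It
    is refilled as soon as it is exhausted, so it is never empty.\<close>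
  define f where "f z = (let c' = the (st (hd (snd z)) (fst z)) in
      (c', if tl (snd z) = [] then P c' else tl (snd z)))" for z :: "('s \<times> real) \<times> 't list"
  define \<sigma> where "\<sigma> i = (f ^^ i) (c0, P c0)" for i
  have step: "(\<exists>t\<in>E. st t (fst z) = Some (fst (f z))) \<and> good (fst (f z)) (snd (f z)) \<and>
     (length (snd z) = 1 \<longrightarrow> fst (f z) \<in> C) \<and> (1 < length (snd z) \<longrightarrow> length (snd (f z)) = length (snd z) - 1)"
    if gd: "good (fst z) (snd z)" for z
  proof -
    obtain c q where z: "z = (c, q)" by (cases z)
    obtain t q' where q: "q = t # q'" using gd unfolding good_def z by (cases q) auto
    obtain c' where c': "c' \<in> C" "W q c = Some c'" using gd unfolding good_def z by auto
    from c'(2) obtain c1 where c1: "st t c = Some c1" "W q' c1 = Some c'" unfolding q by (auto simp: bind_eq_Some_conv)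
    have f: "f z = (c1, if q' = [] then P c1 else q')" by (simp add: f_def z q c1(1) Let_def)
    have E: "t \<in> E" "set q' \<subseteq> E" using gd unfolding good_def z q by auto
    show ?thesis
    proof (cases "q' = []")
      case True
      then have "c1 \<in> C" using c1(2) c'(1) by simp
      then show ?thesis using True E c1 P[of c1] unfolding z q f[unfolded z q] by auto
    next
      case False
      then have "good c1 q'" using c1(2) c'(1) E unfolding good_def by blast
      then show ?thesis using False E c1 unfolding z q f[unfolded z q] by auto
    qed
  qed
  have S: "\<sigma> (Suc i) = f (\<sigma> i)" for i by (simp add: \<sigma>_def)
  have g: "good (fst (\<sigma> i)) (snd (\<sigma> i))" for i
  proof (induction i)
    case 0
    then show ?case using P[OF c0] by (simp add: \<sigma>_def)
  next
    case (Suc i)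
    then show ?case using step[of "\<sigma> i"] by (simp add: S)
  qed
  have later: "\<exists>k>i. fst (\<sigma> k) \<in> C" for i
  proof (induction "length (snd (\<sigma> i))" arbitrary: i rule: less_induct)
    case less
    have "snd (\<sigma> i) \<noteq> []" using g[of i] by (simp add: good_def)
    then consider "length (snd (\<sigma> i)) = 1" | "1 < length (snd (\<sigma> i))"
      by (metis One_nat_def Suc_lessI length_greater_0_conv)
    then show ?case
    proof cases
      case 1
      then have "fst (\<sigma> (Suc i)) \<in> C" using step[OF g[of i]] by (simp add: S)
      then show ?thesis by blast
    next
      case 2
      then have "length (snd (\<sigma> (Suc i))) < length (snd (\<sigma> i))" using step[OF g[of i]] by (simp add: S)
      from less[OF this] show ?thesis by (metis Suc_lessD)
    qed
  qed
  show ?thesis unfolding buechi_def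
  proof (intro exI[of _ "fst \<circ> \<sigma>"] conjI allI)
    show "(fst \<circ> \<sigma>) 0 = c0" by (simp add: \<sigma>_def)
    show "\<exists>t\<in>E. st t ((fst \<circ> \<sigma>) i) = Some ((fst \<circ> \<sigma>) (Suc i))" for i
      using step[OF g[of i]] by (simp add: S)
    show "\<exists>\<^sub>\<infinity>i. fst ((fst \<circ> \<sigma>) i) \<in> F"
      unfolding INFM_nat using later C(1) by (metis comp_apply)
  qed
qed

text \<open>Accepting states that recur forever once the energy is large: either by a cycle that
  does not lose at some energy, or by an arbitrary cycle through a state \<open>s'\<close> at which
  a gaining cycle can make up for all losses.\<close>

definition persistent :: "'s set \<Rightarrow> nat \<Rightarrow> 's \<Rightarrow> bool" where
  "persistent F N t \<longleftrightarrow> t \<in> F \<and>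
     ((\<exists>c y z. c \<noteq> [] \<and> set c \<subseteq> E \<and> length c \<le> N \<and> 0 \<le> y \<and> W c (t, y) = Some (t, z) \<and> y \<le> z) \<or>
      (\<exists>s' q1 q2 c y z. gr t q1 s' \<and> gr s' q2 t \<and> length q1 \<le> N \<and> length q2 \<le> N \<and>
         set c \<subseteq> E \<and> length c \<le> N \<and> 0 \<le> y \<and> W c (s', y) = Some (s', z) \<and> y < z))"

lemma buechi_cycle:
  assumes "t \<in> F" "c \<noteq> []" "set c \<subseteq> E" "0 \<le> y" "W c (t, y) = Some (t, z)" "y \<le> z" "y \<le> w"
  shows "buechi F (t, w)"
proof (rule buechi_recurrent[where C = "{t} \<times> {y..}"])
  fix d assume "d \<in> {t} \<times> {y..}"
  then obtain w' where d: "d = (t, w')" "y \<le> w'" by auto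
  obtain w'' where w'': "W c (t, w') = Some (t, w'')" "z + (w' - y) \<le> w''" using W_mono[OF assms(3,4) d(2) assms(5)] by blast
  then have "(t, w'') \<in> {t} \<times> {y..}" using assms(6) d(2) by simp
  then show "\<exists>p c'. p \<noteq> [] \<and> set p \<subseteq> E \<and> W p d = Some c' \<and> c' \<in> {t} \<times> {y..}"
    using w''(1) assms(2,3) unfolding d(1) by blast
qed (use assms in auto)

lemma persistent_buechi:
  assumes "persistent F N t"
  shows "\<exists>y0. \<forall>y\<ge>y0. buechi F (t, y)"
proof -
  have tF: "t \<in> F" using assms by (simp add: persistent_def)
  from assms consider c y z where "c \<noteq> []" "set c \<subseteq> E" "0 \<le> y" "W c (t, y) = Some (t, z)" "y \<le> z"
    | s' q1 q2 c y z where "gr t q1 s'" "gr s' q2 t" "set c \<subseteq> E" "0 \<le> y" "W c (s', y) = Some (s', z)" "y < z"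
    unfolding persistent_def by blast
  then show ?thesis
  proof cases
    case 1
    then show ?thesis using buechi_cycle[OF tF 1] by blast
  next
    case 2
    obtain x1 where x1: "0 \<le> x1" "\<And>x. x1 \<le> x \<Longrightarrow> \<exists>w\<ge>x - x1. W q1 (t, x) = Some (s', w)" using gr_high[OF 2(1)] by blast
    obtain x2 where x2: "0 \<le> x2" "\<And>x. x2 \<le> x \<Longrightarrow> \<exists>w\<ge>x - x2. rch (s', x) (t, w)" using gr_rch[OF 2(2)] by blast
    have q1: "set q1 \<subseteq> E" using 2(1) by (simp add: gr_def)
    have ne: "c \<noteq> []" using 2(5,6) by auto
    \<comment> \<open>From energy \<open>?Y\<close> on, \<open>q1\<close> loses at most
      \<open>x1\<close> and so reaches \<open>s'\<close> with at least \<open>y\<close>, where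
      \<open>c\<close> gains. Pumping up to \<open>x2 + ?Y\<close> pays for the way back, which
      loses at most \<open>x2\<close>.\<close>
    let ?Y = "x1 + y"
    have "buechi F (t, w0)" if "?Y \<le> w0" for w0
    proof (rule buechi_recurrent[where C = "{t} \<times> {?Y..}"])
      fix d assume "d \<in> {t} \<times> {?Y..}"
      then obtain w where d: "d = (t, w)" "?Y \<le> w" by auto
      obtain a where a: "w - x1 \<le> a" "W q1 (t, w) = Some (s', a)" using x1(2)[of w] d(2) 2(4) by auto
      have ya: "y \<le> a" using a(1) d(2) by simp
      obtain b where b: "W c (s', a) = Some (s', b)" "z + (a - y) \<le> b" using W_mono[OF 2(3,4) ya 2(5)] by blast
      have ab: "a < b" "0 \<le> a" "0 \<le> b" "y \<le> b" using b(2) 2(4,6) ya by auto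
      obtain b' where b': "W c (s', b) = Some (s', b')" "z + (b - y) \<le> b'" using W_mono[OF 2(3,4) ab(4) 2(5)] by blast
      have "b < b'" using b'(2) 2(6) by simp
      from pump[OF 2(3) b'(1) this ab(3)] obtain e where e: "x2 + ?Y \<le> e" "rch (s', b) (s', e)" by blast
      obtain w' where w': "e - x2 \<le> w'" "rch (s', e) (t, w')" using x2(2)[of e] e(1) x1(1) 2(4) by auto
      obtain q where q: "set q \<subseteq> E" "W q (s', b) = Some (t, w')" using rch_trans[OF e(2) w'(2)] unfolding rch_def by blast
      \<comment> \<open>One explicit round of \<open>c\<close> makes the path nonempty;
        \<open>q1\<close> and \<open>q\<close> may both be empty.\<close>
      have "W (q1 @ c @ q) d = Some (t, w')" unfolding d(1) using a(2) b(1) q(2) by (simp add: walk_append)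
      moreover have "(t, w') \<in> {t} \<times> {?Y..}" using w'(1) e(1) by simp
      ultimately show "\<exists>p c'. p \<noteq> [] \<and> set p \<subseteq> E \<and> W p d = Some c' \<and> c' \<in> {t} \<times> {?Y..}"
        using ne q1 2(3) q(1) by (intro exI[of _ "q1 @ c @ q"]) auto
    qed (use tF that in auto)
    then show ?thesis by blast
  qed
qed

lemma run_segment:
  assumes "\<And>i. \<exists>t\<in>E. st t (\<rho> i) = Some (\<rho> (Suc i))" "i \<le> j"
  shows "\<exists>p. length p = j - i \<and> set p \<subseteq> E \<and> W p (\<rho> i) = Some (\<rho> j)"
  using assms(2)
proof (induction j rule: dec_induct)
  case base
  show ?case by (rule exI[of _ "[]"]) simp
next
  case (step j)
  then obtain p where p: "length p = j - i" "set p \<subseteq> E" "W p (\<rho> i) = Some (\<rho> j)" by blast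
  obtain t where t: "t \<in> E" "st t (\<rho> j) = Some (\<rho> (Suc j))" using assms(1) by blast
  show ?case using p t step(1) by (intro exI[of _ "p @ [t]"]) (simp add: walk_append Suc_diff_le)
qed

text \<open>If all short cycles at \<open>t\<close> lost energy from \<open>Y\<close> on, they would lose at least \<open>\<delta> > 0\<close> each time,
  because the loss of a cycle grows as the energy drops.\<close>

lemma recurrent_cycle:
  assumes "t \<in> V" "z 0 \<le> Y" and z: "\<And>i. 0 \<le> z i"
    and cyc: "\<And>i. \<exists>p. p \<noteq> [] \<and> set p \<subseteq> E \<and> W p (t, z i) = Some (t, z (Suc i))"
  shows "(\<exists>c v. c \<noteq> [] \<and> set c \<subseteq> E \<and> length c \<le> Suc n \<and> W c (t, Y) = Some (t, v) \<and> Y \<le> v) \<or>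
    (\<exists>s' q. incr t Y (Suc n) s' \<and> gr s' q t)"
proof (rule ccontr)
  assume neg: "\<not> ?thesis"
  define D where "D = {c. set c \<subseteq> E \<and> length c \<le> Suc n} \<inter> {c. c \<noteq> [] \<and> (\<exists>v. W c (t, Y) = Some (t, v))}"
  have finD: "finite D" unfolding D_def using finite_lists_length_le[OF finE] by blast
  \<comment> \<open>The least loss at \<open>Y\<close> among the finitely many short cycles. The
    element 1 keeps the set nonempty in case there is no such cycle.\<close>
  define \<delta> where "\<delta> = Min (insert 1 ((\<lambda>c. Y - snd (the (W c (t, Y)))) ` D))"
  have "\<delta> \<in> insert 1 ((\<lambda>c. Y - snd (the (W c (t, Y)))) ` D)" unfolding \<delta>_def by (rule Min_in) (use finD in auto)
  then have pos: "0 < \<delta>" using neg unfolding D_def by force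
  have Ym: "\<delta> \<le> Y - v" if "c \<noteq> []" "set c \<subseteq> E" "length c \<le> Suc n" "W c (t, Y) = Some (t, v)" for c v
  proof -
    have "c \<in> D" using that by (auto simp: D_def)
    then have "Y - v \<in> (\<lambda>c. Y - snd (the (W c (t, Y)))) ` D" using that(4) by (intro image_eqI[of _ _ c]) auto
    then show ?thesis unfolding \<delta>_def using finD by (intro Min_le) auto
  qed
  have "z i \<le> Y - real i * \<delta>" for i
  proof (induction i)
    case 0
    then show ?case using assms(2) by simp
  next
    case (Suc i)
    have "0 \<le> real i * \<delta>" using pos by simp
    then have zY: "z i \<le> Y" using Suc by linarith
    obtain p where p: "p \<noteq> []" "set p \<subseteq> E" "W p (t, z i) = Some (t, z (Suc i))" using cyc by blast
    \<comment> \<open>The first transition is kept aside, so that shortening the rest cannot result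
      in the empty cycle. Hence the bound \<open>Suc n\<close>.\<close>
    obtain e p' where e: "p = e # p'" using p(1) by (cases p) auto
    obtain x1 where x1: "src e = t" "ef e (z i) = Some x1" "W p' (tgt e, x1) = Some (t, z (Suc i))"
      using p(3) unfolding e W_Cons by blast
    have E: "e \<in> E" "set p' \<subseteq> E" using p(2) e by auto
    have x10: "0 \<le> x1" by (rule nn[OF E(1) z x1(2)])
    from shorten[OF x10 tgtV[OF E(1)] E(2) x1(3)] show ?case
    proof
      assume "\<exists>p'' y'. set p'' \<subseteq> E \<and> length p'' \<le> n \<and> W p'' (tgt e, x1) = Some (t, y') \<and> z (Suc i) \<le> y'"
      then obtain p'' y' where p'': "set p'' \<subseteq> E" "length p'' \<le> n" "W p'' (tgt e, x1) = Some (t, y')" "z (Suc i) \<le> y'" by blast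
      have s: "set (e # p'') \<subseteq> E" using E p'' by simp
      have "W (e # p'') (t, z i) = Some (t, y')" unfolding W_Cons using x1 p'' by blast
      from W_mono[OF s z zY this] obtain v where v: "W (e # p'') (t, Y) = Some (t, v)" "y' + (Y - z i) \<le> v" by blast
      \<comment> \<open>The cycle is moved up to \<open>Y\<close>, where its loss is at least
        \<open>\<delta>\<close>; at \<open>z i\<close> its loss is no smaller.\<close>
      have "\<delta> \<le> Y - v" by (rule Ym[OF _ s _ v(1)]) (use p'' in auto)
      then have "z (Suc i) \<le> z i - \<delta>" using v(2) p''(4) by linarith
      moreover have "Y - real (Suc i) * \<delta> = Y - real i * \<delta> - \<delta>" by (simp add: algebra_simps)
      ultimately show ?thesis using Suc by linarith
    next
      assume "\<exists>s' q. incr (tgt e) x1 n s' \<and> gr s' q t"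
      then obtain s' q where s': "incr (tgt e) x1 n s'" "gr s' q t" by blast
      obtain p1 c u v where 1: "set p1 \<subseteq> E" "set c \<subseteq> E" "length p1 \<le> n" "length c \<le> n"
        "W p1 (tgt e, x1) = Some (s', u)" "W c (s', u) = Some (s', v)" "u < v" using s'(1) unfolding incr_def by blast
      have s: "set (e # p1) \<subseteq> E" using E 1 by simp
      have "W (e # p1) (t, z i) = Some (s', u)" unfolding W_Cons using x1 1 by blast
      from W_mono[OF s z zY this] obtain u' where u': "W (e # p1) (t, Y) = Some (s', u')" "u + (Y - z i) \<le> u'" by blast
      have "0 \<le> u" by (rule W_nonneg[OF 1(1) x10 1(5)])
      moreover have "u \<le> u'" using u'(2) zY by simp
      ultimately obtain v' where v': "W c (s', u') = Some (s', v')" "v + (u' - u) \<le> v'" using W_mono[OF 1(2) _ _ 1(6)] by blast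
      have "incr t Y (Suc n) s'" unfolding incr_def
        by (rule exI[of _ "e # p1"], rule exI[of _ c], rule exI[of _ u'], rule exI[of _ v']) (use s 1 u' v' in auto)
      then show ?thesis using neg s'(2) by blast
    qed
  qed
  moreover obtain i where "Y < real i * \<delta>" using reals_Archimedean3[OF pos] by blast
  ultimately show False using z[of i] by (smt (verit))
qed

text \<open>In the first case a cycle repeats at finite energy, in the second the energy is made
  unbounded beforehand. There the gaining cycle may be met only after a path of length
  \<open>n\<close> to the recurring state and up to \<open>Suc n\<close> further transitions, whence
  \<open>2 * n + 1\<close>.\<close>

theorem buechi_iff:
  assumes "0 \<le> x" "s \<in> V"
  defines "N \<equiv> 2 * n + 1"
  shows "buechi F (s, x) \<longleftrightarrow>
    (\<exists>p t u c v. set p \<subseteq> E \<and> set c \<subseteq> E \<and> length p \<le> N \<and> length c \<le> N \<and> W p (s, x) = Some (t, u) \<and> t \<in> F \<and>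
        c \<noteq> [] \<and> W c (t, u) = Some (t, v) \<and> u \<le> v) \<or>
    (\<exists>s1 q t. incr s x N s1 \<and> gr s1 q t \<and> length q \<le> N \<and> persistent F N t)" (is "?L \<longleftrightarrow> ?R1 \<or> ?R2")
proof
  assume ?L
  then obtain \<rho> where r: "\<rho> 0 = (s, x)" "\<And>i. \<exists>t\<in>E. st t (\<rho> i) = Some (\<rho> (Suc i))" "\<exists>\<^sub>\<infinity>i. fst (\<rho> i) \<in> F"
    unfolding buechi_def by blast
  have rV: "fst (\<rho> i) \<in> V \<and> 0 \<le> snd (\<rho> i)" for i
  proof -
    obtain p where p: "set p \<subseteq> E" "W p (\<rho> 0) = Some (\<rho> i)" using run_segment[of \<rho> 0 i, OF r(2)] by blast
    obtain a b where ab: "\<rho> i = (a, b)" by (cases "\<rho> i")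
    show ?thesis using W_V[OF p(1) assms(2)] W_nonneg[OF p(1) assms(1)] p(2) unfolding r(1) ab by auto
  qed
  have inf: "infinite {i. fst (\<rho> i) \<in> F}" using r(3) by (simp add: frequently_cofinite)
  have "finite ((\<lambda>i. fst (\<rho> i)) ` {i. fst (\<rho> i) \<in> F})" by (rule finite_subset[OF _ finV]) (use rV in auto)
  from pigeonhole_infinite[OF inf this] obtain i0 where i0: "fst (\<rho> i0) \<in> F"
    "infinite {i \<in> {i. fst (\<rho> i) \<in> F}. fst (\<rho> i) = fst (\<rho> i0)}" by auto
  define t where "t = fst (\<rho> i0)"
  have "{i \<in> {i. fst (\<rho> i) \<in> F}. fst (\<rho> i) = fst (\<rho> i0)} = {i. fst (\<rho> i) = t}" using i0(1) by (auto simp: t_def)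
  then have infK: "infinite {i. fst (\<rho> i) = t}" using i0(2) by simp
  define k where "k i = enumerate {i. fst (\<rho> i) = t} i" for i
  define z where "z i = snd (\<rho> (k i))" for i
  have rk: "\<rho> (k i) = (t, z i)" for i
    using enumerate_in_set[OF infK, of i] by (simp add: z_def k_def prod_eq_iff)
  have km: "k i < k (Suc i)" for i unfolding k_def using enumerate_mono[OF _ infK] by simp
  have z0: "0 \<le> z i" for i using rV by (simp add: z_def)
  have tV: "t \<in> V" using rV by (simp add: t_def)
  have tF: "t \<in> F" using i0 by (simp add: t_def)
  have cyc: "\<exists>p. p \<noteq> [] \<and> set p \<subseteq> E \<and> W p (t, z i) = Some (t, z (Suc i))" for i
  proof -
    obtain p where p: "length p = k (Suc i) - k i" "set p \<subseteq> E" "W p (\<rho> (k i)) = Some (\<rho> (k (Suc i)))"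
      using run_segment[of \<rho> "k i" "k (Suc i)", OF r(2)] km[of i] by auto
    have "p \<noteq> []" using p(1) km[of i] by auto
    then show ?thesis using p unfolding rk by blast
  qed
  have Nn: "Suc n \<le> N" "n \<le> N" by (simp_all add: N_def)
  \<comment> \<open>With \<open>Y = z 0\<close>, either outcome of \<open>recurrent_cycle\<close>
    shows that \<open>t\<close> is persistent.\<close>
  have pers: "persistent F N t"
    using recurrent_cycle[where z = z, OF tV order_refl z0 cyc]
  proof
    assume "\<exists>c v. c \<noteq> [] \<and> set c \<subseteq> E \<and> length c \<le> Suc n \<and> W c (t, z 0) = Some (t, v) \<and> z 0 \<le> v"
    then show ?thesis using tF z0[of 0] Nn(1) unfolding persistent_def by (meson le_trans)
  next
    assume "\<exists>s' q. incr t (z 0) (Suc n) s' \<and> gr s' q t"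
    then obtain s' q where s': "incr t (z 0) (Suc n) s'" "gr s' q t" by blast
    obtain q2 where q2: "gr s' q2 t" "length q2 \<le> n" using gr_short[OF incr_V[OF s'(1) tV] s'(2)] by blast
    obtain p c u v where 1: "set p \<subseteq> E" "set c \<subseteq> E" "length p \<le> Suc n" "length c \<le> Suc n"
        "W p (t, z 0) = Some (s', u)" "W c (s', u) = Some (s', v)" "u < v" using s'(1) unfolding incr_def by blast
    have "gr t p s'" by (rule grI[OF 1(1) z0 1(5)])
    moreover have "0 \<le> u" by (rule W_nonneg[OF 1(1) z0 1(5)])
    moreover have "length p \<le> N" "length q2 \<le> N" "length c \<le> N" using 1(3,4) q2(2) Nn by auto
    ultimately show ?thesis using tF q2(1) 1(2,6,7) unfolding persistent_def by blast
  qed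
  obtain p0 where p0: "set p0 \<subseteq> E" "W p0 (s, x) = Some (t, z 0)" using run_segment[of \<rho> 0 "k 0", OF r(2)] unfolding r(1) rk by blast
  from shorten[OF assms(1,2) p0] show "?R1 \<or> ?R2"
  proof
    assume "\<exists>s1 q. incr s x n s1 \<and> gr s1 q t"
    then obtain s1 q where s1: "incr s x n s1" "gr s1 q t" by blast
    obtain q' where "gr s1 q' t" "length q' \<le> n" using gr_short[OF incr_V[OF s1(1) assms(2)] s1(2)] by blast
    then have ?R2 using incr_le[OF s1(1) Nn(2)] pers Nn(2) by (meson le_trans)
    then show ?thesis by blast
  next
    assume "\<exists>p' y'. set p' \<subseteq> E \<and> length p' \<le> n \<and> W p' (s, x) = Some (t, y') \<and> z 0 \<le> y'"
    then obtain p' y where p': "set p' \<subseteq> E" "length p' \<le> n" "W p' (s, x) = Some (t, y)" "z 0 \<le> y" by blast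
    \<comment> \<open>A second use with \<open>Y = y\<close>, the energy reached by the short path:
      a cycle that does not lose is wanted at exactly this energy, and \<open>y\<close> is at least
      \<open>z 0\<close>.\<close>
    from recurrent_cycle[where z = z, OF tV p'(4) z0 cyc] show ?thesis
    proof
      assume "\<exists>c v. c \<noteq> [] \<and> set c \<subseteq> E \<and> length c \<le> Suc n \<and> W c (t, y) = Some (t, v) \<and> y \<le> v"
      then obtain c v where "c \<noteq> []" "set c \<subseteq> E" "length c \<le> Suc n" "W c (t, y) = Some (t, v)" "y \<le> v" by blast
      moreover have "length c \<le> N" "length p' \<le> N" using calculation(3) p'(2) Nn by auto
      ultimately have ?R1 using p' tF by blast
      then show ?thesis by blast
    next
      assume "\<exists>s' q. incr t y (Suc n) s' \<and> gr s' q t"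
      then obtain s' q where s': "incr t y (Suc n) s'" "gr s' q t" by blast
      obtain q' where q': "gr s' q' t" "length q' \<le> n" using gr_short[OF incr_V[OF s'(1) tV] s'(2)] by blast
      obtain p c u v where 1: "set p \<subseteq> E" "set c \<subseteq> E" "length p \<le> Suc n" "length c \<le> Suc n"
        "W p (t, y) = Some (s', u)" "W c (s', u) = Some (s', v)" "u < v" using s'(1) unfolding incr_def by blast
      have "W (p' @ p) (s, x) = Some (s', u)" using p'(3) 1(5) by (simp add: walk_append)
      moreover have "length (p' @ p) \<le> N" "length c \<le> N" "set (p' @ p) \<subseteq> E" using 1 p' by (auto simp: N_def)
      ultimately have "incr s x N s'" unfolding incr_def using 1 by blast
      then have ?R2 using pers q' Nn(2) by (meson le_trans)
      then show ?thesis by blast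
    qed
  qed
next
  assume "?R1 \<or> ?R2"
  then show ?L
  proof
    assume ?R1
    then obtain p t u c v where 1: "set p \<subseteq> E" "set c \<subseteq> E" "W p (s, x) = Some (t, u)" "t \<in> F"
      "c \<noteq> []" "W c (t, u) = Some (t, v)" "u \<le> v" by blast
    have "0 \<le> u" by (rule W_nonneg[OF 1(1) assms(1) 1(3)])
    then have "buechi F (t, u)" using buechi_cycle[OF 1(4,5,2) _ 1(6,7)] by simp
    then show ?L by (rule buechi_rch[OF rchI[OF 1(1,3)]])
  next
    assume ?R2
    then obtain s1 q t where 1: "incr s x N s1" "gr s1 q t" "persistent F N t" by blast
    obtain y0 where y0: "\<And>y. y0 \<le> y \<Longrightarrow> buechi F (t, y)" using persistent_buechi[OF 1(3)] by blast
    obtain x0 where x0: "\<And>x. x0 \<le> x \<Longrightarrow> \<exists>y\<ge>x - x0. rch (s1, x) (t, y)" using gr_rch[OF 1(2)] by blast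
    obtain w where w: "max x0 (x0 + y0) \<le> w" "rch (s, x) (s1, w)" using incr_high[OF 1(1) assms(1)] by blast
    obtain y where "w - x0 \<le> y" "rch (s1, w) (t, y)" using x0[of w] w(1) by auto
    then show ?L using buechi_rch[OF rch_trans[OF w(2)]] y0[of y] w(1) by auto
  qed
qed

lemma rch_upward: "rch (s, x) (s', y) \<Longrightarrow> 0 \<le> x \<Longrightarrow> x \<le> x' \<Longrightarrow> \<exists>y'. rch (s, x') (s', y')"
  unfolding rch_def using W_mono by blast

text \<open>Read off from the finite witnesses of \<open>buechi_iff\<close>, each of which is lifted
  by \<open>W_mono\<close>, instead of lifting an infinite run step by step.\<close>

lemma buechi_upward:
  assumes "buechi F (s, x)" "0 \<le> x" "s \<in> V" "x \<le> x'"
  shows "buechi F (s, x')"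
proof -
  have incr: "incr s x' N t" if ic: "incr s x N t" for N t
  proof -
    obtain p c u v where 1: "set p \<subseteq> E" "set c \<subseteq> E" "length p \<le> N" "length c \<le> N"
        "W p (s, x) = Some (t, u)" "W c (t, u) = Some (t, v)" "u < v" using ic unfolding incr_def by blast
    obtain u' where u': "W p (s, x') = Some (t, u')" "u + (x' - x) \<le> u'" using W_mono[OF 1(1) assms(2,4) 1(5)] by blast
    have "u \<le> u'" using u'(2) assms(4) by simp
    then obtain v' where "W c (t, u') = Some (t, v')" "v + (u' - u) \<le> v'"
      using W_mono[OF 1(2) W_nonneg[OF 1(1) assms(2) 1(5)] _ 1(6)] by blast
    moreover have "u' < v'" using calculation(2) 1(7) by simp
    ultimately show ?thesis unfolding incr_def using 1 u' by blast
  qed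
  have x': "0 \<le> x'" using assms by simp
  from assms(1)[unfolded buechi_iff[OF assms(2,3)]]
  consider p t u c v where "set p \<subseteq> E" "set c \<subseteq> E" "length p \<le> 2 * n + 1" "length c \<le> 2 * n + 1" "W p (s, x) = Some (t, u)" "t \<in> F"
      "c \<noteq> []" "W c (t, u) = Some (t, v)" "u \<le> v"
    | s1 q t where "incr s x (2 * n + 1) s1" "gr s1 q t" "length q \<le> 2 * n + 1" "persistent F (2 * n + 1) t"
    by blast
  then show ?thesis
  proof cases
    case 1
    obtain u' where u': "W p (s, x') = Some (t, u')" "u + (x' - x) \<le> u'" using W_mono[OF 1(1) assms(2,4) 1(5)] by blast
    have "u \<le> u'" using u'(2) assms(4) by simp
    then obtain v' where "W c (t, u') = Some (t, v')" "v + (u' - u) \<le> v'"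
      using W_mono[OF 1(2) W_nonneg[OF 1(1) assms(2) 1(5)] _ 1(8)] by blast
    moreover have "u' \<le> v'" using calculation(2) 1(9) by simp
    ultimately show ?thesis using 1 u' unfolding buechi_iff[OF x' assms(3)] by blast
  next
    case 2
    then show ?thesis using incr unfolding buechi_iff[OF x' assms(3)] by blast
  qed
qed

end

section \<open>Piecewise affine functions\<close>

type_synonym piece = "rat \<times> rat option \<times> rat \<times> rat"
type_synonym trn = "nat \<times> pw_rep \<times> nat"

abbreviation px :: "piece \<Rightarrow> rat" where "px y \<equiv> fst y"
abbreviation pv :: "piece \<Rightarrow> rat option" where "pv y \<equiv> fst (snd y)"
abbreviation pa :: "piece \<Rightarrow> rat" where "pa y \<equiv> fst (snd (snd y))"
abbreviation pb :: "piece \<Rightarrow> rat" where "pb y \<equiv> snd (snd (snd y))"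

text \<open>Later pieces overwrite earlier ones, so right ends of intervals are not tested. The only
  tests compare \<open>x\<close> with break points, and the fold is of the kind for which programs
  exist.\<close>

definition ev_step :: "real \<Rightarrow> real option \<Rightarrow> piece \<Rightarrow> real option" where
  "ev_step x acc y = (if of_rat (px y) < x then Some (of_rat (pa y) * x + of_rat (pb y))
     else if x < of_rat (px y) then acc else map_option of_rat (pv y))"

definition ev :: "pw_rep \<Rightarrow> real \<Rightarrow> real option" where
  "ev r x = foldl (ev_step x) None r"

text \<open>Since the pieces are affine with slope at least 1, it suffices to compare the value at a
  break point with the one-sided limits there: the right one here, the left one in
  \<open>next_ok\<close>. These are finitely many rational inequalities, which a program can
  check.\<close>

definition piece_ok :: "piece \<Rightarrow> bool" where
  "piece_ok y \<longleftrightarrow> 1 \<le> pa y \<and> 0 \<le> pa y * px y + pb y \<and>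
     (case pv y of None \<Rightarrow> True | Some q \<Rightarrow> 0 \<le> q \<and> q \<le> pa y * px y + pb y)"

text \<open>From the second break point on a value must be present, since smaller energies already
  belong to the domain.\<close>

definition next_ok :: "piece \<Rightarrow> piece \<Rightarrow> bool" where
  "next_ok z y \<longleftrightarrow> px z < px y \<and> (case pv y of None \<Rightarrow> False | Some q \<Rightarrow> pa z * px y + pb z \<le> q)"

definition link_ok :: "piece option \<Rightarrow> piece \<Rightarrow> bool" where
  "link_ok prev y \<longleftrightarrow> piece_ok y \<and> (case prev of None \<Rightarrow> 0 \<le> px y | Some z \<Rightarrow> next_ok z y)"

fun chain_ok :: "piece option \<Rightarrow> pw_rep \<Rightarrow> bool" where
  "chain_ok prev [] = True"
| "chain_ok prev (y # r) = (link_ok prev y \<and> chain_ok (Some y) r)"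

lemma chain_ok_nth: "chain_ok prev r \<longleftrightarrow>
   (\<forall>j<length r. link_ok (case j of 0 \<Rightarrow> prev | Suc i \<Rightarrow> Some (r ! i)) (r ! j))"
proof (induction r arbitrary: prev)
  case (Cons y r)
  have "(\<forall>j<length (y # r). link_ok (case j of 0 \<Rightarrow> prev | Suc i \<Rightarrow> Some ((y # r) ! i)) ((y # r) ! j)) \<longleftrightarrow>
    link_ok prev y \<and> (\<forall>j<length r. link_ok (Some ((y # r) ! j)) (r ! j))"
    by (auto simp: less_Suc_eq_0_disj)
  also have "(\<forall>j<length r. link_ok (Some ((y # r) ! j)) (r ! j)) \<longleftrightarrow>
     (\<forall>j<length r. link_ok (case j of 0 \<Rightarrow> Some y | Suc i \<Rightarrow> Some (r ! i)) (r ! j))"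
    by (auto simp: nth_Cons split: nat.splits)
  finally show ?case using Cons[of "Some y"] by simp
qed simp

lemma chain_sorted: "chain_ok prev r \<Longrightarrow> sorted_wrt (<) (map fst r)"
proof (induction r arbitrary: prev)
  case (Cons y r)
  have IH: "sorted_wrt (<) (map fst r)" using Cons.IH[of "Some y"] Cons.prems by simp
  show ?case
  proof (cases r)
    case (Cons z r')
    then have "px y < px z" using Cons.prems by (simp add: link_ok_def next_ok_def)
    then show ?thesis using IH Cons by force
  qed simp
qed simp

lemma foldl_ev_skip: "\<forall>y\<in>set r. x < of_rat (px y) \<Longrightarrow> foldl (ev_step x) acc r = acc"
  by (induction r) (auto simp: ev_step_def)

text \<open>A recursive form of the evaluation for inductions over the pieces: looking one break
  point ahead decides whether the first piece is responsible.\<close>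

lemma ev_Cons:
  assumes "sorted_wrt (<) (map fst (y # r))"
  shows "ev (y # r) x = (if r \<noteq> [] \<and> of_rat (px (hd r)) \<le> x then ev r x else ev_step x None y)"
proof (cases r)
  case Nil
  then show ?thesis by (simp add: ev_def)
next
  case (Cons z r')
  show ?thesis
  proof (cases "of_rat (px z) \<le> x")
    case True
    then have "ev_step x (ev_step x None y) z = ev_step x None z" by (auto simp: ev_step_def)
    then show ?thesis using Cons True by (simp add: ev_def)
  next
    case False
    have "\<forall>u\<in>set r. px z \<le> px u" using assms Cons by auto
    then have "\<forall>u\<in>set r. (of_rat (px z) :: real) \<le> of_rat (px u)" by (simp add: of_rat_less_eq)
    moreover have "x < of_rat (px z)" using False by simp
    ultimately have "\<forall>u\<in>set r. x < of_rat (px u)" by (meson less_le_trans)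
    then show ?thesis using Cons False foldl_ev_skip[of r x] by (simp add: ev_def)
  qed
qed

lemma ev_nth:
  assumes "sorted_wrt (<) (map fst r)" "j < length r" "of_rat (px (r ! j)) \<le> x"
    "Suc j < length r \<Longrightarrow> x < of_rat (px (r ! Suc j))"
  shows "ev r x = ev_step x None (r ! j)"
  using assms
proof (induction r arbitrary: j)
  case (Cons y r)
  have s: "sorted_wrt (<) (map fst r)" using Cons.prems(1) by simp
  show ?case
  proof (cases j)
    case 0
    then have "\<not> (r \<noteq> [] \<and> of_rat (px (hd r)) \<le> x)" using Cons.prems(4) by (cases r) auto
    then show ?thesis using 0 unfolding ev_Cons[OF Cons.prems(1)] by auto
  next
    case (Suc i)
    then have i: "i < length r" "of_rat (px (r ! i)) \<le> x" using Cons.prems by auto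
    have "px (hd r) \<le> px (r ! i)"
    proof (cases i)
      case 0
      then show ?thesis using i by (cases r) auto
    next
      case (Suc k)
      then have "map fst r ! 0 < map fst r ! i" using sorted_wrt_nth_less[OF s, of 0 i] i by simp
      moreover have "map fst r ! i = px (r ! i)" "map fst r ! 0 = px (hd r)" using i by (simp, cases r) auto
      ultimately show ?thesis by simp
    qed
    then have "(of_rat (px (hd r)) :: real) \<le> of_rat (px (r ! i))" by (simp add: of_rat_less_eq)
    then have "r \<noteq> [] \<and> of_rat (px (hd r)) \<le> x" using i by auto
    moreover have "ev r x = ev_step x None (r ! i)"
      by (rule Cons.IH[OF s i]) (use Cons.prems(4) Suc in auto)
    ultimately show ?thesis using Suc unfolding ev_Cons[OF Cons.prems(1)] by simp
  qed
qed simp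

lemma ev_before:
  assumes "r \<noteq> []" "sorted_wrt (<) (map fst r)" "x < of_rat (px (hd r))"
  shows "ev r x = None"
proof -
  obtain y r' where r: "r = y # r'" using assms(1) by (cases r) auto
  have "\<forall>u\<in>set r. px y \<le> px u" using assms(2) r by auto
  then have "\<forall>u\<in>set r. (of_rat (px y) :: real) \<le> of_rat (px u)" by (simp add: of_rat_less_eq)
  moreover have "x < of_rat (px y)" using assms(3) r by simp
  ultimately have "\<forall>u\<in>set r. x < of_rat (px u)" by (meson less_le_trans)
  then show ?thesis unfolding ev_def by (rule foldl_ev_skip)
qed

lemma locate: "r \<noteq> [] \<Longrightarrow> x < of_rat (px (hd r)) \<or>
   (\<exists>j<length r. of_rat (px (r ! j)) \<le> x \<and> (Suc j < length r \<longrightarrow> x < (of_rat (px (r ! Suc j)) :: real)))"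
proof (induction r)
  case (Cons y r)
  show ?case
  proof (cases "r = [] \<or> x < of_rat (px (hd r))")
    case True
    then show ?thesis by (cases "x < of_rat (px y)") (auto simp: hd_conv_nth)
  next
    case False
    then obtain j where "j < length r" "of_rat (px (r ! j)) \<le> x" "Suc j < length r \<longrightarrow> x < of_rat (px (r ! Suc j))"
      using Cons.IH by blast
    then show ?thesis by (intro disjI2 exI[of _ "Suc j"]) auto
  qed
qed simp

lemma of_rat_lin: "of_rat (a * x + b) = (of_rat a * of_rat x + of_rat b :: real)"
  by (simp add: of_rat_add of_rat_mult)

lemma ev_step_SomeD:
  assumes "piece_ok y" "of_rat (px y) \<le> x" "ev_step x None y = Some u"
  shows "0 \<le> u" "u \<le> of_rat (pa y) * x + of_rat (pb y)"
proof -
  have a: "(1::real) \<le> of_rat (pa y)" using assms(1) unfolding piece_ok_def by (metis of_rat_1 of_rat_less_eq)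
  have b: "(0::real) \<le> of_rat (pa y) * of_rat (px y) + of_rat (pb y)"
    using assms(1) unfolding piece_ok_def of_rat_lin[symmetric] by (metis of_rat_0 of_rat_less_eq)
  have m: "of_rat (pa y) * of_rat (px y) \<le> of_rat (pa y) * x" using a assms(2) by (intro mult_left_mono) auto
  have "0 \<le> u \<and> u \<le> of_rat (pa y) * x + of_rat (pb y)"
  proof (cases "of_rat (px y) < x")
    case True
    then have u: "u = of_rat (pa y) * x + of_rat (pb y)" using assms(3) by (simp add: ev_step_def)
    then show ?thesis using b m by linarith
  next
    case False
    then have x: "x = of_rat (px y)" using assms(2) by simp
    then obtain q where q: "pv y = Some q" "u = of_rat q" using assms(3) by (auto simp: ev_step_def)
    then have "0 \<le> q" "q \<le> pa y * px y + pb y" using assms(1) by (auto simp: piece_ok_def)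
    then have "0 \<le> u" "u \<le> of_rat (pa y * px y + pb y)" using q by (auto simp: of_rat_less_eq)
    then show ?thesis unfolding of_rat_lin x by auto
  qed
  then show "0 \<le> u" "u \<le> of_rat (pa y) * x + of_rat (pb y)" by auto
qed

lemma ev_nonneg: "chain_ok prev r \<Longrightarrow> ev r x = Some u \<Longrightarrow> 0 \<le> u"
proof (induction r arbitrary: prev)
  case Nil
  then show ?case by (simp add: ev_def)
next
  case (Cons y r)
  have p: "piece_ok y" using Cons.prems(1) by (simp add: link_ok_def)
  show ?case
  proof (cases "r \<noteq> [] \<and> of_rat (px (hd r)) \<le> x")
    case True
    then show ?thesis using Cons.IH[of "Some y"] Cons.prems unfolding ev_Cons[OF chain_sorted[OF Cons.prems(1)]] by simp
  next
    case False
    then have e: "ev_step x None y = Some u" using Cons.prems unfolding ev_Cons[OF chain_sorted[OF Cons.prems(1)]] by auto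
    then have "of_rat (px y) \<le> x" by (auto simp: ev_step_def split: if_splits)
    then show ?thesis using ev_step_SomeD[OF p _ e] by simp
  qed
qed

lemma ev_defined:
  assumes "chain_ok prev (y # r)"
  shows "ev (y # r) x \<noteq> None \<longleftrightarrow> (if pv y = None then of_rat (px y) < x else of_rat (px y) \<le> x)"
  using assms
proof (induction r arbitrary: prev y)
  case Nil
  then show ?case by (auto simp: ev_def ev_step_def)
next
  case (Cons z r)
  have n: "next_ok y z" using Cons.prems by (simp add: link_ok_def)
  then have z: "px y < px z" "pv z \<noteq> None" by (auto simp: next_ok_def split: option.splits)
  have yz: "(of_rat (px y) :: real) < of_rat (px z)" using z(1) by (simp add: of_rat_less)
  have IH: "ev (z # r) x \<noteq> None \<longleftrightarrow> of_rat (px z) \<le> x" using Cons.IH[of "Some y" z] Cons.prems z(2) by simp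
  show ?case
  proof (cases "of_rat (px z) \<le> x")
    case True
    then have "ev (y # z # r) x = ev (z # r) x" unfolding ev_Cons[OF chain_sorted[OF Cons.prems]] by simp
    then show ?thesis using IH True yz by auto
  next
    case False
    then have "ev (y # z # r) x = ev_step x None y" unfolding ev_Cons[OF chain_sorted[OF Cons.prems]] by simp
    then show ?thesis by (auto simp: ev_step_def)
  qed
qed

text \<open>Within a piece the slope is at least 1, and at a break point the function can only jump
  upwards: left limit, value and right limit are in increasing order.\<close>

lemma ev_expanding:
  assumes "chain_ok prev r" "ev r x = Some u" "x \<le> x'"
  shows "\<exists>u'. ev r x' = Some u' \<and> u + (x' - x) \<le> u'"
  using assms
proof (induction r arbitrary: prev x u)
  case Nil
  then show ?case by (simp add: ev_def)
next
  case (Cons y r)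
  note C = ev_Cons[OF chain_sorted[OF Cons.prems(1)]]
  have p: "piece_ok y" and r: "chain_ok (Some y) r" using Cons.prems(1) by (auto simp: link_ok_def)
  have a: "(1::real) \<le> of_rat (pa y)" using p unfolding piece_ok_def by (metis of_rat_1 of_rat_less_eq)
  have grow: "of_rat (pa y) * c + (d - c) \<le> of_rat (pa y) * d" if "c \<le> d" for c d :: real
    using mult_right_mono[of 1 "of_rat (pa y)" "d - c"] a that by (simp add: algebra_simps)
  show ?case
  proof (cases "r \<noteq> [] \<and> of_rat (px (hd r)) \<le> x")
    case True
    then have "ev (y # r) x = ev r x" "ev (y # r) x' = ev r x'" using Cons.prems(3) unfolding C by auto
    then show ?thesis using Cons.IH[OF r _ Cons.prems(3)] Cons.prems(2) by simp
  next
    case False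
    then have e: "ev_step x None y = Some u" using Cons.prems(2) unfolding C by auto
    then have yx: "of_rat (px y) \<le> x" by (auto simp: ev_step_def split: if_splits)
    note u = ev_step_SomeD[OF p yx e]
    show ?thesis
    proof (cases "r \<noteq> [] \<and> of_rat (px (hd r)) \<le> x'")
      case True
      then obtain z r' where z: "r = z # r'" by (cases r) auto
      have n: "next_ok y z" using r z by (simp add: link_ok_def)
      then obtain q where q: "pv z = Some q" "pa y * px z + pb y \<le> q" by (auto simp: next_ok_def split: option.splits)
      have xz: "x < of_rat (px z)" using False z by auto
      have "ev r (of_rat (px z)) = Some (of_rat q)"
      proof -
        have "ev r (of_rat (px z)) = ev_step (of_rat (px z)) None z"
        proof -
          have "\<not> (r' \<noteq> [] \<and> of_rat (px (hd r')) \<le> (of_rat (px z) :: real))"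
            using chain_sorted[OF r] z by (cases r') (auto simp: of_rat_less_eq)
          then show ?thesis using ev_Cons[of z r' "of_rat (px z)"] chain_sorted[OF r] z by auto
        qed
        then show ?thesis using q by (simp add: ev_step_def)
      qed
      \<comment> \<open>The way from \<open>x\<close> to \<open>x'\<close> is split at the break
        point \<open>px z\<close>: the first piece covers the part before it, and the induction
        hypothesis, started at its value \<open>q\<close>, the part after it.\<close>
      from Cons.IH[OF r this] True z obtain u' where u': "ev r x' = Some u'" "of_rat q + (x' - of_rat (px z)) \<le> u'" by auto
      have "of_rat (pa y) * of_rat (px z) + of_rat (pb y) \<le> (of_rat q :: real)"
        using q(2) unfolding of_rat_lin[symmetric] by (simp add: of_rat_less_eq)
      moreover have "of_rat (pa y) * x + (of_rat (px z) - x) \<le> of_rat (pa y) * of_rat (px z)" using grow xz by simp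
      ultimately have "u + (x' - x) \<le> u'" using u u'(2) by linarith
      then show ?thesis using u'(1) True unfolding C by simp
    next
      case F: False
      then have e': "ev (y # r) x' = ev_step x' None y" unfolding C by auto
      show ?thesis
      proof (cases "x = x'")
        case True
        then show ?thesis using e e' by simp
      next
        case False
        then have "of_rat (px y) < x'" using yx Cons.prems(3) by simp
        then have "ev_step x' None y = Some (of_rat (pa y) * x' + of_rat (pb y))" by (simp add: ev_step_def)
        moreover have "u + (x' - x) \<le> of_rat (pa y) * x' + of_rat (pb y)"
          using u grow[OF Cons.prems(3)] by linarith
        ultimately show ?thesis using e' by simp
      qed
    qed
  qed
qed

section \<open>Representations and the functions that they represent\<close>

definition rep_ok :: "pw_rep \<Rightarrow> bool" where
  "rep_ok r \<longleftrightarrow> r \<noteq> [] \<and> chain_ok None r"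

definition fun_of :: "pw_rep \<Rightarrow> energy \<Rightarrow> energy" where
  "fun_of r e = (case e of None \<Rightarrow> None | Some c \<Rightarrow>
     if c = top then Some top else map_option ennreal (ev r (enn2real c)))"

lemma fun_of_real: "0 \<le> x \<Longrightarrow> fun_of r (energy_of_real x) = map_option ennreal (ev r x)"
  by (simp add: fun_of_def)

lemma rep_ok_represents:
  assumes "rep_ok r"
  shows "pw_represents r (fun_of r) \<and> ext_energy_fun (fun_of r)"
proof -
  obtain y r' where r: "r = y # r'" using assms by (cases r) (auto simp: rep_ok_def)
  have ch: "chain_ok None r" using assms by (simp add: rep_ok_def)
  have so: "sorted_wrt (<) (map fst r)" by (rule chain_sorted[OF ch])
  have y0: "0 \<le> px y" using ch r by (simp add: link_ok_def)
  then have y0': "(0::real) \<le> of_rat (px y)" by simp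
  have dom: "fun_of r e \<noteq> None \<longleftrightarrow> (if pv y = None then energy_of_real (of_rat (px y)) < e else energy_of_real (of_rat (px y)) \<le> e)" for e
  proof (cases e)
    case None
    then show ?thesis by (simp add: fun_of_def)
  next
    case (Some c)
    show ?thesis
    proof (cases "c = top")
      case True
      then show ?thesis using Some by (simp add: fun_of_def top.not_eq_extremum[symmetric])
    next
      case False
      then obtain x where x: "0 \<le> x" "c = ennreal x" by (cases c) auto
      have "fun_of r e \<noteq> None \<longleftrightarrow> ev r x \<noteq> None" using Some x by (simp add: fun_of_def)
      then show ?thesis using ev_defined[OF ch[unfolded r], of x] Some x y0' unfolding r
        by (auto simp: ennreal_less_iff split: if_splits)
    qed
  qed
  have link: "link_ok (case j of 0 \<Rightarrow> None | Suc i \<Rightarrow> Some (r ! i)) (r ! j)" if "j < length r" for j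
    using ch that unfolding chain_ok_nth by blast
  have pos: "0 \<le> px (r ! j)" if "j < length r" for j
  proof (cases j)
    case 0
    then show ?thesis using y0 r by simp
  next
    case (Suc k)
    then have "map fst r ! 0 < map fst r ! j" using sorted_wrt_nth_less[OF so, of 0 j] that by simp
    moreover have "map fst r ! j = px (r ! j)" using that by simp
    moreover have "map fst r ! 0 = px y" using r by simp
    ultimately show ?thesis using y0 by simp
  qed
  have nxt: "(of_rat (px (r ! j)) :: real) < of_rat (px (r ! Suc j))" if "Suc j < length r" for j
    using sorted_wrt_nth_less[OF so, of j "Suc j"] that by (simp add: of_rat_less)
  have "pw_represents r (fun_of r)"
    unfolding pw_represents_def
  proof (intro conjI allI impI)
    show "r \<noteq> []" "sorted_wrt (<) (map fst r)" "0 \<le> fst (hd r)" using r so y0 by auto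
    show "(\<forall>x. fun_of r x \<noteq> None \<longleftrightarrow> energy_of_real (of_rat (fst (hd r))) \<le> x) \<or>
      (\<forall>x. fun_of r x \<noteq> None \<longleftrightarrow> energy_of_real (of_rat (fst (hd r))) < x)"
      using dom unfolding r by (cases "pv y = None") auto
    fix j assume j: "j < length r"
    obtain xj v a b where e: "r ! j = (xj, v, a, b)" by (cases "r ! j")
    have p: "piece_ok (r ! j)" using link[OF j] by (simp add: link_ok_def)
    have x0: "(0::real) \<le> of_rat xj" using pos[OF j] e by simp
    have 1: "\<forall>q. v = Some q \<longrightarrow> 0 \<le> q" "1 \<le> a" using p unfolding e piece_ok_def by auto
    have "ev r (of_rat xj) = map_option of_rat v"
      using ev_nth[OF so j, of "of_rat xj"] e nxt[of j] by (simp add: ev_step_def)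
    then have 2: "fun_of r (energy_of_real (of_rat xj)) = map_option (\<lambda>q. ennreal (of_rat q)) v"
      using fun_of_real[OF x0, of r] by (simp add: option.map_comp comp_def)
    have 3: "0 \<le> of_rat a * x + of_rat b \<and> fun_of r (energy_of_real x) = energy_of_real (of_rat a * x + of_rat b)"
      if "of_rat xj < x" "Suc j < length r \<longrightarrow> x < of_rat (fst (r ! Suc j))" for x
    proof -
      have x: "0 \<le> x" using x0 that(1) by linarith
      have s: "ev_step x None (r ! j) = Some (of_rat a * x + of_rat b)" using e that by (simp add: ev_step_def)
      have "ev r x = Some (of_rat a * x + of_rat b)" using ev_nth[OF so j, of x] e that s by simp
      then show ?thesis using fun_of_real[OF x, of r] ev_step_SomeD(1)[OF p _ s] e that by simp
    qed
    show "case r ! j of (xj, v, a, b) \<Rightarrow> (\<forall>q. v = Some q \<longrightarrow> 0 \<le> q) \<and>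
        fun_of r (energy_of_real (of_rat xj)) = map_option (\<lambda>q. ennreal (of_rat q)) v \<and> 1 \<le> a \<and>
        (\<forall>x. of_rat xj < x \<and> (Suc j < length r \<longrightarrow> x < of_rat (fst (r ! Suc j))) \<longrightarrow>
           0 \<le> of_rat a * x + of_rat b \<and> fun_of r (energy_of_real x) = energy_of_real (of_rat a * x + of_rat b))"
      unfolding e prod.case using 1 2 3 by blast
  qed
  moreover have "ext_energy_fun (fun_of r)"
    unfolding ext_energy_fun_def
  proof (intro conjI allI impI)
    show "fun_of r None = None" by (simp add: fun_of_def)
    show "(\<forall>x. fun_of r x = None) \<or> fun_of r (Some top) = Some top" by (simp add: fun_of_def)
    fix x1 x2 :: real assume x: "0 \<le> x1 \<and> x1 \<le> x2"
    show "map_option (\<lambda>y. y + ennreal (x2 - x1)) (fun_of r (energy_of_real x1)) \<le> fun_of r (energy_of_real x2)"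
    proof (cases "ev r x1")
      case None
      then show ?thesis using x by (simp add: fun_of_real)
    next
      case (Some u)
      from ev_expanding[OF ch Some, of x2] x obtain u' where u': "ev r x2 = Some u'" "u + (x2 - x1) \<le> u'" by blast
      have "0 \<le> u" by (rule ev_nonneg[OF ch Some])
      then have "ennreal u + ennreal (x2 - x1) \<le> ennreal u'" using u'(2) x by (simp add: ennreal_plus[symmetric] ennreal_leI del: ennreal_plus)
      then show ?thesis using Some u'(1) x by (simp add: fun_of_real)
    qed
  qed
  ultimately show ?thesis by blast
qed

lemma represents_ev:
  assumes "pw_represents r f" "0 \<le> x"
  shows "f (energy_of_real x) = map_option ennreal (ev r x)"
proof -
  have r: "r \<noteq> []" "sorted_wrt (<) (map fst r)" "0 \<le> px (hd r)" using assms(1) by (auto simp: pw_represents_def)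
  have r0: "(0::real) \<le> of_rat (px (hd r))" using r(3) by simp
  from locate[OF r(1), of x] show ?thesis
  proof
    assume lt: "x < of_rat (px (hd r))"
    then have "\<not> energy_of_real (of_rat (px (hd r))) \<le> energy_of_real x" using assms(2) r0 by simp
    then have "f (energy_of_real x) = None" using assms(1) unfolding pw_represents_def by (metis less_imp_le)
    then show ?thesis using ev_before[OF r(1,2) lt] by simp
  next
    assume "\<exists>j<length r. of_rat (px (r ! j)) \<le> x \<and> (Suc j < length r \<longrightarrow> x < of_rat (px (r ! Suc j)))"
    then obtain j where j: "j < length r" "of_rat (px (r ! j)) \<le> x" "Suc j < length r \<longrightarrow> x < of_rat (px (r ! Suc j))" by blast
    obtain xj v a b where e: "r ! j = (xj, v, a, b)" by (cases "r ! j")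
    have rj: "f (energy_of_real (of_rat xj)) = map_option (\<lambda>q. ennreal (of_rat q)) v"
      "\<And>x. of_rat xj < x \<and> (Suc j < length r \<longrightarrow> x < of_rat (fst (r ! Suc j))) \<Longrightarrow>
         f (energy_of_real x) = energy_of_real (of_rat a * x + of_rat b)"
      using assms(1) j(1) e unfolding pw_represents_def by auto
    have ev: "ev r x = ev_step x None (r ! j)" by (rule ev_nth[OF r(2) j(1,2)]) (use j(3) in blast)
    show ?thesis
    proof (cases "of_rat xj < x")
      case True
      then show ?thesis using rj(2)[of x] j(3) ev e by (simp add: ev_step_def)
    next
      case False
      then have "x = of_rat xj" using j(2) e by simp
      then show ?thesis using rj(1) ev e by (simp add: ev_step_def option.map_comp comp_def)
    qed
  qed
qed

text \<open>Carries inequalities from the open intervals, where the affine formula gives the values,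
  to the break points by continuity.\<close>

lemma affine_limit:
  fixes l u \<alpha> \<beta> :: real
  assumes "l < u" "\<And>x. l < x \<Longrightarrow> x < u \<Longrightarrow> \<alpha> * x + \<beta> \<le> 0"
  shows "\<alpha> * l + \<beta> \<le> 0" "\<alpha> * u + \<beta> \<le> 0"
proof -
  have c: "continuous_on S (\<lambda>x. \<alpha> * x + \<beta>)" for S by (intro continuous_intros)
  have "((\<lambda>x. \<alpha> * x + \<beta>) \<longlongrightarrow> \<alpha> * l + \<beta>) (at_right l)" by (intro tendsto_intros)
  then show "\<alpha> * l + \<beta> \<le> 0"
  proof (rule tendsto_upperbound)
    show "\<forall>\<^sub>F x in at_right l. \<alpha> * x + \<beta> \<le> 0"
      unfolding eventually_at_right_field using assms by (intro exI[of _ u]) auto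
  qed simp
  have "((\<lambda>x. \<alpha> * x + \<beta>) \<longlongrightarrow> \<alpha> * u + \<beta>) (at_left u)" by (intro tendsto_intros)
  then show "\<alpha> * u + \<beta> \<le> 0"
  proof (rule tendsto_upperbound)
    show "\<forall>\<^sub>F x in at_left u. \<alpha> * x + \<beta> \<le> 0"
      unfolding eventually_at_left_field using assms by (intro exI[of _ l]) auto
  qed simp
qed

text \<open>Together with \<open>rep_ok_represents\<close>: the checkable condition
  \<open>rep_ok\<close> describes exactly the representations of extended energy functions, so
  invalid inputs can be recognised.\<close>

lemma represents_rep_ok:
  assumes "pw_represents r f" "ext_energy_fun f"
  shows "rep_ok r"
proof -
  have r: "r \<noteq> []" "sorted_wrt (<) (map fst r)" "0 \<le> px (hd r)" using assms(1) by (auto simp: pw_represents_def)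
  have pos: "(0::real) \<le> of_rat (px (r ! j))" if "j < length r" for j
  proof (cases j)
    case 0
    then show ?thesis using r by (simp add: hd_conv_nth)
  next
    case (Suc k)
    then have "map fst r ! 0 < map fst r ! j" using sorted_wrt_nth_less[OF r(2), of 0 j] that by simp
    moreover have "map fst r ! j = px (r ! j)" using that by simp
    moreover have "map fst r ! 0 = px (hd r)" using r(1) by (cases r) auto
    ultimately show ?thesis using r(3) by simp
  qed
  have lt: "(of_rat (px (r ! j)) :: real) < of_rat (px (r ! Suc j))" if "Suc j < length r" for j
    using sorted_wrt_nth_less[OF r(2), of j "Suc j"] that by (simp add: of_rat_less)
  have mono: "map_option (\<lambda>y. y + ennreal (x2 - x1)) (f (energy_of_real x1)) \<le> f (energy_of_real x2)"
    if "0 \<le> x1" "x1 \<le> x2" for x1 x2 using assms(2) that unfolding ext_energy_fun_def by blast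
  \<comment> \<open>The last piece is unbounded; any point to the right of its break point will do
    for taking limits.\<close>
  define ub where "ub j = (if Suc j < length r then of_rat (px (r ! Suc j)) else of_rat (px (r ! j)) + 1 :: real)" for j
  have piece: "(\<forall>q. pv (r ! j) = Some q \<longrightarrow> 0 \<le> q)"
      "f (energy_of_real (of_rat (px (r ! j)))) = map_option (\<lambda>q. ennreal (of_rat q)) (pv (r ! j))" "1 \<le> pa (r ! j)"
      "\<And>x. of_rat (px (r ! j)) < x \<Longrightarrow> x < ub j \<Longrightarrow> 0 \<le> of_rat (pa (r ! j)) * x + of_rat (pb (r ! j)) \<and>
           f (energy_of_real x) = energy_of_real (of_rat (pa (r ! j)) * x + of_rat (pb (r ! j)))"
    if "j < length r" for j
  proof -
    have A: "case r ! j of (xj, v, a, b) \<Rightarrow> (\<forall>q. v = Some q \<longrightarrow> 0 \<le> q) \<and>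
        f (energy_of_real (of_rat xj)) = map_option (\<lambda>q. ennreal (of_rat q)) v \<and> 1 \<le> a \<and>
        (\<forall>x. of_rat xj < x \<and> (Suc j < length r \<longrightarrow> x < of_rat (fst (r ! Suc j))) \<longrightarrow>
           0 \<le> of_rat a * x + of_rat b \<and> f (energy_of_real x) = energy_of_real (of_rat a * x + of_rat b))"
      by (rule assms(1)[unfolded pw_represents_def, THEN conjunct2, THEN conjunct2, THEN conjunct2, THEN conjunct2,
            THEN spec, THEN mp, OF that])
    have u: "x < ub j \<Longrightarrow> Suc j < length r \<longrightarrow> x < of_rat (fst (r ! Suc j))" for x
      unfolding ub_def by (cases "Suc j < length r") simp_all
    note A = A[unfolded case_prod_beta]
    show "(\<forall>q. pv (r ! j) = Some q \<longrightarrow> 0 \<le> q)"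
      "f (energy_of_real (of_rat (px (r ! j)))) = map_option (\<lambda>q. ennreal (of_rat q)) (pv (r ! j))" "1 \<le> pa (r ! j)"
      using A by blast+
    show "0 \<le> of_rat (pa (r ! j)) * x + of_rat (pb (r ! j)) \<and>
           f (energy_of_real x) = energy_of_real (of_rat (pa (r ! j)) * x + of_rat (pb (r ! j)))"
      if "of_rat (px (r ! j)) < x" "x < ub j" for x
      using A that(1) u[OF that(2)] by blast
  qed
  have ub: "of_rat (px (r ! j)) < ub j" for j using lt by (auto simp: ub_def)
  have ok: "piece_ok (r ! j)" if j: "j < length r" for j
  proof -
    let ?x = "of_rat (px (r ! j)) :: real" and ?a = "of_rat (pa (r ! j)) :: real" and ?b = "of_rat (pb (r ! j)) :: real"
    have "- ?a * ?x + - ?b \<le> 0"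
      by (rule affine_limit(1)[OF ub]) (use piece(4)[OF j] in force)
    then have 1: "0 \<le> ?a * ?x + ?b" by simp
    have 2: "of_rat q \<le> ?a * ?x + ?b" if q: "pv (r ! j) = Some q" for q
    proof -
      have q0: "0 \<le> (of_rat q :: real)" using piece(1)[OF j] q by simp
      \<comment> \<open>Expansion from \<open>?x\<close> to a nearby \<open>x\<close>, rewritten as
        an affine inequality in \<open>x\<close>; then \<open>x\<close> tends to \<open>?x\<close>
        from the right.\<close>
      have "(1 - ?a) * ?x + (of_rat q - ?x - ?b) \<le> 0"
      proof (rule affine_limit(1)[OF ub])
        fix x assume x: "?x < x" "x < ub j"
        have "map_option (\<lambda>y. y + ennreal (x - ?x)) (f (energy_of_real ?x)) \<le> f (energy_of_real x)"
          using x pos[OF j] by (intro mono) auto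
        then have "ennreal (of_rat q) + ennreal (x - ?x) \<le> ennreal (?a * x + ?b)"
          using piece(2)[OF j] piece(4)[OF j x] q by simp
        then have "of_rat q + (x - ?x) \<le> ?a * x + ?b"
          using q0 x piece(4)[OF j x] by (simp add: ennreal_plus[symmetric] del: ennreal_plus)
        then show "(1 - ?a) * x + (of_rat q - ?x - ?b) \<le> 0" by (simp add: algebra_simps)
      qed
      then show ?thesis by (simp add: algebra_simps)
    qed
    have nn1: "0 \<le> pa (r ! j) * px (r ! j) + pb (r ! j)" using 1 unfolding of_rat_lin[symmetric] by simp
    have nn2: "q \<le> pa (r ! j) * px (r ! j) + pb (r ! j)" if "pv (r ! j) = Some q" for q
      using 2[OF that] unfolding of_rat_lin[symmetric] by (simp add: of_rat_less_eq)
    show ?thesis using nn1 nn2 piece(1,3)[OF j] by (auto simp: piece_ok_def split: option.splits)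
  qed
  have nx: "next_ok (r ! j) (r ! Suc j)" if j: "Suc j < length r" for j
  proof -
    let ?x = "of_rat (px (r ! j)) :: real" and ?a = "of_rat (pa (r ! j)) :: real" and ?b = "of_rat (pb (r ! j)) :: real"
    let ?z = "of_rat (px (r ! Suc j)) :: real"
    have j': "j < length r" using j by simp
    have u: "ub j = ?z" using j by (simp add: ub_def)
    have le: "map_option (\<lambda>y. y + ennreal (?z - x)) (Some (ennreal (?a * x + ?b))) \<le> map_option (\<lambda>q. ennreal (of_rat q)) (pv (r ! Suc j))"
      if x: "?x < x" "x < ?z" for x
    proof -
      have "map_option (\<lambda>y. y + ennreal (?z - x)) (f (energy_of_real x)) \<le> f (energy_of_real ?z)"
        by (rule mono) (use x pos[OF j'] in linarith)+
      then show ?thesis using piece(4)[OF j' x(1)] x(2) piece(2)[OF j] unfolding u by simp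
    qed
    \<comment> \<open>The function is defined at the midpoint of the piece, and by expansion also at
      the larger energy \<open>?z\<close>.\<close>
    obtain q where q: "pv (r ! Suc j) = Some q"
      using le[of "(?x + ?z) / 2"] lt[OF j] by (cases "pv (r ! Suc j)") auto
    have q0: "0 \<le> (of_rat q :: real)" using piece(1)[OF j] q by simp
    \<comment> \<open>Expansion from \<open>x\<close> to \<open>?z\<close>, where \<open>x\<close>
      tends to \<open>?z\<close> from the left.\<close>
    have "(?a - 1) * ?z + (?b + ?z - of_rat q) \<le> 0"
    proof (rule affine_limit(2)[OF lt[OF j]])
      fix x assume x: "?x < x" "x < ?z"
      have "ennreal (?a * x + ?b) + ennreal (?z - x) \<le> ennreal (of_rat q)" using le[OF x] q by simp
      moreover have "0 \<le> ?a * x + ?b" using piece(4)[OF j' x(1)] x(2) unfolding u by simp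
      ultimately have "?a * x + ?b + (?z - x) \<le> of_rat q" using x q0 by (simp add: ennreal_plus[symmetric] del: ennreal_plus)
      then show "(?a - 1) * x + (?b + ?z - of_rat q) \<le> 0" by (simp add: algebra_simps)
    qed
    then have "?a * ?z + ?b \<le> of_rat q" by (simp add: algebra_simps)
    then have "pa (r ! j) * px (r ! Suc j) + pb (r ! j) \<le> q" unfolding of_rat_lin[symmetric] by (simp add: of_rat_less_eq)
    then show ?thesis using lt[OF j] q by (simp add: next_ok_def of_rat_less)
  qed
  have "link_ok (case j of 0 \<Rightarrow> None | Suc i \<Rightarrow> Some (r ! i)) (r ! j)" if "j < length r" for j
    using ok[OF that] nx r that by (cases j) (auto simp: link_ok_def hd_conv_nth)
  then show ?thesis using r(1) unfolding rep_ok_def chain_ok_nth by blast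
qed

section \<open>Symbolic runs\<close>

text \<open>An oracle tells for which \<open>(\<alpha>, \<beta>)\<close> the value \<open>\<alpha> x + \<beta>\<close> is positive, where \<open>x\<close> is a
  real number, a rational \<open>q\<close> or \<open>q\<close> plus an infinitesimal, or infinity.\<close>

type_synonym affine = "rat \<times> rat"
type_synonym orc = "affine \<Rightarrow> bool"

definition val :: "real \<Rightarrow> affine \<Rightarrow> real" where
  "val x ab = of_rat (fst ab) * x + of_rat (snd ab)"

definition posr :: "real \<Rightarrow> orc" where
  "posr x ab \<longleftrightarrow> 0 < val x ab"

definition posi :: orc where
  "posi ab \<longleftrightarrow> 0 < fst ab \<or> (fst ab = 0 \<and> 0 < snd ab)"

definition posd :: "bool \<Rightarrow> rat \<Rightarrow> orc" where
  "posd e q ab \<longleftrightarrow> 0 < fst ab * q + snd ab \<or> (fst ab * q + snd ab = 0 \<and> e \<and> 0 < fst ab)"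

text \<open>Oracles answer positivity only. The opposite comparison is positivity of the negated
  difference, and equality is the failure of both. A value at a break point is the constant
  expression, with slope 0.\<close>

definition sev_step :: "orc \<Rightarrow> affine \<Rightarrow> affine option \<Rightarrow> piece \<Rightarrow> affine option" where
  "sev_step \<sigma> ab acc y = (if \<sigma> (fst ab, snd ab - px y) then Some (pa y * fst ab, pa y * snd ab + pb y)
     else if \<sigma> (- fst ab, px y - snd ab) then acc else map_option (Pair 0) (pv y))"

definition sev :: "orc \<Rightarrow> pw_rep \<Rightarrow> affine \<Rightarrow> affine option" where
  "sev \<sigma> r ab = foldl (sev_step \<sigma> ab) None r"

definition sst :: "orc \<Rightarrow> trn \<Rightarrow> nat \<times> affine \<Rightarrow> (nat \<times> affine) option" where
  "sst \<sigma> t c = (if fst t = fst c then map_option (Pair (snd (snd t))) (sev \<sigma> (fst (snd t)) (snd c)) else None)"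

abbreviation swalk :: "orc \<Rightarrow> trn list \<Rightarrow> nat \<times> affine \<Rightarrow> (nat \<times> affine) option" where
  "swalk \<sigma> \<equiv> walk (sst \<sigma>)"

definition rst :: "trn \<Rightarrow> nat \<times> real \<Rightarrow> (nat \<times> real) option" where
  "rst t c = (if fst t = fst c then map_option (Pair (snd (snd t))) (ev (fst (snd t)) (snd c)) else None)"

lemma sev_real: "map_option (val x) (sev (posr x) r ab) = ev r (val x ab)"
proof -
  have v: "posr x (fst ab, snd ab - q) \<longleftrightarrow> of_rat q < val x ab" "posr x (- fst ab, q - snd ab) \<longleftrightarrow> val x ab < of_rat q" for q
    by (auto simp: posr_def val_def of_rat_diff of_rat_minus)
  have "map_option (val x) (sev_step (posr x) ab acc y) = ev_step (val x ab) (map_option (val x) acc) y" for acc y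
    unfolding sev_step_def ev_step_def v
    by (auto simp: val_def of_rat_mult of_rat_add algebra_simps option.map_comp comp_def)
  then have "map_option (val x) (foldl (sev_step (posr x) ab) acc r) = foldl (ev_step (val x ab)) (map_option (val x) acc) r" for acc
    by (induction r arbitrary: acc) simp_all
  then show ?thesis by (simp add: sev_def ev_def)
qed

lemma swalk_real: "walk rst p (s, val x ab) = map_option (map_prod id (val x)) (swalk (posr x) p (s, ab))"
proof (induction p arbitrary: s ab)
  case (Cons t p)
  show ?case
  proof (cases "fst t = s")
    case True
    show ?thesis
    proof (cases "sev (posr x) (fst (snd t)) ab")
      case None
      then have "ev (fst (snd t)) (val x ab) = None" using sev_real[of x "fst (snd t)" ab] by simp
      then show ?thesis using None by (simp add: rst_def sst_def)
    next
      case (Some ab')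
      then have "ev (fst (snd t)) (val x ab) = Some (val x ab')" using sev_real[of x "fst (snd t)" ab] by simp
      then show ?thesis using Some Cons[of "snd (snd t)" ab'] True by (simp add: rst_def sst_def)
    qed
  next
    case False
    then show ?thesis by (simp add: rst_def sst_def)
  qed
qed simp

text \<open>The fraction may be unreduced; in this way the bounds just multiply under arithmetic
  operations.\<close>

definition small :: "nat \<Rightarrow> rat \<Rightarrow> bool" where
  "small H q \<longleftrightarrow> (\<exists>n d. q = of_int n / of_int d \<and> \<bar>n\<bar> \<le> int H \<and> 0 < d \<and> d \<le> int H)"

lemma smallI: "q = of_int n / of_int d \<Longrightarrow> \<bar>n\<bar> \<le> int H \<Longrightarrow> 0 < d \<Longrightarrow> d \<le> int H \<Longrightarrow> small H q"
  unfolding small_def by blast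

lemma smallE:
  assumes "small H q"
  obtains n d where "q = of_int n / of_int d" "\<bar>n\<bar> \<le> int H" "0 < d" "d \<le> int H" "0 < H"
proof -
  obtain n d where 1: "q = of_int n / of_int d" "\<bar>n\<bar> \<le> int H" "0 < d" "d \<le> int H" using assms unfolding small_def by blast
  moreover have "0 < H" using 1(3,4) by simp
  ultimately show ?thesis by (rule that)
qed

lemma small_mono: "small H q \<Longrightarrow> H \<le> K \<Longrightarrow> small K q"
proof (elim smallE)
  fix n d assume "H \<le> K" "q = of_int n / of_int d" "\<bar>n\<bar> \<le> int H" "0 < d" "d \<le> int H"
  then show "small K q" by (intro smallI[of q n d]) auto
qed

lemma small_01: "1 \<le> H \<Longrightarrow> small H 0" "1 \<le> H \<Longrightarrow> small H 1"
  by (auto intro: smallI[of _ 0 1] smallI[of _ 1 1])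

lemma small_uminus: "small H q \<Longrightarrow> small H (- q)"
  by (elim smallE) (auto intro!: smallI[of _ "- _"])

lemma small_mult: "small H p \<Longrightarrow> small K q \<Longrightarrow> small (H * K) (p * q)"
proof (elim smallE)
  fix a b c d
  assume 1: "p = of_int a / of_int b" "\<bar>a\<bar> \<le> int H" "0 < b" "b \<le> int H"
    "q = of_int c / of_int d" "\<bar>c\<bar> \<le> int K" "0 < d" "d \<le> int K"
  show ?thesis
  proof (rule smallI)
    show "p * q = of_int (a * c) / of_int (b * d)" using 1 by simp
    show "\<bar>a * c\<bar> \<le> int (H * K)" using 1 by (simp add: abs_mult mult_mono)
    show "0 < b * d" "b * d \<le> int (H * K)" using 1 by (simp_all add: mult_mono)
  qed
qed

lemma small_add: "small H p \<Longrightarrow> small K q \<Longrightarrow> small (2 * H * K) (p + q)"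
proof (elim smallE)
  fix a b c d
  assume 1: "p = of_int a / of_int b" "\<bar>a\<bar> \<le> int H" "0 < b" "b \<le> int H"
    "q = of_int c / of_int d" "\<bar>c\<bar> \<le> int K" "0 < d" "d \<le> int K"
  have m: "\<bar>a\<bar> * d \<le> int H * int K" "\<bar>c\<bar> * b \<le> int K * int H" "b * d \<le> int H * int K" using 1 by (auto intro!: mult_mono)
  show ?thesis
  proof (rule smallI)
    show "p + q = of_int (a * d + c * b) / of_int (b * d)" using 1 by (simp add: field_simps)
    have "\<bar>a * d + c * b\<bar> \<le> \<bar>a\<bar> * d + \<bar>c\<bar> * b" using 1 by (simp add: abs_mult order_trans[OF abs_triangle_ineq])
    also have "\<dots> \<le> int H * int K + int K * int H" using m by linarith
    finally show "\<bar>a * d + c * b\<bar> \<le> int (2 * H * K)" by (simp add: algebra_simps)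
    show "0 < b * d" using 1 by simp
    have "0 \<le> int H * int K" by simp
    then have "b * d \<le> 2 * (int H * int K)" using m by linarith
    then show "b * d \<le> int (2 * H * K)" by (simp add: algebra_simps)
  qed
qed

lemma small_diff: "small H p \<Longrightarrow> small K q \<Longrightarrow> small (2 * H * K) (p - q)"
  using small_add[OF _ small_uminus, of H p K q] by simp

lemma small_divide: "small H p \<Longrightarrow> small K q \<Longrightarrow> q \<noteq> 0 \<Longrightarrow> small (H * K) (p / q)"
proof (elim smallE)
  fix a b c d
  assume q: "q \<noteq> 0" and 1: "p = of_int a / of_int b" "\<bar>a\<bar> \<le> int H" "0 < b" "b \<le> int H"
    "q = of_int c / of_int d" "\<bar>c\<bar> \<le> int K" "0 < d" "d \<le> int K"
  have c: "c \<noteq> 0" using q 1 by auto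
  then have s: "(of_int (sgn c) :: rat) * of_int \<bar>c\<bar> = of_int c" by (metis of_int_mult sgn_mult_abs)
  show ?thesis
  proof (rule smallI)
    have "p / q = of_int a * of_int d / (of_int b * of_int c)" using 1 c by simp
    also have "\<dots> = of_int (a * d * sgn c) / of_int (b * \<bar>c\<bar>)" using c by (cases "c > 0") (auto simp: field_simps)
    finally show "p / q = of_int (a * d * sgn c) / of_int (b * \<bar>c\<bar>)" .
    show "\<bar>a * d * sgn c\<bar> \<le> int (H * K)" using 1 c by (simp add: abs_mult mult_mono)
    show "0 < b * \<bar>c\<bar>" "b * \<bar>c\<bar> \<le> int (H * K)" using 1 c by (simp_all add: mult_mono)
  qed
qed

definition agree :: "nat \<Rightarrow> orc \<Rightarrow> orc \<Rightarrow> bool" where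
  "agree H \<sigma> \<tau> \<longleftrightarrow> (\<forall>a b. small H a \<longrightarrow> small H b \<longrightarrow> \<sigma> (a, b) = \<tau> (a, b))"

definition small_trns :: "nat \<Rightarrow> trn set \<Rightarrow> bool" where
  "small_trns M A \<longleftrightarrow> 1 \<le> M \<and> (\<forall>t\<in>A. \<forall>y\<in>set (fst (snd t)).
     small M (px y) \<and> small M (pa y) \<and> small M (pb y) \<and> (\<forall>q. pv y = Some q \<longrightarrow> small M q))"

definition smalls :: "nat \<Rightarrow> affine \<Rightarrow> bool" where
  "smalls B ab \<longleftrightarrow> small B (fst ab) \<and> small B (snd ab)"

lemma smalls_pos: "smalls B ab \<Longrightarrow> 1 \<le> B"
  by (auto simp: smalls_def elim: smallE)

text \<open>The worst case is the new constant term: the product is bounded by \<open>M * B\<close>,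
  and adding a number bounded by \<open>M\<close> gives \<open>2 * (M * B) * M\<close>.\<close>

lemma smalls_sev:
  assumes "\<forall>y\<in>set r. small M (px y) \<and> small M (pa y) \<and> small M (pb y) \<and> (\<forall>q. pv y = Some q \<longrightarrow> small M q)"
    "smalls B ab" "1 \<le> M" "sev \<sigma> r ab = Some ab'"
  shows "smalls (2 * M\<^sup>2 * B) ab'"
proof -
  have B: "1 \<le> B" by (rule smalls_pos[OF assms(2)])
  have M2: "1 \<le> M\<^sup>2" "M \<le> M\<^sup>2" using assms(3) by (auto simp: power2_eq_square)
  have le: "M * B \<le> 2 * M\<^sup>2 * B" "M \<le> 2 * M\<^sup>2 * B" "1 \<le> 2 * M\<^sup>2 * B"
  proof -
    show "M * B \<le> 2 * M\<^sup>2 * B" using M2 by simp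
    have "M * 1 \<le> 2 * M\<^sup>2 * B" using M2 B by (intro mult_le_mono) auto
    then show "M \<le> 2 * M\<^sup>2 * B" by simp
    then show "1 \<le> 2 * M\<^sup>2 * B" using assms(3) by linarith
  qed
  have step: "\<forall>d. sev_step \<sigma> ab acc y = Some d \<longrightarrow> smalls (2 * M\<^sup>2 * B) d"
    if "\<forall>d. acc = Some d \<longrightarrow> smalls (2 * M\<^sup>2 * B) d"
      and y: "small M (px y) \<and> small M (pa y) \<and> small M (pb y) \<and> (\<forall>q. pv y = Some q \<longrightarrow> small M q)" for acc y
  proof -
    have ab: "small B (fst ab)" "small B (snd ab)" using assms(2) by (auto simp: smalls_def)
    have 1: "small (2 * M\<^sup>2 * B) (pa y * fst ab)"
      by (rule small_mono[OF small_mult[of M _ B] le(1)]) (use y ab in auto)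
    have "small (2 * (M * B) * M) (pa y * snd ab + pb y)"
      by (rule small_add[OF small_mult]) (use y ab in auto)
    then have 2: "small (2 * M\<^sup>2 * B) (pa y * snd ab + pb y)" by (simp add: power2_eq_square algebra_simps)
    have 3: "small (2 * M\<^sup>2 * B) 0" by (rule small_01(1)[OF le(3)])
    have 4: "small (2 * M\<^sup>2 * B) q" if "pv y = Some q" for q
      by (rule small_mono[OF _ le(2)]) (use y that in blast)
    show ?thesis using that(1) 1 2 3 4 by (auto simp: sev_step_def smalls_def)
  qed
  have "\<forall>d. foldl (sev_step \<sigma> ab) acc r = Some d \<longrightarrow> smalls (2 * M\<^sup>2 * B) d"
    if "\<forall>d. acc = Some d \<longrightarrow> smalls (2 * M\<^sup>2 * B) d" for acc
    using assms(1) that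
  proof (induction r arbitrary: acc)
    case (Cons y r)
    have y: "small M (px y) \<and> small M (pa y) \<and> small M (pb y) \<and> (\<forall>q. pv y = Some q \<longrightarrow> small M q)"
      by (rule bspec[OF Cons.prems(1)]) simp
    show ?case unfolding foldl.simps
    proof (rule Cons.IH[OF _ step[OF Cons.prems(2) y]])
      show "\<forall>y\<in>set r. small M (px y) \<and> small M (pa y) \<and> small M (pb y) \<and> (\<forall>q. pv y = Some q \<longrightarrow> small M q)"
        using Cons.prems(1) unfolding list.set by blast
    qed
  qed simp
  then show ?thesis using assms(4) unfolding sev_def by blast
qed

lemma swalk_Cons: "swalk \<sigma> (t # p) (s, ab) = Some c \<longleftrightarrow>
   (\<exists>ab1. fst t = s \<and> sev \<sigma> (fst (snd t)) ab = Some ab1 \<and> swalk \<sigma> p (snd (snd t), ab1) = Some c)"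
  by (cases "sev \<sigma> (fst (snd t)) ab"; cases "fst t = s") (simp_all add: sst_def[of \<sigma> t "(s, ab)"])

lemma smalls_swalk:
  assumes "small_trns M (set p)" "smalls B ab" "swalk \<sigma> p (s, ab) = Some (s', ab')"
  shows "smalls ((2 * M\<^sup>2) ^ length p * B) ab'"
  using assms
proof (induction p arbitrary: s ab B)
  case (Cons t p)
  obtain ab1 where 1: "sev \<sigma> (fst (snd t)) ab = Some ab1" "swalk \<sigma> p (snd (snd t), ab1) = Some (s', ab')"
    using Cons.prems(3) unfolding swalk_Cons by blast
  have t: "\<forall>y\<in>set (fst (snd t)). small M (px y) \<and> small M (pa y) \<and> small M (pb y) \<and> (\<forall>q. pv y = Some q \<longrightarrow> small M q)"
    "1 \<le> M" "small_trns M (set p)" using Cons.prems(1) by (auto simp: small_trns_def)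
  have "smalls ((2 * M\<^sup>2) ^ length p * (2 * M\<^sup>2 * B)) ab'"
    by (rule Cons.IH[OF t(3) smalls_sev[OF t(1) Cons.prems(2) t(2) 1(1)] 1(2)])
  then show ?case by (simp add: algebra_simps)
qed simp

lemma sev_agree:
  assumes "agree H \<sigma> \<tau>" "\<forall>y\<in>set r. small M (px y)" "smalls B ab" "2 * M * B \<le> H" "1 \<le> M"
  shows "sev \<sigma> r ab = sev \<tau> r ab"
proof -
  have ab: "small B (fst ab)" "small B (snd ab)" using assms(3) by (auto simp: smalls_def)
  have BH: "B \<le> H" using assms(4,5) by (metis le_trans mult.commute mult.left_commute mult_le_mono2 nat_mult_1_right one_le_numeral mult_le_mono)
  have "sev_step \<sigma> ab acc y = sev_step \<tau> ab acc y" if "y \<in> set r" for acc y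
  proof -
    have y: "small M (px y)" using assms(2) that by blast
    have d: "small (2 * B * M) (snd ab - px y)" "small (2 * M * B) (px y - snd ab)"
      by (rule small_diff[OF ab(2) y], rule small_diff[OF y ab(2)])
    have d': "small H (snd ab - px y)" "small H (px y - snd ab)"
      using small_mono[OF d(1), of H] small_mono[OF d(2), of H] assms(4) by (auto simp: algebra_simps)
    have a: "small H (fst ab)" "small H (- fst ab)" using small_mono[OF ab(1) BH] small_uminus by auto
    have "\<sigma> (fst ab, snd ab - px y) = \<tau> (fst ab, snd ab - px y)" "\<sigma> (- fst ab, px y - snd ab) = \<tau> (- fst ab, px y - snd ab)"
      using assms(1) a d' unfolding agree_def by blast+
    then show ?thesis unfolding sev_step_def by simp
  qed
  then have "foldl (sev_step \<sigma> ab) acc r = foldl (sev_step \<tau> ab) acc r" for acc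
    by (intro foldl_cong) auto
  then show ?thesis by (simp add: sev_def)
qed

lemma swalk_agree:
  assumes "agree H \<sigma> \<tau>" "small_trns M (set p)" "smalls B ab" "2 * M * ((2 * M\<^sup>2) ^ length p * B) \<le> H"
  shows "swalk \<sigma> p (s, ab) = swalk \<tau> p (s, ab)"
  using assms(2-4)
proof (induction p arbitrary: s ab B)
  case (Cons t p)
  have t: "\<forall>y\<in>set (fst (snd t)). small M (px y) \<and> small M (pa y) \<and> small M (pb y) \<and> (\<forall>q. pv y = Some q \<longrightarrow> small M q)"
    "1 \<le> M" "small_trns M (set p)" using Cons.prems(1) by (auto simp: small_trns_def)
  have "1 \<le> (2 * M\<^sup>2) ^ length (t # p)" using t(2) by (intro one_le_power) simp
  then have "2 * M * (1 * B) \<le> 2 * M * ((2 * M\<^sup>2) ^ length (t # p) * B)" by (intro mult_le_mono) auto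
  from le_trans[OF this Cons.prems(3)] have h: "2 * M * B \<le> H" by simp
  have e: "sev \<sigma> (fst (snd t)) ab = sev \<tau> (fst (snd t)) ab"
    by (rule sev_agree[OF assms(1) _ Cons.prems(2) h t(2)]) (use t(1) in blast)
  show ?case
  proof (cases "sev \<tau> (fst (snd t)) ab")
    case None
    then show ?thesis using e by (simp add: sst_def)
  next
    case (Some ab1)
    have "swalk \<sigma> p (snd (snd t), ab1) = swalk \<tau> p (snd (snd t), ab1)"
      by (rule Cons.IH[OF t(3) smalls_sev[OF t(1) Cons.prems(2) t(2) Some]])
        (use Cons.prems(3) in \<open>simp add: algebra_simps\<close>)
    then show ?thesis using Some e by (simp add: sst_def[of \<sigma> t "(s, ab)"] sst_def[of \<tau> t "(s, ab)"])
  qed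
qed simp

text \<open>A nonzero \<open>a\<close> with denominator at most \<open>H\<close> has absolute value
  at least \<open>1 / H\<close>. Beyond \<open>H * H\<close> the product \<open>a * y\<close>
  therefore exceeds \<open>H\<close> in absolute value, and \<open>b\<close> cannot change the
  sign.\<close>

lemma posi_agree:
  assumes "real (H * H) < y"
  shows "agree H (posr y) posi"
  unfolding agree_def
proof (intro allI impI)
  fix a b assume ab: "small H a" "small H b"
  obtain c d where c: "b = of_int c / of_int d" "\<bar>c\<bar> \<le> int H" "0 < d" "d \<le> int H" "0 < H" using ab(2) by (rule smallE)
  obtain m k where m: "a = of_int m / of_int k" "\<bar>m\<bar> \<le> int H" "0 < k" "k \<le> int H" using ab(1) by (rule smallE)
  have "\<bar>of_rat b\<bar> = \<bar>real_of_int c\<bar> / real_of_int d" using c by (simp add: of_rat_divide)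
  also have "\<dots> \<le> \<bar>real_of_int c\<bar>" using c(3) by (simp add: divide_le_eq mult_le_cancel_left1)
  also have "\<dots> \<le> real H" using c(2) by linarith
  finally have "\<bar>of_rat b :: real\<bar> \<le> real H" .
  then have b: "- real H \<le> of_rat b" "of_rat b \<le> real H" by linarith+
  have y: "0 < y" using assms by (meson le_less_trans of_nat_0_le_iff)
  have big: "real H < of_rat a * y" if "0 < a" "a = of_int m / of_int k" "0 < k" "k \<le> int H"
    for a :: rat and m k :: int
  proof -
    have "0 < m" using that by (simp add: zero_less_divide_iff)
    then have "1 \<le> real_of_int m" by simp
    have "real H * real_of_int k \<le> real H * real H" using that(4) by (intro mult_left_mono) auto
    also have "\<dots> < y" using assms by simp
    also have "\<dots> \<le> real_of_int m * y" using \<open>1 \<le> real_of_int m\<close> y by simp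
    finally have "real H * real_of_int k < real_of_int m * y" .
    moreover have "of_rat a = real_of_int m / real_of_int k" using that(2) by (simp add: of_rat_divide)
    ultimately show ?thesis using that(3) by (simp add: pos_less_divide_eq)
  qed
  consider "a = 0" | "0 < a" | "a < 0" by linarith
  then show "posr y (a, b) = posi (a, b)"
  proof cases
    case 1
    then show ?thesis by (simp add: posr_def posi_def val_def)
  next
    case 2
    then show ?thesis using big[OF 2 m(1,3,4)] b by (simp add: posr_def posi_def val_def)
  next
    case 3
    have "- a = of_int (- m) / of_int k" using m(1) by simp
    from big[OF _ this m(3,4)] 3 have "real H < - (of_rat a * y)" by (simp add: of_rat_minus)
    then show ?thesis using 3 b by (simp add: posr_def posi_def val_def)
  qed
qed

definition cands :: "nat \<Rightarrow> rat set" where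
  "cands K = {mkrat (int m) d |m d. m < K \<and> d < K}"

lemma small_cand: "small H q \<Longrightarrow> 0 \<le> q \<Longrightarrow> H < K \<Longrightarrow> q \<in> cands K"
proof (elim smallE)
  fix n d assume q: "0 \<le> q" "H < K" "q = of_int n / of_int d" "\<bar>n\<bar> \<le> int H" "0 < d" "d \<le> int H"
  have "0 \<le> n" using q by (simp add: zero_le_divide_iff)
  then have "q = mkrat (int (nat n)) (nat d)" "nat n < K" "nat d < K" using q by (auto simp: mkrat_def)
  then show ?thesis unfolding cands_def by blast
qed

lemma cands_nonneg: "q \<in> cands K \<Longrightarrow> 0 \<le> q"
  by (auto simp: cands_def mkrat_def)

lemma finite_cands: "finite (cands K)"
proof -
  have "cands K = (\<lambda>(m, d). mkrat (int m) d) ` ({..<K} \<times> {..<K})" by (auto simp: cands_def)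
  then show ?thesis by simp
qed

text \<open>For nonzero \<open>a\<close> the sign changes at \<open>- b / a\<close>, which is small
  with bound \<open>H * H\<close> and thus a candidate unless it is negative. As no candidate lies
  above \<open>q\<close> and at or below \<open>x\<close>, the sign at \<open>x\<close> is that at
  \<open>q\<close>, or just above \<open>q\<close> if \<open>x\<close> is larger.\<close>

lemma posd_agree:
  assumes "0 \<le> q" "of_rat q \<le> x" "\<forall>c\<in>cands K. \<not> (q < c \<and> of_rat c \<le> x)" "H * H < K"
  shows "agree H (posr x) (posd (of_rat q < x) q)"
  unfolding agree_def
proof (intro allI impI)
  fix a b assume ab: "small H a" "small H b"
  show "posr x (a, b) = posd (of_rat q < x) q (a, b)"
  proof (cases "of_rat q < x")
    case False
    then have x: "x = of_rat q" using assms(2) by simp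
    have "posr x (a, b) \<longleftrightarrow> (0::real) < of_rat (a * q + b)" unfolding x posr_def val_def of_rat_lin by simp
    then show ?thesis using False by (simp add: posd_def)
  next
    case True
    show ?thesis
    proof (cases "a = 0")
      case True
      then show ?thesis by (simp add: posr_def posd_def val_def)
    next
      case a: False
      define p where "p = - b / a"
      have p: "small (H * H) p" unfolding p_def by (rule small_divide[OF small_uminus[OF ab(2)] ab(1) a])
      have np: "\<not> (q < p \<and> of_rat p \<le> x)"
      proof (cases "0 \<le> p")
        case True
        then show ?thesis using assms(3) small_cand[OF p True assms(4)] by blast
      next
        case False
        then show ?thesis using assms(1) by simp
      qed
      have b: "b = - (a * p)" using a by (simp add: p_def)
      have v: "val x (a, b) = of_rat a * (x - of_rat p)" unfolding b val_def by (simp add: of_rat_minus of_rat_mult algebra_simps)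
      have d: "a * q + b = a * (q - p)" unfolding b by (simp add: algebra_simps)
      consider "0 < a" | "a < 0" using a by linarith
      then show ?thesis
      proof cases
        case 1
        have "posr x (a, b) \<longleftrightarrow> of_rat p < x" using 1 by (simp add: posr_def v zero_less_mult_iff)
        also have "\<dots> \<longleftrightarrow> p \<le> q" using np True
          by (metis linorder_not_le not_less_iff_gr_or_eq of_rat_less_eq order_le_less_trans)
        also have "\<dots> \<longleftrightarrow> posd (of_rat q < x) q (a, b)" using 1 True by (auto simp: posd_def d zero_less_mult_iff)
        finally show ?thesis .
      next
        case 2
        have "posr x (a, b) \<longleftrightarrow> x < of_rat p" using 2 by (simp add: posr_def v zero_less_mult_iff)
        also have "\<dots> \<longleftrightarrow> q < p" using np True
          by (metis linorder_not_le of_rat_less order_less_trans)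
        also have "\<dots> \<longleftrightarrow> posd (of_rat q < x) q (a, b)" using 2 by (auto simp: posd_def d zero_less_mult_iff)
        finally show ?thesis .
      qed
    qed
  qed
qed

text \<open>\<open>A False q\<close> judges the energy \<open>q\<close>, and \<open>A True q\<close>
  the energies just above it. If only the latter holds for the least accepted candidate, the ray of
  accepted energies is open.\<close>

lemma threshold:
  fixes A :: "bool \<Rightarrow> rat \<Rightarrow> bool" and R :: "real \<Rightarrow> bool"
  assumes C: "finite C" "0 \<in> C" "\<forall>c\<in>C. 0 \<le> c"
    and up: "\<And>x x'. 0 \<le> x \<Longrightarrow> x \<le> x' \<Longrightarrow> R x \<Longrightarrow> R x'"
    and ag: "\<And>q x. q \<in> C \<Longrightarrow> of_rat q \<le> x \<Longrightarrow> \<forall>c\<in>C. \<not> (q < c \<and> of_rat c \<le> x) \<Longrightarrow> R x = A (of_rat q < x) q"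
  shows "0 \<le> x \<Longrightarrow> R x \<Longrightarrow> \<exists>q\<in>C. A False q \<or> A True q"
    and "q \<in> C \<Longrightarrow> A False q \<or> A True q \<Longrightarrow> \<forall>c\<in>C. A False c \<or> A True c \<longrightarrow> q \<le> c \<Longrightarrow> 0 \<le> x \<Longrightarrow>
      R x \<longleftrightarrow> (if A False q then of_rat q \<le> x else of_rat q < x)"
proof -
  have below: "\<exists>q\<in>C. of_rat q \<le> x \<and> A (of_rat q < x) q" if x: "0 \<le> x" "R x" for x
  proof -
    \<comment> \<open>The largest candidate at or below \<open>x\<close>, which exists because 0 is
      a candidate.\<close>
    define q where "q = Max {c \<in> C. of_rat c \<le> x}"
    have f: "finite {c \<in> C. of_rat c \<le> x}" "{c \<in> C. of_rat c \<le> x} \<noteq> {}" using C x by auto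
    have q: "q \<in> C" "of_rat q \<le> x" using Max_in[OF f] by (auto simp: q_def)
    have "\<forall>c\<in>C. \<not> (q < c \<and> of_rat c \<le> x)" using Max_ge[OF f(1)] by (fastforce simp: q_def)
    then show ?thesis using ag[OF q] x(2) q by blast
  qed
  show "0 \<le> x \<Longrightarrow> R x \<Longrightarrow> \<exists>q\<in>C. A False q \<or> A True q"
    using below[of x] by (metis (full_types))
  assume q: "q \<in> C" "A False q \<or> A True q" and least: "\<forall>c\<in>C. A False c \<or> A True c \<longrightarrow> q \<le> c" and x: "0 \<le> x"
  have q0: "0 \<le> (of_rat q :: real)" using C(3) q(1) by simp
  show "R x \<longleftrightarrow> (if A False q then of_rat q \<le> x else of_rat q < x)"
  proof
    assume "R x"
    then obtain c where c: "c \<in> C" "of_rat c \<le> x" "A (of_rat c < x) c" using below[OF x] by blast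
    then have qc: "q \<le> c" using least by (metis (full_types))
    then have qx: "of_rat q \<le> x" using c(2) by (meson of_rat_less_eq order_trans)
    moreover have "of_rat q < x" if nA: "\<not> A False q"
    proof (rule ccontr)
      assume "\<not> of_rat q < x"
      then have "x = of_rat q" using qx by simp
      then have "c = q" using qc c(2) by (simp add: of_rat_less_eq)
      then show False using c(3) nA \<open>x = of_rat q\<close> by simp
    qed
    ultimately show "if A False q then of_rat q \<le> x else of_rat q < x" by simp
  next
    assume r: "if A False q then of_rat q \<le> x else of_rat q < x"
    show "R x"
    proof (cases "A False q")
      case True
      have "R (of_rat q)" using ag[OF q(1), of "of_rat q"] True by (simp add: of_rat_less_eq)
      then show ?thesis using up[OF q0, of x] r True by simp
    next
      case False
      then have A: "A True q" and qx: "of_rat q < x" using q(2) r by auto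
      \<comment> \<open>A point \<open>y\<close> above \<open>q\<close> is chosen below both
        \<open>x\<close> and the next candidate, so that the verdict just above \<open>q\<close>
        applies to \<open>y\<close>; upward closure then leads from \<open>y\<close> to
        \<open>x\<close>.\<close>
      define m where "m = Min (insert x (of_rat ` {c \<in> C. q < c}))"
      have f: "finite (insert x (of_rat ` {c \<in> C. q < c} :: real set))" using C(1) by simp
      have m: "of_rat q < m" unfolding m_def using f qx by (subst Min_gr_iff) (auto simp: of_rat_less)
      have mx: "m \<le> x" unfolding m_def using f by (intro Min_le) auto
      define y where "y = (of_rat q + m) / 2"
      have y: "of_rat q < y" "y < m" using m by (auto simp: y_def)
      have "\<not> (q < c \<and> of_rat c \<le> y)" if "c \<in> C" for c
      proof
        assume "q < c \<and> of_rat c \<le> y"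
        then have "m \<le> of_rat c" unfolding m_def using f that by (intro Min_le) auto
        then show False using y \<open>q < c \<and> of_rat c \<le> y\<close> by simp
      qed
      then have "R y" using ag[OF q(1), of y] y(1) A by simp
      then show ?thesis using up[of y x] y mx q0 by simp
    qed
  qed
qed

section \<open>The acceptance conditions\<close>

definition ends :: "orc \<Rightarrow> trn list \<Rightarrow> nat \<times> affine \<Rightarrow> (nat \<times> affine \<Rightarrow> bool) \<Rightarrow> bool" where
  "ends \<sigma> p c Q = (case swalk \<sigma> p c of None \<Rightarrow> False | Some d \<Rightarrow> Q d)"

definition dif :: "affine \<Rightarrow> affine \<Rightarrow> affine" where
  "dif a b = (fst a - fst b, snd a - snd b)"

definition up :: "orc \<Rightarrow> trn list \<Rightarrow> nat \<times> affine \<Rightarrow> bool" where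
  "up \<sigma> p c = ends \<sigma> p c (\<lambda>d. fst d = fst c \<and> \<sigma> (dif (snd d) (snd c)))"

text \<open>That a cycle does not lose is expressed by the loss not being positive, since oracles
  cannot test for zero directly.\<close>

definition up0 :: "orc \<Rightarrow> trn list \<Rightarrow> nat \<times> affine \<Rightarrow> bool" where
  "up0 \<sigma> p c = (p \<noteq> [] \<and> ends \<sigma> p c (\<lambda>d. fst d = fst c \<and> \<not> \<sigma> (dif (snd c) (snd d))))"

abbreviation one :: affine where "one \<equiv> (1, 0)"

text \<open>Only the part up to the gaining cycle consults \<open>\<sigma>\<close>. What follows is
  judged by \<open>posi\<close> and starts afresh with the expression \<open>one\<close>.\<close>

definition acc_reach :: "trn list set \<Rightarrow> nat set \<Rightarrow> nat \<Rightarrow> orc \<Rightarrow> bool" where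
  "acc_reach P F s0 \<sigma> \<longleftrightarrow> (\<exists>p\<in>P. ends \<sigma> p (s0, one) (\<lambda>d. fst d \<in> F \<or>
     ((\<exists>c\<in>P. up \<sigma> c d) \<and> (\<exists>q\<in>P. ends posi q (fst d, one) (\<lambda>e. fst e \<in> F)))))"

definition pers :: "trn list set \<Rightarrow> nat set \<Rightarrow> nat \<Rightarrow> bool" where
  "pers P F t \<longleftrightarrow> t \<in> F \<and> ((\<exists>c\<in>P. up0 posi c (t, one)) \<or>
     (\<exists>q\<in>P. ends posi q (t, one) (\<lambda>d. (\<exists>c\<in>P. up posi c (fst d, one)) \<and>
        (\<exists>q'\<in>P. ends posi q' (fst d, one) (\<lambda>e. fst e = t)))))"

definition acc_buechi :: "trn list set \<Rightarrow> nat set \<Rightarrow> nat \<Rightarrow> orc \<Rightarrow> bool" where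
  "acc_buechi P F s0 \<sigma> \<longleftrightarrow> (\<exists>p\<in>P. ends \<sigma> p (s0, one) (\<lambda>d. (fst d \<in> F \<and> (\<exists>c\<in>P. up0 \<sigma> c d)) \<or>
     ((\<exists>c\<in>P. up \<sigma> c d) \<and> (\<exists>q\<in>P. ends posi q (fst d, one) (\<lambda>e. pers P F (fst e))))))"

lemma val_one [simp]: "val x one = x"
  by (simp add: val_def)

lemma val_dif: "val x (dif a b) = val x a - val x b"
  by (simp add: val_def dif_def of_rat_diff algebra_simps)

lemma smalls_one: "smalls 1 one"
  by (simp add: smalls_def small_01)

lemma smalls_dif:
  assumes "smalls A a" "smalls B b"
  shows "smalls (2 * A * B) (dif a b)"
  using assms small_diff unfolding smalls_def dif_def by simp

text \<open>\<open>P\<close> contains all paths of length at most \<open>N\<close>, and only paths of length at most \<open>L\<close>; the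
  bound \<open>H\<close> dominates the numbers arising on up to three consecutive paths.\<close>

locale system =
  fixes Ts :: "trn list" and Ss :: "nat set" and M N L H :: nat and P :: "trn list set"
  assumes reps: "\<forall>t\<in>set Ts. rep_ok (fst (snd t))" and S: "finite Ss" "\<forall>t\<in>set Ts. snd (snd t) \<in> Ss"
    and small: "small_trns M (set Ts)" and N: "2 * card Ss + 1 \<le> N"
    and P: "\<And>p. p \<in> P \<Longrightarrow> set p \<subseteq> set Ts \<and> length p \<le> L" "\<And>p. set p \<subseteq> set Ts \<Longrightarrow> length p \<le> N \<Longrightarrow> p \<in> P"
    and H: "4 * M * ((2 * M\<^sup>2) ^ (2 * L) * (2 * M\<^sup>2) ^ (2 * L)) \<le> H"
begin

lemma esys: "card Ss \<le> k \<Longrightarrow> esys (set Ts) (\<lambda>t. snd (snd t)) (\<lambda>t. ev (fst (snd t))) Ss k"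
proof
  fix t x y assume t: "t \<in> set Ts" and e: "ev (fst (snd t)) x = Some y"
  have ch: "chain_ok None (fst (snd t))" using reps t by (auto simp: rep_ok_def)
  show "0 \<le> y" by (rule ev_nonneg[OF ch e])
  show "x \<le> x' \<Longrightarrow> \<exists>y'. ev (fst (snd t)) x' = Some y' \<and> y + (x' - x) \<le> y'" for x'
    by (rule ev_expanding[OF ch e])
qed (use S in auto)

sublocale E: esys "set Ts" fst "\<lambda>t. snd (snd t)" "\<lambda>t. ev (fst (snd t))" Ss "card Ss"
  by (rule esys[OF order_refl])

lemma st_eq: "E.st = rst"
  by (intro ext) (simp add: E.st_def rst_def)

abbreviation D :: "nat \<Rightarrow> nat" where "D j \<equiv> (2 * M\<^sup>2) ^ (j * L)"

lemma M1: "1 \<le> M" "1 \<le> 2 * M\<^sup>2"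
  using small by (auto simp: small_trns_def)

lemma D_bounds: "1 \<le> D j" "i \<le> j \<Longrightarrow> D i \<le> D j"
proof -
  show "1 \<le> D j" using M1(2) by (rule one_le_power)
  show "i \<le> j \<Longrightarrow> D i \<le> D j" by (rule power_increasing[OF mult_le_mono1 M1(2)])
qed

lemma len_D: "p \<in> P \<Longrightarrow> (2 * M\<^sup>2) ^ length p \<le> D 1"
  unfolding mult_1 by (rule power_increasing) (use P(1) M1(2) in auto)

lemma P_trns: "p \<in> P \<Longrightarrow> small_trns M (set p)"
  using small P(1)[of p] by (auto simp: small_trns_def)

lemma HD: "4 * M * (D 2 * D 2) \<le> H" using H by (simp add: mult.commute)

lemma smalls_mono: "smalls A ab \<Longrightarrow> A \<le> B \<Longrightarrow> smalls B ab"
  unfolding smalls_def using small_mono by blast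

lemma smalls_P:
  assumes "p \<in> P" "smalls (D j) ab" "swalk \<sigma> p (s, ab) = Some (s', ab')"
  shows "smalls (D (Suc j)) ab'"
proof (rule smalls_mono[OF smalls_swalk[OF P_trns[OF assms(1)] assms(2,3)]])
  have "(2 * M\<^sup>2) ^ length p * D j \<le> D 1 * D j" using len_D[OF assms(1)] by (rule mult_le_mono1)
  then show "(2 * M\<^sup>2) ^ length p * D j \<le> D (Suc j)" by (simp add: power_add)
qed

lemma swalk_P_agree:
  assumes "agree H \<sigma> \<tau>" "p \<in> P" "smalls (D 1) ab"
  shows "swalk \<sigma> p (s, ab) = swalk \<tau> p (s, ab)"
proof (rule swalk_agree[OF assms(1) P_trns[OF assms(2)] assms(3)])
  have "(2 * M\<^sup>2) ^ length p * D 1 \<le> D 1 * D 1" using len_D[OF assms(2)] by (rule mult_le_mono1)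
  also have "\<dots> = D 2" by (simp add: power_add[symmetric] mult_2)
  finally have "2 * M * ((2 * M\<^sup>2) ^ length p * D 1) \<le> 2 * M * D 2" by (rule mult_le_mono2)
  also have "\<dots> \<le> 4 * M * (D 2 * D 2)" using D_bounds(1)[of 2] by (intro mult_le_mono) auto
  finally show "2 * M * ((2 * M\<^sup>2) ^ length p * D 1) \<le> H" using HD by linarith
qed

text \<open>Here the largest numbers arise: the expressions at both ends of a cycle, reached after
  at most two paths and bounded by \<open>D 2\<close>, are subtracted.\<close>

lemma dif_agree:
  assumes "agree H \<sigma> \<tau>" "smalls (D 2) a" "smalls (D 2) b"
  shows "\<sigma> (dif a b) = \<tau> (dif a b)"
proof -
  have "2 * D 2 * D 2 = 2 * 1 * (D 2 * D 2)" by simp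
  also have "\<dots> \<le> 4 * M * (D 2 * D 2)" using M1 by (intro mult_le_mono1 mult_le_mono) auto
  finally have "2 * D 2 * D 2 \<le> H" using HD by linarith
  then have "smalls H (dif a b)" by (rule smalls_mono[OF smalls_dif[OF assms(2,3)]])
  then show ?thesis using assms(1) unfolding agree_def smalls_def by (cases "dif a b") auto
qed

lemma up_agree:
  assumes "agree H \<sigma> \<tau>" "c \<in> P" "smalls (D 1) ab"
  shows "up \<sigma> c (s, ab) = up \<tau> c (s, ab)" "up0 \<sigma> c (s, ab) = up0 \<tau> c (s, ab)"
proof -
  have e: "swalk \<sigma> c (s, ab) = swalk \<tau> c (s, ab)" by (rule swalk_P_agree[OF assms])
  have ab: "smalls (D 2) ab" by (rule smalls_mono[OF assms(3) D_bounds(2)]) simp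
  have d: "\<sigma> (dif ab' ab) = \<tau> (dif ab' ab)" "\<sigma> (dif ab ab') = \<tau> (dif ab ab')"
    if "swalk \<tau> c (s, ab) = Some (s', ab')" for s' ab'
  proof -
    have "smalls (D 2) ab'" using smalls_P[OF assms(2,3) that] by (simp add: numeral_2_eq_2)
    then show "\<sigma> (dif ab' ab) = \<tau> (dif ab' ab)" "\<sigma> (dif ab ab') = \<tau> (dif ab ab')"
      using dif_agree[OF assms(1)] ab by blast+
  qed
  show "up \<sigma> c (s, ab) = up \<tau> c (s, ab)" "up0 \<sigma> c (s, ab) = up0 \<tau> c (s, ab)"
    unfolding up_def up0_def ends_def e using d by (auto split: option.splits)
qed

lemma one_D: "smalls (D 1) one" "smalls (D 0) one"
  by (rule smalls_mono[OF smalls_one D_bounds(1)])+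

lemma ends_agree:
  assumes "agree H \<sigma> \<tau>" "p \<in> P" "\<And>d. smalls (D 1) (snd d) \<Longrightarrow> Q d = Q' d"
  shows "ends \<sigma> p (s, one) Q = ends \<tau> p (s, one) Q'"
proof (cases "swalk \<tau> p (s, one)")
  case None
  then show ?thesis unfolding ends_def swalk_P_agree[OF assms(1,2) one_D(1)] by simp
next
  case (Some d)
  then have "smalls (D 1) (snd d)" using smalls_P[OF assms(2) one_D(2), of \<tau> s "fst d" "snd d"] by simp
  then show ?thesis unfolding ends_def swalk_P_agree[OF assms(1,2) one_D(1)] using Some assms(3) by simp
qed

lemma acc_agree:
  assumes "agree H \<sigma> \<tau>"
  shows "acc_reach P F s0 \<sigma> = acc_reach P F s0 \<tau>" "acc_buechi P F s0 \<sigma> = acc_buechi P F s0 \<tau>"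
proof -
  have u: "(\<exists>c\<in>P. up \<sigma> c d) = (\<exists>c\<in>P. up \<tau> c d)" "(\<exists>c\<in>P. up0 \<sigma> c d) = (\<exists>c\<in>P. up0 \<tau> c d)"
    if "smalls (D 1) (snd d)" for d
    using up_agree[OF assms _ that, of _ "fst d"] by auto
  show "acc_reach P F s0 \<sigma> = acc_reach P F s0 \<tau>"
    unfolding acc_reach_def
  proof (rule bex_cong[OF refl], rule ends_agree[OF assms])
    fix d :: "nat \<times> affine" assume d: "smalls (D 1) (snd d)"
    show "(fst d \<in> F \<or> (\<exists>c\<in>P. up \<sigma> c d) \<and> (\<exists>q\<in>P. ends posi q (fst d, one) (\<lambda>e. fst e \<in> F))) =
      (fst d \<in> F \<or> (\<exists>c\<in>P. up \<tau> c d) \<and> (\<exists>q\<in>P. ends posi q (fst d, one) (\<lambda>e. fst e \<in> F)))"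
      unfolding u(1)[OF d] by (rule refl)
  qed
  show "acc_buechi P F s0 \<sigma> = acc_buechi P F s0 \<tau>"
    unfolding acc_buechi_def
  proof (rule bex_cong[OF refl], rule ends_agree[OF assms])
    fix d :: "nat \<times> affine" assume d: "smalls (D 1) (snd d)"
    show "(fst d \<in> F \<and> (\<exists>c\<in>P. up0 \<sigma> c d) \<or> (\<exists>c\<in>P. up \<sigma> c d) \<and> (\<exists>q\<in>P. ends posi q (fst d, one) (\<lambda>e. pers P F (fst e)))) =
      (fst d \<in> F \<and> (\<exists>c\<in>P. up0 \<tau> c d) \<or> (\<exists>c\<in>P. up \<tau> c d) \<and> (\<exists>q\<in>P. ends posi q (fst d, one) (\<lambda>e. pers P F (fst e))))"
      unfolding u[OF d] by (rule refl)
  qed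
qed

lemma real_up:
  "up (posr x) c (s, ab) \<longleftrightarrow> (\<exists>v. walk rst c (s, val x ab) = Some (s, v) \<and> val x ab < v)"
  "up0 (posr x) c (s, ab) \<longleftrightarrow> c \<noteq> [] \<and> (\<exists>v. walk rst c (s, val x ab) = Some (s, v) \<and> val x ab \<le> v)"
  by (cases "swalk (posr x) c (s, ab)"; force simp: up_def up0_def ends_def swalk_real posr_def val_dif)+

lemma real_ends: "ends (posr x) p (s, one) (\<lambda>d. Q (fst d) (val x (snd d))) \<longleftrightarrow>
   (\<exists>t u. walk rst p (s, x) = Some (t, u) \<and> Q t u)"
proof -
  have e: "walk rst p (s, x) = map_option (map_prod id (val x)) (swalk (posr x) p (s, one))"
    using swalk_real[of p s x one] by simp
  show ?thesis unfolding e ends_def by (cases "swalk (posr x) p (s, one)") auto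
qed

definition Y :: real where "Y = real (H * H) + 1"

lemma Y: "0 \<le> Y" "Y \<le> y \<Longrightarrow> agree H (posr y) posi"
  using posi_agree[of H y] by (auto simp: Y_def add_nonneg_nonneg)

lemma P_set: "p \<in> P \<Longrightarrow> set p \<subseteq> set Ts"
  using P(1) by blast

text \<open>On paths in \<open>P\<close> the answers of \<open>posi\<close> are those of every real
  energy from \<open>Y\<close> on, and a path that is executable at all is executable at some such
  energy.\<close>

lemma inf_ends:
  assumes "q \<in> P"
  shows "ends posi q (s, one) (\<lambda>d. Q (fst d)) \<longleftrightarrow> (\<exists>t. E.gr s q t \<and> Q t)"
proof -
  have e: "ends posi q (s, one) (\<lambda>d. Q (fst d)) \<longleftrightarrow> (\<exists>t u. walk rst q (s, y) = Some (t, u) \<and> Q t)" if "Y \<le> y" for y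
    using real_ends[of y q s "\<lambda>t _. Q t"]
      ends_agree[OF Y(2)[OF that] assms, of "\<lambda>d. Q (fst d)" "\<lambda>d. Q (fst d)" s] by simp
  show ?thesis
  proof
    assume "ends posi q (s, one) (\<lambda>d. Q (fst d))"
    then obtain t u where "walk rst q (s, Y) = Some (t, u)" "Q t" unfolding e[OF order_refl] by blast
    then show "\<exists>t. E.gr s q t \<and> Q t"
      using E.grI[OF P_set[OF assms] Y(1), of s t u] unfolding st_eq by blast
  next
    assume "\<exists>t. E.gr s q t \<and> Q t"
    then obtain t where t: "E.gr s q t" "Q t" by blast
    obtain x0 where x0: "\<And>x. x0 \<le> x \<Longrightarrow> \<exists>y. walk rst q (s, x) = Some (t, y)"
      using E.gr_high[OF t(1)] unfolding st_eq by blast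
    have "Y \<le> max x0 Y" "x0 \<le> max x0 Y" by auto
    then show "ends posi q (s, one) (\<lambda>d. Q (fst d))" using e x0 t(2) by blast
  qed
qed

text \<open>A gain at some energy persists at all higher ones, in particular beyond
  \<open>Y\<close>, where real energies and infinity give the same answers.\<close>

lemma inf_up:
  assumes "c \<in> P"
  shows "up posi c (s, one) \<longleftrightarrow> (\<exists>y\<ge>0. \<exists>z. walk rst c (s, y) = Some (s, z) \<and> y < z)" (is ?A)
    and "up0 posi c (s, one) \<longleftrightarrow> c \<noteq> [] \<and> (\<exists>y\<ge>0. \<exists>z. walk rst c (s, y) = Some (s, z) \<and> y \<le> z)" (is ?B)
proof -
  have e: "up posi c (s, one) \<longleftrightarrow> (\<exists>z. walk rst c (s, y) = Some (s, z) \<and> y < z)"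
    "up0 posi c (s, one) \<longleftrightarrow> c \<noteq> [] \<and> (\<exists>z. walk rst c (s, y) = Some (s, z) \<and> y \<le> z)" if "Y \<le> y" for y
    using real_up[of y c s one] up_agree[OF Y(2)[OF that] assms one_D(1), of s] by simp_all
  have m: "\<exists>z'. walk rst c (s, max y Y) = Some (s, z') \<and> z + (max y Y - y) \<le> z'"
    if "walk rst c (s, y) = Some (s, z)" "0 \<le> y" for y z
    using E.W_mono[OF P_set[OF assms] that(2), of "max y Y" s s z] that(1) unfolding st_eq by simp
  show ?A
  proof
    assume "up posi c (s, one)"
    then show "\<exists>y\<ge>0. \<exists>z. walk rst c (s, y) = Some (s, z) \<and> y < z" using e(1)[OF order_refl] Y(1) by blast
  next
    assume "\<exists>y\<ge>0. \<exists>z. walk rst c (s, y) = Some (s, z) \<and> y < z"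
    then obtain y z where yz: "0 \<le> y" "walk rst c (s, y) = Some (s, z)" "y < z" by blast
    obtain z' where z': "walk rst c (s, max y Y) = Some (s, z')" "z + (max y Y - y) \<le> z'" using m[OF yz(2,1)] by blast
    have "max y Y < z'" using z'(2) yz(3) by linarith
    then show "up posi c (s, one)" using e(1)[of "max y Y"] z'(1) by auto
  qed
  show ?B
  proof
    assume "up0 posi c (s, one)"
    then show "c \<noteq> [] \<and> (\<exists>y\<ge>0. \<exists>z. walk rst c (s, y) = Some (s, z) \<and> y \<le> z)" using e(2)[OF order_refl] Y(1) by blast
  next
    assume a: "c \<noteq> [] \<and> (\<exists>y\<ge>0. \<exists>z. walk rst c (s, y) = Some (s, z) \<and> y \<le> z)"
    then obtain y z where yz: "0 \<le> y" "walk rst c (s, y) = Some (s, z)" "y \<le> z" by blast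
    obtain z' where z': "walk rst c (s, max y Y) = Some (s, z')" "z + (max y Y - y) \<le> z'" using m[OF yz(2,1)] by blast
    have "max y Y \<le> z'" using z'(2) yz(3) by linarith
    then show "up0 posi c (s, one)" using e(2)[of "max y Y"] z'(1) a by auto
  qed
qed

lemma acc_reach_real: "acc_reach P F s0 (posr x) \<longleftrightarrow>
   (\<exists>p\<in>P. \<exists>t u. walk rst p (s0, x) = Some (t, u) \<and> (t \<in> F \<or> ((\<exists>c\<in>P. \<exists>v. walk rst c (t, u) = Some (t, v) \<and> u < v) \<and>
      (\<exists>q\<in>P. \<exists>s'. E.gr t q s' \<and> s' \<in> F))))"
proof -
  have q: "(\<exists>q\<in>P. ends posi q (t, one) (\<lambda>e. fst e \<in> F)) = (\<exists>q\<in>P. \<exists>s'. E.gr t q s' \<and> s' \<in> F)" for t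
    using inf_ends[of _ t "\<lambda>s. s \<in> F"] by blast
  have u: "up (posr x) c d \<longleftrightarrow> (\<exists>v. walk rst c (fst d, val x (snd d)) = Some (fst d, v) \<and> val x (snd d) < v)" for c d
    using real_up(1)[of x c "fst d" "snd d"] by simp
  show ?thesis unfolding acc_reach_def q u
    by (subst real_ends[where Q = "\<lambda>t u. t \<in> F \<or> ((\<exists>c\<in>P. \<exists>v. walk rst c (t, u) = Some (t, v) \<and> u < v) \<and>
      (\<exists>q\<in>P. \<exists>s'. E.gr t q s' \<and> s' \<in> F))"]) (rule refl)
qed

lemma gr_P: "E.gr s q t \<Longrightarrow> length q \<le> N \<Longrightarrow> q \<in> P"
  using P(2) by (auto simp: E.gr_def)

lemma incr_P: "E.incr s x N t \<Longrightarrow> (\<exists>p\<in>P. \<exists>c\<in>P. \<exists>u v. walk rst p (s, x) = Some (t, u) \<and> walk rst c (t, u) = Some (t, v) \<and> u < v)"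
  unfolding E.incr_def st_eq using P(2) by blast

lemma incr_L: "p \<in> P \<Longrightarrow> c \<in> P \<Longrightarrow> walk rst p (s, x) = Some (t, u) \<Longrightarrow> walk rst c (t, u) = Some (t, v) \<Longrightarrow> u < v \<Longrightarrow>
    L \<le> k \<Longrightarrow> E.incr s x k t"
  unfolding E.incr_def st_eq using P(1) by (meson le_trans)

theorem acc_reach_iff:
  assumes "0 \<le> x" "s0 \<in> Ss"
  shows "acc_reach P F s0 (posr x) \<longleftrightarrow> (\<exists>s' y. E.rch (s0, x) (s', y) \<and> s' \<in> F)"
proof
  assume "acc_reach P F s0 (posr x)"
  then obtain p t u where p: "p \<in> P" "walk rst p (s0, x) = Some (t, u)"
    "t \<in> F \<or> ((\<exists>c\<in>P. \<exists>v. walk rst c (t, u) = Some (t, v) \<and> u < v) \<and> (\<exists>q\<in>P. \<exists>s'. E.gr t q s' \<and> s' \<in> F))"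
    unfolding acc_reach_real by blast
  from p(3) show "\<exists>s' y. E.rch (s0, x) (s', y) \<and> s' \<in> F"
  proof
    assume "t \<in> F"
    then show ?thesis using p(1,2) P_set unfolding E.rch_def st_eq by blast
  next
    assume "(\<exists>c\<in>P. \<exists>v. walk rst c (t, u) = Some (t, v) \<and> u < v) \<and> (\<exists>q\<in>P. \<exists>s'. E.gr t q s' \<and> s' \<in> F)"
    then obtain c v q s' where c: "c \<in> P" "walk rst c (t, u) = Some (t, v)" "u < v" "q \<in> P" "E.gr t q s'" "s' \<in> F" by blast
    \<comment> \<open>Paths in \<open>P\<close> may be longer than \<open>card Ss\<close>. The
      characterisation is applied with a larger bound on the number of states, for which they count
      as short.\<close>
    let ?k = "max (card Ss) L"
    have "E.incr s0 x ?k t" by (rule incr_L[OF p(1) c(1) p(2) c(2,3)]) simp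
    moreover have "length q \<le> ?k" by (rule max.coboundedI2[OF conjunct2[OF P(1)[OF c(4)]]])
    moreover have "card Ss \<le> ?k" by simp
    ultimately show ?thesis using esys.reach_iff[OF esys, of ?k x s0 fst F] assms c(5,6) by blast
  qed
next
  assume "\<exists>s' y. E.rch (s0, x) (s', y) \<and> s' \<in> F"
  from this[unfolded E.reach_iff[OF assms]]
  consider p s' y where "set p \<subseteq> set Ts" "length p \<le> card Ss" "walk rst p (s0, x) = Some (s', y)" "s' \<in> F"
    | t q s' where "E.incr s0 x (card Ss) t" "E.gr t q s'" "length q \<le> card Ss" "s' \<in> F"
    unfolding st_eq by blast
  then show "acc_reach P F s0 (posr x)"
  proof cases
    case 1
    have "p \<in> P" by (rule P(2)[OF 1(1)]) (use 1(2) N in simp)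
    then show ?thesis unfolding acc_reach_real using 1(3,4) by blast
  next
    case 2
    have "card Ss \<le> N" using N by simp
    from incr_P[OF E.incr_le[OF 2(1) this]] obtain p c u v where
      p: "p \<in> P" "c \<in> P" "walk rst p (s0, x) = Some (t, u)" "walk rst c (t, u) = Some (t, v)" "u < v" by blast
    have "q \<in> P" by (rule gr_P[OF 2(2)]) (use 2(3) N in simp)
    then show ?thesis unfolding acc_reach_real using p 2(2,4) by blast
  qed
qed

lemma pers_eq: "pers P F t \<longleftrightarrow> t \<in> F \<and> ((\<exists>c\<in>P. c \<noteq> [] \<and> (\<exists>y\<ge>0. \<exists>z. walk rst c (t, y) = Some (t, z) \<and> y \<le> z)) \<or>
    (\<exists>q\<in>P. \<exists>s'. E.gr t q s' \<and> (\<exists>c\<in>P. \<exists>y\<ge>0. \<exists>z. walk rst c (s', y) = Some (s', z) \<and> y < z) \<and> (\<exists>q'\<in>P. E.gr s' q' t)))"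
proof -
  have 1: "(\<exists>c\<in>P. up0 posi c (t, one)) = (\<exists>c\<in>P. c \<noteq> [] \<and> (\<exists>y\<ge>0. \<exists>z. walk rst c (t, y) = Some (t, z) \<and> y \<le> z))"
    using inf_up(2) by blast
  have 2: "(\<exists>c\<in>P. up posi c (s', one)) = (\<exists>c\<in>P. \<exists>y\<ge>0. \<exists>z. walk rst c (s', y) = Some (s', z) \<and> y < z)" for s'
    using inf_up(1) by blast
  have 3: "(\<exists>q'\<in>P. ends posi q' (s', one) (\<lambda>e. fst e = t)) = (\<exists>q'\<in>P. E.gr s' q' t)" for s'
    using inf_ends[of _ s' "\<lambda>s. s = t"] by blast
  have 4: "(\<exists>q\<in>P. ends posi q (t, one) (\<lambda>d. Q (fst d))) = (\<exists>q\<in>P. \<exists>s'. E.gr t q s' \<and> Q s')" for Q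
    using inf_ends[of _ t Q] by blast
  show ?thesis unfolding pers_def 1 2 3
    by (subst 4[of "\<lambda>s'. (\<exists>c\<in>P. \<exists>y\<ge>0. \<exists>z. walk rst c (s', y) = Some (s', z) \<and> y < z) \<and> (\<exists>q'\<in>P. E.gr s' q' t)"]) (rule refl)
qed

lemma pers_persistent: "pers P F t \<Longrightarrow> L \<le> k \<Longrightarrow> E.persistent F k t"
  unfolding pers_eq E.persistent_def st_eq using P(1) by (meson le_trans)

lemma persistent_pers: "E.persistent F N t \<Longrightarrow> pers P F t"
  unfolding pers_eq E.persistent_def st_eq using P(2) gr_P by meson

lemma acc_buechi_real: "acc_buechi P F s0 (posr x) \<longleftrightarrow>
   (\<exists>p\<in>P. \<exists>t u. walk rst p (s0, x) = Some (t, u) \<and> ((t \<in> F \<and> (\<exists>c\<in>P. c \<noteq> [] \<and> (\<exists>v. walk rst c (t, u) = Some (t, v) \<and> u \<le> v))) \<or>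
     ((\<exists>c\<in>P. \<exists>v. walk rst c (t, u) = Some (t, v) \<and> u < v) \<and> (\<exists>q\<in>P. \<exists>s'. E.gr t q s' \<and> pers P F s'))))"
proof -
  have q: "(\<exists>q\<in>P. ends posi q (t, one) (\<lambda>e. pers P F (fst e))) = (\<exists>q\<in>P. \<exists>s'. E.gr t q s' \<and> pers P F s')" for t
    using inf_ends[of _ t "pers P F"] by blast
  have u: "up (posr x) c d \<longleftrightarrow> (\<exists>v. walk rst c (fst d, val x (snd d)) = Some (fst d, v) \<and> val x (snd d) < v)"
    "up0 (posr x) c d \<longleftrightarrow> c \<noteq> [] \<and> (\<exists>v. walk rst c (fst d, val x (snd d)) = Some (fst d, v) \<and> val x (snd d) \<le> v)" for c d
    using real_up[of x c "fst d" "snd d"] by simp_all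
  show ?thesis unfolding acc_buechi_def q u
    by (subst real_ends[where Q = "\<lambda>t u. (t \<in> F \<and> (\<exists>c\<in>P. c \<noteq> [] \<and> (\<exists>v. walk rst c (t, u) = Some (t, v) \<and> u \<le> v))) \<or>
     ((\<exists>c\<in>P. \<exists>v. walk rst c (t, u) = Some (t, v) \<and> u < v) \<and> (\<exists>q\<in>P. \<exists>s'. E.gr t q s' \<and> pers P F s'))"]) (rule refl)
qed

theorem acc_buechi_iff:
  assumes "0 \<le> x" "s0 \<in> Ss"
  shows "acc_buechi P F s0 (posr x) \<longleftrightarrow> E.buechi F (s0, x)"
proof
  \<comment> \<open>As for reachability, the bound on the number of states is raised until all paths
    in \<open>P\<close> count as short. The other direction uses the exact number of states.\<close>
  let ?k = "max (card Ss) L"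
  have k: "card Ss \<le> ?k" "L \<le> ?k" "L \<le> 2 * ?k + 1" by auto
  note B = esys.buechi_iff[OF esys[OF k(1)] assms, where src = fst and F = F, unfolded st_eq]
  assume "acc_buechi P F s0 (posr x)"
  then obtain p t u where p: "p \<in> P" "walk rst p (s0, x) = Some (t, u)"
    "(t \<in> F \<and> (\<exists>c\<in>P. c \<noteq> [] \<and> (\<exists>v. walk rst c (t, u) = Some (t, v) \<and> u \<le> v))) \<or>
     ((\<exists>c\<in>P. \<exists>v. walk rst c (t, u) = Some (t, v) \<and> u < v) \<and> (\<exists>q\<in>P. \<exists>s'. E.gr t q s' \<and> pers P F s'))"
    unfolding acc_buechi_real by blast
  have len: "set q \<subseteq> set Ts \<and> length q \<le> 2 * ?k + 1" if "q \<in> P" for q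
    using P(1)[OF that] k(3) by (meson le_trans)
  from p(3) show "E.buechi F (s0, x)"
  proof
    assume "t \<in> F \<and> (\<exists>c\<in>P. c \<noteq> [] \<and> (\<exists>v. walk rst c (t, u) = Some (t, v) \<and> u \<le> v))"
    then show ?thesis unfolding B using p(1,2) len by blast
  next
    assume "(\<exists>c\<in>P. \<exists>v. walk rst c (t, u) = Some (t, v) \<and> u < v) \<and> (\<exists>q\<in>P. \<exists>s'. E.gr t q s' \<and> pers P F s')"
    then obtain c v q s' where c: "c \<in> P" "walk rst c (t, u) = Some (t, v)" "u < v" "q \<in> P" "E.gr t q s'" "pers P F s'" by blast
    have "E.incr s0 x (2 * ?k + 1) t" by (rule incr_L[OF p(1) c(1) p(2) c(2,3) k(3)])
    then show ?thesis unfolding B using len[OF c(4)] c(5) pers_persistent[OF c(6) k(3)] by blast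
  qed
next
  note B = E.buechi_iff[OF assms, where F = F, unfolded st_eq]
  assume "E.buechi F (s0, x)"
  then consider p t u c v where "set p \<subseteq> set Ts" "set c \<subseteq> set Ts" "length p \<le> 2 * card Ss + 1" "length c \<le> 2 * card Ss + 1"
      "walk rst p (s0, x) = Some (t, u)" "t \<in> F" "c \<noteq> []" "walk rst c (t, u) = Some (t, v)" "u \<le> v"
    | s1 q t where "E.incr s0 x (2 * card Ss + 1) s1" "E.gr s1 q t" "length q \<le> 2 * card Ss + 1" "E.persistent F (2 * card Ss + 1) t"
    unfolding B by blast
  then show "acc_buechi P F s0 (posr x)"
  proof cases
    case 1
    have "p \<in> P" "c \<in> P" using P(2)[OF 1(1)] P(2)[OF 1(2)] 1(3,4) N by auto
    then show ?thesis unfolding acc_buechi_real using 1(5-9) by blast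
  next
    case 2
    obtain p c u v where
      p: "p \<in> P" "c \<in> P" "walk rst p (s0, x) = Some (s1, u)" "walk rst c (s1, u) = Some (s1, v)" "u < v"
      using incr_P[OF E.incr_le[OF 2(1) N]] by blast
    have "q \<in> P" by (rule gr_P[OF 2(2)]) (use 2(3) N in simp)
    moreover have "E.persistent F N t"
      using 2(4) N unfolding E.persistent_def by (meson le_trans)
    ultimately show ?thesis unfolding acc_buechi_real using p 2(2) persistent_pers by blast
  qed
qed

end

section \<open>Runs of automata\<close>

context
  fixes Ts :: "trn list" and Tl :: "nat transition list"
  assumes rel: "list_all2 (rel_prod (=) (rel_prod pw_represents (=))) Ts Tl"
begin

lemma rel_ex:
  "(s, f, s') \<in> set Tl \<Longrightarrow> \<exists>r. (s, r, s') \<in> set Ts \<and> pw_represents r f"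
  "(s, r, s') \<in> set Ts \<Longrightarrow> \<exists>f. (s, f, s') \<in> set Tl \<and> pw_represents r f"
  using rel unfolding list_all2_conv_all_nth in_set_conv_nth rel_prod_sel by (metis fst_conv snd_conv prod.collapse)+

lemma global_step_iff:
  assumes "\<forall>t\<in>set Ts. rep_ok (fst (snd t))"
  shows "global_step (set Tl) (s, x) (s', x') \<longleftrightarrow> 0 \<le> x \<and> (\<exists>t\<in>set Ts. rst t (s, x) = Some (s', x'))"
proof
  assume g: "global_step (set Tl) (s, x) (s', x')"
  then obtain f where f: "0 \<le> x" "0 \<le> x'" "(s, f, s') \<in> set Tl" "f (energy_of_real x) = energy_of_real x'"
    by (auto simp: global_step_def)
  obtain r where r: "(s, r, s') \<in> set Ts" "pw_represents r f" using rel_ex(1)[OF f(3)] by blast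
  have "map_option ennreal (ev r x) = Some (ennreal x')" using represents_ev[OF r(2) f(1)] f(4) by simp
  then obtain y where y: "ev r x = Some y" "ennreal y = ennreal x'" by auto
  have "chain_ok None r" using assms r(1) by (force simp: rep_ok_def)
  \<comment> \<open>\<open>ennreal\<close> is injective on nonnegative numbers only, so the sign of
    \<open>y\<close> matters.\<close>
  then have "y = x'" using y(2) f(2) ev_nonneg[OF _ y(1)] by simp
  then have "rst (s, r, s') (s, x) = Some (s', x')" using y(1) by (simp add: rst_def)
  then show "0 \<le> x \<and> (\<exists>t\<in>set Ts. rst t (s, x) = Some (s', x'))" using r(1) f(1) by blast
next
  assume "0 \<le> x \<and> (\<exists>t\<in>set Ts. rst t (s, x) = Some (s', x'))"
  then obtain t where x: "0 \<le> x" and t: "t \<in> set Ts" "rst t (s, x) = Some (s', x')" by blast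
  obtain r where r: "t = (s, r, s')" "ev r x = Some x'" using t(2) by (cases t) (auto simp: rst_def split: if_splits)
  obtain f where f: "(s, f, s') \<in> set Tl" "pw_represents r f" using rel_ex(2) t(1) r(1) by blast
  have "chain_ok None r" using assms t(1) r(1) by (force simp: rep_ok_def)
  then have "0 \<le> x'" using ev_nonneg r(2) by blast
  then show "global_step (set Tl) (s, x) (s', x')"
    using represents_ev[OF f(2) x] r(2) f(1) x by (auto simp: global_step_def)
qed

end

context system
begin

lemma rch_iff:
  assumes rel: "list_all2 (rel_prod (=) (rel_prod pw_represents (=))) Ts Tl" and x: "0 \<le> x"
  shows "has_reaching_run (set Tl) s0 F x \<longleftrightarrow> (\<exists>s' y. E.rch (s0, x) (s', y) \<and> s' \<in> F)"
proof -
  note g = global_step_iff[OF rel reps]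
  have 1: "(global_step (set Tl))\<^sup>*\<^sup>* c c' \<Longrightarrow> E.rch c c'" for c c'
  proof (induction rule: rtranclp_induct)
    case base
    show ?case by (rule E.rch_refl)
  next
    case (step c1 c2)
    obtain t where t: "t \<in> set Ts" "rst t c1 = Some c2"
      using step(2) g[of "fst c1" "snd c1" "fst c2" "snd c2"] by auto
    have "E.rch c1 c2" by (rule E.rchI[of "[t]"]) (use t st_eq in auto)
    then show ?case by (rule E.rch_trans[OF step(3)])
  qed
  have 2: "(global_step (set Tl))\<^sup>*\<^sup>* (s, y) c'" if "set p \<subseteq> set Ts" "walk rst p (s, y) = Some c'" "0 \<le> y" for p s y c'
    using that
  proof (induction p arbitrary: s y)
    case (Cons t p)
    obtain s1 y1 where 1: "rst t (s, y) = Some (s1, y1)" "walk rst p (s1, y1) = Some c'"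
      using Cons.prems(2) by (auto simp: bind_eq_Some_conv)
    have st: "global_step (set Tl) (s, y) (s1, y1)" using g Cons.prems(1,3) 1(1) by auto
    then have "0 \<le> y1" by (simp add: global_step_def)
    then have "(global_step (set Tl))\<^sup>*\<^sup>* (s1, y1) c'" using Cons.IH[OF _ 1(2)] Cons.prems(1) by simp
    then show ?case using st by (meson converse_rtranclp_into_rtranclp)
  qed simp
  have "(global_step (set Tl))\<^sup>*\<^sup>* (s0, x) c' \<longleftrightarrow> E.rch (s0, x) c'" for c'
    using 1[of "(s0, x)" c'] 2[of _ s0 x c'] x unfolding E.rch_def st_eq by blast
  then show ?thesis unfolding has_reaching_run_def by simp
qed

lemma buechi_run_iff:
  assumes rel: "list_all2 (rel_prod (=) (rel_prod pw_represents (=))) Ts Tl" and x: "0 \<le> x"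
  shows "has_buechi_run (set Tl) s0 F x \<longleftrightarrow> E.buechi F (s0, x)"
proof -
  note g = global_step_iff[OF rel reps]
  have "(\<forall>i. global_step (set Tl) (\<rho> i) (\<rho> (Suc i))) \<longleftrightarrow> (\<forall>i. \<exists>t\<in>set Ts. rst t (\<rho> i) = Some (\<rho> (Suc i)))"
    if r0: "\<rho> 0 = (s0, x)" for \<rho>
  proof
    assume a: "\<forall>i. global_step (set Tl) (\<rho> i) (\<rho> (Suc i))"
    show "\<forall>i. \<exists>t\<in>set Ts. rst t (\<rho> i) = Some (\<rho> (Suc i))"
    proof
      fix i
      show "\<exists>t\<in>set Ts. rst t (\<rho> i) = Some (\<rho> (Suc i))"
        using spec[OF a, of i] g[of "fst (\<rho> i)" "snd (\<rho> i)" "fst (\<rho> (Suc i))" "snd (\<rho> (Suc i))"] by simp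
    qed
  next
    assume a: "\<forall>i. \<exists>t\<in>set Ts. rst t (\<rho> i) = Some (\<rho> (Suc i))"
    have st: "0 \<le> snd (\<rho> i) \<Longrightarrow> global_step (set Tl) (\<rho> i) (\<rho> (Suc i))" for i
      using spec[OF a, of i] g[of "fst (\<rho> i)" "snd (\<rho> i)" "fst (\<rho> (Suc i))" "snd (\<rho> (Suc i))"] by simp
    have "0 \<le> snd (\<rho> i)" for i
    proof (induction i)
      case 0
      then show ?case using x r0 by simp
    next
      case (Suc i)
      from st[OF this] show ?case by (simp add: global_step_def case_prod_beta)
    qed
    then show "\<forall>i. global_step (set Tl) (\<rho> i) (\<rho> (Suc i))" using st by blast
  qed
  then show ?thesis unfolding has_buechi_run_def E.buechi_def st_eq by blast
qed

text \<open>On all small expressions the oracle of a real \<open>x\<close> agrees with that of the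
  largest candidate at or below \<open>x\<close>, so that \<open>threshold\<close> applies.
  \<open>K\<close> exceeds \<open>H * H\<close>, the bound for zeros of small expressions.\<close>

theorem decide:
  assumes s0: "s0 \<in> Ss" and K: "H * H < K"
    and AR: "(A = acc_reach P F s0 \<and> R = (\<lambda>x. \<exists>s' y. E.rch (s0, x) (s', y) \<and> s' \<in> F)) \<or>
      (A = acc_buechi P F s0 \<and> R = (\<lambda>x. E.buechi F (s0, x)))"
  shows "0 \<le> x \<Longrightarrow> R x \<Longrightarrow> \<exists>q\<in>cands K. A (posd False q) \<or> A (posd True q)"
    and "q \<in> cands K \<Longrightarrow> A (posd False q) \<or> A (posd True q) \<Longrightarrow>
      \<forall>c\<in>cands K. A (posd False c) \<or> A (posd True c) \<longrightarrow> q \<le> c \<Longrightarrow> 0 \<le> x \<Longrightarrow>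
      R x \<longleftrightarrow> (if A (posd False q) then of_rat q \<le> x else of_rat q < x)"
proof -
  have AR': "0 \<le> x \<Longrightarrow> A (posr x) = R x" "agree H \<sigma> \<tau> \<Longrightarrow> A \<sigma> = A \<tau>" for x \<sigma> \<tau>
    using AR acc_reach_iff[OF _ s0] acc_buechi_iff[OF _ s0] acc_agree by auto
  have z: "0 \<in> cands K"
  proof (rule small_cand)
    show "small (Suc 0) 0" by (rule small_01) simp
    have "1 * (1 * 1) \<le> 4 * M * (D 2 * D 2)"
      by (rule mult_le_mono[OF _ mult_le_mono]) (use M1(1) D_bounds(1)[of 2] in linarith)+
    then have "1 \<le> H" using HD by linarith
    then have "1 * 1 \<le> H * H" by (intro mult_le_mono)
    then show "Suc 0 < K" using K by linarith
  qed simp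
  have up: "R x \<Longrightarrow> R x'" if "0 \<le> x" "x \<le> x'" for x x'
    using AR E.rch_upward[OF _ that] E.buechi_upward[OF _ that(1) s0 that(2)] by blast
  have ag: "R x = A (posd (of_rat q < x) q)" if "q \<in> cands K" "of_rat q \<le> x" "\<forall>c\<in>cands K. \<not> (q < c \<and> of_rat c \<le> x)" for q x
  proof -
    have q: "0 \<le> q" by (rule cands_nonneg[OF that(1)])
    then have "(0::real) \<le> of_rat q" by simp
    then have "0 \<le> x" using that(2) by linarith
    then show ?thesis using AR'(1)[of x] AR'(2)[OF posd_agree[OF q that(2,3) K]] by simp
  qed
  have C: "\<forall>c\<in>cands K. 0 \<le> c" by (blast dest: cands_nonneg)
  note t = threshold[of "cands K" R "\<lambda>e q. A (posd e q)", OF finite_cands z C]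
  show "0 \<le> x \<Longrightarrow> R x \<Longrightarrow> \<exists>q\<in>cands K. A (posd False q) \<or> A (posd True q)"
    by (rule t(1)) (assumption | (rule up; assumption) | (rule ag; assumption))+
  show "q \<in> cands K \<Longrightarrow> A (posd False q) \<or> A (posd True q) \<Longrightarrow>
      \<forall>c\<in>cands K. A (posd False c) \<or> A (posd True c) \<longrightarrow> q \<le> c \<Longrightarrow> 0 \<le> x \<Longrightarrow>
      R x \<longleftrightarrow> (if A (posd False q) then of_rat q \<le> x else of_rat q < x)"
    by (rule t(2)) (assumption | (rule up; assumption) | (rule ag; assumption))+
qed

end

section \<open>Parsing\<close>

text \<open>By the equivalence the parser fails on everything that does not begin with a genuine
  encoding; thus malformed words are recognised.\<close>

definition parsable :: "('a::code \<Rightarrow> bool list) \<Rightarrow> bool" where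
  "parsable enc \<longleftrightarrow> (\<exists>p. X p \<and> (\<forall>w x w'. p w = Some (x, w') \<longleftrightarrow> w = enc x @ w'))"

lemma parsableI: "X p \<Longrightarrow> (\<And>w x w'. p w = Some (x, w') \<longleftrightarrow> w = enc x @ w') \<Longrightarrow> parsable enc"
  unfolding parsable_def by blast

lemma parsableE:
  assumes "parsable enc"
  obtains p where "X p" "\<And>w x w'. p w = Some (x, w') \<longleftrightarrow> w = enc x @ w'"
  using assms unfolding parsable_def by blast

lemma parsable_bool: "parsable (\<lambda>b::bool. [b])"
proof (rule parsableI)
  let ?p = "\<lambda>w::bool list. case w of [] \<Rightarrow> None | b # w' \<Rightarrow> Some (b, w')"
  show "X ?p" by (intro X_intros)
  show "?p w = Some (x, w') \<longleftrightarrow> w = [x] @ w'" for w x w' by (cases w) auto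
qed

lemma parsable_pair:
  assumes "parsable e" "parsable e'"
  shows "parsable (\<lambda>z. e (fst z) @ e' (snd z))"
proof -
  obtain p where p: "X p" "\<And>w x w'. p w = Some (x, w') \<longleftrightarrow> w = e x @ w'" by (rule parsableE[OF assms(1)]) blast
  obtain q where q: "X q" "\<And>w x w'. q w = Some (x, w') \<longleftrightarrow> w = e' x @ w'" by (rule parsableE[OF assms(2)]) blast
  let ?r = "\<lambda>w. case p w of None \<Rightarrow> None | Some z \<Rightarrow>
    (case q (snd z) of None \<Rightarrow> None | Some y \<Rightarrow> Some ((fst z, fst y), snd y))"
  show ?thesis
  proof (rule parsableI)
    show "X ?r" by (intro X_intros X_comp[OF p(1)] X_comp[OF q(1)])
    show "?r w = Some (x, w') \<longleftrightarrow> w = (e (fst x) @ e' (snd x)) @ w'" for w x w'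
    proof -
      obtain a b where x: "x = (a, b)" by (cases x)
      have "?r w = Some (x, w') \<longleftrightarrow> (\<exists>v. p w = Some (a, v) \<and> q v = Some (b, w'))"
        unfolding x by (auto split: option.splits)
      also have "\<dots> \<longleftrightarrow> w = (e a @ e' b) @ w'" unfolding p(2) q(2) by auto
      finally show ?thesis by (simp add: x)
    qed
  qed
qed

text \<open>The parsed value is encoded again and compared. This rejects unnatural representatives
  such as leading zeros, a negative zero or an unreduced fraction.\<close>

lemma parsable_map:
  assumes "parsable e" and f: "X f" and g: "X g" and fg: "\<And>y. f (g y) = y"
  shows "parsable (\<lambda>y. e (g y))"
proof -
  obtain p where p: "X p" "\<And>w x w'. p w = Some (x, w') \<longleftrightarrow> w = e x @ w'" by (rule parsableE[OF assms(1)]) blast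
  let ?r = "\<lambda>w. case p w of None \<Rightarrow> None | Some z \<Rightarrow>
    (if g (f (fst z)) = fst z then Some (f (fst z), snd z) else None)"
  show ?thesis
  proof (rule parsableI)
    show "X ?r" by (intro X_intros X_comp[OF p(1)] X_comp[OF f] X_comp[OF g])
    show "?r w = Some (y, w') \<longleftrightarrow> w = e (g y) @ w'" for w y w'
    proof -
      have "?r w = Some (y, w') \<longleftrightarrow> p w = Some (g y, w')"
        using fg by (cases "p w") auto
      then show ?thesis by (simp add: p(2))
    qed
  qed
qed

lemma parsable_option:
  assumes "parsable e"
  shows "parsable (enc_option e)"
proof -
  obtain p where p: "X p" "\<And>w x w'. p w = Some (x, w') \<longleftrightarrow> w = e x @ w'" by (rule parsableE[OF assms(1)]) blast
  let ?r = "\<lambda>w. case w of [] \<Rightarrow> None | b # v \<Rightarrow> (if b then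
    (case p v of None \<Rightarrow> None | Some z \<Rightarrow> Some (Some (fst z), snd z)) else Some (None, v))"
  show ?thesis
  proof (rule parsableI)
    show "X ?r" by (intro X_intros X_comp[OF p(1)])
    show "?r w = Some (y, w') \<longleftrightarrow> w = enc_option e y @ w'" for w y w'
    proof (cases w)
      case (Cons b v)
      show ?thesis
      proof (cases y)
        case None
        then show ?thesis by (auto simp: Cons enc_option_def split: option.splits)
      next
        case (Some a)
        have "?r w = Some (y, w') \<longleftrightarrow> b \<and> p v = Some (a, w')" by (auto simp: Some Cons split: option.splits)
        then show ?thesis by (auto simp: Some Cons enc_option_def p(2))
      qed
    qed (auto simp: enc_option_def split: option.splits)
  qed
qed

text \<open>The state consists of the parsed elements in reverse order, the rest of the input and a flag
  that tells if the end of the list has been read.\<close>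

definition list_step :: "(bool list \<Rightarrow> ('a \<times> bool list) option) \<Rightarrow>
    'a list \<times> bool list \<times> bool \<Rightarrow> 'a list \<times> bool list \<times> bool" where
  "list_step p st = (if snd (snd st) then st else case fst (snd st) of [] \<Rightarrow> st | b # r \<Rightarrow>
     if b then (case p r of None \<Rightarrow> st | Some z \<Rightarrow> (fst z # fst st, snd z, False)) else (fst st, r, True))"

lemma foldl_funpow: "foldl (\<lambda>s _. f s) s w = (f ^^ length w) s"
  by (induction w arbitrary: s) (simp_all add: funpow_swap1)

lemma enc_list_simps: "enc_list e [] = [False]" "enc_list e (x # xs) = True # e x @ enc_list e xs"
  by (simp_all add: enc_list_def)

lemma list_step_enc:
  assumes p: "\<And>w x w'. p w = Some (x, w') \<longleftrightarrow> w = e x @ w'"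
  shows "length xs < n \<Longrightarrow> (list_step p ^^ n) (acc, enc_list e xs @ w', False) = (rev xs @ acc, w', True)"
proof (induction xs arbitrary: n acc)
  case Nil
  have "(list_step p ^^ m) (acc, w', True) = (acc, w', True)" for m
    by (induction m) (simp_all add: list_step_def)
  moreover obtain m where "n = Suc m" using Nil by (cases n) auto
  moreover have "list_step p (acc, False # w', False) = (acc, w', True)" by (simp add: list_step_def)
  ultimately show ?case by (simp add: funpow_Suc_right enc_list_simps del: funpow.simps)
next
  case (Cons x xs)
  obtain m where m: "n = Suc m" "length xs < m" using Cons.prems by (cases n) auto
  have "p (e x @ enc_list e xs @ w') = Some (x, enc_list e xs @ w')" by (simp add: p)
  then have "list_step p (acc, enc_list e (x # xs) @ w', False) = (x # acc, enc_list e xs @ w', False)"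
    by (simp add: list_step_def enc_list_simps)
  then show ?case using Cons.IH[OF m(2), of "x # acc"] by (simp add: m(1) funpow_Suc_right del: funpow.simps)
qed

text \<open>Besides correctness, the number and the size of the parsed elements are bounded. The
  size of an element is only known to be polynomial in the input, not linear in its encoding, so
  both bounds are used for the size of the accumulator.\<close>

definition list_inv where
  "list_inv e B w n st \<longleftrightarrow> w = concat (map (\<lambda>x. True # e x) (rev (fst st))) @ (if snd (snd st) then [False] else []) @ fst (snd st) \<and>
     length (fst st) \<le> n \<and> (\<forall>x\<in>set (fst st). sz x \<le> B)"

lemma list_inv_step:
  assumes p: "\<And>w x w'. p w = Some (x, w') \<longleftrightarrow> w = e x @ w'"
    and B: "\<And>r z. sz r \<le> sz w \<Longrightarrow> p r = Some z \<Longrightarrow> sz (fst z) \<le> B"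
    and inv: "list_inv e B w n st"
  shows "list_inv e B w (Suc n) (list_step p st)"
proof -
  obtain acc rest d where st: "st = (acc, rest, d)" by (cases st)
  note i = inv[unfolded list_inv_def st fst_conv snd_conv]
  show ?thesis
  proof (cases "d \<or> rest = []")
    case True
    then show ?thesis using i by (auto simp: list_step_def st list_inv_def)
  next
    case False
    then obtain b r where r: "rest = b # r" and d: "\<not> d" by (cases rest) auto
    show ?thesis
    proof (cases "b \<and> p r \<noteq> None")
      case True
      then obtain x v where xv: "p r = Some (x, v)" by auto
      have "sz w + 1 = sz (concat (map (\<lambda>x. True # e x) (rev acc)) @ [b]) + sz r"
        using i d r sz_append[of "concat (map (\<lambda>x. True # e x) (rev acc)) @ [b]" r] by simp
      moreover have "1 \<le> sz (concat (map (\<lambda>x. True # e x) (rev acc)) @ [b])" by simp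
      ultimately have "sz r \<le> sz w" by linarith
      then have "sz x \<le> B" using B[OF _ xv] by simp
      moreover have "r = e x @ v" using xv p by blast
      ultimately show ?thesis using i d r True xv by (simp add: list_step_def st list_inv_def)
    next
      case False
      then consider "\<not> b" | "b" "p r = None" by blast
      then show ?thesis using i d r by cases (simp_all add: list_step_def st list_inv_def)
    qed
  qed
qed

lemma parsable_list:
  fixes e :: "'a::code \<Rightarrow> bool list"
  assumes "parsable e"
  shows "parsable (enc_list e)"
proof -
  obtain p where p: "X p" "\<And>w x w'. p w = Some (x, w') \<longleftrightarrow> w = e x @ w'" by (rule parsableE[OF assms(1)]) blast
  obtain k where k: "\<And>w. sz (p w) \<le> (sz w + 2) ^ k" using X_polyb[OF p(1)] unfolding polyb_def by blast
  let ?B = "\<lambda>w. (sz w + 2) ^ k"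
  have B: "sz (fst z) \<le> ?B w" if "sz r \<le> sz w" "p r = Some z" for w r z
  proof -
    have "sz (fst z) \<le> sz (p r)" using that(2) by (cases z) simp
    also have "\<dots> \<le> ?B r" by (rule k)
    also have "\<dots> \<le> ?B w" using that(1) by (intro power_mono) auto
    finally show ?thesis .
  qed
  let ?i = "\<lambda>w. ([], w, False)"
  have inv: "list_inv e (?B w) w n ((list_step p ^^ n) (?i w))" for w n
  proof (induction n)
    case 0
    show ?case by (simp add: list_inv_def)
  next
    case (Suc n)
    have "list_inv e (?B w) w (Suc n) (list_step p ((list_step p ^^ n) (?i w)))"
      by (rule list_inv_step[OF p(2) _ Suc]) (rule B)
    then show ?case by simp
  qed
  \<comment> \<open>The fold ignores the elements of \<open>w\<close>; the length of
    \<open>w\<close> serves as a number of rounds that is always sufficient.\<close>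
  let ?F = "\<lambda>w. foldl (\<lambda>st _. list_step p st) (?i w) w"
  let ?r = "\<lambda>w. if snd (snd (?F w)) then Some (rev (fst (?F w)), fst (snd (?F w))) else None"
  have F: "X (\<lambda>w. foldl ((\<lambda>w st y. list_step p st) w) (?i w) ((\<lambda>w. w) w))"
  proof (rule X_foldl)
    show "X (\<lambda>z::bool list \<times> ('a list \<times> bool list \<times> bool) \<times> bool. list_step p (fst (snd z)))"
      unfolding list_step_def by (intro X_intros X_comp[OF p(1)])
    show "polyb (\<lambda>w. 20 + (1 + sz w * (1 + ?B w)) + sz w)" by (intro poly_intros)
    fix w ys zs :: "bool list" assume w: "w = ys @ zs"
    let ?s = "(list_step p ^^ length ys) (?i w)"
    have i: "w = (concat (map (\<lambda>x. True # e x) (rev (fst ?s))) @ (if snd (snd ?s) then [False] else [])) @ fst (snd ?s)"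
      "length (fst ?s) \<le> length ys" "\<forall>x\<in>set (fst ?s). sz x \<le> ?B w"
      using inv[of w "length ys"] by (simp_all add: list_inv_def)
    have "sz w + 1 = sz (concat (map (\<lambda>x. True # e x) (rev (fst ?s))) @ (if snd (snd ?s) then [False] else [])) + sz (fst (snd ?s))"
      by (subst i(1)) (rule sz_append)
    moreover have "1 \<le> sz (concat (map (\<lambda>x. True # e x) (rev (fst ?s))) @ (if snd (snd ?s) then [False] else []))" by simp
    ultimately have 1: "sz (fst (snd ?s)) \<le> sz w" by linarith
    have "length (fst ?s) \<le> sz w" using i(2) w length_le_sz[of w] by simp
    then have "1 + length (fst ?s) * (1 + ?B w) \<le> 1 + sz w * (1 + ?B w)" by (intro add_left_mono mult_le_mono1)
    then have 2: "sz (fst ?s) \<le> 1 + sz w * (1 + ?B w)" using sz_list_bound[OF i(3)] by linarith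
    have "sz ?s = 2 + sz (fst ?s) + sz (fst (snd ?s)) + sz (snd (snd ?s))" by (cases ?s) simp
    then show "sz (foldl (\<lambda>st y. list_step p st) (?i w) ys) \<le> 20 + (1 + sz w * (1 + ?B w)) + sz w"
      using 1 2 sz_bool[of "snd (snd ?s)"] by (simp only: foldl_funpow)
  qed (intro X_intros)+
  show ?thesis
  proof (rule parsableI)
    show "X ?r" by (intro X_intros F)
    show "?r w = Some (xs, w') \<longleftrightarrow> w = enc_list e xs @ w'" for w xs w'
    proof
      assume "?r w = Some (xs, w')"
      then have r: "snd (snd (?F w))" "xs = rev (fst (?F w))" "w' = fst (snd (?F w))" by (simp_all split: if_splits)
      show "w = enc_list e xs @ w'"
        using inv[of w "length w"] r by (simp add: foldl_funpow list_inv_def enc_list_def)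
    next
      assume w: "w = enc_list e xs @ w'"
      have "length xs \<le> length (concat (map (\<lambda>x. True # e x) xs))" by (induction xs) auto
      then have "length xs < length w" by (simp add: w enc_list_def)
      from list_step_enc[OF p(2) this, of "[]" w'] have "?F w = (rev xs, w', True)"
        by (simp add: foldl_funpow w)
      then show "?r w = Some (xs, w')" by simp
    qed
  qed
qed

definition bits_nat :: "bool list \<Rightarrow> nat" where
  "bits_nat bs = foldl (\<lambda>n b. if b then Suc (n + n) else n + n) 0 (rev bs)"

lemma bits_nat_simps [simp]: "bits_nat [] = 0" "bits_nat (b # bs) = of_bool b + 2 * bits_nat bs"
  by (simp_all add: bits_nat_def)

lemma bits_nat_less: "bits_nat bs < 2 ^ length bs"
  by (induction bs) auto

lemma bits_nat_bits [simp]: "bits_nat (nat_bits n) = n"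
proof (induction n rule: less_induct)
  case (less n)
  show ?case
  proof (cases "n = 0")
    case False
    then have "bits_nat (nat_bits (n div 2)) = n div 2" using less by simp
    then show ?thesis using False by (simp add: nat_bits_pos)
  qed simp
qed

lemma nat_bits_nat: "bs = [] \<or> last bs \<Longrightarrow> nat_bits (bits_nat bs) = bs"
proof (induction bs)
  case (Cons b bs)
  have IH: "nat_bits (bits_nat bs) = bs" using Cons by (cases bs) auto
  show ?case
  proof (cases "bits_nat (b # bs) = 0")
    case True
    then have "\<not> b" "bits_nat bs = 0" by (cases b; simp)+
    then show ?thesis using IH Cons.prems by simp
  next
    case False
    then show ?thesis using IH by (subst nat_bits_pos) auto
  qed
qed simp

lemma X_bits_nat [X_intros]: "X f \<Longrightarrow> X (\<lambda>x. bits_nat (f x))"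
proof -
  have "X (\<lambda>x. foldl ((\<lambda>_ n b. if b then Suc (n + n) else n + n) x) ((\<lambda>_. 0) x) (rev x))"
  proof (rule X_foldl)
    show "polyb (\<lambda>x::bool list. 4 * sz x + 1)" by (intro poly_intros)
    fix x ys zs :: "bool list" assume "rev x = ys @ zs"
    then have "length ys \<le> length x" by (metis length_append length_rev le_add1)
    then have l: "length ys \<le> sz x" using length_le_sz[of x] by linarith
    have "bits_nat (rev ys) < 2 ^ length ys" using bits_nat_less[of "rev ys"] by simp
    then have "sz (bits_nat (rev ys)) \<le> 4 * length ys + 1" by (rule sz_nat_le)
    then show "sz (foldl (\<lambda>n b. if b then Suc (n + n) else n + n) 0 ys) \<le> 4 * sz x + 1"
      using l by (simp add: bits_nat_def)
  qed (intro X_intros)+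
  then have "X bits_nat" unfolding bits_nat_def[abs_def] .
  then show "X f \<Longrightarrow> X (\<lambda>x. bits_nat (f x))" by (rule X_comp)
qed

lemma parsable_word: "parsable enc_word"
  unfolding enc_word_def by (rule parsable_list[OF parsable_bool])

lemma parsable_nat: "parsable enc_nat"
  using parsable_map[OF parsable_word X_bits_nat[OF X_id] X_nat_bits[OF X_id]]
  by (simp add: enc_nat_def[abs_def])

lemma parsable_int: "parsable enc_int"
proof -
  have "parsable (\<lambda>y. (\<lambda>z. (\<lambda>b. [b]) (fst z) @ enc_nat (snd z)) ((\<lambda>i. (i < 0, nat \<bar>i\<bar>)) y))"
  proof (rule parsable_map[OF parsable_pair[OF parsable_bool parsable_nat]])
    show "X (\<lambda>z. mkint (fst z) (snd z))" by (intro X_intros)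
    show "X (\<lambda>i::int. (i < 0, nat \<bar>i\<bar>))" by (intro X_intros)
  qed (simp add: mkint_def)
  then show ?thesis by (simp add: enc_int_def[abs_def])
qed

lemma parsable_rat: "parsable enc_rat"
proof -
  have "parsable (\<lambda>y. (\<lambda>z. enc_int (fst z) @ enc_int (snd z)) (quotient_of y))"
  proof (rule parsable_map[OF parsable_pair[OF parsable_int parsable_int]])
    show "X (\<lambda>z. mkrat (fst z) (nat \<bar>snd z\<bar>))" by (intro X_intros)
    show "X quotient_of" by (rule X_quotient_of)
    show "mkrat (num q) (nat \<bar>den q\<bar>) = q" for q using rat_num_den[of q] by (simp add: mkrat_def)
  qed
  then show ?thesis by (simp add: enc_rat_def[abs_def] case_prod_beta)
qed

lemma parsable_pw_rep: "parsable enc_pw_rep"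
  unfolding enc_pw_rep_def case_prod_beta
  by (intro parsable_list parsable_pair parsable_option parsable_rat)

lemma parsable_input: "parsable enc_input"
proof -
  have eq: "enc_input = (\<lambda>z. enc_list enc_nat (fst z) @
      (\<lambda>y. enc_list (\<lambda>z. enc_nat (fst z) @ (\<lambda>y. enc_pw_rep (fst y) @ enc_nat (snd y)) (snd z)) (fst y) @
      (\<lambda>y. enc_nat (fst y) @ (\<lambda>y. enc_list enc_nat (fst y) @ enc_word (snd y)) (snd y)) (snd y)) (snd z))"
    by (simp add: enc_input_def case_prod_beta')
  show ?thesis unfolding eq
    by (rule parsable_pair parsable_list parsable_nat parsable_word parsable_pw_rep)+
qed

lemma X_enc_word [X_intros]: "X f \<Longrightarrow> X (\<lambda>x. enc_word (f x))"
  unfolding enc_word_def enc_list_def by (intro X_intros X_concat_map)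

lemma X_enc_rat [X_intros]: "X f \<Longrightarrow> X (\<lambda>x. enc_rat (f x))"
  unfolding enc_rat_def enc_int_def enc_nat_def case_prod_beta by (intro X_intros)

section \<open>The acceptance conditions are computable in exponential time\<close>

text \<open>A step keeps the accumulator or overwrites it by a value that does not depend on it, so
  sizes do not compound over the steps.\<close>

lemma X_foldl_update:
  fixes s :: "'a::code \<Rightarrow> 'b::code \<Rightarrow> 'c::code \<Rightarrow> 'b"
  assumes s: "X (\<lambda>z. s (fst z) (fst (snd z)) (snd (snd z)))" and i: "X i" and l: "X l"
    and upd: "\<And>x acc y. s x acc y = acc \<or> s x acc y = s x (i x) y"
  shows "X (\<lambda>x. foldl (s x) (i x) (l x))"
proof -
  let ?G = "\<lambda>z. s (fst z) (i (fst z)) (snd z)"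
  have "X (\<lambda>z::'a \<times> 'c. (fst z, i (fst z), snd z))" by (intro X_intros X_comp[OF i])
  from X_comp[OF s this] have "X ?G" by simp
  from X_polyb[OF this] obtain k where k: "\<And>z. sz (?G z) \<le> (sz z + 2) ^ k"
    unfolding polyb_def by blast
  let ?h = "\<lambda>x. sz (i x) + (1 + sz x + sz (l x) + 2) ^ k"
  show ?thesis
  proof (rule X_foldl[OF s i l])
    show "polyb ?h" by (intro poly_intros X_polyb i l)
    fix x ys zs assume l: "l x = ys @ zs"
    have "foldl (s x) (i x) ys = i x \<or> (\<exists>y\<in>set ys. foldl (s x) (i x) ys = s x (i x) y)"
    proof (induction ys rule: rev_induct)
      case (snoc y ys)
      then show ?case using upd[of x "foldl (s x) (i x) ys" y] by auto
    qed simp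
    then show "sz (foldl (s x) (i x) ys) \<le> ?h x"
    proof (elim disjE bexE)
      fix y assume y: "y \<in> set ys" "foldl (s x) (i x) ys = s x (i x) y"
      have "sz y \<le> sz (l x)" using y(1) l by (intro sz_elem) simp
      then have "(sz (x, y) + 2) ^ k \<le> (1 + sz x + sz (l x) + 2) ^ k" by (intro power_mono) auto
      then show ?thesis using k[of "(x, y)"] y(2) by simp
    qed simp
  qed
qed

text \<open>The oracle of the infinite energy, and those just at and just above a rational number.\<close>

type_synonym orc_data = "bool \<times> bool \<times> rat"

definition orc_of :: "orc_data \<Rightarrow> orc" where
  "orc_of d ab = (if fst d then posi ab else posd (fst (snd d)) (snd (snd d)) ab)"

lemma posi_orc: "posi = orc_of (True, False, 0)"
  by (simp add: orc_of_def fun_eq_iff)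

lemma posd_orc: "posd e q = orc_of (False, e, q)"
  by (simp add: orc_of_def fun_eq_iff)

lemma X_orc: "X d \<Longrightarrow> X f \<Longrightarrow> X (\<lambda>x. orc_of (d x) (f x))"
  unfolding orc_of_def posi_def posd_def by (intro X_intros)

lemma X_sev:
  assumes "X d" "X r" "X ab"
  shows "X (\<lambda>x. sev (orc_of (d x)) (r x) (ab x))"
proof -
  have "X (\<lambda>x::orc_data \<times> pw_rep \<times> affine. foldl (sev_step (orc_of (fst x)) (snd (snd x))) None (fst (snd x)))"
  proof (rule X_foldl_update)
    show "X (\<lambda>z::(orc_data \<times> pw_rep \<times> affine) \<times> affine option \<times> piece.
        sev_step (orc_of (fst (fst z))) (snd (snd (fst z))) (fst (snd z)) (snd (snd z)))"
      unfolding sev_step_def map_option_case by (intro X_orc X_intros)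
  qed ((intro X_intros)+, simp add: sev_step_def)
  from X_comp[OF this X_Pair[OF assms(1) X_Pair[OF assms(2,3)]]] show ?thesis by (simp add: sev_def)
qed

lemma X_sst:
  assumes "X d" "X t" "X c"
  shows "X (\<lambda>x. sst (orc_of (d x)) (t x) (c x))"
proof -
  have "X (\<lambda>x::orc_data \<times> trn \<times> nat \<times> affine. sst (orc_of (fst x)) (fst (snd x)) (snd (snd x)))"
    unfolding sst_def map_option_case by (intro X_sev X_intros)
  from X_comp[OF this X_Pair[OF assms(1) X_Pair[OF assms(2,3)]]] show ?thesis by simp
qed

lemma small_sz: "small (2 ^ sz q) (q::rat)"
proof (rule smallI)
  have s: "sz q = 1 + sz (num q) + sz (den q)"
    unfolding sz_def[of q] code_rat_def by (metis prod.collapse sz_def sz_simps(1))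
  have i: "\<bar>i\<bar> \<le> int (2 ^ sz q)" if "sz i \<le> sz q" for i :: int
  proof -
    have "sz i = 1 + sz (i < 0) + sz (nat \<bar>i\<bar>)" unfolding sz_def[of i] code_int_def by (metis sz_def sz_simps(1))
    then have "(2::nat) ^ sz (nat \<bar>i\<bar>) \<le> 2 ^ sz i" by (intro power_increasing) auto
    then have "nat \<bar>i\<bar> < 2 ^ sz i" using nat_less_sz[of "nat \<bar>i\<bar>"] by linarith
    also have "(2::nat) ^ sz i \<le> 2 ^ sz q" using that by (intro power_increasing) auto
    finally show ?thesis by simp
  qed
  show "q = of_int (num q) / of_int (den q)" "0 < den q" by (rule rat_num_den)+
  show "\<bar>num q\<bar> \<le> int (2 ^ sz q)" by (rule i) (simp add: s)
  show "den q \<le> int (2 ^ sz q)" using i[of "den q"] by (simp add: s)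
qed

text \<open>The reduced fraction divides the given one componentwise and is therefore no larger.
  Numerator and denominator contribute at most \<open>4 * k + 5\<close> each, including the
  sign.\<close>

lemma sz_small:
  assumes "small H q" "H < 2 ^ k"
  shows "sz q \<le> 8 * k + 12"
proof -
  obtain n d where nd: "q = of_int n / of_int d" "\<bar>n\<bar> \<le> int H" "0 < d" "d \<le> int H" "0 < H" by (rule smallE[OF assms(1)])
  have "num q * d = n * den q"
  proof -
    have "of_int (num q) / of_int (den q) = (of_int n / of_int d :: rat)" using rat_num_den(1)[of q] nd(1) by simp
    then have "of_int (num q * d) = (of_int (n * den q) :: rat)" using rat_num_den(2)[of q] nd(3) by (simp add: field_simps)
    then show ?thesis by (simp only: of_int_eq_iff)
  qed
  moreover have c: "coprime (num q) (den q)" by (metis prod.collapse quotient_of_coprime)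
  ultimately have "den q dvd d" "num q dvd n"
    by (metis coprime_commute coprime_dvd_mult_right_iff dvd_triv_right, metis c coprime_dvd_mult_left_iff dvd_triv_left)
  then have 1: "\<bar>den q\<bar> \<le> int H" "n \<noteq> 0 \<Longrightarrow> \<bar>num q\<bar> \<le> int H"
    using nd dvd_imp_le_int[of d "den q"] dvd_imp_le_int[of n "num q"] by auto
  have 2: "\<bar>num q\<bar> \<le> int H"
  proof (cases "n = 0")
    case True
    then show ?thesis using nd(1) by simp
  qed (rule 1(2))
  have i: "sz i \<le> 4 * k + 5" if "\<bar>i\<bar> \<le> int H" for i :: int
  proof -
    have "nat \<bar>i\<bar> < 2 ^ k" using that assms(2) by linarith
    then have "sz (nat \<bar>i\<bar>) \<le> 4 * k + 1" by (rule sz_nat_le)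
    moreover have "sz i = 1 + sz (i < 0) + sz (nat \<bar>i\<bar>)" unfolding sz_def[of i] code_int_def by (metis sz_def sz_simps(1))
    ultimately show ?thesis using sz_bool[of "i < 0"] by linarith
  qed
  have s: "sz q = 1 + sz (num q) + sz (den q)"
    unfolding sz_def[of q] code_rat_def by (metis prod.collapse sz_def sz_simps(1))
  show ?thesis using i[OF 1(1)] i[OF 2] s by linarith
qed

lemma small_trns_sz: "sz (p :: trn list) \<le> n \<Longrightarrow> small_trns (2 ^ n) (set p)"
  unfolding small_trns_def
proof (intro conjI ballI)
  fix t y assume n: "sz p \<le> n" and t: "t \<in> set p" "y \<in> set (fst (snd t))"
  have "sz t \<le> sz p" "sz y \<le> sz (fst (snd t))" using t by (auto intro: sz_elem)
  moreover have "sz (fst (snd t)) \<le> sz t" by (cases t) simp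
  ultimately have y: "sz y \<le> n" using n by linarith
  have q: "small (2 ^ n) q" if "sz q \<le> sz y" for q
    by (rule small_mono[OF small_sz power_increasing]) (use that y in auto)
  obtain x v a b where "y = (x, v, a, b)" by (cases y)
  then show "small (2 ^ n) (px y)" "small (2 ^ n) (pa y)" "small (2 ^ n) (pb y)" "\<forall>q. pv y = Some q \<longrightarrow> small (2 ^ n) q"
    by (auto intro: q)
qed simp

lemma swalk_foldl: "swalk \<sigma> p c = foldl (\<lambda>acc t. case acc of None \<Rightarrow> None | Some c \<Rightarrow> sst \<sigma> t c) (Some c) p"
proof -
  have N: "foldl (\<lambda>acc t. case acc of None \<Rightarrow> None | Some c \<Rightarrow> sst \<sigma> t c) None p = None" for p
    by (induction p) auto
  show ?thesis
  proof (induction p arbitrary: c)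
    case (Cons t p)
    then show ?case by (cases "sst \<sigma> t c") (simp_all add: N)
  qed simp
qed

lemma swalk_state: "swalk \<sigma> p c = Some d \<Longrightarrow> fst d = fst c \<or> (\<exists>t\<in>set p. fst d = snd (snd t))"
proof (induction p arbitrary: c)
  case (Cons t p)
  then obtain c' where c': "sst \<sigma> t c = Some c'" "swalk \<sigma> p c' = Some d" by (auto simp: bind_eq_Some_conv)
  have "fst c' = snd (snd t)" using c'(1) by (auto simp: sst_def split: if_splits)
  then show ?case using Cons.IH[OF c'(2)] by auto
qed simp

text \<open>Polynomial size bounds for the single steps would compound along the path. Instead
  \<open>smalls_swalk\<close> is used with \<open>M = 2 ^ sz p\<close>: every transition adds at
  most \<open>1 + 2 * sz p\<close> bits.\<close>

lemma sz_swalk: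
  assumes "swalk \<sigma> p (s, ab) = Some (s', ab')"
  shows "sz (s', ab') \<le> sz p + sz s + 30 + 16 * ((1 + 2 * sz p) * sz p + sz ab + 1)"
proof -
  let ?k = "(1 + 2 * sz p) * sz p + sz ab"
  have "sz s' \<le> sz p + sz s"
    using swalk_state[OF assms]
  proof (elim disjE bexE)
    fix t assume t: "t \<in> set p" "fst (s', ab') = snd (snd t)"
    have "sz s' \<le> sz t" using t(2) by (cases t) auto
    then show ?thesis using sz_elem[OF t(1)] by simp
  qed simp
  moreover have ab: "smalls (2 ^ sz ab) ab"
    unfolding smalls_def
    by (cases ab, intro conjI; rule small_mono[OF small_sz power_increasing]; simp)
  have "smalls ((2 * (2 ^ sz p)\<^sup>2) ^ length p * 2 ^ sz ab) ab'"
    by (rule smalls_swalk[OF small_trns_sz[OF order_refl] ab assms])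
  moreover have "(2 * (2 ^ sz p)\<^sup>2) ^ length p * 2 ^ sz ab < (2::nat) ^ (?k + 1)"
  proof -
    have "(2 * (2 ^ sz p)\<^sup>2) ^ length p * 2 ^ sz ab = (2::nat) ^ ((1 + 2 * sz p) * length p + sz ab)"
      by (simp add: power_mult_distrib power_add power_mult[symmetric] mult.commute algebra_simps)
    also have "\<dots> < 2 ^ (?k + 1)"
      by (intro power_strict_increasing) (use length_le_sz[of p] in \<open>auto intro!: le_imp_less_Suc add_mono mult_le_mono\<close>)
    finally show ?thesis .
  qed
  ultimately have "sz s' \<le> sz p + sz s" "sz (fst ab') \<le> 8 * (?k + 1) + 12" "sz (snd ab') \<le> 8 * (?k + 1) + 12"
    unfolding smalls_def using sz_small by blast+
  then show ?thesis by (cases ab') simp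
qed

lemma X_swalk:
  assumes "X d" "X p" "X c"
  shows "X (\<lambda>x. swalk (orc_of (d x)) (p x) (c x))"
proof -
  have "X (\<lambda>x::orc_data \<times> trn list \<times> nat \<times> affine.
    foldl (\<lambda>acc t. case acc of None \<Rightarrow> None | Some c \<Rightarrow> sst (orc_of (fst x)) t c) (Some (snd (snd x))) (fst (snd x)))"
  proof (rule X_foldl)
    show "X (\<lambda>z::(orc_data \<times> trn list \<times> nat \<times> affine) \<times> (nat \<times> affine) option \<times> trn.
       case fst (snd z) of None \<Rightarrow> None | Some c \<Rightarrow> sst (orc_of (fst (fst z))) (snd (snd z)) c)"
      by (intro X_sst X_intros)
    show "polyb (\<lambda>x::orc_data \<times> trn list \<times> nat \<times> affine. 2 + (sz x + sz x + 30 + 16 * ((1 + 2 * sz x) * sz x + sz x + 1)))"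
      by (intro poly_intros)
    fix x :: "orc_data \<times> trn list \<times> nat \<times> affine" and ys zs :: "trn list"
    assume y: "fst (snd x) = ys @ zs"
    obtain o1 s ab where x: "x = (o1, ys @ zs, s, ab)" using y by (cases x) auto
    have s: "sz ys \<le> sz x" "sz s \<le> sz x" "sz ab \<le> sz x" using sz_append[of ys zs] sz_pos(1)[of zs] unfolding x by auto
    show "sz (foldl (\<lambda>acc t. case acc of None \<Rightarrow> None | Some c \<Rightarrow> sst (orc_of (fst x)) t c) (Some (snd (snd x))) ys) \<le>
       2 + (sz x + sz x + 30 + 16 * ((1 + 2 * sz x) * sz x + sz x + 1))"
    proof (cases "swalk (orc_of o1) ys (s, ab)")
      case None
      then show ?thesis by (simp add: swalk_foldl[symmetric] x)
    next
      case (Some c)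
      obtain s' ab' where c: "c = (s', ab')" by (cases c)
      have "sz c \<le> sz ys + sz s + 30 + 16 * ((1 + 2 * sz ys) * sz ys + sz ab + 1)"
        using sz_swalk[of "orc_of o1" ys s ab s' ab'] Some by (simp add: c)
      also have "\<dots> \<le> sz x + sz x + 30 + 16 * ((1 + 2 * sz x) * sz x + sz x + 1)"
        by (intro add_mono mult_le_mono order_refl s)
      finally have "2 + sz c \<le> 2 + (sz x + sz x + 30 + 16 * ((1 + 2 * sz x) * sz x + sz x + 1))" by (rule add_left_mono)
      moreover have "foldl (\<lambda>acc t. case acc of None \<Rightarrow> None | Some c \<Rightarrow> sst (orc_of (fst x)) t c) (Some (snd (snd x))) ys = Some c"
        using Some unfolding swalk_foldl x fst_conv snd_conv .
      ultimately show ?thesis by (simp only: sz_simps)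
    qed
  qed (intro X_intros)+
  then have "X (\<lambda>x::orc_data \<times> trn list \<times> nat \<times> affine. swalk (orc_of (fst x)) (fst (snd x)) (snd (snd x)))"
    by (simp only: swalk_foldl)
  from X_comp[OF this X_Pair[OF assms(1) X_Pair[OF assms(2,3)]]] show ?thesis by simp
qed

lemma X_ends:
  assumes "X (\<lambda>z. Q (fst z) (snd z))" "X d" "X p" "X c"
  shows "X (\<lambda>x. ends (orc_of (d x)) (p x) (c x) (Q x))"
  unfolding ends_def by (rule X_case_option[OF X_swalk[OF assms(2-4)] X_const assms(1)])

lemma X_up:
  assumes "X d" "X p" "X c"
  shows "X (\<lambda>x. up (orc_of (d x)) (p x) (c x))" "X (\<lambda>x. up0 (orc_of (d x)) (p x) (c x))"
proof -
  have "X (\<lambda>x::orc_data \<times> trn list \<times> nat \<times> affine. up (orc_of (fst x)) (fst (snd x)) (snd (snd x)))"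
    unfolding up_def dif_def by (intro X_ends X_orc X_intros)
  from X_comp[OF this X_Pair[OF assms(1) X_Pair[OF assms(2,3)]]]
  show "X (\<lambda>x. up (orc_of (d x)) (p x) (c x))" by simp
  have "X (\<lambda>x::orc_data \<times> trn list \<times> nat \<times> affine. up0 (orc_of (fst x)) (fst (snd x)) (snd (snd x)))"
    unfolding up0_def dif_def by (intro X_conj X_Not X_eq X_ends X_orc X_intros)
  from X_comp[OF this X_Pair[OF assms(1) X_Pair[OF assms(2,3)]]]
  show "X (\<lambda>x. up0 (orc_of (d x)) (p x) (c x))" by simp
qed

text \<open>A path is coded by a bit string: \<^const>\<open>False\<close> advances a pointer in the list of transitions,
  and \<^const>\<open>True\<close> takes the transition under the pointer and resets it. Path number \<open>m\<close> is
  given by the binary digits of \<open>m\<close>.\<close>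

definition dec_step :: "'a list \<Rightarrow> 'a list \<times> 'a list \<Rightarrow> bool \<Rightarrow> 'a list \<times> 'a list" where
  "dec_step Ts st b = (if b then (Ts, case fst st of [] \<Rightarrow> snd st | t # ts \<Rightarrow> t # snd st)
     else (case fst st of [] \<Rightarrow> [] | t # ts \<Rightarrow> ts, snd st))"

definition dec :: "'a list \<Rightarrow> nat \<Rightarrow> 'a list" where
  "dec Ts m = rev (snd (foldl (dec_step Ts) (Ts, []) (nat_bits m)))"

definition paths :: "'a list \<Rightarrow> nat \<Rightarrow> 'a list set" where
  "paths Ts B = dec Ts ` {..<B}"

lemma dec_step_simps:
  "dec_step Ts ([], acc) True = (Ts, acc)" "dec_step Ts (t # ts, acc) True = (Ts, t # acc)"
  "dec_step Ts ([], acc) False = ([], acc)" "dec_step Ts (t # ts, acc) False = (ts, acc)"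
  by (simp_all add: dec_step_def)

lemma dec_inv: "(\<exists>us. Ts = us @ fst (foldl (dec_step Ts) (Ts, []) bs)) \<and>
   set (snd (foldl (dec_step Ts) (Ts, []) bs)) \<subseteq> set Ts \<and> length (snd (foldl (dec_step Ts) (Ts, []) bs)) \<le> length bs"
proof (induction bs rule: rev_induct)
  case (snoc b bs)
  obtain cur acc where c: "foldl (dec_step Ts) (Ts, []) bs = (cur, acc)" by fastforce
  obtain us where us: "Ts = us @ cur" "set acc \<subseteq> set Ts" "length acc \<le> length bs" using snoc c by auto
  show ?case
  proof (cases cur)
    case Nil
    then show ?thesis using us c by (cases b) (auto simp: dec_step_simps)
  next
    case (Cons t ts)
    have "Ts = (us @ [t]) @ ts" using us(1) Cons by simp
    then have "\<exists>vs. Ts = vs @ ts" by blast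
    moreover have "t \<in> set Ts" using us(1) Cons by simp
    ultimately show ?thesis using us(2,3) c Cons by (cases b) (auto simp: dec_step_simps)
  qed
qed simp

text \<open>The code found ends in \<open>True\<close>, hence it has no leading zeros and consists
  of the digits of some number. Every transition costs at most \<open>length Ts\<close>
  bits.\<close>

lemma dec_surj:
  assumes "set p \<subseteq> set Ts"
  shows "\<exists>bs. (bs = [] \<or> last bs) \<and> length bs \<le> length p * length Ts \<and>
    (\<forall>acc. foldl (dec_step Ts) (Ts, acc) bs = (Ts, rev p @ acc))"
  using assms
proof (induction p)
  case (Cons t p)
  obtain bs where bs: "bs = [] \<or> last bs" "length bs \<le> length p * length Ts"
     "\<And>acc. foldl (dec_step Ts) (Ts, acc) bs = (Ts, rev p @ acc)" using Cons by auto
  obtain i where i: "i < length Ts" "Ts ! i = t" using Cons.prems by (auto simp: in_set_conv_nth)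
  have d: "foldl (dec_step Ts) (Ts, acc) (replicate j False) = (drop j Ts, acc)" for acc j
  proof (induction j)
    case (Suc j)
    have r: "replicate (Suc j) False = replicate j False @ [False]" by (simp add: replicate_append_same)
    have "drop (Suc j) Ts = tl (drop j Ts)" by (simp add: drop_Suc tl_drop)
    then show ?case using Suc unfolding r by (cases "drop j Ts") (simp_all add: dec_step_simps)
  qed simp
  have "foldl (dec_step Ts) (Ts, acc) (replicate i False @ True # bs) = (Ts, rev (t # p) @ acc)" for acc
    using Cons_nth_drop_Suc[OF i(1), symmetric] i(2) by (simp add: d dec_step_simps bs(3))
  moreover have "length (replicate i False @ True # bs) \<le> length (t # p) * length Ts" using bs(2) i(1) by simp
  moreover have "last (replicate i False @ True # bs)" using bs(1) by auto
  ultimately show ?case by blast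
qed simp

text \<open>Each digit contributes at most one transition. The resulting bound exceeds the length up
  to which \<open>paths_surj\<close> finds all paths; this is why \<open>N\<close> and
  \<open>L\<close> are kept apart in \<open>system\<close>.\<close>

lemma paths_bound: "p \<in> paths Ts (2 ^ k) \<Longrightarrow> set p \<subseteq> set Ts \<and> length p \<le> k"
proof -
  assume "p \<in> paths Ts (2 ^ k)"
  then obtain m where m: "m < 2 ^ k" "p = dec Ts m" by (auto simp: paths_def)
  show ?thesis using dec_inv[of Ts "nat_bits m"] length_nat_bits[OF m(1)] by (auto simp: m(2) dec_def)
qed

lemma paths_surj:
  assumes "set p \<subseteq> set Ts" "length p \<le> N" "N * length Ts \<le> k"
  shows "p \<in> paths Ts (2 ^ k)"
proof -
  obtain bs where bs: "bs = [] \<or> last bs" "length bs \<le> length p * length Ts"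
     "\<And>acc. foldl (dec_step Ts) (Ts, acc) bs = (Ts, rev p @ acc)" using dec_surj[OF assms(1)] by blast
  have "dec Ts (bits_nat bs) = p" by (simp add: dec_def nat_bits_nat[OF bs(1)] bs(3))
  moreover have "length bs \<le> k" using bs(2) mult_le_mono1[OF assms(2), of "length Ts"] assms(3) by linarith
  then have "bits_nat bs < 2 ^ k" using bits_nat_less[of bs] power_increasing[of "length bs" k "2::nat"] by linarith
  ultimately show ?thesis unfolding paths_def by blast
qed

lemma X_dec:
  fixes l :: "'a::code \<Rightarrow> 'b::code list"
  assumes "X l" "X m"
  shows "X (\<lambda>x. dec (l x) (m x))"
proof -
  have "X (\<lambda>x::'b list \<times> nat. foldl (dec_step (fst x)) (fst x, []) (nat_bits (snd x)))"
  proof (rule X_foldl)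
    show "X (\<lambda>z::('b list \<times> nat) \<times> ('b list \<times> 'b list) \<times> bool. dec_step (fst (fst z)) (fst (snd z)) (snd (snd z)))"
      unfolding dec_step_def by (intro X_intros)
    show "polyb (\<lambda>x::'b list \<times> nat. 2 + sz x + sz x * (1 + sz x))" by (intro poly_intros)
    fix x :: "'b list \<times> nat" and ys zs assume y: "nat_bits (snd x) = ys @ zs"
    let ?s = "foldl (dec_step (fst x)) (fst x, []) ys"
    obtain us where us: "fst x = us @ fst ?s" "set (snd ?s) \<subseteq> set (fst x)" "length (snd ?s) \<le> length ys"
      using dec_inv[of "fst x" ys] by (elim conjE exE) (rule that)
    have x: "sz x = 1 + sz (fst x) + sz (snd x)" by (cases x) simp
    have "sz (us @ fst ?s) + 1 = sz us + sz (fst ?s)" by (rule sz_append)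
    then have 1: "sz (fst ?s) \<le> sz (fst x)" using arg_cong[OF us(1), of sz] sz_pos(1)[of us] by linarith
    have "length (snd ?s) \<le> length (nat_bits (snd x))" using us(3) y by simp
    also have "\<dots> \<le> sz (snd x)" unfolding sz_nat by (rule length_le_sz)
    finally have l: "length (snd ?s) \<le> sz x" using x by simp
    have "\<forall>t\<in>set (snd ?s). sz t \<le> sz x"
    proof
      fix t assume "t \<in> set (snd ?s)"
      then have "t \<in> set (fst x)" using us(2) by blast
      then show "sz t \<le> sz x" using sz_elem[of t "fst x"] x by linarith
    qed
    from sz_list_bound[OF this] have 2: "sz (snd ?s) \<le> 1 + length (snd ?s) * (1 + sz x)" .
    have 3: "length (snd ?s) * (1 + sz x) \<le> sz x * (1 + sz x)" by (rule mult_le_mono1[OF l])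
    have "sz ?s = 1 + sz (fst ?s) + sz (snd ?s)" by (cases ?s) simp
    then show "sz ?s \<le> 2 + sz x + sz x * (1 + sz x)" using 1 2 3 x by linarith
  qed (intro X_intros)+
  then have "X (\<lambda>x::'b list \<times> nat. dec (fst x) (snd x))" unfolding dec_def by (intro X_intros)
  from X_comp[OF this X_Pair[OF assms]] show ?thesis by simp
qed

text \<open>The number \<open>B x\<close> of paths may be exponential, because only the number of
  its digits enters the size.\<close>

lemma X_ex_paths:
  assumes "X (\<lambda>z. Q (fst z) (snd z))" "X l" "X B"
  shows "X (\<lambda>x. \<exists>p\<in>paths (l x) (B x). Q x p)"
proof -
  have "X (\<lambda>z. (fst z, dec (l (fst z)) (snd z)))" by (intro X_intros X_dec X_comp[OF assms(2)])
  from X_comp[OF assms(1) this] have "X (\<lambda>z. Q (fst z) (dec (l (fst z)) (snd z)))" by simp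
  from X_ex_nat[OF this assms(3)] show ?thesis by (simp add: paths_def Bex_def lessThan_def)
qed

type_synonym env = "trn list \<times> nat \<times> nat list \<times> nat \<times> orc_data"

definition accepts :: "(trn list set \<Rightarrow> nat set \<Rightarrow> nat \<Rightarrow> orc \<Rightarrow> bool) \<Rightarrow> env \<Rightarrow> bool" where
  "accepts acc e = acc (paths (fst e) (fst (snd e))) (set (fst (snd (snd e)))) (fst (snd (snd (snd e))))
     (orc_of (snd (snd (snd (snd e)))))"

lemma X_acc_reach: "X (accepts acc_reach)"
proof -
  have "X (\<lambda>e. accepts acc_reach e)"
    unfolding accepts_def acc_reach_def posi_orc by (intro X_ex_paths X_ends X_up X_orc X_intros)
  then show ?thesis .
qed

lemma X_acc_buechi: "X (accepts acc_buechi)"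
proof -
  have "X (\<lambda>e. accepts acc_buechi e)"
    unfolding accepts_def acc_buechi_def pers_def posi_orc by (intro X_ex_paths X_ends X_up X_orc X_intros)
  then show ?thesis .
qed

lemma X_rep_ok: "X f \<Longrightarrow> X (\<lambda>x. rep_ok (f x))"
proof -
  have eq: "foldl (\<lambda>st y. (fst st \<and> link_ok (snd st) y, Some y)) (b, prev) r =
      (b \<and> chain_ok prev r, if r = [] then prev else Some (last r))" for b prev r
    by (induction r arbitrary: b prev) auto
  have "X (\<lambda>r. foldl ((\<lambda>_ st y. (fst st \<and> link_ok (snd st) y, Some y)) r) ((\<lambda>_. (True, None)) r) ((\<lambda>r. r) r))"
  proof (rule X_foldl)
    show "X (\<lambda>z::pw_rep \<times> (bool \<times> piece option) \<times> piece. (fst (fst (snd z)) \<and> link_ok (snd (fst (snd z))) (snd (snd z)), Some (snd (snd z))))"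
      unfolding link_ok_def piece_ok_def next_ok_def by (intro X_intros)
    show "polyb (\<lambda>r::pw_rep. 6 + sz r)" by (intro poly_intros)
    fix r ys zs :: pw_rep assume r: "r = ys @ zs"
    have "sz (last ys) \<le> sz r" if "ys \<noteq> []" using that r by (intro sz_elem) simp
    then show "sz (foldl (\<lambda>st y. (fst st \<and> link_ok (snd st) y, Some y)) (True, None) ys) \<le> 6 + sz r"
      unfolding eq using sz_bool[of "chain_ok None ys"] by (cases "ys = []") auto
  qed (intro X_intros)+
  then have "X (\<lambda>r::pw_rep. r \<noteq> [] \<and> fst (foldl (\<lambda>st y. (fst st \<and> link_ok (snd st) y, Some y)) (True, None) r))"
    by (intro X_intros)
  then have "X rep_ok" by (simp add: eq rep_ok_def[abs_def])
  then show "X f \<Longrightarrow> X (\<lambda>x. rep_ok (f x))" by (rule X_comp)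
qed

section \<open>The reduction to comparisons of the initial energy\<close>

text \<open>The pairing of symbolic conditions and kinds of runs lets one reduction treat both
  problems.\<close>

definition solves :: "(trn list set \<Rightarrow> nat set \<Rightarrow> nat \<Rightarrow> orc \<Rightarrow> bool) \<Rightarrow>
    (nat transition set \<Rightarrow> nat \<Rightarrow> nat set \<Rightarrow> real \<Rightarrow> bool) \<Rightarrow> bool" where
  "solves acc run \<longleftrightarrow> (acc = acc_reach \<and> run = has_reaching_run) \<or> (acc = acc_buechi \<and> run = has_buechi_run)"

context system
begin

lemma decide_run:
  assumes rel: "list_all2 (rel_prod (=) (rel_prod pw_represents (=))) Ts Tl"
    and s0: "s0 \<in> Ss" and K: "H * H < K" and sol: "solves acc run" and x: "0 \<le> x"
  shows "run (set Tl) s0 F x \<Longrightarrow> \<exists>q\<in>cands K. acc P F s0 (posd False q) \<or> acc P F s0 (posd True q)"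
    and "q \<in> cands K \<Longrightarrow> acc P F s0 (posd False q) \<or> acc P F s0 (posd True q) \<Longrightarrow>
      \<forall>c\<in>cands K. acc P F s0 (posd False c) \<or> acc P F s0 (posd True c) \<longrightarrow> q \<le> c \<Longrightarrow>
      run (set Tl) s0 F x \<longleftrightarrow> (if acc P F s0 (posd False q) then of_rat q \<le> x else of_rat q < x)"
proof -
  have "\<exists>R. ((acc P F s0 = acc_reach P F s0 \<and> R = (\<lambda>x. \<exists>s' y. E.rch (s0, x) (s', y) \<and> s' \<in> F)) \<or>
      (acc P F s0 = acc_buechi P F s0 \<and> R = (\<lambda>x. E.buechi F (s0, x)))) \<and> run (set Tl) s0 F x = R x"
    using sol unfolding solves_def
  proof (elim disjE conjE)
    assume "acc = acc_reach" "run = has_reaching_run"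
    then show ?thesis
      by (intro exI[of _ "\<lambda>x. \<exists>s' y. E.rch (s0, x) (s', y) \<and> s' \<in> F"] conjI disjI1) (simp_all add: rch_iff[OF rel x])
  next
    assume "acc = acc_buechi" "run = has_buechi_run"
    then show ?thesis
      by (intro exI[of _ "\<lambda>x. E.buechi F (s0, x)"] conjI disjI2) (simp_all add: buechi_run_iff[OF rel x])
  qed
  then obtain R where AR: "(acc P F s0 = acc_reach P F s0 \<and> R = (\<lambda>x. \<exists>s' y. E.rch (s0, x) (s', y) \<and> s' \<in> F)) \<or>
      (acc P F s0 = acc_buechi P F s0 \<and> R = (\<lambda>x. E.buechi F (s0, x)))" and R: "run (set Tl) s0 F x = R x"
    by (elim exE conjE) (rule that)
  note d = decide[OF s0 K AR]
  show "run (set Tl) s0 F x \<Longrightarrow> \<exists>q\<in>cands K. acc P F s0 (posd False q) \<or> acc P F s0 (posd True q)"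
    unfolding R by (rule d(1)[OF x])
  show "q \<in> cands K \<Longrightarrow> acc P F s0 (posd False q) \<or> acc P F s0 (posd True q) \<Longrightarrow>
      \<forall>c\<in>cands K. acc P F s0 (posd False c) \<or> acc P F s0 (posd True c) \<longrightarrow> q \<le> c \<Longrightarrow>
      run (set Tl) s0 F x \<longleftrightarrow> (if acc P F s0 (posd False q) then of_rat q \<le> x else of_rat q < x)"
    unfolding R by (rule d(2)[OF _ _ _ x])
qed

end

text \<open>With all components of the input of size at most \<open>n\<close>, there are at most \<open>2 ^ path_bits n\<close>
  paths to be tried, and all rational numbers that occur on them are quotients of integers below
  \<open>2 ^ rat_bits n\<close>.\<close>

definition path_bits :: "nat \<Rightarrow> nat" where
  "path_bits n = (2 * n + 1) * n"

definition rat_bits :: "nat \<Rightarrow> nat" where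
  "rat_bits n = 2 + n + (1 + 2 * n) * (4 * path_bits n)"

lemma system_input:
  assumes "\<forall>t\<in>set Ts. rep_ok (fst (snd t)) \<and> snd (snd t) \<in> set Ss" "sz Ss \<le> n" "sz Ts \<le> n"
  shows "system Ts (set Ss) (2 ^ n) (2 * n + 1) (path_bits n) (2 ^ rat_bits n) (paths Ts (2 ^ path_bits n))"
proof
  show "small_trns (2 ^ n) (set Ts)" by (rule small_trns_sz[OF assms(3)])
  have "card (set Ss) \<le> n" using card_length[of Ss] length_le_sz[of Ss] assms(2) by linarith
  then show "2 * card (set Ss) + 1 \<le> 2 * n + 1" by simp
  show "p \<in> paths Ts (2 ^ path_bits n) \<Longrightarrow> set p \<subseteq> set Ts \<and> length p \<le> path_bits n" for p
    by (rule paths_bound)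
  have "length Ts \<le> n" using length_le_sz[of Ts] assms(3) by linarith
  then have "(2 * n + 1) * length Ts \<le> path_bits n" unfolding path_bits_def by (rule mult_le_mono2)
  then show "set p \<subseteq> set Ts \<Longrightarrow> length p \<le> 2 * n + 1 \<Longrightarrow> p \<in> paths Ts (2 ^ path_bits n)" for p
    by (rule paths_surj[rotated 2])
  \<comment> \<open>With \<open>M = 2 ^ n\<close>, the bound on \<open>H\<close> is a power of two:
    the factors 4 and \<open>M\<close> give \<open>2 + n\<close>, and the two powers of
    \<open>2 * M\<^sup>2\<close> with exponent \<open>2 * path_bits n\<close> give the rest of
    \<open>rat_bits n\<close>.\<close>
  have "2 * (2 ^ n)\<^sup>2 = (2::nat) ^ (1 + 2 * n)" by (simp add: power_mult[symmetric] mult.commute)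
  then have "4 * 2 ^ n * ((2 * (2 ^ n)\<^sup>2) ^ (2 * path_bits n) * (2 * (2 ^ n)\<^sup>2) ^ (2 * path_bits n)) =
      (2::nat) ^ 2 * 2 ^ n * (2 ^ ((1 + 2 * n) * (2 * path_bits n)) * 2 ^ ((1 + 2 * n) * (2 * path_bits n)))"
    by (simp only: power_mult[symmetric]) simp
  also have "\<dots> = 2 ^ rat_bits n" unfolding power_add[symmetric] rat_bits_def
    by (rule arg_cong[where f = "\<lambda>k. 2 ^ k"]) (simp add: algebra_simps)
  finally show "4 * 2 ^ n * ((2 * (2 ^ n)\<^sup>2) ^ (2 * path_bits n) * (2 * (2 ^ n)\<^sup>2) ^ (2 * path_bits n)) \<le> (2::nat) ^ rat_bits n"
    by simp
qed (use assms(1) in auto)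

definition cand :: "nat \<Rightarrow> nat \<Rightarrow> rat" where
  "cand K i = mkrat (int (i mod K)) (i div K)"

lemma cands_cand: "cands K = cand K ` {..<K * K}"
proof (intro equalityI subsetI)
  fix q assume "q \<in> cands K"
  then obtain m d where md: "q = mkrat (int m) d" "m < K" "d < K" by (auto simp: cands_def)
  have "m + d * K < K + d * K" using md(2) by simp
  also have "\<dots> = Suc d * K" by simp
  also have "\<dots> \<le> K * K" using md(3) by (intro mult_le_mono1) simp
  finally have "m + d * K \<in> {..<K * K}" by simp
  moreover have "q = cand K (m + d * K)" using md by (simp add: cand_def)
  ultimately show "q \<in> cand K ` {..<K * K}" by blast
next
  fix q assume "q \<in> cand K ` {..<K * K}"
  then obtain i where i: "i < K * K" "q = cand K i" by auto
  then have "0 < K" by (cases K) auto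
  then have "i mod K < K" "i div K < K" using i(1) by (auto simp: less_mult_imp_div_less)
  then show "q \<in> cands K" unfolding cands_def i(2) cand_def by blast
qed

text \<open>There are finitely many candidates, so a least accepted one exists as soon as any is
  accepted. The default value \<open>K * K\<close> of the search therefore means that none
  is.\<close>

lemma bleast_cand:
  assumes i: "i = bleast (K * K) Q"
    and Q: "\<And>i. Q i \<longleftrightarrow> A (cand K i) \<and> (\<forall>j<K * K. A (cand K j) \<longrightarrow> cand K i \<le> cand K j)"
  shows "i < K * K \<Longrightarrow> cand K i \<in> cands K \<and> A (cand K i) \<and> (\<forall>c\<in>cands K. A c \<longrightarrow> cand K i \<le> c)"
    and "\<not> i < K * K \<Longrightarrow> \<forall>c\<in>cands K. \<not> A c"
proof -
  have Q': "Q i \<longleftrightarrow> A (cand K i) \<and> (\<forall>c\<in>cands K. A c \<longrightarrow> cand K i \<le> c)" for i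
    unfolding cands_cand using Q by auto
  show "i < K * K \<Longrightarrow> cand K i \<in> cands K \<and> A (cand K i) \<and> (\<forall>c\<in>cands K. A c \<longrightarrow> cand K i \<le> c)"
  proof -
    assume l: "i < K * K"
    then have "Q i" using bleast_cases[of "K * K" Q] i by simp
    moreover have "cand K i \<in> cands K" unfolding cands_cand using l by simp
    ultimately show ?thesis unfolding Q' by blast
  qed
  show "\<not> i < K * K \<Longrightarrow> \<forall>c\<in>cands K. \<not> A c"
  proof (rule ccontr)
    assume l: "\<not> i < K * K" and "\<not> (\<forall>c\<in>cands K. \<not> A c)"
    then have C: "finite {c \<in> cands K. A c}" "{c \<in> cands K. A c} \<noteq> {}" using finite_cands[of K] by auto
    have m: "Min {c \<in> cands K. A c} \<in> {c \<in> cands K. A c}" by (rule Min_in[OF C])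
    then obtain j where j: "j < K * K" "Min {c \<in> cands K. A c} = cand K j" unfolding cands_cand by auto
    have "Q j" unfolding Q' j(2)[symmetric] using m Min_le[OF C(1)] by blast
    then show False using bleast_cases[of "K * K" Q] i l j(1) by simp
  qed
qed

text \<open>The parameters are the input and the numbers of paths and of numerators of candidates.\<close>

type_synonym params = "input_data \<times> nat \<times> nat"

definition holds :: "(trn list set \<Rightarrow> nat set \<Rightarrow> nat \<Rightarrow> orc \<Rightarrow> bool) \<Rightarrow> params \<Rightarrow> bool \<Rightarrow> rat \<Rightarrow> bool" where
  "holds acc x b q = accepts acc (fst (snd (fst x)), fst (snd x), fst (snd (snd (snd (fst x)))), fst (snd (snd (fst x))), False, b, q)"

definition least :: "(trn list set \<Rightarrow> nat set \<Rightarrow> nat \<Rightarrow> orc \<Rightarrow> bool) \<Rightarrow> params \<Rightarrow> nat \<Rightarrow> bool" where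
  "least acc x i \<longleftrightarrow> (holds acc x False (cand (snd (snd x)) i) \<or> holds acc x True (cand (snd (snd x)) i)) \<and>
     (\<forall>j<snd (snd x) * snd (snd x). holds acc x False (cand (snd (snd x)) j) \<or> holds acc x True (cand (snd (snd x)) j) \<longrightarrow>
        cand (snd (snd x)) i \<le> cand (snd (snd x)) j)"

text \<open>The bit asks for the strict comparison, in case the candidate itself is not accepted.
  The empty word is not the encoding of any comparison, so \<open>(False, [])\<close> stands for
  rejection.\<close>

definition query :: "(trn list set \<Rightarrow> nat set \<Rightarrow> nat \<Rightarrow> orc \<Rightarrow> bool) \<Rightarrow> params \<Rightarrow> nat \<Rightarrow> bool \<times> bool list" where
  "query acc x i = (if i < snd (snd x) * snd (snd x)
     then (\<not> holds acc x False (cand (snd (snd x)) i), enc_word (snd (snd (snd (snd (fst x))))) @ enc_rat (cand (snd (snd x)) i))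
     else (False, []))"

definition answer :: "(trn list set \<Rightarrow> nat set \<Rightarrow> nat \<Rightarrow> orc \<Rightarrow> bool) \<Rightarrow> params \<Rightarrow> bool \<times> bool list" where
  "answer acc x = query acc x (bleast (snd (snd x) * snd (snd x)) (least acc x))"

lemma X_answer:
  assumes "solves acc run" "X f"
  shows "X (\<lambda>x. answer acc (f x))"
proof -
  have acc: "X (accepts acc)" using assms(1) X_acc_reach X_acc_buechi by (auto simp: solves_def)
  have "X (\<lambda>x. answer acc x)"
    unfolding answer_def query_def least_def holds_def cand_def by (intro X_intros X_comp[OF acc])
  from X_comp[OF this assms(2)] show ?thesis .
qed

definition valid :: "input_data \<Rightarrow> bool" where
  "valid I \<longleftrightarrow> (\<forall>t\<in>set (fst (snd I)). rep_ok (fst (snd t)) \<and> fst t \<in> set (fst I) \<and> snd (snd t) \<in> set (fst I)) \<and>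
     fst (snd (snd I)) \<in> set (fst I) \<and> (\<forall>s\<in>set (fst (snd (snd (snd I)))). s \<in> set (fst I))"

lemma X_valid: "X f \<Longrightarrow> X (\<lambda>x. valid (f x))"
proof -
  have "X (\<lambda>I. valid I)" unfolding valid_def by (intro X_rep_ok X_intros)
  then show "X f \<Longrightarrow> X (\<lambda>x. valid (f x))" by (rule X_comp)
qed

definition queries :: "(bool list \<rightharpoonup> real) \<Rightarrow> bool \<Rightarrow> bool list set" where
  "queries \<nu> b = {enc_word u @ enc_rat q | u q x. \<nu> u = Some x \<and> (if b then of_rat q < x else of_rat q \<le> x)}"

lemma queries_iff:
  "enc_word u @ enc_rat q \<in> queries \<nu> b \<longleftrightarrow> (\<exists>x. \<nu> u = Some x \<and> (if b then of_rat q < x else of_rat q \<le> x))"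
proof -
  have "u = u' \<and> q = q'" if "enc_word u @ enc_rat q = enc_word u' @ enc_rat q'" for u' q'
    using prefix_codeD[OF prefix_code_word that] prefix_codeD[OF prefix_code_rat, of q "[]" q' "[]"] by simp
  then show ?thesis unfolding queries_def by blast
qed

lemma Nil_queries: "[] \<notin> queries \<nu> b"
  by (auto simp: queries_def enc_word_def enc_list_def)

lemma answer_run:
  assumes sol: "solves acc run" and val: "valid I" and I: "I = (Ss, Ts, s0, Fs, u)" and n: "sz I \<le> n"
    and rel: "list_all2 (rel_prod (=) (rel_prod pw_represents (=))) Ts Tl"
    and x: "\<nu> u = Some x" "0 \<le> x"
    and a: "a = answer acc (I, 2 ^ path_bits n, 2 ^ (2 * rat_bits n + 1))"
  shows "run (set Tl) s0 (set Fs) x \<longleftrightarrow> snd a \<in> queries \<nu> (fst a)"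
proof -
  let ?P = "paths Ts (2 ^ path_bits n)" and ?K = "2 ^ (2 * rat_bits n + 1) :: nat"
  interpret system Ts "set Ss" "2 ^ n" "2 * n + 1" "path_bits n" "2 ^ rat_bits n" ?P
    by (rule system_input) (use val n in \<open>auto simp: valid_def I\<close>)
  \<comment> \<open>Zeros of the tests have numerators and denominators up to the square of
    \<open>2 ^ rat_bits n\<close>; one more bit makes the bound strict.\<close>
  have K: "2 ^ rat_bits n * 2 ^ rat_bits n < ?K"
    by (simp add: mult_2 power_add)
  have s0: "s0 \<in> set Ss" using val by (simp add: valid_def I)
  define A where "A b q = acc ?P (set Fs) s0 (posd b q)" for b q
  define K where "K = ?K"
  define x' where "x' = (I, 2 ^ path_bits n :: nat, K)"
  have h: "holds acc x' b q = A b q" for b q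
    by (simp add: holds_def accepts_def I posd_orc A_def x'_def)
  note d = decide_run[OF rel s0 K sol x(2), where F = "set Fs", folded A_def K_def]
  define i where "i = bleast (K * K) (least acc x')"
  have l: "least acc x' i \<longleftrightarrow> (A False (cand K i) \<or> A True (cand K i)) \<and>
      (\<forall>j<K * K. A False (cand K j) \<or> A True (cand K j) \<longrightarrow> cand K i \<le> cand K j)" for i
    unfolding least_def h by (simp add: x'_def)
  note b = bleast_cand[OF i_def, of "\<lambda>q. A False q \<or> A True q", OF l]
  have a': "a = (if i < K * K then (\<not> A False (cand K i), enc_word u @ enc_rat (cand K i)) else (False, []))"
    unfolding a K_def[symmetric] x'_def[symmetric] answer_def query_def h by (simp add: x'_def i_def I)
  show ?thesis
  proof (cases "i < K * K")
    case True
    note b = b(1)[OF True]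
    have "snd a \<in> queries \<nu> (fst a) \<longleftrightarrow> (if A False (cand K i) then of_rat (cand K i) \<le> x else of_rat (cand K i) < x)"
      using True by (simp add: a' queries_iff x(1))
    also have "\<dots> \<longleftrightarrow> run (set Tl) s0 (set Fs) x"
      by (rule d(2)[symmetric]) (use b in blast)+
    finally show ?thesis by (rule sym)
  next
    case False
    have "\<not> run (set Tl) s0 (set Fs) x" using b(2)[OF False] d(1) by blast
    then show ?thesis using False Nil_queries by (simp add: a')
  qed
qed

lemma X_power: "X f \<Longrightarrow> X (\<lambda>x. f x ^ k :: nat)"
proof (induction k)
  case 0
  show ?case by (simp add: X_const)
next
  case (Suc k)
  then show ?case by (simp add: X_mult)
qed

lemma polyb_length: "polyb (\<lambda>w::'a::code list. length w)"
  by (rule polyb_mono[OF polyb_sz]) (rule length_le_sz)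

definition problem :: "(nat transition set \<Rightarrow> nat \<Rightarrow> nat set \<Rightarrow> real \<Rightarrow> bool) \<Rightarrow> (bool list \<rightharpoonup> real) \<Rightarrow> bool list set" where
  "problem run \<nu> = {enc_input I | I S T s0 F x0.
        describes \<nu> I S T s0 F x0 \<and> pw_automaton S T \<and> s0 \<in> S \<and> F \<subseteq> S \<and> 0 \<le> x0 \<and> run T s0 F x0}"

lemma describes_valid:
  assumes "describes \<nu> I S T s0 F x0" "pw_automaton S T" "s0 \<in> S" "F \<subseteq> S"
  shows "valid I"
proof -
  obtain Ss Ts s Fs u where I: "I = (Ss, Ts, s, Fs, u)" by (cases I)
  obtain Tl where d: "S = set Ss" "T = set Tl" "list_all2 (rel_prod (=) (rel_prod pw_represents (=))) Ts Tl"
    "s0 = s" "F = set Fs" "\<nu> u = Some x0" using assms(1) unfolding describes_def I by auto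
  have "rep_ok (fst (snd t)) \<and> fst t \<in> set Ss \<and> snd (snd t) \<in> set Ss" if t: "t \<in> set Ts" for t
  proof -
    obtain p r q where t': "t = (p, r, q)" by (cases t)
    obtain f where f: "(p, f, q) \<in> set Tl" "pw_represents r f" using rel_ex(2)[OF d(3)] t t' by blast
    then have "f \<in> E_pw" "p \<in> set Ss" "q \<in> set Ss" using assms(2) d(1,2) by (auto simp: pw_automaton_def)
    then show ?thesis using represents_rep_ok[OF f(2)] by (auto simp: t' E_pw_def)
  qed
  then show ?thesis using assms(3,4) d by (auto simp: valid_def I)
qed

lemma valid_automaton:
  assumes "valid (Ss, Ts, s0, Fs, u)"
  defines "Tl \<equiv> map (\<lambda>(s, r, s'). (s, fun_of r, s')) Ts"
  shows "list_all2 (rel_prod (=) (rel_prod pw_represents (=))) Ts Tl" "pw_automaton (set Ss) (set Tl)"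
    "s0 \<in> set Ss" "set Fs \<subseteq> set Ss"
proof -
  have ok: "pw_represents (fst (snd t)) (fun_of (fst (snd t))) \<and> ext_energy_fun (fun_of (fst (snd t)))" if "t \<in> set Ts" for t
    by (rule rep_ok_represents) (use assms that in \<open>auto simp: valid_def\<close>)
  then show "list_all2 (rel_prod (=) (rel_prod pw_represents (=))) Ts Tl"
    unfolding Tl_def list_all2_conv_all_nth by (auto simp: rel_prod_sel case_prod_beta)
  have "set Tl \<subseteq> set Ss \<times> E_pw \<times> set Ss"
    using ok assms(1) by (fastforce simp: Tl_def valid_def E_pw_def piecewise_affine_def)
  then show "pw_automaton (set Ss) (set Tl)" by (simp add: pw_automaton_def)
qed (use assms(1) in \<open>auto simp: valid_def\<close>)

text \<open>One reduction serves all namings \<open>\<nu>\<close>: the search never looks at the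
  initial energy, and only the answer to the final comparison depends on
  \<open>\<nu>\<close>.\<close>

lemma problem_reduction:
  assumes sol: "solves acc run"
  shows "\<exists>g. X g \<and> (\<forall>\<nu>. (\<forall>x\<in>ran \<nu>. 0 \<le> x) \<longrightarrow> problem run \<nu> = {w. snd (g w) \<in> queries \<nu> (fst (g w))})"
proof -
  obtain p where p: "X p" "\<And>w I w'. p w = Some (I, w') \<longleftrightarrow> w = enc_input I @ w'"
    by (rule parsableE[OF parsable_input]) blast
  obtain k where k: "\<And>w. sz (p w) \<le> (sz w + 2) ^ k" using X_polyb[OF p(1)] unfolding polyb_def by blast
  \<comment> \<open>Since \<open>sz w \<le> 4 * length w + 1\<close>, this bounds the size of the
    parsed input. It is computable from the length of the word and polynomially bounded as a number,
    as required by \<open>X_exp2\<close>.\<close>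
  define n where "n w = (4 * length w + 3) ^ k" for w :: "bool list"
  define f where "f I w = answer acc (I, 2 ^ path_bits (n w), 2 ^ (2 * rat_bits (n w) + 1))" for I and w :: "bool list"
  define g where "g w = (case p w of None \<Rightarrow> (False, []) | Some z \<Rightarrow>
    (if snd z = [] \<and> valid (fst z) then f (fst z) w else (False, [])))" for w
  have pe: "p (enc_input I) = Some (I, [])" for I by (simp add: p(2))
  have sz_I: "sz I \<le> n (enc_input I)" for I
  proof -
    have "sz I \<le> sz (p (enc_input I))" by (simp add: pe)
    also have "\<dots> \<le> (sz (enc_input I) + 2) ^ k" by (rule k)
    also have "\<dots> \<le> n (enc_input I)" unfolding n_def using sz_bits(2)[of "enc_input I"] by (intro power_mono) auto
    finally show ?thesis .
  qed
  have g_enc: "g (enc_input I) = (if valid I then f I (enc_input I) else (False, []))" for I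
    by (simp add: g_def pe)
  have "X (\<lambda>w. n w)" unfolding n_def by (intro X_power X_intros)
  note nX = X_comp[OF this]
  have np: "polyb (\<lambda>w. n w)" unfolding n_def by (intro poly_intros polyb_length)
  have "X (\<lambda>w. 2 ^ path_bits (n w) :: nat)"
    by (rule X_exp2; unfold path_bits_def; intro X_intros nX poly_intros np)
  note X1 = X_comp[OF this]
  have "X (\<lambda>w. 2 ^ (2 * rat_bits (n w) + 1) :: nat)"
    by (rule X_exp2; unfold path_bits_def rat_bits_def; intro X_intros nX poly_intros np)
  note X2 = X_comp[OF this]
  have "X (\<lambda>w. g w)" unfolding g_def f_def
    by (intro X_case_option X_if X_answer[OF sol] X_valid X1 X2 X_intros p(1))
  moreover have "problem run \<nu> = {w. snd (g w) \<in> queries \<nu> (fst (g w))}" if nonneg: "\<forall>x\<in>ran \<nu>. 0 \<le> x" for \<nu>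
  proof (intro equalityI subsetI)
    fix w assume "w \<in> problem run \<nu>"
    then obtain I S T s0 F x0 where w: "w = enc_input I" "describes \<nu> I S T s0 F x0" "pw_automaton S T" "s0 \<in> S" "F \<subseteq> S"
      "0 \<le> x0" "run T s0 F x0" unfolding problem_def by blast
    have v: "valid I" by (rule describes_valid[OF w(2-5)])
    obtain Ss Ts s Fs u where I: "I = (Ss, Ts, s, Fs, u)" by (cases I)
    obtain Tl where d: "T = set Tl" "list_all2 (rel_prod (=) (rel_prod pw_represents (=))) Ts Tl"
      "s0 = s" "F = set Fs" "\<nu> u = Some x0" using w(2) unfolding describes_def I by auto
    have "g w = f I w" unfolding w(1) g_enc using v by simp
    then have "snd (g w) \<in> queries \<nu> (fst (g w))"
      using answer_run[where \<nu> = \<nu> and u = u, OF sol v I sz_I[of I] d(2) d(5) w(6) f_def[of I "enc_input I"]] w(7) unfolding w(1) d by simp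
    then show "w \<in> {w. snd (g w) \<in> queries \<nu> (fst (g w))}" by simp
  next
    fix w assume "w \<in> {w. snd (g w) \<in> queries \<nu> (fst (g w))}"
    then have q: "snd (g w) \<in> queries \<nu> (fst (g w))" by simp
    obtain z where z: "p w = Some z" "snd z = []" "valid (fst z)"
      using q Nil_queries[of \<nu> False] by (auto simp: g_def split: option.splits if_splits)
    obtain Ss Ts s Fs u where I: "fst z = (Ss, Ts, s, Fs, u)" by (cases "fst z")
    have w: "w = enc_input (fst z)" using z(1,2) p(2)[of w "fst z" "[]"] by (cases z) simp
    have gw: "g w = f (fst z) w" using z by (simp add: g_def)
    \<comment> \<open>The problem asks for some functions with the given representations, and
      \<open>fun_of\<close> provides them.\<close>
    define Tl where "Tl = map (\<lambda>(s, r, s'). (s, fun_of r, s')) Ts"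
    note va = valid_automaton[OF z(3)[unfolded I], folded Tl_def]
    have "\<exists>x. \<nu> u = Some x"
      using q unfolding gw f_def answer_def query_def I
      by (auto simp: queries_iff Nil_queries split: if_splits)
    then obtain x where x: "\<nu> u = Some x" by blast
    have x0: "0 \<le> x" using nonneg x by (auto simp: ran_def)
    have "run (set Tl) s (set Fs) x"
      using answer_run[where \<nu> = \<nu> and u = u, OF sol z(3) I sz_I[of "fst z"] va(1) x x0 f_def[of "fst z" "enc_input (fst z)"]] q unfolding gw w[symmetric] by simp
    moreover have "describes \<nu> (fst z) (set Ss) (set Tl) s (set Fs) x"
      unfolding describes_def I using va(1) x by auto
    ultimately show "w \<in> problem run \<nu>" unfolding problem_def using w va x0 by blast
  qed
  ultimately show ?thesis by blast
qed

lemma problem_in: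
  assumes "solves acc run" "\<forall>x\<in>ran \<nu>. 0 \<le> x"
  shows "energies_comparable_in DECIDABLE \<nu> \<Longrightarrow> problem run \<nu> \<in> DECIDABLE"
    and "energies_comparable_in EXPTIME \<nu> \<Longrightarrow> problem run \<nu> \<in> EXPTIME"
proof -
  obtain g where g: "X g" "problem run \<nu> = {w. snd (g w) \<in> queries \<nu> (fst (g w))}"
    using problem_reduction[OF assms(1)] assms(2) by blast
  have q: "energies_comparable_in C \<nu> \<longleftrightarrow> queries \<nu> False \<in> C \<and> queries \<nu> True \<in> C" for C
    by (simp add: energies_comparable_in_def queries_def)
  have e: "problem run \<nu> = {w. snd (g w) \<in> (if fst (g w) then queries \<nu> True else queries \<nu> False)}"
    unfolding g(2) by (rule Collect_cong) (simp split: if_splits)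
  show "energies_comparable_in DECIDABLE \<nu> \<Longrightarrow> problem run \<nu> \<in> DECIDABLE"
    unfolding q e by (elim conjE) (rule DECIDABLE_reduction[OF g(1)])
  show "energies_comparable_in EXPTIME \<nu> \<Longrightarrow> problem run \<nu> \<in> EXPTIME"
    unfolding q e by (elim conjE) (rule EXPTIME_reduction[OF g(1)])
qed

theorem theorem5:
  fixes \<nu> :: "bool list \<rightharpoonup> real"
  assumes nonneg: "\<forall>x \<in> ran \<nu>. 0 \<le> x"
    and computable: "energies_comparable_in DECIDABLE \<nu>"
  shows "reachability_problem \<nu> \<in> DECIDABLE \<and> buechi_problem \<nu> \<in> DECIDABLE \<and>
    (energies_comparable_in EXPTIME \<nu> \<longrightarrow>
       reachability_problem \<nu> \<in> EXPTIME \<and> buechi_problem \<nu> \<in> EXPTIME)"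
proof -
  have s: "solves acc_reach has_reaching_run" "solves acc_buechi has_buechi_run" by (simp_all add: solves_def)
  have e: "reachability_problem \<nu> = problem has_reaching_run \<nu>" "buechi_problem \<nu> = problem has_buechi_run \<nu>"
    by (simp_all add: reachability_problem_def buechi_problem_def problem_def)
  show ?thesis unfolding e using problem_in[OF s(1) nonneg] problem_in[OF s(2) nonneg] computable by blast
qed

end
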